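(* Let $d\geq 2$ and $0<\lambda^*<\infty$. There exists a constant $\beta_0=\beta_0(\lambda^*,d)<\infty$ such that for every $\beta\geq\beta_0$ and every symmetric distribution $\mathsf{P}$ of the boundary fields with zero mean, strictly positive variance, and satisfying $\mathsf{P}(|\lambda_0|>\lambda^* )=0$, the following hold: (1) If $d>3$, then $\mathsf{P}$-almost surely the set of (weak) limit points of the sequence $\{\mu_n^\lambda\}_{n\in\mathbb{N}}$ is exactly $\{\mu^+,\mu^-\}$. (2) If $d\in\{2,3\}$ and $\omega>0$, then $\mathsf{P}$-almost surely the set of (weak) limit points of the sequence $\{\mu_{[n^{4-d+\omega}]}^\lambda\}_{n\in\mathbb{N}}$ is exactly $\{\mu^+,\mu^-\}$ (here $[\cdot]$ denotes the integer part).
   Context: Fix $d\geq 2$. For $n\in\mathbb{N}$ let $\Lambda_n=\{x\in\mathbb{Z}^d: -\tfrac n2<x_i\leq \tfrac n2,\ i=1,\dots,d\}$, let $\partial\Lambda_n$ be the set of $x\in\Lambda_n$ having at least one nearest neighbour in $\mathbb{Z}^d\setminus\Lambda_n$, and $\Omega_n=\{-1,1\}^{\Lambda_n}$. Let $\lambda=(\lambda_x)_{x\in\mathbb{Z}^d}$ be independent identically distributed real random variables with (product) law $\mathsf{P}$. For $\beta>0$ and $\sigma_n\in\Omega_n$ set $H_n^\lambda(\sigma_n)=-\beta\sum_{\langle x,y\rangle,\,x,y\in\Lambda_n}(\sigma_x\sigma_y-1)-\sum_{x\in\partial\Lambda_n}\lambda_x\sigma_x$, where $\langle x,y\rangle$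 runs over unordered nearest-neighbour pairs, and let $\mu_n^\lambda(\sigma_n)=e^{-H_n^\lambda(\sigma_n)}/Z_n^\lambda$ with $Z_n^\lambda=\sum_{\sigma_n\in\Omega_n}e^{-H_n^\lambda(\sigma_n)}$ (a random probability measure on $\Omega_n$). Similarly let $H_n^\pm(\sigma_n)=-\beta\sum_{\langle x,y\rangle,\,x,y\in\Lambda_n}(\sigma_x\sigma_y-1)\mp\beta\sum_{x\in\partial\Lambda_n}\sigma_x$ and $\mu_n^\pm$ the corresponding Gibbs measures on $\Omega_n$; $\mu^\pm$ denote their weak limits as $n\to\infty$, i.e. the plus and minus Gibbs states of the nearest-neighbour Ising model at inverse temperature $\beta$ on $\mathbb{Z}^d$. Weak convergence of measures on $\Omega_n$ to a measure on $\{-1,1\}^{\mathbb{Z}^d}$ means convergence of the expectations of every function depending on finitely many spins (these sites being contained in $\Lambda_n$ for all large $n$). *)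

theory Defs
  imports "HOL-Probability.Probability"
begin

type_synonym site = "nat \<Rightarrow> int"   (* points of Z^d: coordinates i < d, zero for i \<ge> d *)
type_synonym config = "site \<Rightarrow> real"

definition lattice :: "nat \<Rightarrow> site set" where
  "lattice d = {x. \<forall>i\<ge>d. x i = 0}"

definition box :: "nat \<Rightarrow> nat \<Rightarrow> site set" where
  "box d n = {x \<in> lattice d. \<forall>i<d. - real n / 2 < real_of_int (x i) \<and> real_of_int (x i) \<le> real n / 2}"

definition adj :: "nat \<Rightarrow> site \<Rightarrow> site \<Rightarrow> bool" where
  "adj d x y \<longleftrightarrow> x \<in> lattice d \<and> y \<in> lattice d \<and> (\<Sum>i<d. \<bar>x i - y i\<bar>) = 1"

definition bdry :: "nat \<Rightarrow> nat \<Rightarrow> site set" where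
  "bdry d n = {x \<in> box d n. \<exists>y. adj d x y \<and> y \<notin> box d n}"

definition edges :: "nat \<Rightarrow> nat \<Rightarrow> site set set" where
  "edges d n = {{x, y} | x y. x \<in> box d n \<and> y \<in> box d n \<and> adj d x y}"

definition configs :: "nat \<Rightarrow> nat \<Rightarrow> config set" where
  "configs d n = PiE (box d n) (\<lambda>_. {-1, 1})"

definition hamiltonian :: "nat \<Rightarrow> real \<Rightarrow> nat \<Rightarrow> (site \<Rightarrow> real) \<Rightarrow> config \<Rightarrow> real" where
  "hamiltonian d \<beta> n h \<sigma> =
     - \<beta> * (\<Sum>e\<in>edges d n. (\<Prod>z\<in>e. \<sigma> z) - 1) - (\<Sum>x\<in>bdry d n. h x * \<sigma> x)"

definition partition_fn :: "nat \<Rightarrow> real \<Rightarrow> nat \<Rightarrow> (site \<Rightarrow> real) \<Rightarrow> real" where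
  "partition_fn d \<beta> n h = (\<Sum>\<sigma>\<in>configs d n. exp (- hamiltonian d \<beta> n h \<sigma>))"

(* finite-volume configurations are extended by +1 outside the box (irrelevant for local functions
   once their support lies in the box) *)
definition extend :: "nat \<Rightarrow> nat \<Rightarrow> config \<Rightarrow> config" where
  "extend d n \<sigma> x = (if x \<in> box d n then \<sigma> x else 1)"

definition gibbs_exp :: "nat \<Rightarrow> real \<Rightarrow> nat \<Rightarrow> (site \<Rightarrow> real) \<Rightarrow> (config \<Rightarrow> real) \<Rightarrow> real" where
  "gibbs_exp d \<beta> n h f =
     (\<Sum>\<sigma>\<in>configs d n. exp (- hamiltonian d \<beta> n h \<sigma>) * f (extend d n \<sigma>)) / partition_fn d \<beta> n h"

definition local_fun :: "nat \<Rightarrow> (config \<Rightarrow> real) \<Rightarrow> bool" where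
  "local_fun d f \<longleftrightarrow> (\<exists>A. finite A \<and> A \<subseteq> lattice d \<and> (\<forall>\<sigma> \<tau>. (\<forall>x\<in>A. \<sigma> x = \<tau> x) \<longrightarrow> f \<sigma> = f \<tau>))"

definition inf_space :: "nat \<Rightarrow> config measure" where
  "inf_space d = PiM (lattice d) (\<lambda>_. count_space {-1, 1})"

definition is_state :: "nat \<Rightarrow> config measure \<Rightarrow> bool" where
  "is_state d \<nu> \<longleftrightarrow> prob_space \<nu> \<and> sets \<nu> = sets (inf_space d)"

(* weak limit points of a sequence of measures, given by their expectation functionals E n *)
definition limit_points :: "nat \<Rightarrow> (nat \<Rightarrow> (config \<Rightarrow> real) \<Rightarrow> real) \<Rightarrow> config measure set" where
  "limit_points d E = {\<nu>. is_state d \<nu> \<and>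
     (\<exists>r. strict_mono r \<and> (\<forall>f. local_fun d f \<longrightarrow> (\<lambda>k. E (r k) f) \<longlonglongrightarrow> integral\<^sup>L \<nu> f))}"

definition plus_state :: "nat \<Rightarrow> real \<Rightarrow> config measure" where
  "plus_state d \<beta> = (THE \<nu>. is_state d \<nu> \<and>
     (\<forall>f. local_fun d f \<longrightarrow> (\<lambda>n. gibbs_exp d \<beta> n (\<lambda>_. \<beta>) f) \<longlonglongrightarrow> integral\<^sup>L \<nu> f))"

definition minus_state :: "nat \<Rightarrow> real \<Rightarrow> config measure" where
  "minus_state d \<beta> = (THE \<nu>. is_state d \<nu> \<and>
     (\<forall>f. local_fun d f \<longrightarrow> (\<lambda>n. gibbs_exp d \<beta> n (\<lambda>_. - \<beta>) f) \<longlonglongrightarrow> integral\<^sup>L \<nu> f))"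

definition admissible_law :: "real \<Rightarrow> real measure \<Rightarrow> bool" where
  "admissible_law lam_star P \<longleftrightarrow>
     prob_space P \<and> sets P = sets borel \<and>
     distr P borel uminus = P \<and>
     integrable P (\<lambda>x. x) \<and> integral\<^sup>L P (\<lambda>x. x) = 0 \<and>
     prob_space.variance P (\<lambda>x. x) > 0 \<and>
     measure P {x. lam_star < \<bar>x\<bar>} = 0"

end

theory Submission
  imports Defs
begin

text \<open>
  A configuration is identified with its set of plus sites. Contours are the sets \<open>A\<close> that are connected
  together with their complement and occupy at most half of the box; by a canonical-path argument such a set
  touches the boundary of the box in at most \<open>4 d\<close> times as many sites as it has boundary bonds, so at low
  temperature bounded boundary fields do not spoil the Peierls argument. Up to a small fraction of the
  weight, the configurations therefore split into a plus and a minus ensemble, according to the sign of the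
  central cluster, i.e. the cluster all of whose complementary components are smaller than half of the box.
  In the plus ensemble a given box is very likely surrounded by a screen of plus spins. The largest screen is
  measurable with respect to the outside, and the FKG inequality sandwiches the conditional expectations
  between plus states of two boxes; hence the Gibbs measure is close to a mixture of the plus and the minus
  state.

  The weights of this mixture are governed by the logarithm \<open>G\<close> of the ratio of the two ensemble weights.
  Flipping the sign of one boundary field of absolute value at least \<open>a\<close> changes \<open>G\<close> monotonically by a fixed
  amount, so Sperner's theorem, applied to the signs of the symmetric fields, bounds the probability that
  \<open>\<bar>G\<bar> \<le> K\<close> by a multiple of the inverse square root of the number of boundary sites. By Borel-Cantelli
  \<open>\<bar>G\<bar>\<close> tends to infinity along the sequence of boxes, while symmetry and the independence of the fields on
  disjoint boundaries make both signs occur infinitely often.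
\<close>

subsection \<open>The FKG inequality and Sperner's theorem\<close>

text \<open>No spins are fixed outside the box, so contours may end on its faces and there is no
  outer component to serve as the sea; comparison with half of the box replaces it. Flipping a
  contour gains \<open>2 * \<beta>\<close> per bond and may lose \<open>2 * l\<close> per boundary
  site, so it is enough that \<open>\<beta>\<close> is large relative to \<open>l\<close> and
  \<open>d\<close>. The estimates hold for every field bounded by \<open>l\<close>; randomness
  enters only in the weights of the two ensembles. The field \<open>\<beta>\<close> that defines the
  plus state may exceed \<open>l\<close> and is reached from \<open>l\<close> by monotonicity.
  \<open>G\<close> is not a sum of independent terms, so a local limit theorem does not apply
  directly, whereas an antichain argument needs only increments bounded below. Its rate, the inverse
  root of \<open>n ^ (d - 1)\<close>, is summable over all \<open>n\<close> exactly when
  \<open>d > 3\<close>; for boxes of side \<open>n powr e\<close> the condition becomes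
  \<open>e * (d - 1) / 2 > 1\<close>, which \<open>e = 4 - d + \<omega>\<close> meets for
  \<open>d = 2\<close> and \<open>d = 3\<close>.\<close>

lemma sum_Pow_insert:
  fixes f :: "'a set \<Rightarrow> real"
  assumes "finite V" "x \<notin> V"
  shows "(\<Sum>S\<in>Pow (insert x V). f S) = (\<Sum>S\<in>Pow V. f S) + (\<Sum>S\<in>Pow V. f (insert x S))"
proof -
  have inj: "inj_on (insert x) (Pow V)"
    using assms(2) by (intro inj_onI) (metis Diff_insert_absorb PowD insert_absorb subset_iff)
  have "(\<Sum>S\<in>Pow (insert x V). f S) = (\<Sum>S\<in>Pow V. f S) + (\<Sum>S\<in>insert x ` Pow V. f S)"
    unfolding Pow_insert using assms by (intro sum.union_disjoint) auto
  also have "(\<Sum>S\<in>insert x ` Pow V. f S) = (\<Sum>S\<in>Pow V. f (insert x S))"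
    using inj by (simp add: sum.reindex)
  finally show ?thesis .
qed

text \<open>Splitting on one site, the ratio of the two conditional weights is itself increasing, so the
  inequality for the remaining sites also yields the monotonicity in the split site.\<close>

lemma fkg_inequality:
  fixes w f g :: "'a set \<Rightarrow> real"
  assumes "finite V"
    and "\<And>S. S \<subseteq> V \<Longrightarrow> 0 < w S"
    and "\<And>S T. S \<subseteq> V \<Longrightarrow> T \<subseteq> V \<Longrightarrow> w S * w T \<le> w (S \<union> T) * w (S \<inter> T)"
    and "\<And>S T. S \<subseteq> T \<Longrightarrow> T \<subseteq> V \<Longrightarrow> f S \<le> f T"
    and "\<And>S T. S \<subseteq> T \<Longrightarrow> T \<subseteq> V \<Longrightarrow> g S \<le> g T"
  shows "(\<Sum>S\<in>Pow V. w S * f S) * (\<Sum>S\<in>Pow V. w S * g S)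
         \<le> (\<Sum>S\<in>Pow V. w S) * (\<Sum>S\<in>Pow V. w S * f S * g S)"
  using assms
proof (induction V arbitrary: w f g rule: finite_induct)
  case empty
  then show ?case by simp
next
  case (insert x V)
  note pos = insert.prems(1) and sm = insert.prems(2) and mf = insert.prems(3) and mg = insert.prems(4)
  define w1 where "w1 S = w (insert x S)" for S
  define W0 where "W0 = (\<Sum>S\<in>Pow V. w S)"
  define W1 where "W1 = (\<Sum>S\<in>Pow V. w1 S)"
  define F0 where "F0 = (\<Sum>S\<in>Pow V. w S * f S)"
  define F1 where "F1 = (\<Sum>S\<in>Pow V. w1 S * f (insert x S))"
  define G0 where "G0 = (\<Sum>S\<in>Pow V. w S * g S)"
  define G1 where "G1 = (\<Sum>S\<in>Pow V. w1 S * g (insert x S))"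
  define H0 where "H0 = (\<Sum>S\<in>Pow V. w S * f S * g S)"
  define H1 where "H1 = (\<Sum>S\<in>Pow V. w1 S * f (insert x S) * g (insert x S))"
  have p0: "0 < w S" if "S \<subseteq> V" for S using pos that by blast
  have p1: "0 < w1 S" if "S \<subseteq> V" for S unfolding w1_def using pos that by blast
  have s0: "w S * w T \<le> w (S \<union> T) * w (S \<inter> T)" if "S \<subseteq> V" "T \<subseteq> V" for S T
    using sm that by blast
  have s1: "w1 S * w1 T \<le> w1 (S \<union> T) * w1 (S \<inter> T)" if "S \<subseteq> V" "T \<subseteq> V" for S T
  proof -
    have "insert x S \<union> insert x T = insert x (S \<union> T)" "insert x S \<inter> insert x T = insert x (S \<inter> T)"
      by auto
    then show ?thesis unfolding w1_def using sm[of "insert x S" "insert x T"] that by auto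
  qed
  define r where "r S = w1 S / w S" for S
  have mr: "r S \<le> r T" if "S \<subseteq> T" "T \<subseteq> V" for S T
  proof -
    have e: "insert x S \<union> T = insert x T" "insert x S \<inter> T = S" using that insert.hyps by auto
    have "w1 S * w T \<le> w1 T * w S"
      unfolding w1_def using sm[of "insert x S" T] that e by auto
    then show ?thesis unfolding r_def using p0[of S] p0[of T] that
      by (simp add: field_simps)
  qed
  have W0p: "W0 > 0" unfolding W0_def using p0 insert.hyps by (intro sum_pos) auto
  have W1p: "W1 > 0" unfolding W1_def using p1 insert.hyps by (intro sum_pos) auto
  have wr: "w S * r S = w1 S" if "S \<in> Pow V" for S using p0[of S] that by (simp add: r_def)
  have up: "F0 * W1 \<le> W0 * F1" if mf: "\<And>S T. S \<subseteq> T \<Longrightarrow> T \<subseteq> insert x V \<Longrightarrow> f S \<le> f T"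
    and F0: "F0 = (\<Sum>S\<in>Pow V. w S * f S)" and F1: "F1 = (\<Sum>S\<in>Pow V. w1 S * f (insert x S))"
    for f :: "'a set \<Rightarrow> real" and F0 F1
  proof -
    have "(\<Sum>S\<in>Pow V. w S * f S) * (\<Sum>S\<in>Pow V. w S * r S)
         \<le> (\<Sum>S\<in>Pow V. w S) * (\<Sum>S\<in>Pow V. w S * f S * r S)"
    proof (rule insert.IH)
      show "f S \<le> f T" if "S \<subseteq> T" "T \<subseteq> V" for S T using that by (intro mf) blast+
    qed (fact p0 s0 mr)+
    also have "(\<Sum>S\<in>Pow V. w S * r S) = W1"
      unfolding W1_def using wr by (intro sum.cong) auto
    also have "(\<Sum>S\<in>Pow V. w S * f S * r S) = (\<Sum>S\<in>Pow V. w1 S * f S)"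
      using wr by (intro sum.cong) (auto simp: mult_ac)
    finally have 1: "F0 * W1 \<le> W0 * (\<Sum>S\<in>Pow V. w1 S * f S)" unfolding F0 W0_def .
    have "(\<Sum>S\<in>Pow V. w1 S * f S) \<le> F1"
      unfolding F1
    proof (intro sum_mono mult_left_mono)
      fix S assume "S \<in> Pow V"
      then show "f S \<le> f (insert x S)" "0 \<le> w1 S"
        using p1[of S] by (auto intro!: mf simp: less_imp_le)
    qed
    then show ?thesis using 1 W0p by (meson mult_left_mono order_trans less_imp_le)
  qed
  have f01: "F0 * W1 \<le> W0 * F1" by (rule up[OF mf F0_def F1_def])
  have g01: "G0 * W1 \<le> W0 * G1" by (rule up[OF mg G0_def G1_def])
  have h0: "F0 * G0 \<le> W0 * H0" unfolding F0_def G0_def W0_def H0_def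
  proof (rule insert.IH)
    show "f S \<le> f T" "g S \<le> g T" if "S \<subseteq> T" "T \<subseteq> V" for S T
      using that by (intro mf mg; blast)+
  qed (fact p0 s0)+
  have h1: "F1 * G1 \<le> W1 * H1" unfolding F1_def G1_def W1_def H1_def
  proof (rule insert.IH)
    show "f (insert x S) \<le> f (insert x T)" "g (insert x S) \<le> g (insert x T)"
      if "S \<subseteq> T" "T \<subseteq> V" for S T
      using that by (intro mf mg; blast)+
  qed (fact p1 s1)+
  \<comment> \<open>\<open>a0\<close>, \<open>a1\<close>, \<open>b0\<close>, \<open>b1\<close> are
    the conditional means of \<open>f\<close> and \<open>g\<close> given the split site. Inside each
    half the correlation is positive by \<open>h0\<close> and \<open>h1\<close>; between the halves
    it is Chebyshev's inequality for the two-point law with weights \<open>W0\<close> and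
    \<open>W1\<close>.\<close>
  have key: "(F0 + F1) * (G0 + G1) \<le> (W0 + W1) * (H0 + H1)"
  proof -
    define a0 where "a0 = F0 / W0"
    define a1 where "a1 = F1 / W1"
    define b0 where "b0 = G0 / W0"
    define b1 where "b1 = G1 / W1"
    have "a0 \<le> a1" "b0 \<le> b1" unfolding a0_def a1_def b0_def b1_def using f01 g01 W0p W1p
      by (simp_all add: field_simps)
    then have "0 \<le> (a1 - a0) * (b1 - b0)" by simp
    then have "0 \<le> W0 * W1 * ((a1 - a0) * (b1 - b0))" using W0p W1p by simp
    moreover have "F0 = W0 * a0" "F1 = W1 * a1" "G0 = W0 * b0" "G1 = W1 * b1"
      unfolding a0_def a1_def b0_def b1_def using W0p W1p by simp_all
    moreover have "W0 * a0 * b0 \<le> H0" "W1 * a1 * b1 \<le> H1"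
      unfolding a0_def a1_def b0_def b1_def using h0 h1 W0p W1p by (simp_all add: field_simps)
    then have "(W0 + W1) * (W0 * a0 * b0 + W1 * a1 * b1) \<le> (W0 + W1) * (H0 + H1)"
      using W0p W1p by (intro mult_left_mono) auto
    ultimately show ?thesis by (simp add: algebra_simps)
  qed
  show ?case using key insert.hyps
    by (simp add: sum_Pow_insert W0_def W1_def F0_def F1_def G0_def G1_def H0_def H1_def w1_def)
qed

text \<open>Taking the density as the second increasing function in \<open>fkg_inequality\<close>
  shows that an increasing tilt raises the means of increasing functions. With \<open>r\<close> the
  exponential of a field difference this is monotonicity in the boundary field.\<close>

lemma fkg_tilt:
  fixes w r f :: "'a set \<Rightarrow> real"
  assumes "finite V" and "\<And>S. S \<subseteq> V \<Longrightarrow> 0 < w S"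
    and "\<And>S T. S \<subseteq> V \<Longrightarrow> T \<subseteq> V \<Longrightarrow> w S * w T \<le> w (S \<union> T) * w (S \<inter> T)"
    and "\<And>S T. S \<subseteq> T \<Longrightarrow> T \<subseteq> V \<Longrightarrow> r S \<le> r T"
    and "\<And>S. S \<subseteq> V \<Longrightarrow> 0 < r S"
    and "\<And>S T. S \<subseteq> T \<Longrightarrow> T \<subseteq> V \<Longrightarrow> f S \<le> f T"
  shows "(\<Sum>S\<in>Pow V. w S * f S) / (\<Sum>S\<in>Pow V. w S)
         \<le> (\<Sum>S\<in>Pow V. w S * r S * f S) / (\<Sum>S\<in>Pow V. w S * r S)"
proof -
  have "(\<Sum>S\<in>Pow V. w S * r S) * (\<Sum>S\<in>Pow V. w S * f S)
         \<le> (\<Sum>S\<in>Pow V. w S) * (\<Sum>S\<in>Pow V. w S * r S * f S)"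
    by (rule fkg_inequality) (fact assms)+
  moreover have "0 < (\<Sum>S\<in>Pow V. w S)" "0 < (\<Sum>S\<in>Pow V. w S * r S)"
    using assms by (auto intro!: sum_pos)
  ultimately show ?thesis by (simp add: field_simps)
qed

text \<open>Induction by averaging: a member \<open>A \<noteq> V\<close> survives in
  \<open>V - {x}\<close> for each of the \<open>card V - card A\<close> points \<open>x\<close>
  outside it. Summing the inequalities for all \<open>V - {x}\<close> and applying the absorption
  identity for binomials gives \<open>card V\<close> times the sum for \<open>V\<close>. The case
  \<open>V \<in> F\<close> stands apart, since then \<open>F\<close> is a singleton.\<close>

lemma lym_inequality:
  assumes "finite V" "F \<subseteq> Pow V" "\<And>A B. A \<in> F \<Longrightarrow> B \<in> F \<Longrightarrow> A \<subseteq> B \<Longrightarrow> A = B"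
  shows "(\<Sum>A\<in>F. 1 / real (card V choose card A)) \<le> 1"
  using assms
proof (induction "card V" arbitrary: V F)
  case 0
  then have "F = {} \<or> F = {{}}" by auto
  then show ?case by auto
next
  case (Suc N)
  show ?case
  proof (cases "V \<in> F")
    case True
    then have "F = {V}" using Suc.prems by blast
    then show ?thesis by simp
  next
    case False
    have finF: "finite F" using Suc.prems by (meson finite_Pow_iff finite_subset)
    have lt: "card A < card V" if "A \<in> F" for A
      using that False Suc.prems by (metis PowD psubsetI psubset_card_mono subsetD)
    have "(\<Sum>A\<in>{A\<in>F. x \<notin> A}. 1 / real (N choose card A)) \<le> 1" if "x \<in> V" for x
    proof -
      have c: "card (V - {x}) = N" using that Suc by simp
      show ?thesis using Suc.hyps(1)[of "V - {x}" "{A\<in>F. x \<notin> A}"] Suc.prems c that by auto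
    qed
    then have "(\<Sum>x\<in>V. \<Sum>A\<in>{A\<in>F. x \<notin> A}. 1 / real (N choose card A)) \<le> (\<Sum>x\<in>V. 1)"
      by (intro sum_mono) auto
    also have "(\<Sum>x\<in>V. \<Sum>A\<in>{A\<in>F. x \<notin> A}. 1 / real (N choose card A))
        = (\<Sum>A\<in>F. \<Sum>x\<in>{x\<in>V. x \<notin> A}. 1 / real (N choose card A))"
      by (rule sum.swap_restrict) (use Suc.prems finF in auto)
    also have "\<dots> = (\<Sum>A\<in>F. real (Suc N) * (1 / real (card V choose card A)))"
    proof (rule sum.cong[OF refl])
      fix A assume A: "A \<in> F"
      then have fA: "A \<subseteq> V" using Suc.prems by auto
      have "{x\<in>V. x \<notin> A} = V - A" by auto
      then have cd: "card {x\<in>V. x \<notin> A} = Suc N - card A"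
        using fA Suc by (simp add: card_Diff_subset finite_subset)
      define k where "k = card A"
      have k: "k \<le> N" using lt[OF A] Suc by (simp add: k_def)
      have "(Suc N - k) * (Suc N choose k) = Suc N * (N choose k)"
        using binomial_absorb_comp[of "Suc N" k] by simp
      then have "real (Suc N - k) * real (Suc N choose k) = real (Suc N) * real (N choose k)"
        by (metis of_nat_mult)
      moreover have "real (Suc N choose k) > 0" "real (N choose k) > 0" using k by auto
      ultimately have "real (Suc N - k) * (1 / real (N choose k)) = real (Suc N) * (1 / real (Suc N choose k))"
        by (simp add: field_simps)
      then show "(\<Sum>x\<in>{x\<in>V. x \<notin> A}. 1 / real (N choose card A)) = real (Suc N) * (1 / real (card V choose card A))"
        using cd Suc k_def by simp
    qed
    also have "\<dots> = real (Suc N) * (\<Sum>A\<in>F. 1 / real (card V choose card A))"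
      by (simp add: sum_distrib_left)
    finally show ?thesis using Suc.hyps(2) by (simp del: of_nat_Suc)
  qed
qed

lemma sperner:
  assumes "finite V" "F \<subseteq> Pow V" "\<And>A B. A \<in> F \<Longrightarrow> B \<in> F \<Longrightarrow> A \<subseteq> B \<Longrightarrow> A = B"
  shows "card F \<le> (card V choose (card V div 2))"
proof -
  define c where "c = (card V choose (card V div 2))"
  have c: "c > 0" unfolding c_def by simp
  have "(\<Sum>A\<in>F. 1 / real c) \<le> (\<Sum>A\<in>F. 1 / real (card V choose card A))"
  proof (rule sum_mono)
    fix A assume "A \<in> F"
    then have "card A \<le> card V" using assms by (auto intro: card_mono)
    moreover have "card V choose card A \<le> c" unfolding c_def by (rule binomial_maximum)
    ultimately show "1 / real c \<le> 1 / real (card V choose card A)"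
      using c by (intro divide_left_mono) auto
  qed
  also have "\<dots> \<le> 1" by (rule lym_inequality[OF assms])
  finally have "real (card F) \<le> real c" using c by (simp add: field_simps)
  then show ?thesis unfolding c_def by simp
qed

text \<open>The square keeps roots out of the induction, and the factor \<open>2 * m + 1\<close>
  makes it close: the step multiplies the left side by
  \<open>4 * (2 * m + 1) * (2 * m + 3) / (m + 1) ^ 2\<close>, which is below \<open>16\<close>
  because \<open>(2 * m + 1) * (2 * m + 3) = 4 * (m + 1) ^ 2 - 1\<close>.\<close>

lemma central_binomial_even_le: "real ((2 * m) choose m) ^ 2 * (2 * real m + 1) \<le> (4 ^ m) ^ 2"
proof (induction m)
  case 0
  then show ?case by simp
next
  case (Suc m)
  define c where "c = real ((2 * m) choose m)"
  define c' where "c' = real ((2 * Suc m) choose Suc m)"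
  have rec: "c' * (real m + 1) = 2 * (2 * real m + 1) * c"
  proof -
    have a: "Suc m * (Suc (Suc (2*m)) choose Suc m) = Suc (Suc (2*m)) * (Suc (2*m) choose m)"
      by (rule Suc_times_binomial)
    have b: "Suc m * (Suc (2*m) choose Suc m) = Suc (2*m) * (2*m choose m)"
      by (rule Suc_times_binomial)
    have s: "(Suc (2*m) choose m) = (Suc (2*m) choose Suc m)"
      using binomial_symmetric[of m "Suc (2*m)"] by (simp add: algebra_simps)
    have "Suc m * (2 * Suc m choose Suc m) = 2 * (Suc m * (Suc (2*m) choose Suc m))"
      using a s by simp
    also have "\<dots> = 2 * (Suc (2*m) * (2*m choose m))" using b by simp
    finally have "real (Suc m * (2 * Suc m choose Suc m)) = real (2 * (Suc (2*m) * (2*m choose m)))" by (rule arg_cong)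
    then show ?thesis unfolding c_def c'_def by (simp add: algebra_simps)
  qed
  define M where "M = real m + 1"
  have Mp: "M > 0" "M^2 > 0" unfolding M_def by auto
  have "c'^2 * (2 * real (Suc m) + 1) * M^2 = (c' * M)^2 * (2 * real m + 3)"
    by (simp add: power_mult_distrib algebra_simps)
  also have "\<dots> = (2 * (2 * real m + 1) * c)^2 * (2 * real m + 3)"
    using rec unfolding M_def by simp
  also have "\<dots> = 4 * (2 * real m + 1) * (2 * real m + 3) * (c^2 * (2 * real m + 1))"
    by (simp add: power2_eq_square algebra_simps)
  also have "\<dots> \<le> 4 * (2 * real m + 1) * (2 * real m + 3) * ((4^m)^2)"
    using Suc unfolding c_def by (intro mult_left_mono) auto
  also have "\<dots> \<le> (16 * M^2) * ((4^m)^2)"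
    unfolding M_def by (intro mult_right_mono) (auto simp: power2_eq_square algebra_simps)
  also have "\<dots> = (4 ^ Suc m)^2 * M^2" by (simp add: power2_eq_square algebra_simps)
  finally show ?case using Mp unfolding c'_def by simp
qed

lemma central_binomial_le:
  assumes "N > 0"
  shows "real (N choose (N div 2)) \<le> 2 * 2 ^ N / sqrt (real N)"
proof -
  define m where "m = N div 2"
  have pre: "real ((2 * m) choose m) * sqrt (2 * real m + 1) \<le> 4 ^ m"
  proof (rule power2_le_imp_le)
    have "(real ((2 * m) choose m) * sqrt (2 * real m + 1))\<^sup>2 = real ((2 * m) choose m) ^ 2 * (2 * real m + 1)"
      by (subst power_mult_distrib) (subst real_sqrt_pow2, auto)
    then show "(real ((2 * m) choose m) * sqrt (2 * real m + 1))\<^sup>2 \<le> (4 ^ m)\<^sup>2"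
      using central_binomial_even_le[of m] by presburger
  qed (rule zero_le_power, simp)
  consider "N = 2 * m" | "N = Suc (2 * m)" unfolding m_def by linarith
  then have "real (N choose m) * sqrt (real N) \<le> 2 * 2 ^ N"
  proof cases
    case 1
    have "real (N choose m) * sqrt (real N) \<le> real ((2*m) choose m) * sqrt (2 * real m + 1)"
      unfolding 1 by (intro mult_left_mono) auto
    also have "\<dots> \<le> 2 ^ N" using pre 1 by (simp add: power_mult)
    finally show ?thesis using zero_le_power[of "2::real" N] by linarith
  next
    case 2
    have "Suc (2*m) choose m \<le> 2 * (2*m choose m)"
    proof (cases m)
      case (Suc k)
      have "2*m choose k \<le> 2*m choose m" using binomial_maximum'[of m k] by simp
      then show ?thesis unfolding Suc by simp
    qed simp
    then have "real (N choose m) \<le> 2 * real (2*m choose m)" unfolding 2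
      by (metis of_nat_le_iff of_nat_mult of_nat_numeral)
    then have "real (N choose m) * sqrt (real N) \<le> 2 * real ((2*m) choose m) * sqrt (2 * real m + 1)"
      unfolding 2 by (intro mult_mono) (auto simp: add.commute)
    also have "\<dots> \<le> 2 * 4 ^ m" using pre by simp
    also have "\<dots> = 2 ^ N" unfolding 2 by (simp add: power_mult)
    finally show ?thesis using zero_le_power[of "2::real" N] by linarith
  qed
  then show ?thesis unfolding m_def using assms by (simp add: field_simps)
qed

subsection \<open>Clusters and contours\<close>

definition up :: "site \<Rightarrow> nat \<Rightarrow> site" where
  "up x i = x(i := x i + 1)"

text \<open>Neighbours are described by a direction and a unit step rather than by distance, which
  fits the coding of a bond by its base site and direction. A step in a direction below
  \<open>d\<close> preserves the lattice.\<close>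

definition nb :: "nat \<Rightarrow> site \<Rightarrow> site \<Rightarrow> bool" where
  "nb d x y \<longleftrightarrow> (\<exists>i<d. y = up x i \<or> x = up y i)"

definition step_rel :: "nat \<Rightarrow> site set \<Rightarrow> (site \<times> site) set" where
  "step_rel d S = {(x, y). x \<in> S \<and> y \<in> S \<and> nb d x y}"

text \<open>For \<open>x\<close> outside \<open>S\<close> this is empty, the reflexive pair being
  discarded by \<open>y \<in> S\<close>.\<close>

definition cluster :: "nat \<Rightarrow> site set \<Rightarrow> site \<Rightarrow> site set" where
  "cluster d S x = {y \<in> S. (x, y) \<in> (step_rel d S)\<^sup>*}"

definition conn :: "nat \<Rightarrow> site set \<Rightarrow> bool" where
  "conn d A \<longleftrightarrow> (\<forall>x\<in>A. \<forall>y\<in>A. (x, y) \<in> (step_rel d A)\<^sup>*)"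

lemma nb_sym: "nb d x y \<longleftrightarrow> nb d y x"
  by (auto simp: nb_def)

lemma nb_up: "i < d \<Longrightarrow> nb d x (up x i)"
  by (auto simp: nb_def)

lemma step_rel_sym: "(x, y) \<in> (step_rel d S)\<^sup>* \<Longrightarrow> (y, x) \<in> (step_rel d S)\<^sup>*"
proof -
  have "sym (step_rel d S)" by (auto simp: step_rel_def sym_def nb_sym)
  then show "(x, y) \<in> (step_rel d S)\<^sup>* \<Longrightarrow> (y, x) \<in> (step_rel d S)\<^sup>*"
    by (meson sym_rtrancl symD)
qed

lemma step_rel_mono: "S \<subseteq> T \<Longrightarrow> (step_rel d S)\<^sup>* \<subseteq> (step_rel d T)\<^sup>*"
  by (rule rtrancl_mono) (auto simp: step_rel_def)

lemma cluster_subset: "cluster d S x \<subseteq> S"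
  by (auto simp: cluster_def)

lemma cluster_self: "x \<in> S \<Longrightarrow> x \<in> cluster d S x"
  by (auto simp: cluster_def)

lemma cluster_nb: "y \<in> cluster d S x \<Longrightarrow> z \<in> S \<Longrightarrow> nb d y z \<Longrightarrow> z \<in> cluster d S x"
  unfolding cluster_def by (auto simp: step_rel_def intro: rtrancl_into_rtrancl)

lemma step_rel_in_cluster:
  assumes "(x, y) \<in> (step_rel d S)\<^sup>*" "x \<in> S"
  shows "(x, y) \<in> (step_rel d (cluster d S x))\<^sup>* \<and> y \<in> cluster d S x"
  using assms(1)
proof (induction rule: rtrancl_induct)
  case base
  then show ?case using cluster_self assms by auto
next
  case (step y z)
  then have "z \<in> cluster d S x" using cluster_nb by (auto simp: step_rel_def)
  then show ?case using step by (auto simp: step_rel_def intro: rtrancl_into_rtrancl)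
qed

lemma conn_cluster:
  assumes "x \<in> S"
  shows "conn d (cluster d S x)"
  unfolding conn_def
proof (intro ballI)
  fix y z assume "y \<in> cluster d S x" "z \<in> cluster d S x"
  then have "(x, y) \<in> (step_rel d (cluster d S x))\<^sup>*" "(x, z) \<in> (step_rel d (cluster d S x))\<^sup>*"
    using step_rel_in_cluster[OF _ assms] by (auto simp: cluster_def)
  then show "(y, z) \<in> (step_rel d (cluster d S x))\<^sup>*" using step_rel_sym rtrancl_trans by metis
qed

lemma cluster_mono: "S \<subseteq> T \<Longrightarrow> cluster d S x \<subseteq> cluster d T x"
  unfolding cluster_def using step_rel_mono[of S T] by auto

lemma conn_subset_cluster:
  assumes "conn d A" "A \<subseteq> S" "x \<in> A"
  shows "A \<subseteq> cluster d S x"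
  using assms step_rel_mono[OF assms(2), of d] by (auto simp: conn_def cluster_def)

lemma conn_invariant:
  assumes "conn d A" "x \<in> A" "y \<in> A"
    and "\<And>u v. u \<in> A \<Longrightarrow> v \<in> A \<Longrightarrow> nb d u v \<Longrightarrow> P u \<Longrightarrow> P v" and "P x"
  shows "P y"
proof -
  have "(x, y) \<in> (step_rel d A)\<^sup>*" using assms by (auto simp: conn_def)
  then show ?thesis
    by (induction rule: rtrancl_induct) (use assms in \<open>auto simp: step_rel_def\<close>)
qed

text \<open>Follow a path in \<open>B\<close> from a point outside the removed component
  \<open>E\<close> towards \<open>C\<close> and stop at its first visit to \<open>C\<close>. Until
  then it runs in \<open>B - C\<close>, where it cannot enter the component \<open>E\<close> from
  outside. So every remaining point reaches the connected set \<open>C\<close> without touching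
  \<open>E\<close>.\<close>

lemma conn_Diff_cluster:
  assumes "conn d B" "conn d C" "C \<subseteq> B" "C \<noteq> {}" "y \<in> B - C"
  shows "conn d (B - cluster d (B - C) y)"
proof -
  define E where "E = cluster d (B - C) y"
  have CE: "C \<subseteq> B - E" unfolding E_def using cluster_subset assms by blast
  obtain c where c: "c \<in> C" using assms by auto
  have reach: "u \<in> B - E \<Longrightarrow> \<exists>c'\<in>C. (u, c') \<in> (step_rel d (B - E))\<^sup>*"
    if "(u, c) \<in> (step_rel d B)\<^sup>*" for u
    using that
  proof (induction rule: converse_rtrancl_induct)
    case base
    then show ?case using c by auto
  next
    case (step u v)
    show ?case
    proof (cases "u \<in> C")
      case True
      then show ?thesis by auto
    next
      case False
      have uv: "nb d u v" "u \<in> B" "v \<in> B" using step by (auto simp: step_rel_def)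
      have "v \<notin> E"
      proof
        assume "v \<in> E"
        then have "u \<in> E" unfolding E_def using cluster_nb[of v d "B - C" y u] uv False nb_sym by auto
        then show False using step by auto
      qed
      then obtain c' where "c' \<in> C" "(v, c') \<in> (step_rel d (B - E))\<^sup>*" using step uv by auto
      moreover have "(u, v) \<in> step_rel d (B - E)" using step uv \<open>v \<notin> E\<close> by (auto simp: step_rel_def)
      ultimately show ?thesis by (meson converse_rtrancl_into_rtrancl)
    qed
  qed
  have "conn d (B - E)" unfolding conn_def
  proof (intro ballI)
    fix u v assume uv: "u \<in> B - E" "v \<in> B - E"
    have "(u, c) \<in> (step_rel d B)\<^sup>*" "(v, c) \<in> (step_rel d B)\<^sup>*"
      using uv c assms by (auto simp: conn_def)
    then obtain c1 c2 where c12: "c1 \<in> C" "(u, c1) \<in> (step_rel d (B - E))\<^sup>*"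
       "c2 \<in> C" "(v, c2) \<in> (step_rel d (B - E))\<^sup>*" using reach uv by blast
    have "(c1, c2) \<in> (step_rel d C)\<^sup>*" using c12 assms by (auto simp: conn_def)
    then have "(c1, c2) \<in> (step_rel d (B - E))\<^sup>*" using step_rel_mono[OF CE] by auto
    then show "(u, v) \<in> (step_rel d (B - E))\<^sup>*"
      using c12 step_rel_sym rtrancl_trans by metis
  qed
  then show ?thesis unfolding E_def .
qed

section \<open>Central clusters, the two ensembles and contours\<close>

definition is_central :: "nat \<Rightarrow> site set \<Rightarrow> site set \<Rightarrow> site set \<Rightarrow> bool" where
  "is_central d B S C \<longleftrightarrow> (\<exists>x\<in>S. C = cluster d S x) \<and>
     (\<forall>y\<in>B - C. 2 * card (cluster d (B - C) y) < card B)"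

definition Omega_plus :: "nat \<Rightarrow> site set \<Rightarrow> site set set" where
  "Omega_plus d B = {S. S \<subseteq> B \<and> (\<exists>C. is_central d B S C)}"

definition Omega_minus :: "nat \<Rightarrow> site set \<Rightarrow> site set set" where
  "Omega_minus d B = {S. S \<subseteq> B \<and> B - S \<in> Omega_plus d B}"

text \<open>Only disagreement across the edge boundary of \<open>A\<close> is required, not which
  side is plus, so the notion is invariant under reversing all spins.\<close>

definition cutting :: "nat \<Rightarrow> site set \<Rightarrow> site set \<Rightarrow> site set \<Rightarrow> bool" where
  "cutting d B A S \<longleftrightarrow> (\<forall>u\<in>A. \<forall>v\<in>B - A. nb d u v \<longrightarrow> (u \<in> S) \<noteq> (v \<in> S))"

definition contours :: "nat \<Rightarrow> site set \<Rightarrow> site set set" where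
  "contours d B = {A. A \<subseteq> B \<and> A \<noteq> {} \<and> conn d A \<and> conn d (B - A) \<and> 2 * card A \<le> card B}"

text \<open>If a plus cluster and a minus cluster were both central, the minus one would lie in a
  component \<open>E\<close> of the complement of the plus one. Then \<open>B - E\<close> is
  connected and avoids the minus cluster, so it lies in a component \<open>E'\<close> of the
  complement of that cluster. Two sets smaller than half of \<open>B\<close> would cover
  \<open>B\<close>.\<close>

lemma Omega_disjoint:
  assumes "finite B" "conn d B"
  shows "Omega_plus d B \<inter> Omega_minus d B = {}"
proof (rule ccontr)
  assume "\<not> ?thesis"
  then obtain S C C' where S: "S \<subseteq> B" and C: "is_central d B S C" and C': "is_central d B (B - S) C'"
    by (auto simp: Omega_plus_def Omega_minus_def)
  obtain x x' where x: "x \<in> S" "C = cluster d S x" and x': "x' \<in> B - S" "C' = cluster d (B - S) x'"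
    using C C' by (auto simp: is_central_def)
  have sub: "C \<subseteq> S" "C' \<subseteq> B - S" using x x' cluster_subset by blast+
  have xC: "x \<in> C" "x' \<in> C'" using x x' cluster_self by auto
  have cC: "conn d C" "conn d C'" using x x' conn_cluster by auto
  define E where "E = cluster d (B - C) x'"
  define E' where "E' = cluster d (B - C') x"
  have x'B: "x' \<in> B - C" "x \<in> B - C'" using x x' sub S by auto
  have "C' \<subseteq> E" unfolding E_def by (rule conn_subset_cluster) (use sub xC cC in auto)
  have "B - E \<subseteq> E'" unfolding E'_def
  proof (rule conn_subset_cluster)
    show "conn d (B - E)" unfolding E_def
      by (rule conn_Diff_cluster) (use assms cC sub S xC x'B in auto)
    show "B - E \<subseteq> B - C'" using \<open>C' \<subseteq> E\<close> by auto
    show "x \<in> B - E" using E_def cluster_subset[of d "B - C" x'] xC S x by auto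
  qed
  then have "B \<subseteq> E \<union> E'" by auto
  moreover have fin: "finite (E \<union> E')" using cluster_subset assms unfolding E_def E'_def
    by (meson Diff_subset finite_UnI finite_subset)
  ultimately have "card B \<le> card E + card E'"
    by (meson card_Un_le card_mono order_trans)
  moreover have "2 * card E < card B" "2 * card E' < card B"
    using C C' x'B unfolding is_central_def E_def E'_def by auto
  ultimately show False by linarith
qed

text \<open>This makes the Peierls argument possible inside the plus ensemble. A hole
  \<open>A\<close> of the central cluster \<open>C\<close> has all its outer neighbours in
  \<open>C\<close>, and a plus spin of \<open>A\<close> next to \<open>C\<close> would belong to
  \<open>C\<close>; so spins disagree along the border of \<open>A\<close>. Flipping
  \<open>A\<close> leaves \<open>C\<close> untouched and can only enlarge the cluster containing it,
  which shrinks the holes: the result is again in the plus ensemble.\<close>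

lemma central_contour:
  assumes "finite B" "conn d B" "S \<subseteq> B" "is_central d B S C" "y \<in> B - C"
    and A: "A = cluster d (B - C) y"
  shows "A \<in> contours d B" "cutting d B A S" "y \<in> A"
    "(S - A) \<union> (A - S) \<in> Omega_plus d B"
    "\<And>u v. u \<in> A \<Longrightarrow> v \<in> B - A \<Longrightarrow> nb d u v \<Longrightarrow> v \<in> C"
proof -
  obtain x where x: "x \<in> S" "C = cluster d S x" using assms by (auto simp: is_central_def)
  have CS: "C \<subseteq> S" "x \<in> C" using x cluster_subset cluster_self by auto
  have cC: "conn d C" using x conn_cluster by auto
  show yA: "y \<in> A" unfolding A using assms cluster_self by auto
  have AB: "A \<subseteq> B - C" unfolding A by (rule cluster_subset)
  have "conn d (B - A)" unfolding A
    by (rule conn_Diff_cluster) (use assms cC CS in auto)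
  moreover have "conn d A" unfolding A using assms by (intro conn_cluster) auto
  moreover have "2 * card A \<le> card B" using assms unfolding is_central_def by (simp add: less_imp_le)
  ultimately show "A \<in> contours d B" unfolding contours_def using AB yA by auto
  show nC: "v \<in> C" if "u \<in> A" "v \<in> B - A" "nb d u v" for u v
    using that cluster_nb[of u d "B - C" y v] unfolding A by auto
  show "cutting d B A S" unfolding cutting_def
  proof (intro ballI impI)
    fix u v assume uv: "u \<in> A" "v \<in> B - A" "nb d u v"
    then have "v \<in> C" by (rule nC)
    moreover have "u \<notin> S"
    proof
      assume "u \<in> S"
      then have "u \<in> C" using cluster_nb[of v d S x u] \<open>v \<in> C\<close> uv x nb_sym by auto
      then show False using uv AB by auto
    qed
    ultimately show "(u \<in> S) \<noteq> (v \<in> S)" using CS by auto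
  qed
  define S' where "S' = (S - A) \<union> (A - S)"
  define C' where "C' = cluster d S' x"
  have "C \<subseteq> S'" unfolding S'_def using CS AB by auto
  then have CC': "C \<subseteq> C'" unfolding C'_def using cC CS by (intro conn_subset_cluster) auto
  have "is_central d B S' C'" unfolding is_central_def
  proof (intro conjI ballI)
    show "\<exists>x\<in>S'. C' = cluster d S' x" using \<open>C \<subseteq> S'\<close> CS C'_def by auto
    fix z assume z: "z \<in> B - C'"
    have "cluster d (B - C') z \<subseteq> cluster d (B - C) z" using CC' by (intro cluster_mono) auto
    then have "card (cluster d (B - C') z) \<le> card (cluster d (B - C) z)"
      using assms(1) by (intro card_mono) (auto intro: finite_subset[OF cluster_subset])
    moreover have "2 * card (cluster d (B - C) z) < card B" using assms z CC' by (auto simp: is_central_def)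
    ultimately show "2 * card (cluster d (B - C') z) < card B" by linarith
  qed
  moreover have "S' \<subseteq> B" unfolding S'_def using assms AB by auto
  ultimately show "(S - A) \<union> (A - S) \<in> Omega_plus d B" unfolding Omega_plus_def S'_def by auto
qed

text \<open>Outside both ensembles every site is enclosed. The cluster \<open>C\<close> of a plus
  site \<open>x\<close> is not central, so some hole \<open>E\<close> occupies at least half of
  \<open>B\<close>; then \<open>B - E\<close> is a connected set around \<open>x\<close> of at most
  half the size. A minus site is treated by reversing all spins.\<close>

lemma noncentral_contour:
  assumes "finite B" "conn d B" "S \<subseteq> B" "S \<notin> Omega_plus d B" "S \<notin> Omega_minus d B" "x \<in> B"
  shows "\<exists>A\<in>contours d B. x \<in> A \<and> cutting d B A S"
proof -
  have main: "\<exists>A\<in>contours d B. x \<in> A \<and> cutting d B A S"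
    if S: "S \<subseteq> B" "S \<notin> Omega_plus d B" and x: "x \<in> S" for S
  proof -
    define C where "C = cluster d S x"
    have C: "C \<subseteq> S" "x \<in> C" "conn d C" unfolding C_def
      using x cluster_subset cluster_self conn_cluster by auto
    have "\<not> is_central d B S C" using S by (auto simp: Omega_plus_def)
    then obtain y where y: "y \<in> B - C" "\<not> 2 * card (cluster d (B - C) y) < card B"
      using x by (auto simp: is_central_def C_def)
    define E where "E = cluster d (B - C) y"
    have E: "E \<subseteq> B - C" "conn d E" "y \<in> E" unfolding E_def
      using y cluster_subset conn_cluster cluster_self by auto
    have "conn d (B - E)" unfolding E_def by (rule conn_Diff_cluster) (use assms C S y in auto)
    moreover have "B - (B - E) = E" using E by auto
    moreover have "card (B - E) = card B - card E"
      using E assms by (intro card_Diff_subset) (auto intro: finite_subset)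
    \<comment> \<open>Equality can occur here, which is why \<open>contours\<close> admits sets of
      exactly half the size.\<close>
    then have "2 * card (B - E) \<le> card B" using y unfolding E_def by auto
    moreover have xBE: "x \<in> B - E" using C E S by auto
    ultimately have "B - E \<in> contours d B" using E unfolding contours_def by auto
    moreover note xBE
    moreover have "cutting d B (B - E) S" unfolding cutting_def
    proof (intro ballI impI)
      fix u v assume u: "u \<in> B - E" and v: "v \<in> B - (B - E)" and uv: "nb d u v"
      have vE: "v \<in> E" using v E by auto
      have "u \<in> C"
      proof (rule ccontr)
        assume "u \<notin> C"
        then have "u \<in> E" unfolding E_def using cluster_nb[of v d "B - C" y u] vE u uv nb_sym E_def by auto
        then show False using u by auto
      qed
      moreover have "v \<notin> S"
      proof
        assume "v \<in> S"
        then have "v \<in> C" unfolding C_def using cluster_nb[of u d S x v] \<open>u \<in> C\<close> uv C_def by auto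
        then show False using vE E by auto
      qed
      ultimately show "(u \<in> S) \<noteq> (v \<in> S)" using C by auto
    qed
    ultimately show ?thesis by auto
  qed
  show ?thesis
  proof (cases "x \<in> S")
    case True
    then show ?thesis using main assms by auto
  next
    case False
    have "B - S \<notin> Omega_plus d B" using assms by (auto simp: Omega_minus_def)
    then obtain A where A: "A \<in> contours d B" "x \<in> A" "cutting d B A (B - S)"
      using main[of "B - S"] False assms by auto
    have "cutting d B A S" unfolding cutting_def
    proof (intro ballI impI)
      fix u v assume "u \<in> A" "v \<in> B - A" "nb d u v"
      moreover from this have "u \<in> B" "v \<in> B" using A by (auto simp: contours_def)
      ultimately show "(u \<in> S) \<noteq> (v \<in> S)" using A(3) by (auto simp: cutting_def)
    qed
    then show ?thesis using A by auto
  qed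
qed

subsection \<open>Isoperimetry in a box\<close>

text \<open>The least integer above \<open>- n / 2\<close>. For even \<open>n\<close> the box is not
  symmetric about the origin: \<open>lo n = 1 - hi n\<close>.\<close>

definition lo :: "nat \<Rightarrow> int" where "lo n = - ((int n - 1) div 2)"
definition hi :: "nat \<Rightarrow> int" where "hi n = int n div 2"

lemma hi_lo: "hi n - lo n + 1 = int n"
  unfolding lo_def hi_def by linarith

lemma mem_box: "x \<in> box d n \<longleftrightarrow> x \<in> lattice d \<and> (\<forall>i<d. lo n \<le> x i \<and> x i \<le> hi n)"
proof -
  have "(- real n / 2 < real_of_int z \<and> real_of_int z \<le> real n / 2) \<longleftrightarrow> lo n \<le> z \<and> z \<le> hi n" for z
  proof -
    have "- real n / 2 < real_of_int z \<longleftrightarrow> - int n < 2 * z"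
      by (simp add: field_simps) linarith
    also have "\<dots> \<longleftrightarrow> lo n \<le> z" unfolding lo_def by linarith
    finally have 1: "- real n / 2 < real_of_int z \<longleftrightarrow> lo n \<le> z" .
    have "real_of_int z \<le> real n / 2 \<longleftrightarrow> 2 * z \<le> int n"
      by (simp add: field_simps) linarith
    also have "\<dots> \<longleftrightarrow> z \<le> hi n" unfolding hi_def by linarith
    finally show ?thesis using 1 by simp
  qed
  then show ?thesis unfolding box_def by auto
qed

definition slice :: "nat \<Rightarrow> nat \<Rightarrow> nat \<Rightarrow> int \<Rightarrow> site set" where
  "slice d n j t = {x \<in> box d n. x j = t}"

lemma box_eq_PiE_dflt: "box d n = PiE_dflt {..<d} 0 (\<lambda>_. {lo n..hi n})"
  by (auto simp: mem_box PiE_dflt_def lattice_def)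

lemma card_interval: "card {lo n..hi n} = n"
  using hi_lo[of n] by simp

lemma finite_box [simp]: "finite (box d n)"
  unfolding box_eq_PiE_dflt by (intro finite_PiE_dflt) auto

lemma card_box: "card (box d n) = n ^ d"
  unfolding box_eq_PiE_dflt by (subst card_PiE_dflt) (auto simp del: card_atLeastAtMost_int simp: card_interval)

lemma card_slice:
  assumes "j < d" "lo n \<le> t" "t \<le> hi n"
  shows "card (slice d n j t) = n ^ (d - 1)"
proof -
  have "slice d n j t = PiE_dflt {..<d} 0 (\<lambda>i. if i = j then {t} else {lo n..hi n})"
    (is "_ = ?R")
  proof (intro set_eqI iffI)
    fix x assume "x \<in> ?R"
    then have 1: "i < d \<Longrightarrow> x i \<in> (if i = j then {t} else {lo n..hi n})" and 2: "\<not> i < d \<Longrightarrow> x i = 0" for i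
      by (auto simp: PiE_dflt_def)
    have "lo n \<le> x i \<and> x i \<le> hi n" if "i < d" for i
      using 1[OF that] assms by (cases "i = j") auto
    moreover have "x j = t" using 1[of j] assms by auto
    ultimately show "x \<in> slice d n j t" using 2 by (auto simp: slice_def mem_box lattice_def)
  qed (auto simp: slice_def mem_box PiE_dflt_def lattice_def)
  then have "card (slice d n j t) = (\<Prod>i<d. card (if i = j then {t} else {lo n..hi n}))"
    by (simp, subst card_PiE_dflt) auto
  also have "\<dots> = (\<Prod>i<d. if i = j then 1 else n)"
    by (intro prod.cong) (auto simp del: card_atLeastAtMost_int simp: card_interval)
  also have "\<dots> = (\<Prod>i\<in>{..<d} - {j}. n)"
    using assms by (subst prod.remove[of _ j]) auto
  also have "\<dots> = n ^ (d - 1)" using assms by (simp add: card_Diff_singleton)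
  finally show ?thesis .
qed

lemma finite_slice [simp]: "finite (slice d n j t)"
  by (auto simp: slice_def)

lemma box_upd: "x \<in> box d n \<Longrightarrow> k < d \<Longrightarrow> lo n \<le> t \<Longrightarrow> t \<le> hi n \<Longrightarrow> x(k := t) \<in> box d n"
  by (auto simp: mem_box lattice_def)

text \<open>Each nearest-neighbour pair inside the box is listed once, by its endpoint with the
  smaller coordinate and the direction.\<close>

definition bonds :: "nat \<Rightarrow> nat \<Rightarrow> (site \<times> nat) set" where
  "bonds d n = {(x, i). i < d \<and> x \<in> box d n \<and> up x i \<in> box d n}"

definition bd :: "nat \<Rightarrow> nat \<Rightarrow> site set \<Rightarrow> (site \<times> nat) set" where
  "bd d n A = {(x, i). (x, i) \<in> bonds d n \<and> (x \<in> A) \<noteq> (up x i \<in> A)}"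

lemma finite_bonds [simp]: "finite (bonds d n)"
  by (rule finite_subset[of _ "box d n \<times> {..<d}"]) (auto simp: bonds_def)

lemma bd_subset: "bd d n A \<subseteq> bonds d n"
  by (auto simp: bd_def)

lemma finite_bd [simp]: "finite (bd d n A)"
  by (rule finite_subset[OF bd_subset]) simp

lemma up_upd: "up (x(k := t)) k = x(k := t + 1)"
  by (auto simp: up_def)

lemma up_commute: "up (up x i) j = up (up x j) i"
  by (auto simp: up_def fun_eq_iff)

lemma int_switch:
  fixes s t :: int
  assumes "s \<le> t" "P s \<noteq> P t"
  shows "\<exists>r. s \<le> r \<and> r < t \<and> P r \<noteq> P (r + 1)"
proof (rule ccontr)
  assume a: "\<not> ?thesis"
  have "r \<le> t \<longrightarrow> P r = P s" if "s \<le> r" for r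
    using that
  proof (induction r rule: int_ge_induct)
    case (step i)
    have "i + 1 \<le> t \<longrightarrow> P i = P (i + 1)" using a step by auto
    then show ?case using step by auto
  qed simp
  from this[of t] show False using assms by auto
qed

lemma line_cross:
  assumes "z \<in> box d n" "k < d" "lo n \<le> s" "s \<le> hi n" "lo n \<le> t" "t \<le> hi n"
    and "(z(k := s) \<in> A) \<noteq> (z(k := t) \<in> A)"
  shows "\<exists>r. (z(k := r), k) \<in> bd d n A"
proof -
  have "\<exists>r. (z(k := r), k) \<in> bd d n A" if st: "s \<le> t" "lo n \<le> s" "t \<le> hi n"
    "(z(k := s) \<in> A) \<noteq> (z(k := t) \<in> A)" for s t
  proof -
    obtain r where r: "s \<le> r" "r < t" "(z(k := r) \<in> A) \<noteq> (z(k := r + 1) \<in> A)"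
      using int_switch[of s t "\<lambda>r. z(k := r) \<in> A"] st by auto
    have "z(k := r) \<in> box d n" "z(k := r + 1) \<in> box d n"
      using assms r st by (auto intro!: box_upd)
    then show ?thesis using r assms by (auto simp: bd_def bonds_def up_upd)
  qed
  from this[of s t] this[of t s] show ?thesis using assms by (cases "s \<le> t") auto
qed

text \<open>As \<open>K\<close> grows by one index at a time, \<open>mix K x y\<close> runs from
  \<open>x\<close> to \<open>y\<close> through the corners of a lattice path.\<close>

definition mix :: "nat set \<Rightarrow> site \<Rightarrow> site \<Rightarrow> site" where
  "mix K x y = (\<lambda>i. if i \<in> K then y i else x i)"

lemma mix_box: "x \<in> box d n \<Longrightarrow> y \<in> box d n \<Longrightarrow> mix K x y \<in> box d n"
  by (auto simp: mix_def mem_box lattice_def)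

lemma mix_full: "x \<in> lattice d \<Longrightarrow> y \<in> lattice d \<Longrightarrow> {..<d} \<subseteq> K \<Longrightarrow> mix K x y = y"
proof (rule ext)
  fix i assume "x \<in> lattice d" "y \<in> lattice d" "{..<d} \<subseteq> K"
  then show "mix K x y i = y i" by (cases "i < d") (auto simp: mix_def lattice_def)
qed

lemma mix_insert: "mix (insert k K) x y = (mix K x y)(k := y k)"
  by (auto simp: mix_def)

lemma mix_switch:
  assumes "P (mix K x y) \<noteq> P (mix (K \<union> {..<m}) x y)"
  shows "\<exists>k<m. k \<notin> K \<and> P (mix (K \<union> {..<k}) x y) \<noteq> P ((mix (K \<union> {..<k}) x y)(k := y k))"
proof (rule ccontr)
  assume a: "\<not> ?thesis"
  have "k \<le> m \<Longrightarrow> P (mix (K \<union> {..<k}) x y) = P (mix K x y)" for k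
  proof (induction k)
    case (Suc k)
    have e: "K \<union> {..<Suc k} = insert k (K \<union> {..<k})" by auto
    show ?case
    proof (cases "k \<in> K")
      case True
      then have "K \<union> {..<Suc k} = K \<union> {..<k}" by (auto simp: less_Suc_eq)
      then show ?thesis using Suc by simp
    next
      case False
      then have "P (mix (K \<union> {..<k}) x y) = P ((mix (K \<union> {..<k}) x y)(k := y k))"
        using Suc.prems a Suc_le_lessD by blast
      moreover have "P (mix (K \<union> {..<k}) x y) = P (mix K x y)" using Suc by simp
      ultimately show ?thesis unfolding e mix_insert by metis
    qed
  qed simp
  from this[of m] show False using assms by auto
qed

text \<open>The number of boundary bonds on the whole line through \<open>z\<close> in direction
  \<open>k\<close>; the value of \<open>z\<close> at \<open>k\<close> is overwritten. Counting along
  the whole line bounds the count along any segment of it.\<close>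

definition crossings :: "nat \<Rightarrow> nat \<Rightarrow> site set \<Rightarrow> nat \<Rightarrow> site \<Rightarrow> nat" where
  "crossings d n A k z = card {t. (z(k := t), k) \<in> bd d n A}"

lemma finite_crossings: "finite {t. (z(k := t), k) \<in> bd d n A}"
proof -
  have "(\<lambda>t. (z(k := t), k)) ` {t. (z(k := t), k) \<in> bd d n A} \<subseteq> bd d n A" by auto
  moreover have "inj_on (\<lambda>t. (z(k := t), k)) {t. (z(k := t), k) \<in> bd d n A}"
    by (auto intro!: inj_onI dest: fun_upd_eqD)
  ultimately show ?thesis by (meson finite_bd finite_imageD finite_subset)
qed

lemma crossings_ge_1:
  assumes "z \<in> box d n" "k < d" "lo n \<le> t" "t \<le> hi n" "(z \<in> A) \<noteq> (z(k := t) \<in> A)"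
  shows "1 \<le> crossings d n A k z"
proof -
  have "\<exists>r. (z(k := r), k) \<in> bd d n A"
    by (rule line_cross[of z d n k "z k" t]) (use assms in \<open>auto simp: mem_box\<close>)
  then have "{t. (z(k := t), k) \<in> bd d n A} \<noteq> {}" by auto
  then show ?thesis unfolding crossings_def using finite_crossings
    by (simp add: Suc_leI card_gt_0_iff)
qed

text \<open>The lines in direction \<open>k\<close> are indexed by their unique point in a slice
  orthogonal to \<open>k\<close>, and each boundary bond of direction \<open>k\<close> lies on
  exactly one of them.\<close>

lemma sum_crossings_slice:
  assumes "k < d" "lo n \<le> t" "t \<le> hi n"
  shows "(\<Sum>z\<in>slice d n k t. crossings d n A k z) = card {(x, i) \<in> bd d n A. i = k}"
proof -
  have "(\<Sum>z\<in>slice d n k t. crossings d n A k z)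
      = card (SIGMA z:slice d n k t. {s. (z(k := s), k) \<in> bd d n A})"
    unfolding crossings_def using finite_crossings by (subst card_SigmaI) auto
  also have "\<dots> = card {(x, i) \<in> bd d n A. i = k}"
  proof (rule bij_betw_same_card[of "\<lambda>(z, s). (z(k := s), k)"], rule bij_betwI')
    fix p q assume "p \<in> (SIGMA z:slice d n k t. {s. (z(k := s), k) \<in> bd d n A})"
      "q \<in> (SIGMA z:slice d n k t. {s. (z(k := s), k) \<in> bd d n A})"
    then obtain z s z' s' where pq: "p = (z, s)" "q = (z', s')" "z k = t" "z' k = t"
      by (auto simp: slice_def)
    show "((case p of (z, s) \<Rightarrow> (z(k := s), k)) = (case q of (z, s) \<Rightarrow> (z(k := s), k))) = (p = q)"
    proof
      assume "(case p of (z, s) \<Rightarrow> (z(k := s), k)) = (case q of (z, s) \<Rightarrow> (z(k := s), k))"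
      then have e: "z(k := s) = z'(k := s')" using pq by simp
      have "s = s'" using fun_cong[OF e, of k] by simp
      moreover have "z = (z(k := s))(k := t)" "z' = (z'(k := s'))(k := t)" using pq by auto
      ultimately show "p = q" using e pq by metis
    qed auto
  next
    fix p assume "p \<in> (SIGMA z:slice d n k t. {s. (z(k := s), k) \<in> bd d n A})"
    then show "(case p of (z, s) \<Rightarrow> (z(k := s), k)) \<in> {(x, i) \<in> bd d n A. i = k}" by auto
  next
    fix q assume q: "q \<in> {(x, i) \<in> bd d n A. i = k}"
    then obtain x where x: "q = (x, k)" "(x, k) \<in> bd d n A" by auto
    then have "x(k := t) \<in> slice d n k t"
      using assms by (auto simp: slice_def bd_def bonds_def intro: box_upd)
    then have "(x(k := t), x k) \<in> (SIGMA z:slice d n k t. {s. (z(k := s), k) \<in> bd d n A})"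
      using x by auto
    moreover have "q = (\<lambda>(z, s). (z(k := s), k)) (x(k := t), x k)" using x by auto
    ultimately show "\<exists>p\<in>(SIGMA z:slice d n k t. {s. (z(k := s), k) \<in> bd d n A}).
        q = (case p of (z, s) \<Rightarrow> (z(k := s), k))" by blast
  qed
  finally show ?thesis .
qed

lemma sum_crossings_box:
  assumes "k < d"
  shows "(\<Sum>z\<in>box d n. crossings d n A k z) = n * card {(x, i) \<in> bd d n A. i = k}"
proof -
  have "box d n = (\<Union>t\<in>{lo n..hi n}. slice d n k t)"
    using assms by (auto simp: slice_def mem_box)
  moreover have "(\<Sum>z\<in>(\<Union>t\<in>{lo n..hi n}. slice d n k t). crossings d n A k z)
      = (\<Sum>t\<in>{lo n..hi n}. \<Sum>z\<in>slice d n k t. crossings d n A k z)"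
    by (rule sum.UNION_disjoint) (auto simp: slice_def)
  ultimately have "(\<Sum>z\<in>box d n. crossings d n A k z)
      = (\<Sum>t\<in>{lo n..hi n}. \<Sum>z\<in>slice d n k t. crossings d n A k z)"
    by metis
  also have "\<dots> = (\<Sum>t\<in>{lo n..hi n}. card {(x, i) \<in> bd d n A. i = k})"
    using assms by (intro sum.cong) (auto simp: sum_crossings_slice)
  finally show ?thesis using card_interval[of n] by simp
qed

text \<open>Exchanging the coordinates in \<open>K\<close> between \<open>x\<close> and
  \<open>y\<close> is an involution. Since \<open>j \<in> K\<close>, the point
  \<open>mix K y x\<close> has the \<open>j\<close>-coordinate of \<open>x\<close> and stays in the
  slice, while \<open>mix K x y\<close> becomes a free point of the box. So the mixed point is
  uniform in the box when the pair is uniform.\<close>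

lemma sum_crossings_mix:
  assumes "k < d" "j < d" "j \<in> K" "lo n \<le> t" "t \<le> hi n"
  shows "(\<Sum>(x, y)\<in>slice d n j t \<times> box d n. crossings d n A k (mix K x y))
       = n ^ d * card {(x, i) \<in> bd d n A. i = k}"
proof -
  have inv: "mix K (mix K x y) (mix K y x) = x" for x y :: site
    by (auto simp: mix_def)
  have "(\<Sum>(x, y)\<in>slice d n j t \<times> box d n. crossings d n A k (mix K x y))
      = (\<Sum>(w, z)\<in>slice d n j t \<times> box d n. crossings d n A k z)"
    by (rule sum.reindex_bij_witness[of _ "\<lambda>(w, z). (mix K z w, mix K w z)" "\<lambda>(x, y). (mix K y x, mix K x y)"])
      (use assms in \<open>auto simp: inv slice_def intro!: mix_box, auto simp: mix_def\<close>)
  also have "\<dots> = card (slice d n j t) * (\<Sum>z\<in>box d n. crossings d n A k z)"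
    by (simp add: sum.cartesian_product[symmetric])
  also have "\<dots> = n ^ (d - 1) * (n * card {(x, i) \<in> bd d n A. i = k})"
    using assms by (simp add: card_slice sum_crossings_box)
  also have "\<dots> = n ^ d * card {(x, i) \<in> bd d n A. i = k}"
    using assms by (cases d) auto
  finally show ?thesis .
qed

text \<open>Canonical paths: move from \<open>x\<close> in the slice to \<open>y\<close> in the box one coordinate at a time, the
  direction of the slice first; every bond is then used by at most \<open>n ^ d\<close> pairs.\<close>

lemma slice_isoperimetry:
  assumes "A \<subseteq> box d n" "j < d" "lo n \<le> t" "t \<le> hi n"
  shows "card (A \<inter> slice d n j t) * card (box d n - A) \<le> n ^ d * card (bd d n A)"
proof -
  define m where "m k = card {(x, i) \<in> bd d n A. i = k}" for k
  define N where "N = n ^ d"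
  \<comment> \<open>The path changes coordinate \<open>j\<close> first. Either that line already
    leaves \<open>A\<close>, or membership switches at a later coordinate \<open>k\<close>, when the
    current point is \<open>mix ({j} \<union> {..<k}) x y\<close>.\<close>
  have pt: "1 \<le> crossings d n A j x + (\<Sum>k\<in>{..<d} - {j}. crossings d n A k (mix ({j} \<union> {..<k}) x y))"
    if x: "x \<in> A \<inter> slice d n j t" and y: "y \<in> box d n - A" for x y
  proof -
    have xb: "x \<in> box d n" "y \<in> box d n" using x y by (auto simp: slice_def)
    have yr: "lo n \<le> y k" "y k \<le> hi n" if "k < d" for k using xb that by (auto simp: mem_box)
    show ?thesis
    proof (cases "x(j := y j) \<in> A")
      case False
      then have "1 \<le> crossings d n A j x" using x xb assms yr by (intro crossings_ge_1[of x d n j "y j"]) auto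
      then show ?thesis by linarith
    next
      case True
      have e0: "mix {j} x y = x(j := y j)" by (auto simp: mix_def)
      have e1: "mix ({j} \<union> {..<d}) x y = y" using xb by (intro mix_full) (auto simp: mem_box)
      obtain k where k: "k < d" "k \<notin> {j}"
        "(mix ({j} \<union> {..<k}) x y \<in> A) \<noteq> ((mix ({j} \<union> {..<k}) x y)(k := y k) \<in> A)"
        using mix_switch[of "\<lambda>z. z \<in> A" "{j}" x y d] e0 e1 True y by auto
      then have "1 \<le> crossings d n A k (mix ({j} \<union> {..<k}) x y)"
        using xb yr by (intro crossings_ge_1[of _ d n k "y k"] mix_box) auto
      also have "\<dots> \<le> (\<Sum>k\<in>{..<d} - {j}. crossings d n A k (mix ({j} \<union> {..<k}) x y))"
        using k by (intro member_le_sum) auto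
      finally show ?thesis by linarith
    qed
  qed
  have "card (A \<inter> slice d n j t) * card (box d n - A)
      = (\<Sum>(x, y)\<in>(A \<inter> slice d n j t) \<times> (box d n - A). 1)" by simp
  also have "\<dots> \<le> (\<Sum>(x, y)\<in>(A \<inter> slice d n j t) \<times> (box d n - A). crossings d n A j x
      + (\<Sum>k\<in>{..<d} - {j}. crossings d n A k (mix ({j} \<union> {..<k}) x y)))"
    using pt by (intro sum_mono) auto
  also have "\<dots> \<le> (\<Sum>(x, y)\<in>slice d n j t \<times> box d n. crossings d n A j x
      + (\<Sum>k\<in>{..<d} - {j}. crossings d n A k (mix ({j} \<union> {..<k}) x y)))"
    by (intro sum_mono2) auto
  also have "\<dots> = (\<Sum>(x, y)\<in>slice d n j t \<times> box d n. crossings d n A j x)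
      + (\<Sum>(x, y)\<in>slice d n j t \<times> box d n. \<Sum>k\<in>{..<d} - {j}. crossings d n A k (mix ({j} \<union> {..<k}) x y))"
    by (simp add: sum.distrib case_prod_unfold)
  also have "(\<Sum>(x, y)\<in>slice d n j t \<times> box d n. crossings d n A j x) = N * m j"
    unfolding m_def N_def using assms sum_crossings_slice[of j d n t A]
    by (simp add: sum.cartesian_product[symmetric] card_box sum_distrib_left[symmetric])
  also have "(\<Sum>(x, y)\<in>slice d n j t \<times> box d n. \<Sum>k\<in>{..<d} - {j}. crossings d n A k (mix ({j} \<union> {..<k}) x y))
      = (\<Sum>k\<in>{..<d} - {j}. \<Sum>(x, y)\<in>slice d n j t \<times> box d n. crossings d n A k (mix ({j} \<union> {..<k}) x y))"
    unfolding case_prod_unfold by (rule sum.swap)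
  also have "\<dots> = (\<Sum>k\<in>{..<d} - {j}. N * m k)"
    unfolding m_def N_def using assms by (intro sum.cong refl sum_crossings_mix) auto
  also have "N * m j + (\<Sum>k\<in>{..<d} - {j}. N * m k) = N * (\<Sum>k<d. m k)"
    using assms by (simp add: sum.remove[of _ j] sum_distrib_left distrib_left)
  also have "(\<Sum>k<d. m k) = card (bd d n A)"
  proof -
    have "bd d n A = (\<Union>k<d. {(x, i) \<in> bd d n A. i = k})" by (auto simp: bd_def bonds_def)
    then have "card (bd d n A) = card (\<Union>k<d. {(x, i) \<in> bd d n A. i = k})" by simp
    also have "\<dots> = (\<Sum>k<d. m k)" unfolding m_def
      by (rule card_UN_disjoint) (auto intro: finite_subset[OF _ finite_bd[of d n A]])
    finally show ?thesis by simp
  qed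
  finally show ?thesis unfolding N_def .
qed

text \<open>\<open>A\<close> has at most half the volume, so its complement has at least
  \<open>n ^ d / 2\<close> points; dividing \<open>slice_isoperimetry\<close> by this leaves the
  factor \<open>2\<close>, free of \<open>n\<close>.\<close>

lemma card_slice_le:
  assumes "A \<subseteq> box d n" "2 * card A \<le> card (box d n)" "j < d"
  shows "card (A \<inter> slice d n j t) \<le> 2 * card (bd d n A)"
proof (cases "lo n \<le> t \<and> t \<le> hi n")
  case True
  then have n: "n > 0" using hi_lo[of n] by auto
  have "card (box d n - A) = card (box d n) - card A"
    using assms by (intro card_Diff_subset) (auto intro: finite_subset)
  then have c: "n ^ d \<le> 2 * card (box d n - A)" using assms by (simp add: card_box)
  have "card (A \<inter> slice d n j t) * n ^ d \<le> card (A \<inter> slice d n j t) * (2 * card (box d n - A))"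
    using c by (rule mult_left_mono) simp
  also have "\<dots> \<le> 2 * (n ^ d * card (bd d n A))"
    using slice_isoperimetry[OF assms(1,3)] True by simp
  finally show ?thesis using n by (simp add: mult.commute mult.left_commute)
next
  case False
  then have "slice d n j t = {}" using assms by (auto simp: slice_def mem_box)
  then show ?thesis by simp
qed

lemma adj_iff: "adj d x y \<longleftrightarrow> x \<in> lattice d \<and> y \<in> lattice d \<and> nb d x y"
proof (cases "x \<in> lattice d \<and> y \<in> lattice d")
  case True
  have "(\<Sum>i<d. \<bar>x i - y i\<bar>) = 1 \<longleftrightarrow> nb d x y"
  proof
    assume s: "(\<Sum>i<d. \<bar>x i - y i\<bar>) = 1"
    then obtain i where i: "i < d" "x i \<noteq> y i"
      by (metis (no_types, lifting) abs_zero diff_self lessThan_iff sum.neutral zero_neq_one)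
    have "(\<Sum>i<d. \<bar>x i - y i\<bar>) = \<bar>x i - y i\<bar> + (\<Sum>k\<in>{..<d} - {i}. \<bar>x k - y k\<bar>)"
      using i by (subst sum.remove[of _ i]) auto
    moreover have nn: "0 \<le> (\<Sum>k\<in>{..<d} - {i}. \<bar>x k - y k\<bar>)" by (intro sum_nonneg) auto
    ultimately have "\<bar>x i - y i\<bar> = 1" and z: "(\<Sum>k\<in>{..<d} - {i}. \<bar>x k - y k\<bar>) = 0" using s i by linarith+
    have "\<forall>k\<in>{..<d} - {i}. x k = y k" using z by (subst (asm) sum_nonneg_eq_0_iff) auto
    then have eq: "x k = y k" if "k \<noteq> i" for k using that True by (cases "k < d") (auto simp: lattice_def)
    have "y = up x i \<or> x = up y i" using \<open>\<bar>x i - y i\<bar> = 1\<close> eq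
      unfolding up_def fun_eq_iff by (auto simp: abs_if split: if_splits)
    then show "nb d x y" using i by (auto simp: nb_def)
  next
    assume "nb d x y"
    then obtain i where i: "i < d" "y = up x i \<or> x = up y i" by (auto simp: nb_def)
    have "(\<Sum>i<d. \<bar>x i - y i\<bar>) = \<bar>x i - y i\<bar> + (\<Sum>k\<in>{..<d} - {i}. \<bar>x k - y k\<bar>)"
      using i by (subst sum.remove[of _ i]) auto
    also have "(\<Sum>k\<in>{..<d} - {i}. \<bar>x k - y k\<bar>) = 0" using i by (intro sum.neutral) (auto simp: up_def split: if_splits)
    also have "\<bar>x i - y i\<bar> = 1" using i by (auto simp: up_def)
    finally show "(\<Sum>i<d. \<bar>x i - y i\<bar>) = 1" by simp
  qed
  then show ?thesis using True by (auto simp: adj_def)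
qed (auto simp: adj_def)

lemma up_lattice: "i < d \<Longrightarrow> up x i \<in> lattice d \<longleftrightarrow> x \<in> lattice d"
  by (auto simp: up_def lattice_def)

lemma nb_lattice: "nb d x y \<Longrightarrow> x \<in> lattice d \<longleftrightarrow> y \<in> lattice d"
  by (auto simp: nb_def up_lattice)

lemma bdry_iff:
  "x \<in> bdry d n \<longleftrightarrow> x \<in> box d n \<and> (\<exists>i<d. x i = lo n \<or> x i = hi n)"
proof -
  have "(\<exists>y. adj d x y \<and> y \<notin> box d n) \<longleftrightarrow> (\<exists>i<d. x i = lo n \<or> x i = hi n)" if x: "x \<in> box d n"
  proof
    assume "\<exists>y. adj d x y \<and> y \<notin> box d n"
    then obtain y i where y: "y \<notin> box d n" "y \<in> lattice d" "i < d" "y = up x i \<or> x = up y i"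
      by (auto simp: adj_iff nb_def)
    from y(4) show "\<exists>i<d. x i = lo n \<or> x i = hi n"
    proof
      assume "y = up x i"
      then have "y = x(i := x i + 1)" by (simp add: up_def)
      then have "\<not> x i + 1 \<le> hi n" using y(1,3) x box_upd[of x d n i "x i + 1"] by (auto simp: mem_box)
      then show ?thesis using x y by (intro exI[of _ i]) (auto simp: mem_box)
    next
      assume "x = up y i"
      then have "y = x(i := x i - 1)" by (auto simp: up_def)
      then have "\<not> lo n \<le> x i - 1" using y(1,3) x box_upd[of x d n i "x i - 1"] by (auto simp: mem_box)
      then show ?thesis using x y by (intro exI[of _ i]) (auto simp: mem_box)
    qed
  next
    assume "\<exists>i<d. x i = lo n \<or> x i = hi n"
    then obtain i where i: "i < d" "x i = lo n \<or> x i = hi n" by auto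
    define y where "y = (if x i = hi n then up x i else x(i := x i - 1))"
    have "y \<notin> box d n" using i by (auto simp: y_def mem_box up_def)
    moreover have "nb d x y" using i by (auto simp: y_def nb_def up_def)
    ultimately show "\<exists>y. adj d x y \<and> y \<notin> box d n"
      using x nb_lattice[of d x y] by (auto simp: adj_iff mem_box)
  qed
  then show ?thesis unfolding bdry_def by auto
qed

lemma finite_bdry [simp]: "finite (bdry d n)"
  by (rule finite_subset[OF _ finite_box[of d n]]) (auto simp: bdry_def)

text \<open>The boundary of the box consists of \<open>2 * d\<close> faces, each a slice that meets
  \<open>A\<close> in at most \<open>2 * card (bd d n A)\<close> sites. This is what bounds the
  field energy of a contour by its length.\<close>

lemma card_Int_bdry_le:
  assumes "A \<subseteq> box d n" "2 * card A \<le> card (box d n)"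
  shows "card (A \<inter> bdry d n) \<le> 4 * d * card (bd d n A)"
proof -
  have "A \<inter> bdry d n \<subseteq> (\<Union>j<d. A \<inter> slice d n j (lo n) \<union> A \<inter> slice d n j (hi n))"
    using assms by (auto simp: bdry_iff slice_def)
  then have "card (A \<inter> bdry d n) \<le> card (\<Union>j<d. A \<inter> slice d n j (lo n) \<union> A \<inter> slice d n j (hi n))"
    by (intro card_mono) auto
  also have "\<dots> \<le> (\<Sum>j<d. card (A \<inter> slice d n j (lo n) \<union> A \<inter> slice d n j (hi n)))"
    by (intro card_UN_le) auto
  also have "\<dots> \<le> (\<Sum>j<d. 4 * card (bd d n A))"
  proof (rule sum_mono)
    fix j assume "j \<in> {..<d}"
    then have "card (A \<inter> slice d n j (lo n)) \<le> 2 * card (bd d n A)" "card (A \<inter> slice d n j (hi n)) \<le> 2 * card (bd d n A)"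
      using card_slice_le[OF assms] by auto
    then show "card (A \<inter> slice d n j (lo n) \<union> A \<inter> slice d n j (hi n)) \<le> 4 * card (bd d n A)"
      using card_Un_le[of "A \<inter> slice d n j (lo n)" "A \<inter> slice d n j (hi n)"] by linarith
  qed
  finally show ?thesis by simp
qed

subsection \<open>Counting contours\<close>

lemma line_conn:
  assumes "z \<in> box d n" "k < d" "lo n \<le> s" "s \<le> hi n" "lo n \<le> t" "t \<le> hi n"
  shows "(z(k := s), z(k := t)) \<in> (step_rel d (box d n))\<^sup>*"
proof -
  have "t \<le> hi n \<longrightarrow> (z(k := s), z(k := t)) \<in> (step_rel d (box d n))\<^sup>*" if "s \<le> t" "lo n \<le> s" for s t
    using that(1)
  proof (induction t rule: int_ge_induct)
    case (step i)
    show ?case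
    proof
      assume "i + 1 \<le> hi n"
      then have "(z(k := i), z(k := i + 1)) \<in> step_rel d (box d n)"
        using assms that step.hyps nb_up[of k d "z(k := i)"]
        by (auto simp: step_rel_def up_upd intro!: box_upd)
      then show "(z(k := s), z(k := i + 1)) \<in> (step_rel d (box d n))\<^sup>*"
        using step.IH \<open>i + 1 \<le> hi n\<close> rtrancl_into_rtrancl by (smt (verit, best))
    qed
  qed simp
  then show ?thesis using assms step_rel_sym by (cases "s \<le> t") auto
qed

lemma conn_box: "conn d (box d n)"
  unfolding conn_def
proof (intro ballI)
  fix x y assume xy: "x \<in> box d n" "y \<in> box d n"
  have "k \<le> d \<Longrightarrow> (x, mix {..<k} x y) \<in> (step_rel d (box d n))\<^sup>*" for k
  proof (induction k)
    case 0
    then show ?case by (simp add: mix_def)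
  next
    case (Suc k)
    have z: "mix {..<k} x y \<in> box d n" using xy by (rule mix_box)
    have "(mix {..<k} x y)(k := x k) = mix {..<k} x y" by (auto simp: mix_def)
    moreover have "(mix {..<k} x y)(k := y k) = mix {..<Suc k} x y" unfolding lessThan_Suc mix_insert ..
    ultimately have "(mix {..<k} x y, mix {..<Suc k} x y) \<in> (step_rel d (box d n))\<^sup>*"
      using line_conn[OF z, of k "x k" "y k"] xy Suc.prems by (auto simp: mem_box)
    then show ?case using Suc by (meson Suc_leD rtrancl_trans)
  qed
  from this[of d] show "(x, y) \<in> (step_rel d (box d n))\<^sup>*"
    using mix_full[of x d y "{..<d}"] xy by (auto simp: mem_box)
qed

lemma up_box_iff: "x \<in> box d n \<Longrightarrow> i < d \<Longrightarrow> up x i \<in> box d n \<longleftrightarrow> x i + 1 \<le> hi n"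
  by (auto simp: up_def mem_box lattice_def)

text \<open>The first cohomology modulo two of a box vanishes.\<close>

lemma mod2_potential:
  fixes \<phi> :: "site \<Rightarrow> nat \<Rightarrow> bool"
  assumes closed: "\<And>x i j. i < d \<Longrightarrow> j < d \<Longrightarrow> i \<noteq> j \<Longrightarrow> x \<in> box d n \<Longrightarrow> up x i \<in> box d n \<Longrightarrow> up x j \<in> box d n \<Longrightarrow>
      (\<phi> x i \<noteq> \<phi> (up x j) i) = (\<phi> x j \<noteq> \<phi> (up x i) j)"
  shows "\<exists>g :: site \<Rightarrow> bool. \<forall>x\<in>box d n. \<forall>i<d. up x i \<in> box d n \<longrightarrow> \<phi> x i = (g x \<noteq> g (up x i))"
proof -
  \<comment> \<open>Induction on the number \<open>k\<close> of free coordinates: the potential is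
    built on the face where the coordinates from \<open>k\<close> on equal
    \<open>lo n\<close>.\<close>
  define Q where "Q k g \<longleftrightarrow> (\<forall>x\<in>box d n. \<forall>i<k. up x i \<in> box d n \<longrightarrow> (\<forall>j. k \<le> j \<and> j < d \<longrightarrow> x j = lo n) \<longrightarrow>
      \<phi> x i = (g x \<noteq> g (up x i)))" for k and g :: "site \<Rightarrow> bool"
  have "k \<le> d \<Longrightarrow> \<exists>g. Q k g" for k
  proof (induction k)
    case (Suc k)
    then obtain g where "Q k g" using Suc_leD by blast
    then have g: "\<phi> x i = (g x \<noteq> g (up x i))"
      if "x \<in> box d n" "i < k" "up x i \<in> box d n" "\<forall>j. k \<le> j \<and> j < d \<longrightarrow> x j = lo n" for x i
      using that unfolding Q_def by blast
    have kd: "k < d" using Suc by auto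
    \<comment> \<open>The parity of \<open>\<phi>\<close> along the line from the face to
      \<open>x\<close>, a discrete line integral; the new potential adds it to the old one at the
      foot of the line.\<close>
    define s where "s x = odd (card {t. lo n \<le> t \<and> t < x k \<and> \<phi> (x(k := t)) k})" for x :: site
    define g' where "g' x = (g (x(k := lo n)) \<noteq> s x)" for x
    have dirk: "\<phi> x k = (g' x \<noteq> g' (up x k))" if x: "x \<in> box d n" for x
    proof -
      have fin: "finite {t. lo n \<le> t \<and> t < x k \<and> \<phi> (x(k := t)) k}"
        by (rule finite_subset[of _ "{lo n..x k}"]) auto
      have "{t. lo n \<le> t \<and> t < up x k k \<and> \<phi> ((up x k)(k := t)) k} =
          {t. lo n \<le> t \<and> t < x k \<and> \<phi> (x(k := t)) k} \<union> (if \<phi> x k then {x k} else {})"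
        using x kd by (auto simp: up_def mem_box less_le)
      then have "s (up x k) = (s x \<noteq> \<phi> x k)" unfolding s_def using fin by (auto simp: card_insert_if)
      moreover have "(up x k)(k := lo n) = x(k := lo n)" by (auto simp: up_def)
      ultimately show ?thesis unfolding g'_def by auto
    qed
    \<comment> \<open>Move away from the face one unit square at a time: \<open>closed\<close> for
      the square in directions \<open>i\<close> and \<open>k\<close>, with \<open>dirk\<close> on
      its two sides of direction \<open>k\<close>, carries the identity from \<open>x\<close> to
      \<open>up x k\<close>.\<close>
    have diri: "\<phi> x i = (g' x \<noteq> g' (up x i))"
      if "x \<in> box d n" "i < k" "up x i \<in> box d n" "\<forall>j. Suc k \<le> j \<and> j < d \<longrightarrow> x j = lo n" for x i
      using that
    proof (induction "nat (x k - lo n)" arbitrary: x)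
      case 0
      then have xk: "x k = lo n" using kd by (auto simp: mem_box)
      have ik: "up x i k = lo n" using 0 xk by (auto simp: up_def)
      have emp: "{t. lo n \<le> t \<and> t < lo n \<and> P t} = {}" for P by auto
      have "s x = False" unfolding s_def xk emp by simp
      moreover have "s (up x i) = False" unfolding s_def ik emp by simp
      moreover have "x(k := lo n) = x" "(up x i)(k := lo n) = up x i" using xk ik by auto
      moreover have "\<phi> x i = (g x \<noteq> g (up x i))"
      proof (rule g)
        show "\<forall>j. k \<le> j \<and> j < d \<longrightarrow> x j = lo n"
        proof (intro allI impI)
          fix j assume "k \<le> j \<and> j < d"
          then show "x j = lo n" using 0 xk by (cases "j = k") auto
        qed
      qed (use 0 in auto)
      ultimately show ?case unfolding g'_def by auto
    next
      case (Suc m y)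
      define x where "x = y(k := y k - 1)"
      have y: "y = up x k" unfolding x_def up_def by auto
      have xk: "lo n \<le> x k" using Suc unfolding x_def by auto
      have xb: "x \<in> box d n" unfolding x_def using Suc kd by (intro box_upd) (auto simp: mem_box)
      have i: "i < d" "i \<noteq> k" using Suc kd by auto
      have uxi: "up x i \<in> box d n" using Suc xb i up_box_iff[of x d n i] up_box_iff[of y d n i] by (auto simp: x_def)
      have IH: "\<phi> x i = (g' x \<noteq> g' (up x i))"
        using Suc xb uxi by (intro Suc.hyps(1)) (auto simp: x_def)
      have "(\<phi> x i \<noteq> \<phi> (up x k) i) = (\<phi> x k \<noteq> \<phi> (up x i) k)"
        using closed[of i k x] i kd xb uxi Suc y by auto
      then show ?case using IH dirk[OF xb] dirk[OF uxi] unfolding y up_commute[of x k i] by auto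
    qed
    have "Q (Suc k) g'" unfolding Q_def
    proof (intro ballI allI impI)
      fix x i assume "x \<in> box d n" "i < Suc k" "up x i \<in> box d n" "\<forall>j. Suc k \<le> j \<and> j < d \<longrightarrow> x j = lo n"
      then show "\<phi> x i = (g' x \<noteq> g' (up x i))"
        using dirk[of x] diri[of x i] by (cases "i = k") auto
    qed
    then show ?case by blast
  qed (auto simp: Q_def)
  then obtain g where "Q d g" by blast
  then show ?thesis unfolding Q_def by (intro exI[of _ g]) auto
qed

text \<open>Directions are ignored; only the base sites are compared. This coarse relation links all
  four sides of a unit square and still leaves at most \<open>d * 3 ^ d\<close> partners per
  bond.\<close>

definition near :: "site \<times> nat \<Rightarrow> site \<times> nat \<Rightarrow> bool" where
  "near e f \<longleftrightarrow> (\<forall>l. \<bar>fst e l - fst f l\<bar> \<le> 1)"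

text \<open>Suppose no bond of \<open>T\<close> is near the rest of the boundary. A unit square has
  an even number of boundary bonds, pairwise near, so \<open>T\<close> contains all or none of them;
  hence \<open>T\<close> is closed modulo two and has a potential \<open>g\<close>. As
  \<open>T\<close> consists of boundary bonds, \<open>g\<close> is constant on \<open>A\<close> and
  on its complement, both connected, so \<open>T\<close> contains every boundary bond or
  none.\<close>

lemma bd_connected:
  assumes A: "A \<in> contours d (box d n)" and T: "T \<subseteq> bd d n A" "T \<noteq> {}" "T \<noteq> bd d n A"
  shows "\<exists>e\<in>T. \<exists>f\<in>bd d n A - T. near e f"
proof (rule ccontr)
  assume no: "\<not> ?thesis"
  have up: "near e f \<Longrightarrow> e \<in> T \<Longrightarrow> f \<in> bd d n A \<Longrightarrow> f \<in> T" for e f using no by auto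
  have "\<exists>g :: site \<Rightarrow> bool. \<forall>x\<in>box d n. \<forall>i<d. up x i \<in> box d n \<longrightarrow> ((x, i) \<in> T) = (g x \<noteq> g (up x i))"
  proof (rule mod2_potential)
    fix x i j assume x: "i < d" "j < d" "i \<noteq> j" "x \<in> box d n" "up x i \<in> box d n" "up x j \<in> box d n"
    have u2: "up (up x i) j \<in> box d n" "up (up x j) i \<in> box d n"
      using x up_box_iff[of "up x i" d n j] up_box_iff[of "up x j" d n i] up_box_iff[of x d n j] up_box_iff[of x d n i]
      by (auto simp: up_def)
    have par: "(((x, i) \<in> bd d n A) \<noteq> ((up x j, i) \<in> bd d n A)) = (((x, j) \<in> bd d n A) \<noteq> ((up x i, j) \<in> bd d n A))"
      using x u2 up_commute[of x i j] by (auto simp: bd_def bonds_def)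
    define P where "P = {(x, i), (up x j, i), (x, j), (up x i, j)}"
    have nP: "near e f" if "e \<in> P" "f \<in> P" for e f
      using that unfolding P_def near_def up_def by auto
    show "(((x, i) \<in> T) \<noteq> ((up x j, i) \<in> T)) = (((x, j) \<in> T) \<noteq> ((up x i, j) \<in> T))"
    proof (cases "P \<inter> T = {}")
      case True
      then show ?thesis unfolding P_def by auto
    next
      case False
      then obtain e where e: "e \<in> P" "e \<in> T" by auto
      have "f \<in> T \<longleftrightarrow> f \<in> bd d n A" if "f \<in> P" for f using up[OF nP[OF e(1) that] e(2)] T by auto
      then show ?thesis using par unfolding P_def by auto
    qed
  qed
  then obtain g :: "site \<Rightarrow> bool" where g: "\<And>x i. (x, i) \<in> bonds d n \<Longrightarrow> ((x, i) \<in> T) = (g x \<noteq> g (up x i))"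
    by (auto simp: bonds_def)
  have AB: "A \<subseteq> box d n" "conn d A" "conn d (box d n - A)" using A by (auto simp: contours_def)
  have const: "g u = g v" if uv: "nb d u v" "u \<in> box d n" "v \<in> box d n" "(u \<in> A) = (v \<in> A)" for u v
  proof -
    obtain i where "i < d" "v = up u i \<or> u = up v i" using uv(1) unfolding nb_def by blast
    then show ?thesis
    proof (elim disjE)
      assume "i < d" "v = up u i"
      then have "(u, i) \<in> bonds d n" "(u, i) \<notin> bd d n A" using that by (auto simp: bd_def bonds_def)
      then show ?thesis using g[of u i] T \<open>v = up u i\<close> by auto
    next
      assume "i < d" "u = up v i"
      then have "(v, i) \<in> bonds d n" "(v, i) \<notin> bd d n A" using that by (auto simp: bd_def bonds_def)
      then show ?thesis using g[of v i] T \<open>u = up v i\<close> by auto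
    qed
  qed
  have cA: "g u = g v" if "u \<in> A" "v \<in> A" for u v
    using conn_invariant[OF AB(2) that, of "\<lambda>z. g u = g z"] const AB by blast
  have cB: "g u = g v" if "u \<in> box d n - A" "v \<in> box d n - A" for u v
    using conn_invariant[OF AB(3) that, of "\<lambda>z. g u = g z"] const by blast
  have same: "(e \<in> T) = (f \<in> T)" if "e \<in> bd d n A" "f \<in> bd d n A" for e f
  proof -
    obtain x i y j where ef: "e = (x, i)" "f = (y, j)" by (metis surj_pair)
    then have b: "(x, i) \<in> bonds d n" "(y, j) \<in> bonds d n" using that by (auto simp: bd_def)
    have "(x \<in> A \<and> up x i \<in> box d n - A) \<or> (up x i \<in> A \<and> x \<in> box d n - A)"
      "(y \<in> A \<and> up y j \<in> box d n - A) \<or> (up y j \<in> A \<and> y \<in> box d n - A)"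
      using that ef by (auto simp: bd_def bonds_def)
    then have "(g x \<noteq> g (up x i)) = (g y \<noteq> g (up y j))" using cA cB by metis
    then show ?thesis using g[OF b(1)] g[OF b(2)] ef by auto
  qed
  show False using same T by blast
qed

text \<open>A new element \<open>f\<close> related to a visited \<open>e\<close> is inserted as a
  detour \<open>e, f, e\<close> at an occurrence of \<open>e\<close>. Each new element costs two
  entries, whence the length \<open>2 * card S - 1\<close>.\<close>

lemma walk_cover:
  assumes "finite S" "r \<in> S"
    and "\<And>T. T \<subseteq> S \<Longrightarrow> r \<in> T \<Longrightarrow> T \<noteq> S \<Longrightarrow> \<exists>e\<in>T. \<exists>f\<in>S - T. R e f"
    and sym: "\<And>e f. R e f \<Longrightarrow> R f e"
  shows "\<exists>w. w \<noteq> [] \<and> hd w = r \<and> set w = S \<and> length w = 2 * card S - 1 \<and> successively R w"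
proof -
  have "Suc j \<le> card S \<Longrightarrow> \<exists>w. w \<noteq> [] \<and> hd w = r \<and> set w \<subseteq> S \<and> card (set w) = Suc j \<and>
      length w = 2 * j + 1 \<and> successively R w" for j
  proof (induction j)
    case 0
    then show ?case using assms(2) by (intro exI[of _ "[r]"]) auto
  next
    case (Suc j)
    then obtain w where w: "w \<noteq> []" "hd w = r" "set w \<subseteq> S" "card (set w) = Suc j"
      "length w = 2 * j + 1" "successively R w" by auto
    then have "set w \<noteq> S" using Suc by auto
    moreover have "r \<in> set w" using w by (metis hd_in_set)
    ultimately obtain e f where ef: "e \<in> set w" "f \<in> S - set w" "R e f" using assms(3)[of "set w"] w by auto
    obtain u v where uv: "w = u @ e # v" using ef by (metis split_list)
    define w' where "w' = u @ e # f # e # v"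
    have "successively R w'" using w(6) ef(3) sym unfolding w'_def uv
      by (auto simp: successively_append_iff successively_Cons)
    moreover have "set w' = insert f (set w)" unfolding w'_def uv by auto
    moreover have "hd w' = r" using w unfolding w'_def uv by (cases u) auto
    ultimately show ?case using w ef unfolding w'_def
      by (intro exI[of _ w']) (auto simp: w'_def uv card_insert_if)
  qed
  moreover have "card S > 0" using assms by (auto simp: card_gt_0_iff)
  ultimately obtain w where w: "w \<noteq> []" "hd w = r" "set w \<subseteq> S" "card (set w) = card S"
      "length w = 2 * (card S - 1) + 1" "successively R w"
    by (metis Suc_diff_1 order_refl)
  moreover have "set w = S" using w assms by (intro card_subset_eq) auto
  ultimately show ?thesis using \<open>card S > 0\<close> by (intro exI[of _ w]) auto
qed

lemma card_walks_le:
  assumes "\<And>e. finite {f. R e f}" "\<And>e. card {f. R e f} \<le> D"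
  shows "finite {w. w \<noteq> [] \<and> hd w = r \<and> length w = Suc l \<and> successively R w} \<and>
     card {w. w \<noteq> [] \<and> hd w = r \<and> length w = Suc l \<and> successively R w} \<le> D ^ l"
proof (induction l arbitrary: r)
  case 0
  have "{w. w \<noteq> [] \<and> hd w = r \<and> length w = Suc 0 \<and> successively R w} = {[r]}"
    by (auto simp: length_Suc_conv)
  then show ?case by simp
next
  case (Suc l)
  define W where "W r l = {w. w \<noteq> [] \<and> hd w = r \<and> length w = Suc l \<and> successively R w}" for r l
  have IH: "finite (W f l)" "card (W f l) \<le> D ^ l" for f using Suc unfolding W_def by auto
  have sub: "W r (Suc l) \<subseteq> (#) r ` (\<Union>f\<in>{f. R r f}. W f l)"
  proof
    fix w assume "w \<in> W r (Suc l)"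
    then obtain v where v: "w = r # v" "length v = Suc l" "successively R (r # v)"
      unfolding W_def by (cases w) auto
    then have "v \<noteq> []" "R r (hd v)" "successively R v" by (auto simp: successively_Cons)
    then have "v \<in> W (hd v) l" "hd v \<in> {f. R r f}" using v unfolding W_def by auto
    then show "w \<in> (#) r ` (\<Union>f\<in>{f. R r f}. W f l)" using v by blast
  qed
  have fin: "finite (\<Union>f\<in>{f. R r f}. W f l)" using assms IH by auto
  have "card (W r (Suc l)) \<le> card ((#) r ` (\<Union>f\<in>{f. R r f}. W f l))"
    using fin by (intro card_mono[OF _ sub]) auto
  also have "\<dots> \<le> card (\<Union>f\<in>{f. R r f}. W f l)" using fin by (rule card_image_le)
  also have "\<dots> \<le> (\<Sum>f\<in>{f. R r f}. card (W f l))" using assms by (intro card_UN_le) auto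
  also have "\<dots> \<le> (\<Sum>f\<in>{f. R r f}. D ^ l)" using IH by (intro sum_mono) auto
  also have "\<dots> \<le> D * D ^ l" using assms(2)[of r] by simp
  finally have "card (W r (Suc l)) \<le> D ^ Suc l" by simp
  moreover have "finite (W r (Suc l))" using fin by (intro finite_subset[OF sub]) auto
  ultimately show ?case unfolding W_def by auto
qed

text \<open>Changing \<open>u\<close> into \<open>v\<close> coordinate by coordinate keeps
  coordinate \<open>j\<close> fixed, so the bond where membership switches has its base in the
  slice.\<close>

lemma slice_bd:
  assumes "u \<in> A \<inter> slice d n j t" "v \<in> slice d n j t - A" "j < d"
  shows "\<exists>z i. (z, i) \<in> bd d n A \<and> z j = t"
proof -
  have b: "u \<in> box d n" "v \<in> box d n" "u j = t" "v j = t" using assms by (auto simp: slice_def)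
  have "(mix {} u v \<in> A) \<noteq> (mix ({} \<union> {..<d}) u v \<in> A)"
    using assms b mix_full[of u d v "{..<d}"] by (auto simp: mix_def mem_box)
  then obtain k where k: "k < d" "(mix ({} \<union> {..<k}) u v \<in> A) \<noteq> ((mix ({} \<union> {..<k}) u v)(k := v k) \<in> A)"
    using mix_switch[of "\<lambda>z. z \<in> A" "{}" u v d] by blast
  define z where "z = mix {..<k} u v"
  have z: "z \<in> box d n" "z j = t" "z k = u k" using b mix_box[of u d n v "{..<k}"] unfolding z_def by (auto simp: mix_def)
  have kj: "k \<noteq> j"
  proof
    assume "k = j"
    then have "z(k := v k) = z" using b z by auto
    then show False using k unfolding z_def by auto
  qed
  have "(z \<in> A) \<noteq> (z(k := v k) \<in> A)" using k(2) by (simp add: z_def)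
  then have "\<exists>r. (z(k := r), k) \<in> bd d n A"
    using z(1) b(2) k(1) by (intro line_cross[of z d n k "z k" "v k"]) (auto simp: mem_box)
  then show ?thesis using kj z by force
qed

lemma contour_bd_pos:
  assumes "A \<in> contours d (box d n)" "0 < d"
  shows "0 < card (bd d n A)"
proof -
  obtain x where x: "x \<in> A" using assms by (auto simp: contours_def)
  have A: "A \<subseteq> box d n" "2 * card A \<le> card (box d n)" using assms by (auto simp: contours_def)
  have "A \<inter> slice d n 0 (x 0) \<noteq> {}" using x A by (auto simp: slice_def)
  then have "0 < card (A \<inter> slice d n 0 (x 0))" by (simp add: card_gt_0_iff)
  then show ?thesis using card_slice_le[OF A assms(2), of "x 0"] by linarith
qed

text \<open>A short contour meets few slices: a slice that meets it cannot be contained in it, hence carries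
  a bond of its boundary.\<close>

lemma contour_diameter:
  assumes A: "A \<in> contours d (box d n)" and d: "2 \<le> d" and n: "2 * card (bd d n A) < n"
    and xy: "x \<in> A" "y \<in> A"
  shows "\<bar>x j - y j\<bar> \<le> int (card (bd d n A))"
proof -
  have sub: "A \<subseteq> box d n" "2 * card A \<le> card (box d n)" "conn d A" using A by (auto simp: contours_def)
  have main: "y j - x j \<le> int (card (bd d n A))" if j: "j < d" and xy: "x \<in> A" "y \<in> A" and le: "x j \<le> y j" for x y
  proof -
    have ex: "\<exists>z i. (z, i) \<in> bd d n A \<and> z j = t" if t: "x j \<le> t" "t \<le> y j" for t
    proof -
      have "A \<inter> slice d n j t \<noteq> {}"
      proof
        assume e: "A \<inter> slice d n j t = {}"
        then have ne: "\<And>z. z \<in> A \<Longrightarrow> z j \<noteq> t" using sub by (auto simp: slice_def)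
        have "y j < t"
        proof (rule conn_invariant[OF sub(3) xy, where P = "\<lambda>z. z j < t"])
          fix u v assume uv: "u \<in> A" "v \<in> A" "nb d u v" "u j < t"
          then have "v j \<le> u j + 1" by (auto simp: nb_def up_def)
          then show "v j < t" using uv ne[of v] by auto
        next
          show "x j < t" using t ne[of x] xy by auto
        qed
        then show False using t by auto
      qed
      then obtain u where u: "u \<in> A \<inter> slice d n j t" by auto
      have tr: "lo n \<le> t" "t \<le> hi n" using u j by (auto simp: slice_def mem_box)
      have "card (A \<inter> slice d n j t) < card (slice d n j t)"
      proof -
        have "card (A \<inter> slice d n j t) \<le> 2 * card (bd d n A)" using card_slice_le sub j by auto
        also have "\<dots> < n" by fact
        also have "n = n ^ 1" by simp
        also have "\<dots> \<le> n ^ (d - 1)" using d n by (intro power_increasing) auto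
        also have "\<dots> = card (slice d n j t)" using card_slice j tr by auto
        finally show ?thesis .
      qed
      then obtain v where "v \<in> slice d n j t - A"
        by (metis Diff_eq_empty_iff equals0I inf.absorb2 less_irrefl)
      then show ?thesis using slice_bd u j by blast
    qed
    \<comment> \<open>Bonds chosen on different slices differ in coordinate \<open>j\<close>, so at
      most \<open>card (bd d n A)\<close> slices lie between \<open>x\<close> and
      \<open>y\<close>.\<close>
    define f where "f t = (SOME e. e \<in> bd d n A \<and> fst e j = t)" for t
    have f: "f t \<in> bd d n A \<and> fst (f t) j = t" if "t \<in> {x j..y j}" for t
      unfolding f_def by (rule someI_ex) (use ex[of t] that in auto)
    have "inj_on f {x j..y j}" using f by (metis inj_onI)
    moreover have "f ` {x j..y j} \<subseteq> bd d n A" using f by auto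
    ultimately have "card {x j..y j} \<le> card (bd d n A)" by (metis card_inj_on_le finite_bd)
    then show ?thesis by auto
  qed
  show ?thesis
  proof (cases "j < d")
    case True
    then show ?thesis using main[of x y] main[of y x] xy by (cases "x j \<le> y j") auto
  next
    case False
    then have "x j = 0" "y j = 0" using xy sub by (auto simp: mem_box lattice_def subset_iff)
    then show ?thesis by simp
  qed
qed

text \<open>Counting the contours through \<open>x\<close> needs a starting bond close to
  \<open>x\<close>. If \<open>2 * m < n\<close> the diameter bound supplies it, with one extra unit
  for the far endpoint of the bond; otherwise the whole box has side at most
  \<open>2 * m\<close>.\<close>

lemma contour_root:
  assumes A: "A \<in> contours d (box d n)" and d: "2 \<le> d" and x: "x \<in> A"
  shows "\<exists>e\<in>bd d n A. \<forall>l. \<bar>fst e l - x l\<bar> \<le> 2 * int (card (bd d n A))"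
proof -
  define m where "m = card (bd d n A)"
  have m: "m > 0" unfolding m_def using contour_bd_pos[OF A] d by auto
  then obtain y i where yi: "(y, i) \<in> bd d n A" unfolding m_def
    by (metis card_gt_0_iff equals0I surj_pair)
  have xb: "x \<in> box d n" using A x by (auto simp: contours_def)
  have yb: "y \<in> box d n" "up y i \<in> box d n" "y \<in> A \<or> up y i \<in> A" using yi by (auto simp: bd_def bonds_def)
  have "\<bar>y l - x l\<bar> \<le> 2 * int m" for l
  proof (cases "2 * m < n")
    case True
    have "\<bar>z l - x l\<bar> \<le> int m" if "z \<in> A" for z
      using contour_diameter[OF A d _ that x] True unfolding m_def by auto
    then have "\<bar>y l - x l\<bar> \<le> int m \<or> \<bar>up y i l - x l\<bar> \<le> int m" using yb by auto
    moreover have "\<bar>up y i l - y l\<bar> \<le> 1" by (auto simp: up_def)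
    ultimately show ?thesis using m by linarith
  next
    case False
    show ?thesis
    proof (cases "l < d")
      case True
      then have "lo n \<le> y l" "y l \<le> hi n" "lo n \<le> x l" "x l \<le> hi n" using xb yb by (auto simp: mem_box)
      then show ?thesis using hi_lo[of n] False by linarith
    next
      case False
      then show ?thesis using xb yb by (auto simp: mem_box lattice_def)
    qed
  qed
  then show ?thesis using yi unfolding m_def by force
qed

lemma card_cube_bonds:
  fixes x :: site and R :: nat
  shows "finite {(y, i). i < d \<and> (\<forall>l. \<bar>y l - x l\<bar> \<le> (if l < d then int R else 0))} \<and>
    card {(y, i). i < d \<and> (\<forall>l. \<bar>y l - x l\<bar> \<le> (if l < d then int R else 0))} \<le> d * (2 * R + 1) ^ d"
proof -
  define Q where "Q = PiE_dflt {..<d} 0 (\<lambda>_::nat. {- int R..int R})"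
  have cQ: "card Q = (2 * R + 1) ^ d" unfolding Q_def
    by (subst card_PiE_dflt) (auto simp: nat_add_distrib nat_mult_distrib)
  have fQ: "finite Q" unfolding Q_def by (intro finite_PiE_dflt) auto
  have sub: "{(y, i). i < d \<and> (\<forall>l. \<bar>y l - x l\<bar> \<le> (if l < d then int R else 0))}
     \<subseteq> (\<lambda>(z, i). ((\<lambda>l. x l + z l), i)) ` (Q \<times> {..<d})"
  proof (clarify)
    fix y i assume a: "i < d" "\<forall>l. \<bar>y l - x l\<bar> \<le> (if l < d then int R else 0)"
    have "(\<lambda>l. y l - x l) \<in> Q" unfolding Q_def PiE_dflt_def
    proof (clarify, intro conjI impI)
      fix l
      show "y l - x l \<in> {- int R..int R}" if "l \<in> {..<d}" using a(2)[rule_format, of l] that by auto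
      show "y l - x l = 0" if "l \<notin> {..<d}" using a(2)[rule_format, of l] that by auto
    qed
    then show "(y, i) \<in> (\<lambda>(z, i). ((\<lambda>l. x l + z l), i)) ` (Q \<times> {..<d})"
      using a by (intro image_eqI[of _ _ "((\<lambda>l. y l - x l), i)"]) auto
  qed
  have "card {(y, i). i < d \<and> (\<forall>l. \<bar>y l - x l\<bar> \<le> (if l < d then int R else 0))} \<le> card (Q \<times> {..<d})"
    using fQ by (intro surj_card_le[OF _ sub]) auto
  then show ?thesis using cQ fQ finite_subset[OF sub] by (auto simp: mult.commute)
qed

section \<open>The number of contours through a site\<close>

definition thru :: "nat \<Rightarrow> nat \<Rightarrow> site \<Rightarrow> nat \<Rightarrow> site set set" where
  "thru d n x m = {A \<in> contours d (box d n). x \<in> A \<and> card (bd d n A) = m}"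

lemma finite_contours [simp]: "finite (contours d (box d n))"
  by (rule finite_subset[of _ "Pow (box d n)"]) (auto simp: contours_def)

text \<open>Along a path in the connected box membership changes exactly at the boundary bonds, so
  the boundary and one member determine the set.\<close>

lemma bd_inj:
  assumes "A \<subseteq> box d n" "A' \<subseteq> box d n" "x \<in> A" "x \<in> A'" "bd d n A = bd d n A'"
  shows "A = A'"
proof -
  have "z \<in> A \<longleftrightarrow> z \<in> A'" if z: "z \<in> box d n" for z
  proof (rule conn_invariant[OF conn_box _ z, where P = "\<lambda>z. z \<in> A \<longleftrightarrow> z \<in> A'"])
    show "x \<in> box d n" "x \<in> A \<longleftrightarrow> x \<in> A'" using assms by auto
    fix u v assume uv: "u \<in> box d n" "v \<in> box d n" "nb d u v" "(u \<in> A) = (u \<in> A')"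
    then obtain i where i: "i < d" "v = up u i \<or> u = up v i" by (auto simp: nb_def)
    have "(u \<in> A) \<noteq> (v \<in> A) \<longleftrightarrow> (u \<in> A') \<noteq> (v \<in> A')"
    proof (cases "v = up u i")
      case True
      have "(u, i) \<in> bd d n A \<longleftrightarrow> (u, i) \<in> bd d n A'" using assms by auto
      then show ?thesis using uv i True by (auto simp: bd_def bonds_def)
    next
      case False
      then have "u = up v i" using i by auto
      moreover have "(v, i) \<in> bd d n A \<longleftrightarrow> (v, i) \<in> bd d n A'" using assms by auto
      ultimately show ?thesis using uv i by (auto simp: bd_def bonds_def)
    qed
    then show "(v \<in> A) = (v \<in> A')" using uv by auto
  qed
  then show ?thesis using assms by auto
qed

text \<open>A boundary of \<open>m\<close> bonds is recovered from a root bond within distance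
  \<open>2 * m\<close> of \<open>x\<close> and a covering walk of \<open>2 * m - 1\<close> entries.
  The two factors count the roots and the continuations, at most \<open>d * 3 ^ d\<close> per
  step.\<close>

lemma card_thru_le:
  assumes d: "2 \<le> d" and m: "0 < m"
  shows "card (thru d n x m) \<le> (d * (4 * m + 1) ^ d) * (d * 3 ^ d) ^ (2 * m - 2)"
proof -
  define Rt where "Rt = {(y, i). i < d \<and> (\<forall>l. \<bar>y l - x l\<bar> \<le> (if l < d then int (2 * m) else 0))}"
  define nr where "nr e f \<longleftrightarrow> fst e \<in> lattice d \<and> fst f \<in> lattice d \<and> snd f < d \<and> snd e < d \<and> near e f" for e f :: "site \<times> nat"
  define W where "W r = {w. w \<noteq> [] \<and> hd w = r \<and> length w = Suc (2 * m - 2) \<and> successively nr w}" for r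
  have nr: "finite {f. nr e f}" "card {f. nr e f} \<le> d * 3 ^ d" for e
  proof -
    have sub: "{f. nr e f} \<subseteq> {(y, i). i < d \<and> (\<forall>l. \<bar>y l - fst e l\<bar> \<le> (if l < d then int 1 else 0))}"
      unfolding nr_def near_def lattice_def by (auto simp: abs_minus_commute)
    note c = card_cube_bonds[of d "fst e" 1]
    show "finite {f. nr e f}" using finite_subset[OF sub] c by blast
    have "card {f. nr e f} \<le> card {(y, i). i < d \<and> (\<forall>l. \<bar>y l - fst e l\<bar> \<le> (if l < d then int 1 else 0))}"
      using c by (intro card_mono[OF _ sub]) blast
    also have "\<dots> \<le> d * (2 * 1 + 1) ^ d" using c by blast
    finally show "card {f. nr e f} \<le> d * 3 ^ d" by simp
  qed
  have fW: "finite (W r)" "card (W r) \<le> (d * 3 ^ d) ^ (2 * m - 2)" for r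
    using card_walks_le[of nr, OF nr] unfolding W_def by auto
  have sub: "bd d n ` thru d n x m \<subseteq> set ` (\<Union>r\<in>Rt. W r)"
  proof
    fix S assume "S \<in> bd d n ` thru d n x m"
    then obtain A where A: "A \<in> contours d (box d n)" "x \<in> A" "card (bd d n A) = m" "S = bd d n A"
      by (auto simp: thru_def)
    obtain r where r: "r \<in> bd d n A" "\<forall>l. \<bar>fst r l - x l\<bar> \<le> 2 * int m"
      using contour_root[OF A(1) d A(2)] A by auto
    have xl: "x \<in> lattice d" using A by (auto simp: contours_def mem_box subset_iff)
    have bl: "fst e \<in> lattice d \<and> snd e < d" if "e \<in> bd d n A" for e
      using that by (auto simp: bd_def bonds_def mem_box)
    have "r \<in> Rt" unfolding Rt_def using r bl[OF r(1)] xl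
      by (auto simp: case_prod_unfold lattice_def)
    have "\<exists>w. w \<noteq> [] \<and> hd w = r \<and> set w = bd d n A \<and> length w = 2 * card (bd d n A) - 1 \<and> successively nr w"
    proof (rule walk_cover)
      fix T assume T: "T \<subseteq> bd d n A" "r \<in> T" "T \<noteq> bd d n A"
      then obtain e f where "e \<in> T" "f \<in> bd d n A - T" "near e f"
        using bd_connected[OF A(1), of T] by (metis empty_iff)
      then show "\<exists>e\<in>T. \<exists>f\<in>bd d n A - T. nr e f" using T bl unfolding nr_def by blast
    qed (use r in \<open>auto simp: nr_def near_def abs_minus_commute\<close>)
    then obtain w where w: "w \<noteq> []" "hd w = r" "set w = S" "length w = 2 * m - 1" "successively nr w"
      using A by auto
    then have "w \<in> W r" unfolding W_def using m by auto
    then show "S \<in> set ` (\<Union>r\<in>Rt. W r)" using \<open>r \<in> Rt\<close> w by blast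
  qed
  have fR: "finite Rt" "card Rt \<le> d * (2 * (2 * m) + 1) ^ d"
    using card_cube_bonds[of d x "2 * m"] unfolding Rt_def by blast+
  have fU: "finite (\<Union>r\<in>Rt. W r)" using fW fR by auto
  have "inj_on (bd d n) (thru d n x m)"
    by (rule inj_onI, rule bd_inj) (auto simp: thru_def contours_def)
  then have "card (thru d n x m) = card (bd d n ` thru d n x m)" by (simp add: card_image)
  also have "\<dots> \<le> card (\<Union>r\<in>Rt. W r)" using sub fU by (metis surj_card_le)
  also have "\<dots> \<le> (\<Sum>r\<in>Rt. card (W r))" using fR by (intro card_UN_le) auto
  also have "\<dots> \<le> (\<Sum>r\<in>Rt. (d * 3 ^ d) ^ (2 * m - 2))" using fW by (intro sum_mono) auto
  also have "\<dots> = card Rt * (d * 3 ^ d) ^ (2 * m - 2)" by simp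
  also have "\<dots> \<le> (d * (4 * m + 1) ^ d) * (d * 3 ^ d) ^ (2 * m - 2)"
    using fR by (intro mult_right_mono) auto
  finally show ?thesis .
qed

text \<open>The polynomial factor is absorbed by \<open>4 * m + 1 \<le> 5 * 2 ^ m\<close>. The base,
  independent of \<open>n\<close>, \<open>x\<close> and \<open>m\<close>, becomes
  \<open>contour_const\<close>.\<close>

lemma card_thru_le_exp:
  assumes d: "2 \<le> d" and m: "0 < m"
  shows "card (thru d n x m) \<le> (d ^ 3 * 3 ^ (2 * d) * 5 ^ d * 2 ^ d) ^ m"
proof -
  have mm: "4 * m + 1 \<le> 5 * 2 ^ m"
  proof -
    have "m < 2 ^ m" by (rule less_exp)
    then show ?thesis by linarith
  qed
  obtain k where k: "m = Suc k" using m by (cases m) auto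
  have "card (thru d n x m) \<le> (d * (4 * m + 1) ^ d) * (d * 3 ^ d) ^ (2 * m - 2)" by (rule card_thru_le[OF assms])
  also have "\<dots> \<le> (d ^ m * ((5 * 2 ^ m) ^ d)) * (d * 3 ^ d) ^ (2 * m)"
    using d m mm by (intro mult_mono power_mono power_increasing) (auto intro: self_le_power)
  also have "\<dots> \<le> (d ^ m * ((5 ^ m * 2 ^ m) ^ d)) * (d * 3 ^ d) ^ (2 * m)"
    using m by (intro mult_mono power_mono) (auto intro: self_le_power)
  also have "(5 ^ m * 2 ^ m) ^ d = (5 ^ d * 2 ^ d :: nat) ^ m"
    by (metis mult.commute power_mult power_mult_distrib)
  also have "(d * 3 ^ d) ^ (2 * m) = (d ^ 2 * 3 ^ (2 * d)) ^ m"
    by (metis mult.commute power_mult power_mult_distrib)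
  also have "d ^ m * (5 ^ d * 2 ^ d) ^ m * (d ^ 2 * 3 ^ (2 * d)) ^ m
      = (d * (5 ^ d * 2 ^ d) * (d ^ 2 * 3 ^ (2 * d))) ^ m"
    by (simp only: power_mult_distrib)
  also have "d * (5 ^ d * 2 ^ d) * (d ^ 2 * 3 ^ (2 * d)) = d ^ 3 * 3 ^ (2 * d) * 5 ^ d * 2 ^ d"
    by (simp only: power3_eq_cube power2_eq_square mult_ac)
  finally show ?thesis .
qed

subsection \<open>Peierls estimates\<close>

text \<open>The Boltzmann weight of the configuration with plus set \<open>S\<close>: a broken bond
  contributes \<open>- 2 * \<beta>\<close> to the exponent, an agreeing one nothing. The match with
  \<open>hamiltonian\<close> is \<open>exp_hamiltonian\<close>.\<close>

definition wt :: "nat \<Rightarrow> real \<Rightarrow> nat \<Rightarrow> (site \<Rightarrow> real) \<Rightarrow> site set \<Rightarrow> real" where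
  "wt d \<beta> n h S = exp (- 2 * \<beta> * real (card (bd d n S)) + (\<Sum>x\<in>bdry d n. h x * (if x \<in> S then 1 else - 1)))"

definition Zw :: "nat \<Rightarrow> real \<Rightarrow> nat \<Rightarrow> (site \<Rightarrow> real) \<Rightarrow> site set set \<Rightarrow> real" where
  "Zw d \<beta> n h X = (\<Sum>S\<in>X. wt d \<beta> n h S)"

definition flip :: "site set \<Rightarrow> site set \<Rightarrow> site set" where
  "flip A S = (S - A) \<union> (A - S)"

lemma wt_pos: "0 < wt d \<beta> n h S"
  by (simp add: wt_def)

lemma Zw_nonneg: "0 \<le> Zw d \<beta> n h X"
  unfolding Zw_def by (intro sum_nonneg) (simp add: wt_pos less_imp_le)

lemma Zw_mono: "finite Y \<Longrightarrow> X \<subseteq> Y \<Longrightarrow> Zw d \<beta> n h X \<le> Zw d \<beta> n h Y"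
  unfolding Zw_def by (intro sum_mono2) (auto simp: wt_pos less_imp_le)

lemma Zw_Un_le: "finite X \<Longrightarrow> finite Y \<Longrightarrow> Zw d \<beta> n h (X \<union> Y) \<le> Zw d \<beta> n h X + Zw d \<beta> n h Y"
  unfolding Zw_def using sum.union_inter[of X Y "wt d \<beta> n h"] sum_nonneg[of "X \<inter> Y" "wt d \<beta> n h"]
  by (simp add: wt_pos less_imp_le)

lemma Zw_UN_le:
  assumes "finite I" "\<And>i. i \<in> I \<Longrightarrow> finite (X i)"
  shows "Zw d \<beta> n h (\<Union>i\<in>I. X i) \<le> (\<Sum>i\<in>I. Zw d \<beta> n h (X i))"
  using assms
proof (induction I rule: finite_induct)
  case (insert i I)
  have "Zw d \<beta> n h (\<Union>i\<in>insert i I. X i) \<le> Zw d \<beta> n h (X i) + Zw d \<beta> n h (\<Union>i\<in>I. X i)"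
    using insert by (simp add: Zw_Un_le)
  then show ?case using insert by auto
qed (simp add: Zw_def)

lemma flip_flip: "flip A (flip A S) = S"
  by (auto simp: flip_def)

lemma flip_inj: "inj_on (flip A) X"
  by (metis flip_flip inj_onI)

lemma bd_flip: "bd d n (flip A S) = (bd d n S - bd d n A) \<union> (bd d n A - bd d n S)"
  by (auto simp: bd_def flip_def)

lemma cutting_bd:
  assumes "cutting d (box d n) A S"
  shows "bd d n A \<subseteq> bd d n S"
proof
  fix e assume e: "e \<in> bd d n A"
  obtain x i where xi: "e = (x, i)" by (cases e)
  have "i < d" "x \<in> box d n" "up x i \<in> box d n" "(x \<in> A) \<noteq> (up x i \<in> A)"
    using e xi by (auto simp: bd_def bonds_def)
  moreover have "nb d x (up x i)" "nb d (up x i) x" using nb_up nb_sym \<open>i < d\<close> by blast+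
  ultimately have "(x \<in> S) \<noteq> (up x i \<in> S)" using assms unfolding cutting_def by blast
  then show "e \<in> bd d n S" using e xi by (auto simp: bd_def)
qed

text \<open>Flipping removes the \<open>card (bd d n A)\<close> broken bonds on the border of
  \<open>A\<close>, each worth \<open>2 * \<beta>\<close>. A field term changes by at most
  \<open>2 * l\<close>, and only on \<open>A \<inter> bdry d n\<close>, which has at most
  \<open>4 * d\<close> sites per boundary bond; this is the \<open>8 * d * l\<close>.\<close>

lemma wt_flip:
  assumes A: "A \<subseteq> box d n" "2 * card A \<le> card (box d n)" and b: "bd d n A \<subseteq> bd d n S"
    and h: "\<And>x. x \<in> bdry d n \<Longrightarrow> \<bar>h x\<bar> \<le> l" and l: "0 \<le> l"
  shows "wt d \<beta> n h S \<le> exp (- 2 * \<beta> + 8 * real d * l) ^ card (bd d n A) * wt d \<beta> n h (flip A S)"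
proof -
  define m where "m = card (bd d n A)"
  have "bd d n (flip A S) = bd d n S - bd d n A" using b by (auto simp: bd_flip)
  then have "card (bd d n (flip A S)) = card (bd d n S) - m" using b unfolding m_def
    by (simp add: card_Diff_subset)
  moreover have "m \<le> card (bd d n S)" unfolding m_def using b by (intro card_mono) auto
  ultimately have c: "real (card (bd d n S)) = real (card (bd d n (flip A S))) + real m" by simp
  define s where "s x S = (if x \<in> S then 1 else - 1 :: real)" for x :: site and S
  have "(\<Sum>x\<in>bdry d n. h x * s x S) - (\<Sum>x\<in>bdry d n. h x * s x (flip A S))
      = (\<Sum>x\<in>bdry d n. h x * (s x S - s x (flip A S)))"
    by (simp add: sum_subtractf algebra_simps)
  also have "\<dots> \<le> (\<Sum>x\<in>bdry d n. if x \<in> A then 2 * l else 0)"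
  proof (rule sum_mono)
    fix x assume "x \<in> bdry d n"
    then have "\<bar>h x\<bar> \<le> l" by (rule h)
    then show "h x * (s x S - s x (flip A S)) \<le> (if x \<in> A then 2 * l else 0)"
      by (auto simp: s_def flip_def)
  qed
  also have "\<dots> = 2 * l * real (card (A \<inter> bdry d n))"
    by (subst sum.inter_restrict[symmetric]) (auto simp: Int_commute)
  also have "\<dots> \<le> 2 * l * real (4 * d * m)"
    using card_Int_bdry_le[OF A] l unfolding m_def by (intro mult_left_mono) (simp_all only: of_nat_le_iff)
  finally have f: "(\<Sum>x\<in>bdry d n. h x * s x S) \<le> (\<Sum>x\<in>bdry d n. h x * s x (flip A S)) + 8 * real d * l * real m"
    by (simp add: algebra_simps)
  have "wt d \<beta> n h S \<le> exp ((- 2 * \<beta> + 8 * real d * l) * real m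
      + (- 2 * \<beta> * real (card (bd d n (flip A S))) + (\<Sum>x\<in>bdry d n. h x * s x (flip A S))))"
    unfolding wt_def using f c by (simp add: s_def algebra_simps)
  also have "\<dots> = exp (- 2 * \<beta> + 8 * real d * l) ^ m * wt d \<beta> n h (flip A S)"
    unfolding exp_add[of "(- 2 * \<beta> + 8 * real d * l) * real m"] wt_def s_def exp_of_nat2_mult ..
  finally show ?thesis unfolding m_def .
qed

definition contour_const :: "nat \<Rightarrow> real" where
  "contour_const d = real (d ^ 3 * 3 ^ (2 * d) * 5 ^ d * 2 ^ d)"

text \<open>The subtracted remainder is what the induction step consumes.\<close>

lemma geometric_tail: "(\<Sum>m=L..<L + k. (1/8::real) ^ m) \<le> 2 * (1/8) ^ L - 2 * (1/8) ^ (L + k)"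
proof (induction k)
  case (Suc k)
  have "(\<Sum>m=L..<L + Suc k. (1/8::real) ^ m) = (\<Sum>m=L..<L + k. (1/8::real) ^ m) + (1/8) ^ (L + k)"
    by simp
  also have "\<dots> \<le> 2 * (1/8) ^ L - 2 * (1/8) ^ (L + k) + (1/8) ^ (L + k)" using Suc by simp
  also have "\<dots> \<le> 2 * (1/8) ^ L - 2 * (1/8) ^ (L + Suc k)"
    using zero_le_power[of "1/8::real" "L + k"] by simp
  finally show ?case .
qed simp

text \<open>With ratio \<open>1/8\<close> the sum over all contours through a site is at most
  \<open>1/4\<close>, the case \<open>L = 1\<close>; the resulting odds of three to one reappear in
  \<open>gain\<close>.\<close>

lemma contour_sum:
  assumes d: "2 \<le> d" and q: "0 \<le> q" "q * contour_const d \<le> 1/8" and L: "1 \<le> L"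
  shows "(\<Sum>A\<in>{A \<in> contours d (box d n). x \<in> A \<and> L \<le> card (bd d n A)}. q ^ card (bd d n A)) \<le> 2 * (1/8) ^ L"
proof -
  define M where "M = Suc (card (bonds d n)) + L"
  have le: "card (bd d n A) < M" for A
    unfolding M_def using card_mono[OF finite_bonds bd_subset, of d n A] by simp
  have fin: "finite (thru d n x m)" for m unfolding thru_def by simp
  have "{A \<in> contours d (box d n). x \<in> A \<and> L \<le> card (bd d n A)} = (\<Union>m\<in>{L..<M}. thru d n x m)"
    using le unfolding thru_def by auto
  then have "(\<Sum>A\<in>{A \<in> contours d (box d n). x \<in> A \<and> L \<le> card (bd d n A)}. q ^ card (bd d n A))
     = (\<Sum>A\<in>(\<Union>m\<in>{L..<M}. thru d n x m). q ^ card (bd d n A))" by metis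
  also have "\<dots> = (\<Sum>m=L..<M. \<Sum>A\<in>thru d n x m. q ^ card (bd d n A))"
    using fin by (intro sum.UNION_disjoint) (auto simp: thru_def)
  also have "\<dots> = (\<Sum>m=L..<M. real (card (thru d n x m)) * q ^ m)"
    by (intro sum.cong refl) (simp add: thru_def)
  also have "\<dots> \<le> (\<Sum>m=L..<M. (1/8) ^ m)"
  proof (rule sum_mono)
    fix m assume "m \<in> {L..<M}"
    then have m: "0 < m" using L by auto
    have "real (card (thru d n x m)) \<le> contour_const d ^ m"
      unfolding contour_const_def of_nat_power[symmetric] of_nat_le_iff by (rule card_thru_le_exp[OF d m])
    then have "real (card (thru d n x m)) * q ^ m \<le> contour_const d ^ m * q ^ m"
      using q by (intro mult_right_mono) auto
    also have "\<dots> = (q * contour_const d) ^ m" by (simp add: power_mult_distrib mult.commute)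
    also have "\<dots> \<le> (1/8) ^ m" using q by (intro power_mono) (auto simp: contour_const_def)
    finally show "real (card (thru d n x m)) * q ^ m \<le> (1/8) ^ m" .
  qed
  also have "\<dots> \<le> 2 * (1/8) ^ L"
    using geometric_tail[of L "Suc (card (bonds d n))"] zero_le_power[of "1/8::real" "L + Suc (card (bonds d n))"]
    unfolding M_def by (simp only: add.commute[of "Suc (card (bonds d n))" L]) linarith
  finally show ?thesis .
qed

text \<open>\<open>l\<close> bounds the fields. \<open>cold\<close> turns number times cost of
  contours into a geometric series of ratio at most \<open>1/8\<close>;
  \<open>l \<le> \<beta>\<close> lets the field \<open>\<beta>\<close> of the plus state dominate
  the constant field \<open>l\<close>.\<close>

locale low_temp =
  fixes d :: nat and \<beta> l :: real
  assumes d2: "2 \<le> d" and l_nonneg: "0 \<le> l" and l_le: "l \<le> \<beta>"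
    and cold: "exp (- 2 * \<beta> + 8 * real d * l) * contour_const d \<le> 1/8"
begin

abbreviation "B n \<equiv> box d n"
abbreviation "Z n h X \<equiv> Zw d \<beta> n h X"
abbreviation "q \<equiv> exp (- 2 * \<beta> + 8 * real d * l)"
abbreviation "OmP n \<equiv> Omega_plus d (box d n)"
abbreviation "OmM n \<equiv> Omega_minus d (box d n)"

definition bounded_field :: "nat \<Rightarrow> (site \<Rightarrow> real) \<Rightarrow> bool" where
  "bounded_field n h \<longleftrightarrow> (\<forall>x\<in>bdry d n. \<bar>h x\<bar> \<le> l)"

lemma finite_Om [simp]: "finite (OmP n)" "finite (OmM n)"
  by (auto intro!: finite_subset[of _ "Pow (B n)"] simp: Omega_plus_def Omega_minus_def)

text \<open>The Peierls argument in general form: every \<open>S\<close> in \<open>F\<close> is sent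
  into \<open>G\<close> by flipping some \<open>A\<close> in \<open>AA\<close> whose boundary bonds
  are all broken in \<open>S\<close>. For fixed \<open>A\<close> flipping is injective and costs
  \<open>q ^ card (bd d n A)\<close>; the choice of \<open>A\<close> is paid for by the sum.\<close>

lemma flip_bound:
  assumes h: "bounded_field n h" and AA: "AA \<subseteq> contours d (B n)" and G: "finite G" and F: "finite F"
    and ex: "\<And>S. S \<in> F \<Longrightarrow> \<exists>A\<in>AA. bd d n A \<subseteq> bd d n S \<and> flip A S \<in> G"
    and tail: "(\<Sum>A\<in>AA. q ^ card (bd d n A)) \<le> c"
  shows "Z n h F \<le> c * Z n h G"
proof -
  have finA: "finite AA" using AA finite_contours finite_subset by blast
  define FA where "FA A = {S \<in> F. bd d n A \<subseteq> bd d n S \<and> flip A S \<in> G}" for A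
  have "F \<subseteq> (\<Union>A\<in>AA. FA A)" using ex unfolding FA_def by blast
  then have "Z n h F \<le> Z n h (\<Union>A\<in>AA. FA A)" using finA F by (intro Zw_mono) (auto simp: FA_def)
  also have "\<dots> \<le> (\<Sum>A\<in>AA. Z n h (FA A))" using finA F by (intro Zw_UN_le) (auto simp: FA_def)
  also have "\<dots> \<le> (\<Sum>A\<in>AA. q ^ card (bd d n A) * Z n h G)"
  proof (rule sum_mono)
    fix A assume "A \<in> AA"
    then have A: "A \<subseteq> B n" "2 * card A \<le> card (B n)" using AA by (auto simp: contours_def)
    have "Z n h (FA A) \<le> (\<Sum>S\<in>FA A. q ^ card (bd d n A) * wt d \<beta> n h (flip A S))"
      unfolding Zw_def using h l_nonneg
      by (intro sum_mono wt_flip[OF A]) (auto simp: FA_def bounded_field_def)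
    also have "\<dots> = q ^ card (bd d n A) * (\<Sum>T\<in>flip A ` FA A. wt d \<beta> n h T)"
      by (simp add: sum.reindex[OF flip_inj] sum_distrib_left)
    also have "(\<Sum>T\<in>flip A ` FA A. wt d \<beta> n h T) \<le> Z n h G"
      unfolding Zw_def using G by (intro sum_mono2) (auto simp: FA_def wt_pos less_imp_le)
    finally show "Z n h (FA A) \<le> q ^ card (bd d n A) * Z n h G" by simp
  qed
  also have "\<dots> = (\<Sum>A\<in>AA. q ^ card (bd d n A)) * Z n h G" by (simp add: sum_distrib_right)
  also have "\<dots> \<le> c * Z n h G" using tail Zw_nonneg by (rule mult_right_mono)
  finally show ?thesis .
qed

definition bad :: "nat \<Rightarrow> site \<Rightarrow> nat \<Rightarrow> site set set" where
  "bad n x L = {S \<in> OmP n. \<exists>C. is_central d (B n) S C \<and> x \<notin> C \<and>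
     L \<le> card (bd d n (cluster d (B n - C) x))}"

lemma bad_le:
  assumes h: "bounded_field n h" and x: "x \<in> B n" and L: "1 \<le> L"
  shows "Z n h (bad n x L) \<le> 2 * (1/8) ^ L * Z n h (OmP n)"
proof (rule flip_bound[OF h])
  show "(\<Sum>A\<in>{A \<in> contours d (B n). x \<in> A \<and> L \<le> card (bd d n A)}. q ^ card (bd d n A)) \<le> 2 * (1/8) ^ L"
    by (rule contour_sum[OF d2 _ cold L]) simp
  show "finite (bad n x L)" unfolding bad_def by simp
  fix S assume "S \<in> bad n x L"
  then obtain C where C: "S \<subseteq> B n" "is_central d (B n) S C" "x \<notin> C" "L \<le> card (bd d n (cluster d (B n - C) x))"
    by (auto simp: bad_def Omega_plus_def)
  define A where "A = cluster d (B n - C) x"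
  note c = central_contour[OF finite_box conn_box C(1,2) _ A_def]
  show "\<exists>A\<in>{A \<in> contours d (B n). x \<in> A \<and> L \<le> card (bd d n A)}. bd d n A \<subseteq> bd d n S \<and> flip A S \<in> OmP n"
    using c(1-4) C x cutting_bd unfolding flip_def A_def[symmetric] by blast
qed auto

lemma central_bad:
  assumes "S \<in> OmP n" "is_central d (B n) S C" "x \<in> B n" "x \<notin> C"
  shows "S \<in> bad n x 1"
proof -
  define A where "A = cluster d (B n - C) x"
  have "S \<subseteq> B n" using assms by (auto simp: Omega_plus_def)
  then have "A \<in> contours d (B n)"
    using central_contour(1)[OF finite_box conn_box _ assms(2) _ A_def] assms by auto
  then have "0 < card (bd d n A)" using contour_bd_pos d2 by auto
  then show ?thesis using assms unfolding bad_def A_def by auto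
qed

lemma minus_at_le:
  assumes h: "bounded_field n h" and x: "x \<in> B n"
  shows "Z n h {S \<in> OmP n. x \<notin> S} \<le> 1/4 * Z n h (OmP n)"
proof -
  have "{S \<in> OmP n. x \<notin> S} \<subseteq> bad n x 1"
  proof
    fix S assume S: "S \<in> {S \<in> OmP n. x \<notin> S}"
    then obtain C where C: "is_central d (B n) S C" by (auto simp: Omega_plus_def)
    then have "C \<subseteq> S" using cluster_subset by (auto simp: is_central_def)
    then have "x \<notin> C" using S by auto
    then show "S \<in> bad n x 1" using central_bad[OF _ C x] S by blast
  qed
  then have "Z n h {S \<in> OmP n. x \<notin> S} \<le> Z n h (bad n x 1)"
    by (intro Zw_mono) (auto simp: bad_def)
  also have "\<dots> \<le> 1/4 * Z n h (OmP n)" using bad_le[OF h x, of 1] by simp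
  finally show ?thesis .
qed

lemma bd_compl: "S \<subseteq> B n \<Longrightarrow> bd d n (B n - S) = bd d n S"
  by (auto simp: bd_def bonds_def)

lemma wt_compl:
  assumes "S \<subseteq> B n"
  shows "wt d \<beta> n h (B n - S) = wt d \<beta> n (\<lambda>x. - h x) S"
proof -
  have "(\<Sum>x\<in>bdry d n. h x * (if x \<in> B n - S then 1 else - 1)) = (\<Sum>x\<in>bdry d n. - h x * (if x \<in> S then 1 else - 1))"
    by (intro sum.cong) (auto simp: bdry_def)
  then show ?thesis unfolding wt_def bd_compl[OF assms] by simp
qed

lemma Z_compl:
  assumes "X \<subseteq> Pow (B n)"
  shows "Z n h {S. S \<subseteq> B n \<and> B n - S \<in> X} = Z n (\<lambda>x. - h x) X"
  unfolding Zw_def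
  by (rule sum.reindex_bij_witness[of _ "\<lambda>S. B n - S" "\<lambda>S. B n - S"])
    (use assms in \<open>auto simp: double_diff wt_compl[symmetric] subset_iff\<close>)

text \<open>Estimates for the minus ensemble are read off from the plus ensemble in the reversed
  field.\<close>

lemma Z_OmM: "Z n h (OmM n) = Z n (\<lambda>x. - h x) (OmP n)"
  unfolding Omega_minus_def by (rule Z_compl) (auto simp: Omega_plus_def)

lemma bounded_uminus: "bounded_field n h \<Longrightarrow> bounded_field n (\<lambda>x. - h x)"
  by (simp add: bounded_field_def)

text \<open>Distances are measured in coordinate \<open>0\<close> alone. A separation above
  \<open>2 * L + 1\<close> keeps the boundaries of contours shorter than \<open>L\<close> around two
  of the points disjoint; the extra unit allows for the length of a bond.\<close>

definition far_points :: "nat \<Rightarrow> site set \<Rightarrow> nat \<Rightarrow> bool" where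
  "far_points n X L \<longleftrightarrow> X \<subseteq> B n \<and> (\<forall>x\<in>X. \<forall>y\<in>X. x \<noteq> y \<longrightarrow> 2 * int L + 1 < \<bar>x 0 - y 0\<bar>)"

definition in_short :: "nat \<Rightarrow> nat \<Rightarrow> site set \<Rightarrow> site set set" where
  "in_short n L X = {S. S \<subseteq> B n \<and> (\<forall>x\<in>X. \<exists>A\<in>contours d (B n). x \<in> A \<and> card (bd d n A) < L \<and> bd d n A \<subseteq> bd d n S)}"

lemma finite_in_short [simp]: "finite (in_short n L X)"
  by (rule finite_subset[of _ "Pow (B n)"]) (auto simp: in_short_def)

lemma bd_disjoint:
  assumes A: "A \<in> contours d (B n)" "x \<in> A" "card (bd d n A) < L"
    and A': "A' \<in> contours d (B n)" "y \<in> A'" "card (bd d n A') < L"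
    and n: "2 * L \<le> n" and far: "2 * int L + 1 < \<bar>x 0 - y 0\<bar>"
  shows "bd d n A \<inter> bd d n A' = {}"
proof (rule ccontr)
  assume "\<not> ?thesis"
  then obtain z i where z: "(z, i) \<in> bd d n A" "(z, i) \<in> bd d n A'" by auto
  obtain u where u: "u \<in> A" "u = z \<or> u = up z i" using z by (auto simp: bd_def)
  obtain v where v: "v \<in> A'" "v = z \<or> v = up z i" using z by (auto simp: bd_def)
  have "\<bar>u 0 - v 0\<bar> \<le> 1" using u v by (auto simp: up_def)
  moreover have "\<bar>x 0 - u 0\<bar> \<le> int (card (bd d n A))" using contour_diameter[OF A(1) d2 _ A(2) u(1)] A n by auto
  moreover have "\<bar>y 0 - v 0\<bar> \<le> int (card (bd d n A'))" using contour_diameter[OF A'(1) d2 _ A'(2) v(1)] A' n by auto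
  ultimately show False using far A A' by linarith
qed

text \<open>One factor \<open>1/4\<close> per point: flipping a short contour around
  \<open>x\<close> leaves the broken bonds of short contours around the other points in place,
  because their boundaries are disjoint from its own. The flipped configuration is therefore still
  counted for the smaller set \<open>X\<close>.\<close>

lemma in_short_le:
  assumes h: "bounded_field n h" and n: "2 * L \<le> n"
  shows "finite X \<Longrightarrow> far_points n X L \<Longrightarrow> Z n h (in_short n L X) \<le> (1/4) ^ card X * Z n h (Pow (B n))"
proof (induction X rule: finite_induct)
  case empty
  have "in_short n L {} = Pow (B n)" by (auto simp: in_short_def)
  then show ?case by simp
next
  case (insert x X)
  define AA where "AA = {A \<in> contours d (B n). x \<in> A \<and> card (bd d n A) < L}"
  have "(\<Sum>A\<in>AA. q ^ card (bd d n A)) \<le> (\<Sum>A\<in>{A \<in> contours d (B n). x \<in> A \<and> 1 \<le> card (bd d n A)}. q ^ card (bd d n A))"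
    unfolding AA_def using contour_bd_pos d2 by (intro sum_mono2) (auto simp: Suc_le_eq)
  also have "\<dots> \<le> 1/4" using contour_sum[OF d2 _ cold, of 1 n x] by simp
  finally have t: "(\<Sum>A\<in>AA. q ^ card (bd d n A)) \<le> 1/4" .
  have "Z n h (in_short n L (insert x X)) \<le> 1/4 * Z n h (in_short n L X)"
  proof (rule flip_bound[OF h _ _ _ _ t])
    fix S assume S: "S \<in> in_short n L (insert x X)"
    then obtain A where A: "A \<in> contours d (B n)" "x \<in> A" "card (bd d n A) < L" "bd d n A \<subseteq> bd d n S"
      by (auto simp: in_short_def)
    have "flip A S \<in> in_short n L X" unfolding in_short_def
    proof (intro CollectI conjI ballI)
      show "flip A S \<subseteq> B n" using S A by (auto simp: in_short_def flip_def contours_def)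
      fix y assume y: "y \<in> X"
      then obtain A' where A': "A' \<in> contours d (B n)" "y \<in> A'" "card (bd d n A') < L" "bd d n A' \<subseteq> bd d n S"
        using S by (auto simp: in_short_def)
      have "x \<noteq> y" using insert y by auto
      then have "bd d n A \<inter> bd d n A' = {}" using insert.prems y
        by (intro bd_disjoint[OF A(1-3) A'(1-3) n]) (auto simp: far_points_def)
      then have "bd d n A' \<subseteq> bd d n (flip A S)" using A'(4) by (auto simp: bd_flip)
      then show "\<exists>A'\<in>contours d (B n). y \<in> A' \<and> card (bd d n A') < L \<and> bd d n A' \<subseteq> bd d n (flip A S)"
        using A' by blast
    qed
    then show "\<exists>A\<in>AA. bd d n A \<subseteq> bd d n S \<and> flip A S \<in> in_short n L X" using A unfolding AA_def by blast
  qed (auto simp: AA_def)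
  also have "\<dots> \<le> 1/4 * ((1/4) ^ card X * Z n h (Pow (B n)))"
    using insert by (intro mult_left_mono) (auto simp: far_points_def)
  finally show ?case using insert by simp
qed

abbreviation "Om0 n \<equiv> Pow (B n) - OmP n - OmM n"

text \<open>Every site of \<open>X\<close> is enclosed by a contour. If some point of
  \<open>X\<close> has a long one around it, the tail sum pays, once per point; otherwise all points
  have short ones and \<open>in_short_le\<close> pays \<open>1/4\<close> per point.\<close>

lemma Om0_le:
  assumes h: "bounded_field n h" and n: "2 * L \<le> n" and L: "1 \<le> L" and X: "finite X" "far_points n X L"
  shows "Z n h (Om0 n) \<le> ((1/4) ^ card X + real (card X) * (2 * (1/8) ^ L)) * Z n h (Pow (B n))"
proof -
  define T where "T x = {S \<in> Pow (B n). \<exists>A\<in>contours d (B n). x \<in> A \<and> L \<le> card (bd d n A) \<and> bd d n A \<subseteq> bd d n S}" for x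
  have fT: "finite (T x)" for x unfolding T_def by simp
  have T: "Z n h (T x) \<le> 2 * (1/8) ^ L * Z n h (Pow (B n))" for x
  proof (rule flip_bound[OF h])
    show "(\<Sum>A\<in>{A \<in> contours d (B n). x \<in> A \<and> L \<le> card (bd d n A)}. q ^ card (bd d n A)) \<le> 2 * (1/8) ^ L"
      by (rule contour_sum[OF d2 _ cold L]) simp
  next
    fix S assume "S \<in> T x"
    then obtain A where A: "A \<in> contours d (B n)" "x \<in> A" "L \<le> card (bd d n A)" "bd d n A \<subseteq> bd d n S" "S \<subseteq> B n"
      by (auto simp: T_def)
    then have "flip A S \<in> Pow (B n)" by (auto simp: flip_def contours_def)
    then show "\<exists>A\<in>{A \<in> contours d (B n). x \<in> A \<and> L \<le> card (bd d n A)}. bd d n A \<subseteq> bd d n S \<and> flip A S \<in> Pow (B n)"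
      using A by blast
  qed (auto simp: T_def)
  have "Om0 n \<subseteq> in_short n L X \<union> (\<Union>x\<in>X. T x)"
  proof
    fix S assume S: "S \<in> Om0 n"
    have ex: "\<exists>A\<in>contours d (B n). x \<in> A \<and> bd d n A \<subseteq> bd d n S" if "x \<in> X" for x
      using noncentral_contour[OF finite_box conn_box, of S d n x] S X(2) that cutting_bd
      by (auto simp: far_points_def subset_iff)
    show "S \<in> in_short n L X \<union> (\<Union>x\<in>X. T x)"
    proof (cases "S \<in> (\<Union>x\<in>X. T x)")
      case False
      have "\<exists>A\<in>contours d (B n). x \<in> A \<and> card (bd d n A) < L \<and> bd d n A \<subseteq> bd d n S" if "x \<in> X" for x
        using ex[OF that] False S that unfolding T_def by (auto simp: not_le)
      then show ?thesis using S by (auto simp: in_short_def)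
    qed simp
  qed
  then have "Z n h (Om0 n) \<le> Z n h (in_short n L X \<union> (\<Union>x\<in>X. T x))"
    using X fT by (intro Zw_mono) auto
  also have "\<dots> \<le> Z n h (in_short n L X) + Z n h (\<Union>x\<in>X. T x)"
    using X fT by (intro Zw_Un_le) auto
  also have "\<dots> \<le> Z n h (in_short n L X) + (\<Sum>x\<in>X. Z n h (T x))"
    using X fT by (intro add_left_mono Zw_UN_le) auto
  also have "\<dots> \<le> (1/4) ^ card X * Z n h (Pow (B n)) + (\<Sum>x\<in>X. 2 * (1/8) ^ L * Z n h (Pow (B n)))"
    using in_short_le[OF h n X] T by (intro add_mono sum_mono) auto
  finally show ?thesis by (simp add: algebra_simps)
qed

text \<open>The points are placed on one edge of the box, \<open>2 * L + 2\<close> apart in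
  coordinate \<open>0\<close>.\<close>

lemma ex_far_points:
  assumes "k * (2 * L + 2) \<le> n"
  shows "\<exists>X. finite X \<and> card X = k \<and> far_points n X L"
proof -
  define p where "p i = (\<lambda>j::nat. if j = 0 then lo n + int i * (2 * int L + 2) else if j < d then lo n else 0)" for i :: nat
  have d0: "0 < d" using d2 by auto
  have sep: "2 * int L + 1 < \<bar>p i 0 - p j 0\<bar>" if "i \<noteq> j" for i j
  proof -
    have "p i 0 - p j 0 = (int i - int j) * (2 * int L + 2)" by (simp add: p_def algebra_simps)
    then have "\<bar>p i 0 - p j 0\<bar> = \<bar>int i - int j\<bar> * (2 * int L + 2)" by (simp add: abs_mult)
    also have "\<dots> \<ge> 1 * (2 * int L + 2)" using that by (intro mult_right_mono) auto
    finally show ?thesis by simp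
  qed
  have inj: "inj_on p {..<k}"
  proof (rule inj_onI, rule ccontr)
    fix i j assume "p i = p j" "i \<noteq> j"
    then show False using sep[of i j] by simp
  qed
  have mem: "p i \<in> B n" if "i < k" for i
  proof -
    have "Suc i * (2 * L + 2) \<le> n" using that assms by (meson Suc_leI le_trans mult_le_mono1)
    then have "int i * (2 * int L + 2) + (2 * int L + 2) \<le> int n"
      by (metis (mono_tags, lifting) add.commute mult_Suc of_nat_add of_nat_le_iff of_nat_mult of_nat_numeral)
    moreover have "0 \<le> int i * (2 * int L + 2)" by simp
    moreover have "p i 0 = lo n + int i * (2 * int L + 2)" by (simp add: p_def)
    ultimately have p0: "lo n \<le> p i 0" "p i 0 \<le> hi n" "lo n \<le> hi n" using hi_lo[of n] by linarith+
    have pj: "p i j = lo n" if "j \<noteq> 0" "j < d" for j using that by (simp add: p_def)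
    have "lo n \<le> p i j \<and> p i j \<le> hi n" if "j < d" for j
      using p0 pj[of j] that by (cases "j = 0") auto
    moreover have "p i j = 0" if "d \<le> j" for j using that d0 by (simp add: p_def)
    ultimately show ?thesis by (simp add: mem_box lattice_def)
  qed
  show ?thesis
  proof (intro exI[of _ "p ` {..<k}"] conjI)
    show "far_points n (p ` {..<k}) L" unfolding far_points_def
    proof (intro conjI ballI impI)
      show "p ` {..<k} \<subseteq> B n" using mem by (intro image_subsetI) simp
      fix x y assume "x \<in> p ` {..<k}" "y \<in> p ` {..<k}" "x \<noteq> y"
      then obtain i j where "x = p i" "y = p j" "i \<noteq> j" by blast
      then show "2 * int L + 1 < \<bar>x 0 - y 0\<bar>" using sep[of i j] by simp
    qed
  qed (simp_all add: card_image[OF inj])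
qed

lemma Om0_small:
  assumes "0 < \<delta>"
  shows "\<exists>n0. \<forall>n\<ge>n0. \<forall>h. bounded_field n h \<longrightarrow> Z n h (Om0 n) \<le> \<delta> * Z n h (Pow (B n))"
proof -
  \<comment> \<open>The number \<open>k\<close> of points is fixed before the length
    \<open>L\<close>, because the tail term carries the factor \<open>k\<close>; only then is
    \<open>n\<close> taken large enough to place the points.\<close>
  obtain k where k: "(1/4::real) ^ k < \<delta> / 2" using real_arch_pow_inv[of "\<delta>/2" "1/4"] assms by auto
  have "(\<lambda>L. real k * (2 * (1/8::real) ^ L)) \<longlonglongrightarrow> real k * (2 * 0)"
    by (intro tendsto_intros LIMSEQ_power_zero) auto
  then have "eventually (\<lambda>L. real k * (2 * (1/8::real) ^ L) < \<delta> / 2) sequentially"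
    using assms by (intro order_tendstoD(2)) auto
  then obtain N where N: "\<And>L. N \<le> L \<Longrightarrow> real k * (2 * (1/8::real) ^ L) < \<delta> / 2"
    unfolding eventually_sequentially by blast
  define L where "L = max 1 N"
  have L: "1 \<le> L" "real k * (2 * (1/8::real) ^ L) < \<delta> / 2"
    using N[of L] by (auto simp: L_def)
  show ?thesis
  proof (intro exI[of _ "2 * L + k * (2 * L + 2)"] allI impI)
    fix n h assume n: "2 * L + k * (2 * L + 2) \<le> n" and h: "bounded_field n h"
    obtain X where X: "finite X" "card X = k" "far_points n X L"
      using ex_far_points[of k L n] n by auto
    have "Z n h (Om0 n) \<le> ((1/4) ^ k + real k * (2 * (1/8) ^ L)) * Z n h (Pow (B n))"
      using Om0_le[OF h _ L(1) X(1,3)] n X by auto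
    also have "\<dots> \<le> \<delta> * Z n h (Pow (B n))"
      using k L by (intro mult_right_mono Zw_nonneg) auto
    finally show "Z n h (Om0 n) \<le> \<delta> * Z n h (Pow (B n))" .
  qed
qed

end

subsection \<open>Screens of plus spins\<close>

lemma card_cut_submodular:
  assumes "finite E"
  shows "card {e \<in> E. (p e \<in> S \<union> T) \<noteq> (r e \<in> S \<union> T)} + card {e \<in> E. (p e \<in> S \<inter> T) \<noteq> (r e \<in> S \<inter> T)}
    \<le> card {e \<in> E. (p e \<in> S) \<noteq> (r e \<in> S)} + card {e \<in> E. (p e \<in> T) \<noteq> (r e \<in> T)}"
proof -
  have c: "card {e \<in> E. P e} = (\<Sum>e\<in>E. if P e then 1 else 0)" for P
    using assms by (simp add: sum.inter_filter[symmetric])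
  show ?thesis unfolding c sum.distrib[symmetric] by (intro sum_mono) auto
qed

lemma bd_filter: "bd d n A = {e \<in> bonds d n. (fst e \<in> A) \<noteq> (up (fst e) (snd e) \<in> A)}"
  by (auto simp: bd_def)

lemma card_bd_submodular:
  "card (bd d n (S \<union> T)) + card (bd d n (S \<inter> T)) \<le> card (bd d n S) + card (bd d n T)"
  unfolding bd_filter by (rule card_cut_submodular) simp

text \<open>The lattice condition behind the FKG inequality: the edge boundary is submodular and the
  field term is modular, whatever the signs of \<open>h\<close>.\<close>

lemma wt_supermodular:
  assumes "0 \<le> \<beta>"
  shows "wt d \<beta> n h S * wt d \<beta> n h T \<le> wt d \<beta> n h (S \<union> T) * wt d \<beta> n h (S \<inter> T)"
proof -
  define e where "e S = real (card (bd d n S))" for S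
  define g where "g S = (\<Sum>x\<in>bdry d n. h x * (if x \<in> S then 1 else - 1))" for S
  have "e (S \<union> T) + e (S \<inter> T) \<le> e S + e T"
    unfolding e_def of_nat_add[symmetric] of_nat_le_iff by (rule card_bd_submodular)
  then have 1: "2 * \<beta> * (e (S \<union> T) + e (S \<inter> T)) \<le> 2 * \<beta> * (e S + e T)"
    using assms by (intro mult_left_mono) auto
  have 2: "g S + g T = g (S \<union> T) + g (S \<inter> T)"
    unfolding g_def sum.distrib[symmetric] by (intro sum.cong) auto
  show ?thesis unfolding wt_def exp_add[symmetric] exp_le_cancel_iff
    using 1 2 unfolding e_def g_def by (simp add: algebra_simps)
qed

text \<open>The edge boundary in the whole lattice instead of the box. Counting the bonds that leave
  the volume amounts to plus spins outside, so \<open>cwt\<close> weighs the minus set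
  \<open>M\<close> under plus boundary conditions.\<close>

definition cut :: "nat \<Rightarrow> site set \<Rightarrow> (site \<times> nat) set" where
  "cut d M = {(x, i). i < d \<and> (x \<in> M) \<noteq> (up x i \<in> M)}"

definition cwt :: "nat \<Rightarrow> real \<Rightarrow> site set \<Rightarrow> real" where
  "cwt d \<beta> M = exp (- 2 * \<beta> * real (card (cut d M)))"

definition plus_exp :: "nat \<Rightarrow> real \<Rightarrow> site set \<Rightarrow> (site set \<Rightarrow> real) \<Rightarrow> real" where
  "plus_exp d \<beta> V f = (\<Sum>M\<in>Pow V. cwt d \<beta> M * f (V - M)) / (\<Sum>M\<in>Pow V. cwt d \<beta> M)"

text \<open>Two more units of side add one layer on every side, whatever the parity of
  \<open>n\<close>; this is the origin of the margin \<open>m + 2 \<le> n\<close>.\<close>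

lemma lo_hi_plus2: "lo (n + 2) = lo n - 1" "hi (n + 2) = hi n + 1"
  unfolding lo_def hi_def by linarith+

lemma lo_hi_mono: "m \<le> n \<Longrightarrow> lo n \<le> lo m" "m \<le> n \<Longrightarrow> hi m \<le> hi n"
  unfolding lo_def hi_def by (auto intro!: zdiv_mono1)

lemma box_mono: "m \<le> n \<Longrightarrow> box d m \<subseteq> box d n"
  using lo_hi_mono[of m n] by (fastforce simp: mem_box)

lemma nb_box:
  assumes "v \<in> box d m" "nb d u v" "m + 2 \<le> n"
  shows "u \<in> box d n"
proof -
  have "u \<in> lattice d" using assms nb_lattice[of d u v] by (auto simp: mem_box)
  moreover have "\<bar>u j - v j\<bar> \<le> 1" for j using assms by (auto simp: nb_def up_def)
  then have "lo (m + 2) \<le> u j" "u j \<le> hi (m + 2)" if "j < d" for j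
    using assms(1) that unfolding lo_hi_plus2 mem_box by (smt (verit))+
  ultimately have "u \<in> box d (m + 2)" by (auto simp: mem_box)
  then show ?thesis using box_mono[OF assms(3)] by auto
qed

lemma cut_eq_bd:
  assumes "M \<subseteq> box d m" "m + 2 \<le> n"
  shows "cut d M = bd d n M"
proof -
  have "x \<in> box d n \<and> up x i \<in> box d n" if "i < d" "(x \<in> M) \<noteq> (up x i \<in> M)" for x i
    using that assms nb_up[OF that(1), of x] nb_sym nb_box[OF _ _ assms(2)] box_mono[of m n d]
    by (metis add_leD1 subsetD)
  then show ?thesis by (auto simp: cut_def bd_def bonds_def)
qed

lemma cwt_supermodular:
  assumes "0 \<le> \<beta>" "S \<subseteq> box d m" "T \<subseteq> box d m"
  shows "cwt d \<beta> S * cwt d \<beta> T \<le> cwt d \<beta> (S \<union> T) * cwt d \<beta> (S \<inter> T)"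
proof -
  have e: "cut d S = bd d (m + 2) S" "cut d T = bd d (m + 2) T" "cut d (S \<union> T) = bd d (m + 2) (S \<union> T)"
    "cut d (S \<inter> T) = bd d (m + 2) (S \<inter> T)"
    using assms by (auto intro!: cut_eq_bd)
  have "real (card (bd d (m + 2) (S \<union> T))) + real (card (bd d (m + 2) (S \<inter> T)))
      \<le> real (card (bd d (m + 2) S)) + real (card (bd d (m + 2) T))"
    unfolding of_nat_add[symmetric] of_nat_le_iff by (rule card_bd_submodular)
  then have "2 * \<beta> * (real (card (bd d (m + 2) (S \<union> T))) + real (card (bd d (m + 2) (S \<inter> T))))
      \<le> 2 * \<beta> * (real (card (bd d (m + 2) S)) + real (card (bd d (m + 2) T)))"
    using assms by (intro mult_left_mono) auto
  then show ?thesis unfolding cwt_def e exp_add[symmetric] exp_le_cancel_iff by (simp add: algebra_simps)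
qed

lemma cwt_pos: "0 < cwt d \<beta> M"
  by (simp add: cwt_def)

definition local_on :: "site set \<Rightarrow> (site set \<Rightarrow> real) \<Rightarrow> bool" where
  "local_on J f \<longleftrightarrow> (\<forall>S. f S = f (S \<inter> J))"

lemma local_onD: "local_on J f \<Longrightarrow> S \<inter> J = T \<inter> J \<Longrightarrow> f S = f T"
  unfolding local_on_def by metis

text \<open>The plus measure on \<open>V\<close> is that on \<open>V'\<close> conditioned on having
  no minus spin in \<open>V' - V\<close>. As functions of the minus set \<open>M\<close>, both
  \<open>- f (V' - M)\<close> and the negative of the indicator of \<open>M \<subseteq> V\<close>
  are increasing, so the FKG inequality applies.\<close>

lemma plus_exp_mono:
  assumes b: "0 \<le> \<beta>" and V: "V \<subseteq> V'" "V' \<subseteq> box d m" and J: "J \<subseteq> V"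
    and loc: "local_on J f" and mono: "\<And>S T. S \<subseteq> T \<Longrightarrow> f S \<le> f T"
  shows "plus_exp d \<beta> V' f \<le> plus_exp d \<beta> V f"
proof -
  have fV': "finite V'" using V finite_subset by (metis finite_box)
  have fV: "finite V" using V fV' finite_subset by blast
  define c where "c = cwt d \<beta>"
  define G where "G M = (if M \<subseteq> V then - 1 else 0 :: real)" for M
  have key: "(\<Sum>M\<in>Pow V'. c M * (- f (V' - M))) * (\<Sum>M\<in>Pow V'. c M * G M)
      \<le> (\<Sum>M\<in>Pow V'. c M) * (\<Sum>M\<in>Pow V'. c M * (- f (V' - M)) * G M)"
  proof (rule fkg_inequality[OF fV'])
    show "c S * c T \<le> c (S \<union> T) * c (S \<inter> T)" if "S \<subseteq> V'" "T \<subseteq> V'" for S T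
      unfolding c_def using that V by (intro cwt_supermodular[OF b, of _ d m]) auto
    show "- f (V' - S) \<le> - f (V' - T)" if "S \<subseteq> T" "T \<subseteq> V'" for S T
      using that mono[of "V' - T" "V' - S"] by auto
    show "G S \<le> G T" if "S \<subseteq> T" "T \<subseteq> V'" for S T using that by (auto simp: G_def)
  qed (simp add: c_def cwt_pos)
  have e1: "(\<Sum>M\<in>Pow V'. c M * G M) = - (\<Sum>M\<in>Pow V. c M)"
  proof -
    have "(\<Sum>M\<in>Pow V'. c M * G M) = (\<Sum>M\<in>Pow V. c M * G M)"
      using V fV' by (intro sum.mono_neutral_right) (auto simp: G_def)
    also have "\<dots> = (\<Sum>M\<in>Pow V. - c M)" by (intro sum.cong) (auto simp: G_def)
    finally show ?thesis by (simp add: sum_negf)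
  qed
  have e2: "(\<Sum>M\<in>Pow V'. c M * (- f (V' - M)) * G M) = (\<Sum>M\<in>Pow V. c M * f (V - M))"
  proof -
    have "(\<Sum>M\<in>Pow V'. c M * (- f (V' - M)) * G M) = (\<Sum>M\<in>Pow V. c M * (- f (V' - M)) * G M)"
      using V fV' by (intro sum.mono_neutral_right) (auto simp: G_def)
    also have "\<dots> = (\<Sum>M\<in>Pow V. c M * f (V - M))"
    proof (rule sum.cong[OF refl])
      fix M assume "M \<in> Pow V"
      then have "f (V' - M) = f (V - M)" using V J by (intro local_onD[OF loc]) auto
      then show "c M * (- f (V' - M)) * G M = c M * f (V - M)" using \<open>M \<in> Pow V\<close> by (simp add: G_def)
    qed
    finally show ?thesis .
  qed
  have e3: "(\<Sum>M\<in>Pow V'. c M * (- f (V' - M))) = - (\<Sum>M\<in>Pow V'. c M * f (V' - M))"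
    by (simp add: sum_negf)
  have "(\<Sum>M\<in>Pow V'. c M * f (V' - M)) * (\<Sum>M\<in>Pow V. c M)
      \<le> (\<Sum>M\<in>Pow V'. c M) * (\<Sum>M\<in>Pow V. c M * f (V - M))"
    using key unfolding e1 e2 e3 by simp
  moreover have "0 < (\<Sum>M\<in>Pow V'. c M)" "0 < (\<Sum>M\<in>Pow V. c M)"
    using fV fV' by (auto intro!: sum_pos simp: c_def cwt_pos)
  ultimately show ?thesis unfolding plus_exp_def c_def[symmetric]
    by (simp add: field_simps)
qed

section \<open>Screens and the conditional law inside them\<close>

definition out :: "nat \<Rightarrow> site set \<Rightarrow> site set" where
  "out d V = {u. u \<notin> V \<and> (\<exists>v\<in>V. nb d u v)}"

text \<open>A screen is represented by the volume it encloses, so that unions of screens make sense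
  and a largest one exists.\<close>

definition screens :: "nat \<Rightarrow> nat \<Rightarrow> nat \<Rightarrow> site set \<Rightarrow> site set set" where
  "screens d k m S = {V. box d k \<subseteq> V \<and> V \<subseteq> box d m \<and> out d V \<subseteq> S}"

definition Dplus :: "nat \<Rightarrow> nat \<Rightarrow> nat \<Rightarrow> nat \<Rightarrow> site set set" where
  "Dplus d k m n = {S. S \<subseteq> box d n \<and> screens d k m S \<noteq> {}}"

definition Vmax :: "nat \<Rightarrow> nat \<Rightarrow> nat \<Rightarrow> site set \<Rightarrow> site set" where
  "Vmax d k m S = \<Union> (screens d k m S)"

lemma Vmax_screen:
  assumes "screens d k m S \<noteq> {}"
  shows "Vmax d k m S \<in> screens d k m S"
proof -
  have "out d (Vmax d k m S) \<subseteq> S"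
  proof
    fix u assume "u \<in> out d (Vmax d k m S)"
    then obtain V v where V: "V \<in> screens d k m S" "v \<in> V" "nb d u v" "u \<notin> V"
      by (auto simp: out_def Vmax_def)
    then have "u \<in> out d V" by (auto simp: out_def)
    then show "u \<in> S" using V by (auto simp: screens_def)
  qed
  moreover have "box d k \<subseteq> Vmax d k m S" "Vmax d k m S \<subseteq> box d m"
    using assms by (auto simp: Vmax_def screens_def)
  ultimately show ?thesis by (auto simp: screens_def)
qed

lemma screen_Un:
  assumes "V \<in> screens d k m S" "V' \<in> screens d k m S"
  shows "V \<union> V' \<in> screens d k m S"
proof -
  have "out d (V \<union> V') \<subseteq> out d V \<union> out d V'" by (auto simp: out_def)
  then show ?thesis using assms by (auto simp: screens_def)
qed

text \<open>The largest screen behaves like a stopping time: that it equals \<open>V\<close> is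
  decided by the spins outside \<open>V\<close>. Whether a set containing \<open>V\<close> is a
  screen depends only on its outer boundary, which misses \<open>V\<close>; and a screen of
  \<open>S'\<close> can be united with \<open>V\<close> and then compared with the screens of
  \<open>S\<close>.\<close>

lemma Vmax_cong:
  assumes ne: "screens d k m S \<noteq> {}" and V: "Vmax d k m S = V" and eq: "S - V = S' - V"
  shows "screens d k m S' \<noteq> {}" "Vmax d k m S' = V"
proof -
  have tr: "V' \<in> screens d k m S \<longleftrightarrow> V' \<in> screens d k m S'" if "V \<subseteq> V'" for V'
  proof -
    have "out d V' \<inter> V = {}" using that by (auto simp: out_def)
    then have "out d V' \<subseteq> S \<longleftrightarrow> out d V' \<subseteq> S'" using eq by blast
    then show ?thesis by (simp add: screens_def)
  qed
  have VS: "V \<in> screens d k m S'" using tr[of V] Vmax_screen[OF ne] V by auto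
  then show "screens d k m S' \<noteq> {}" by auto
  have "V'' \<subseteq> V" if "V'' \<in> screens d k m S'" for V''
  proof -
    have "V'' \<union> V \<in> screens d k m S'" using screen_Un that VS by auto
    then have "V'' \<union> V \<in> screens d k m S" using tr[of "V'' \<union> V"] by auto
    then show ?thesis using V unfolding Vmax_def by blast
  qed
  then show "Vmax d k m S' = V" unfolding Vmax_def using VS by blast
qed

text \<open>A bond that touches \<open>V\<close> has both ends in \<open>V \<union> out d V\<close>,
  which \<open>U\<close> contains; so removing \<open>M\<close> from \<open>U\<close> breaks exactly
  the bonds of \<open>cut d M\<close> and leaves the others as they were. The margin keeps
  \<open>M\<close> off the boundary of the box, where the fields act.\<close>

lemma wt_screen:
  assumes V: "V \<subseteq> U" "out d V \<subseteq> U" "V \<subseteq> box d m" "M \<subseteq> V" and n: "m + 2 \<le> n"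
  shows "wt d \<beta> n h (U - M) = cwt d \<beta> M * wt d \<beta> n h U"
proof -
  have cut: "cut d M = bd d n M" using V n by (intro cut_eq_bd[of M d m]) auto
  have eq: "(e \<in> bd d n (U - M) \<longleftrightarrow> e \<in> bd d n M \<or> e \<in> bd d n U) \<and> \<not> (e \<in> bd d n M \<and> e \<in> bd d n U)" for e
  proof -
    obtain x i where e: "e = (x, i)" by (cases e)
    show ?thesis
    proof (cases "i < d \<and> (x \<in> V \<or> up x i \<in> V)")
      case True
      have "nb d x (up x i)" "nb d (up x i) x" using True nb_up nb_sym by blast+
      then have "x \<in> U" "up x i \<in> U" using True V unfolding out_def by blast+
      then show ?thesis unfolding e by (auto simp: bd_def)
    next
      case False
      then show ?thesis unfolding e using V by (auto simp: bd_def bonds_def)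
    qed
  qed
  then have "bd d n (U - M) = bd d n M \<union> bd d n U" "bd d n M \<inter> bd d n U = {}" by blast+
  then have c: "card (bd d n (U - M)) = card (bd d n M) + card (bd d n U)"
    by (simp add: card_Un_disjoint)
  have nb: "x \<notin> M" if xb: "x \<in> bdry d n" for x
  proof
    assume "x \<in> M"
    then have "x \<in> box d m" using V by auto
    moreover obtain i where "i < d" "x i = lo n \<or> x i = hi n" using xb by (auto simp: bdry_iff)
    moreover have "lo n \<le> lo (m + 2)" "hi (m + 2) \<le> hi n" using n by (auto intro: lo_hi_mono)
    moreover have "lo m \<le> x i" "x i \<le> hi m" using \<open>x \<in> box d m\<close> \<open>i < d\<close> by (auto simp: mem_box)
    ultimately show False unfolding lo_hi_plus2 by linarith
  qed
  have "(\<Sum>x\<in>bdry d n. h x * (if x \<in> U - M then 1 else - 1)) = (\<Sum>x\<in>bdry d n. h x * (if x \<in> U then 1 else - 1))"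
    using nb by (intro sum.cong) auto
  then show ?thesis unfolding wt_def cwt_def cut c exp_add[symmetric] by (simp add: algebra_simps)
qed

text \<open>A configuration of the fibre is coded by its outside with \<open>V\<close> filled by
  plus spins, together with its minus set inside \<open>V\<close>. The two parts vary independently
  and the weight factorizes: this is the spatial Markov property at the screen.\<close>

lemma fibre_sum:
  assumes n: "m + 2 \<le> n" and J: "J \<subseteq> box d k" and loc: "local_on J f"
    and F: "F = {S \<in> Dplus d k m n. Vmax d k m S = V}" and ne: "F \<noteq> {}"
  shows "(\<Sum>S\<in>F. wt d \<beta> n h S * f S) = plus_exp d \<beta> V f * Zw d \<beta> n h F"
    "box d k \<subseteq> V" "V \<subseteq> box d m"
proof -
  have VS: "V \<in> screens d k m S" if "S \<in> F" for S
    using that Vmax_screen[of d k m S] unfolding F Dplus_def by auto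
  obtain S0 where "S0 \<in> F" using ne by auto
  then show Vk: "box d k \<subseteq> V" and Vm: "V \<subseteq> box d m" using VS by (auto simp: screens_def)
  have fV: "finite V" using Vm finite_subset by (metis finite_box)
  have Vn: "V \<subseteq> box d n" using Vm box_mono[of m n d] n by auto
  define G where "G = {U \<in> F. V \<subseteq> U}"
  have toF: "S' \<in> F" if "S \<in> F" "S - V = S' - V" "S' \<subseteq> box d n" for S S'
    using that Vmax_cong[of d k m S V S'] unfolding F Dplus_def by auto
  have sm: "(\<Sum>S\<in>F. wt d \<beta> n h S * g S) = (\<Sum>U\<in>G. wt d \<beta> n h U) * (\<Sum>M\<in>Pow V. cwt d \<beta> M * g (V - M))"
    if g: "local_on J g" for g
  proof -
    have "(\<Sum>S\<in>F. wt d \<beta> n h S * g S) = (\<Sum>(U, M)\<in>G \<times> Pow V. wt d \<beta> n h (U - M) * g (U - M))"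
    proof (rule sum.reindex_bij_witness[of _ "\<lambda>(U, M). U - M" "\<lambda>S. (S \<union> V, V - S)"])
      fix S assume S: "S \<in> F"
      show "(case (S \<union> V, V - S) of (U, M) \<Rightarrow> U - M) = S" by auto
      have "S \<union> V \<in> F" by (rule toF[OF S]) (use S Vn in \<open>auto simp: F Dplus_def\<close>)
      then show "(S \<union> V, V - S) \<in> G \<times> Pow V" by (auto simp: G_def)
      have e: "S \<union> V - (V - S) = S" by auto
      show "(case (S \<union> V, V - S) of (U, M) \<Rightarrow> wt d \<beta> n h (U - M) * g (U - M)) = wt d \<beta> n h S * g S"
        by (simp add: e)
    next
      fix p assume "p \<in> G \<times> Pow V"
      then obtain U M where p: "p = (U, M)" "U \<in> F" "V \<subseteq> U" "M \<subseteq> V" by (auto simp: G_def)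
      show "(\<lambda>S. (S \<union> V, V - S)) (case p of (U, M) \<Rightarrow> U - M) = p" using p by auto
      have "U - M \<in> F" by (rule toF[OF p(2)]) (use p in \<open>auto simp: F Dplus_def\<close>)
      then show "(case p of (U, M) \<Rightarrow> U - M) \<in> F" using p by simp
    qed
    also have "\<dots> = (\<Sum>(U, M)\<in>G \<times> Pow V. wt d \<beta> n h U * (cwt d \<beta> M * g (V - M)))"
    proof (rule sum.cong[OF refl], clarify)
      fix U M assume U: "U \<in> G" and M: "M \<subseteq> V"
      have "out d V \<subseteq> U" "V \<subseteq> U" using U VS[of U] by (auto simp: G_def screens_def)
      then have "wt d \<beta> n h (U - M) = cwt d \<beta> M * wt d \<beta> n h U" using M Vm n by (intro wt_screen) auto
      moreover have "g (U - M) = g (V - M)" using \<open>V \<subseteq> U\<close> J Vk by (intro local_onD[OF g]) auto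
      ultimately show "wt d \<beta> n h (U - M) * g (U - M) = wt d \<beta> n h U * (cwt d \<beta> M * g (V - M))" by simp
    qed
    also have "\<dots> = (\<Sum>U\<in>G. wt d \<beta> n h U) * (\<Sum>M\<in>Pow V. cwt d \<beta> M * g (V - M))"
      by (simp add: sum_product sum.cartesian_product)
    finally show ?thesis .
  qed
  have Z: "Zw d \<beta> n h F = (\<Sum>U\<in>G. wt d \<beta> n h U) * (\<Sum>M\<in>Pow V. cwt d \<beta> M)"
    using sm[of "\<lambda>_. 1"] unfolding Zw_def by (simp add: local_on_def)
  have "0 < (\<Sum>M\<in>Pow V. cwt d \<beta> M)" using fV by (auto intro!: sum_pos simp: cwt_pos)
  then show "(\<Sum>S\<in>F. wt d \<beta> n h S * f S) = plus_exp d \<beta> V f * Zw d \<beta> n h F"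
    unfolding sm[OF loc] Z plus_exp_def by simp
qed

lemma finite_Dplus [simp]: "finite (Dplus d k m n)"
  by (rule finite_subset[of _ "Pow (box d n)"]) (auto simp: Dplus_def)

text \<open>The conditional law on a fibre depends on nothing but \<open>V\<close>, which lies
  between the boxes \<open>k\<close> and \<open>m\<close>. The two bounding means are therefore the
  same for all fields \<open>h\<close> and all sizes \<open>n\<close>.\<close>

lemma Dplus_sandwich:
  assumes b: "0 \<le> \<beta>" and n: "m + 2 \<le> n" and J: "J \<subseteq> box d k"
    and loc: "local_on J f" and mono: "\<And>S T. S \<subseteq> T \<Longrightarrow> f S \<le> f T"
  shows "(\<Sum>S\<in>Dplus d k m n. wt d \<beta> n h S * f S) \<le> plus_exp d \<beta> (box d k) f * Zw d \<beta> n h (Dplus d k m n)"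
    "plus_exp d \<beta> (box d m) f * Zw d \<beta> n h (Dplus d k m n) \<le> (\<Sum>S\<in>Dplus d k m n. wt d \<beta> n h S * f S)"
proof -
  define D where "D = Dplus d k m n"
  define Fb where "Fb V = {S \<in> D. Vmax d k m S = V}" for V
  define VV where "VV = Vmax d k m ` D"
  have split: "(\<Sum>S\<in>D. g S) = (\<Sum>V\<in>VV. \<Sum>S\<in>Fb V. g S)" for g :: "site set \<Rightarrow> real"
    unfolding VV_def Fb_def by (rule sum.image_gen) (simp add: D_def)
  have ZF: "0 \<le> Zw d \<beta> n h (Fb V)" for V by (rule Zw_nonneg)
  have each: "(\<Sum>S\<in>Fb V. wt d \<beta> n h S * f S) = plus_exp d \<beta> V f * Zw d \<beta> n h (Fb V)"
    "box d k \<subseteq> V" "V \<subseteq> box d m" if "V \<in> VV" for V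
  proof -
    have ne: "Fb V \<noteq> {}" using that by (auto simp: VV_def Fb_def)
    have eq: "Fb V = {S \<in> Dplus d k m n. Vmax d k m S = V}" by (simp add: Fb_def D_def)
    from fibre_sum[OF n J loc eq ne]
    show "(\<Sum>S\<in>Fb V. wt d \<beta> n h S * f S) = plus_exp d \<beta> V f * Zw d \<beta> n h (Fb V)"
      "box d k \<subseteq> V" "V \<subseteq> box d m" .
  qed
  have JV: "J \<subseteq> V" if "V \<in> VV" for V using each(2)[OF that] J by blast
  have ZD: "Zw d \<beta> n h D = (\<Sum>V\<in>VV. Zw d \<beta> n h (Fb V))" unfolding Zw_def by (rule split)
  have "(\<Sum>S\<in>D. wt d \<beta> n h S * f S) = (\<Sum>V\<in>VV. plus_exp d \<beta> V f * Zw d \<beta> n h (Fb V))"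
    unfolding split by (intro sum.cong refl each)
  also have "\<dots> \<le> (\<Sum>V\<in>VV. plus_exp d \<beta> (box d k) f * Zw d \<beta> n h (Fb V))"
    by (intro sum_mono mult_right_mono ZF plus_exp_mono[OF b each(2) each(3) J loc mono])
  finally show "(\<Sum>S\<in>Dplus d k m n. wt d \<beta> n h S * f S) \<le> plus_exp d \<beta> (box d k) f * Zw d \<beta> n h (Dplus d k m n)"
    unfolding D_def[symmetric] ZD by (simp add: sum_distrib_left)
  have "plus_exp d \<beta> (box d m) f * Zw d \<beta> n h D = (\<Sum>V\<in>VV. plus_exp d \<beta> (box d m) f * Zw d \<beta> n h (Fb V))"
    unfolding ZD by (simp add: sum_distrib_left)
  also have "\<dots> \<le> (\<Sum>V\<in>VV. plus_exp d \<beta> V f * Zw d \<beta> n h (Fb V))"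
    by (intro sum_mono mult_right_mono ZF plus_exp_mono[OF b each(3) order_refl JV loc mono])
  also have "\<dots> = (\<Sum>S\<in>D. wt d \<beta> n h S * f S)"
    unfolding split by (intro sum.cong refl each(1)[symmetric])
  finally show "plus_exp d \<beta> (box d m) f * Zw d \<beta> n h (Dplus d k m n) \<le> (\<Sum>S\<in>Dplus d k m n. wt d \<beta> n h S * f S)"
    unfolding D_def .
qed

text \<open>To be read as: \<open>c\<close> is the mean of \<open>f\<close> in the plus state. It is
  phrased through weights of screened configurations so that it holds at once for all
  \<open>n\<close> and all fields \<open>h\<close>, random or constantly
  \<open>\<beta>\<close>.\<close>

definition plus_limit :: "nat \<Rightarrow> real \<Rightarrow> (site set \<Rightarrow> real) \<Rightarrow> real \<Rightarrow> bool" where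
  "plus_limit d \<beta> f c \<longleftrightarrow> (\<forall>\<delta>>0. \<exists>k0. \<forall>k\<ge>k0. \<forall>m\<ge>k. \<forall>n\<ge>m + 2. \<forall>h.
     \<bar>(\<Sum>S\<in>Dplus d k m n. wt d \<beta> n h S * f S) - c * Zw d \<beta> n h (Dplus d k m n)\<bar> \<le> \<delta> * Zw d \<beta> n h (Dplus d k m n))"

text \<open>Means under plus boundary conditions decrease with the volume and are at least
  \<open>f {}\<close>, so they converge; the sandwich transfers the limit.\<close>

lemma plus_limit_mono:
  assumes b: "0 \<le> \<beta>" and loc: "local_on (box d j) f" and mono: "\<And>S T. S \<subseteq> T \<Longrightarrow> f S \<le> f T"
  shows "\<exists>c. plus_limit d \<beta> f c"
proof -
  define a where "a k = plus_exp d \<beta> (box d (j + k)) f" for k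
  have dec: "a m \<le> a k" if "k \<le> m" for k m
    unfolding a_def by (rule plus_exp_mono[OF b _ order_refl _ loc mono]) (use that in \<open>auto intro!: box_mono\<close>)
  have lb: "f {} \<le> a k" for k
  proof -
    have "finite (Pow (box d (j + k)))" by simp
    then have p: "0 < (\<Sum>M\<in>Pow (box d (j + k)). cwt d \<beta> M)" by (intro sum_pos) (auto simp: cwt_pos)
    have "f {} * (\<Sum>M\<in>Pow (box d (j + k)). cwt d \<beta> M) \<le> (\<Sum>M\<in>Pow (box d (j + k)). cwt d \<beta> M * f (box d (j + k) - M))"
      unfolding sum_distrib_left using cwt_pos[of d \<beta>]
      by (intro sum_mono) (metis empty_subsetI less_imp_le mono mult.commute mult_right_mono)
    then show ?thesis unfolding a_def plus_exp_def using p by (simp add: field_simps)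
  qed
  have "decseq a" using dec by (simp add: decseq_def)
  then obtain c where c: "a \<longlonglongrightarrow> c" "\<And>k. c \<le> a k" using decseq_convergent[of a "f {}"] lb by auto
  have "plus_limit d \<beta> f c" unfolding plus_limit_def
  proof (intro allI impI)
    fix \<delta> :: real assume "0 < \<delta>"
    then have "eventually (\<lambda>k. a k < c + \<delta>) sequentially" using c by (intro order_tendstoD) auto
    then obtain N where N: "\<And>k. N \<le> k \<Longrightarrow> a k < c + \<delta>" unfolding eventually_sequentially by blast
    show "\<exists>k0. \<forall>k\<ge>k0. \<forall>m\<ge>k. \<forall>n\<ge>m + 2. \<forall>h.
     \<bar>(\<Sum>S\<in>Dplus d k m n. wt d \<beta> n h S * f S) - c * Zw d \<beta> n h (Dplus d k m n)\<bar> \<le> \<delta> * Zw d \<beta> n h (Dplus d k m n)"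
    proof (intro exI[of _ "j + N"] allI impI)
      fix k m n h assume kmn: "j + N \<le> k" "k \<le> m" "m + 2 \<le> n"
      define ZD where "ZD = Zw d \<beta> n h (Dplus d k m n)"
      define s where "s = (\<Sum>S\<in>Dplus d k m n. wt d \<beta> n h S * f S)"
      have J: "box d j \<subseteq> box d k" using kmn by (intro box_mono) auto
      have Z: "0 \<le> ZD" unfolding ZD_def by (rule Zw_nonneg)
      have "s \<le> plus_exp d \<beta> (box d k) f * ZD" "plus_exp d \<beta> (box d m) f * ZD \<le> s"
        unfolding s_def ZD_def using Dplus_sandwich[OF b kmn(3) J loc mono] by auto
      moreover have "plus_exp d \<beta> (box d k) f = a (k - j)" "plus_exp d \<beta> (box d m) f = a (m - j)"
        using kmn by (auto simp: a_def)
      moreover have "N \<le> k - j" using kmn by linarith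
      then have "a (k - j) * ZD \<le> (c + \<delta>) * ZD" using N[of "k - j"] Z by (intro mult_right_mono) auto
      moreover have "c * ZD \<le> a (m - j) * ZD" using c(2) Z by (intro mult_right_mono) auto
      ultimately have "s \<le> (c + \<delta>) * ZD" "c * ZD \<le> s" by simp_all
      moreover have "0 \<le> \<delta> * ZD" using \<open>0 < \<delta>\<close> Z by simp
      ultimately have "\<bar>s - c * ZD\<bar> \<le> \<delta> * ZD" by (simp add: algebra_simps abs_le_iff)
      then show "\<bar>(\<Sum>S\<in>Dplus d k m n. wt d \<beta> n h S * f S) - c * Zw d \<beta> n h (Dplus d k m n)\<bar> \<le> \<delta> * Zw d \<beta> n h (Dplus d k m n)"
        unfolding s_def ZD_def .
    qed
  qed
  then show ?thesis by auto
qed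

lemma plus_limit_diff:
  assumes "plus_limit d \<beta> f c" "plus_limit d \<beta> g e"
  shows "plus_limit d \<beta> (\<lambda>S. f S - g S) (c - e)"
  unfolding plus_limit_def
proof (intro allI impI)
  fix \<delta> :: real assume "0 < \<delta>"
  then have "0 < \<delta> / 2" by simp
  then obtain k1 k2 where k1: "\<forall>k\<ge>k1. \<forall>m\<ge>k. \<forall>n\<ge>m + 2. \<forall>h.
     \<bar>(\<Sum>S\<in>Dplus d k m n. wt d \<beta> n h S * f S) - c * Zw d \<beta> n h (Dplus d k m n)\<bar> \<le> \<delta> / 2 * Zw d \<beta> n h (Dplus d k m n)"
   and k2: "\<forall>k\<ge>k2. \<forall>m\<ge>k. \<forall>n\<ge>m + 2. \<forall>h.
     \<bar>(\<Sum>S\<in>Dplus d k m n. wt d \<beta> n h S * g S) - e * Zw d \<beta> n h (Dplus d k m n)\<bar> \<le> \<delta> / 2 * Zw d \<beta> n h (Dplus d k m n)"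
    using assms unfolding plus_limit_def by meson
  show "\<exists>k0. \<forall>k\<ge>k0. \<forall>m\<ge>k. \<forall>n\<ge>m + 2. \<forall>h.
     \<bar>(\<Sum>S\<in>Dplus d k m n. wt d \<beta> n h S * (f S - g S)) - (c - e) * Zw d \<beta> n h (Dplus d k m n)\<bar> \<le> \<delta> * Zw d \<beta> n h (Dplus d k m n)"
  proof (intro exI[of _ "max k1 k2"] allI impI)
    fix k m n h assume kmn: "max k1 k2 \<le> k" "k \<le> m" "m + 2 \<le> n"
    have "(\<Sum>S\<in>Dplus d k m n. wt d \<beta> n h S * (f S - g S))
        = (\<Sum>S\<in>Dplus d k m n. wt d \<beta> n h S * f S) - (\<Sum>S\<in>Dplus d k m n. wt d \<beta> n h S * g S)"
      by (simp add: sum_subtractf right_diff_distrib)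
    moreover have "\<bar>(\<Sum>S\<in>Dplus d k m n. wt d \<beta> n h S * f S) - c * Zw d \<beta> n h (Dplus d k m n)\<bar> \<le> \<delta> / 2 * Zw d \<beta> n h (Dplus d k m n)"
      using k1 kmn by simp
    moreover have "\<bar>(\<Sum>S\<in>Dplus d k m n. wt d \<beta> n h S * g S) - e * Zw d \<beta> n h (Dplus d k m n)\<bar> \<le> \<delta> / 2 * Zw d \<beta> n h (Dplus d k m n)"
      using k2 kmn by simp
    ultimately show "\<bar>(\<Sum>S\<in>Dplus d k m n. wt d \<beta> n h S * (f S - g S)) - (c - e) * Zw d \<beta> n h (Dplus d k m n)\<bar> \<le> \<delta> * Zw d \<beta> n h (Dplus d k m n)"
      by (simp only: left_diff_distrib)
  qed
qed

lemma local_bounded: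
  assumes "local_on (box d j) f"
  shows "\<exists>M\<ge>0. \<forall>S. \<bar>f S\<bar> \<le> M"
proof (intro exI[of _ "\<Sum>T\<in>Pow (box d j). \<bar>f T\<bar>"] conjI allI)
  fix S
  have "\<bar>f S\<bar> = \<bar>f (S \<inter> box d j)\<bar>" using assms by (simp add: local_on_def)
  also have "\<dots> \<le> (\<Sum>T\<in>Pow (box d j). \<bar>f T\<bar>)" by (rule member_le_sum) auto
  finally show "\<bar>f S\<bar> \<le> (\<Sum>T\<in>Pow (box d j). \<bar>f T\<bar>)" .
qed (auto intro: sum_nonneg)

text \<open>A local function is a difference of two increasing ones, the second a multiple of the number of
  plus spins in its support.\<close>

lemma plus_limit_exists:
  assumes b: "0 \<le> \<beta>" and loc: "local_on (box d j) f"
  shows "\<exists>c. plus_limit d \<beta> f c"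
proof -
  obtain M where M: "0 \<le> M" "\<And>S. \<bar>f S\<bar> \<le> M" using local_bounded[OF loc] by auto
  define g where "g S = 2 * M * real (card (S \<inter> box d j))" for S
  have lg: "local_on (box d j) g" by (auto simp: local_on_def g_def Int_assoc)
  have mg: "g S \<le> g T" if "S \<subseteq> T" for S T unfolding g_def
    using M that by (intro mult_left_mono of_nat_mono card_mono) auto
  have lfg: "local_on (box d j) (\<lambda>S. f S + g S)" unfolding local_on_def
    by (intro allI arg_cong2[where f = "(+)"] local_onD[OF loc] local_onD[OF lg]) auto
  have mfg: "f S + g S \<le> f T + g T" if "S \<subseteq> T" for S T
  proof (cases "S \<inter> box d j = T \<inter> box d j")
    case True
    then show ?thesis using local_onD[OF loc True] local_onD[OF lg True] by simp
  next
    case False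
    then have "S \<inter> box d j \<subset> T \<inter> box d j" using that by auto
    then have "card (S \<inter> box d j) < card (T \<inter> box d j)" by (intro psubset_card_mono) auto
    then have "real (card (S \<inter> box d j)) + 1 \<le> real (card (T \<inter> box d j))" by linarith
    then have "2 * M * (real (card (S \<inter> box d j)) + 1) \<le> 2 * M * real (card (T \<inter> box d j))"
      using M by (intro mult_left_mono) auto
    then have "g S + 2 * M \<le> g T" by (simp add: g_def algebra_simps)
    moreover have "f S \<le> M" "- M \<le> f T" using M(2)[of S] M(2)[of T] by linarith+
    ultimately show ?thesis by linarith
  qed
  obtain c1 c2 where "plus_limit d \<beta> (\<lambda>S. f S + g S) c1" "plus_limit d \<beta> g c2"
    using plus_limit_mono[OF b lfg mfg] plus_limit_mono[OF b lg mg] by blast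
  then have "plus_limit d \<beta> (\<lambda>S. (f S + g S) - g S) (c1 - c2)" by (rule plus_limit_diff)
  then show ?thesis by (auto simp: fun_eq_iff)
qed

context low_temp
begin

lemma beta_nonneg: "0 \<le> \<beta>"
  using l_nonneg l_le by simp

lemma box_nonempty: "1 \<le> n \<Longrightarrow> (\<lambda>j. if j < d then lo n else 0) \<in> B n"
  using hi_lo[of n] by (auto simp: mem_box lattice_def)

text \<open>The screen encloses the box \<open>k\<close> together with all holes of the central
  cluster that meet the box \<open>k + 2\<close>. Short holes reach at most \<open>L\<close>
  further, which the choice of \<open>m\<close> provides for. A neighbour of this volume outside it
  lies in the central cluster, hence is plus.\<close>

lemma OmP_not_Dplus_le:
  assumes h: "bounded_field n h" and L: "1 \<le> L" and m: "m = k + 2 + 2 * L" and n: "m + 2 \<le> n"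
  shows "Z n h (OmP n - Dplus d k m n) \<le> real (card (B (k + 2))) * (2 * (1/8) ^ L) * Z n h (OmP n)"
proof -
  have Bk: "B (k + 2) \<subseteq> B n" "B k \<subseteq> B (k + 2)" using m n by (auto intro!: box_mono)
  have "OmP n - Dplus d k m n \<subseteq> (\<Union>y\<in>B (k + 2). bad n y L)"
  proof (rule subsetI, rule ccontr)
    fix S assume S: "S \<in> OmP n - Dplus d k m n" and nb: "S \<notin> (\<Union>y\<in>B (k + 2). bad n y L)"
    have SB: "S \<subseteq> B n" using S by (auto simp: Omega_plus_def)
    obtain C where C: "is_central d (B n) S C" using S by (auto simp: Omega_plus_def)
    have CS: "C \<subseteq> S" using C cluster_subset by (auto simp: is_central_def)
    define A where "A y = cluster d (B n - C) y" for y
    define V where "V = B k \<union> (\<Union>y\<in>B (k + 2) - C. A y)"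
    have cc: "A y \<in> contours d (B n)" "y \<in> A y"
      "\<And>u v. u \<in> A y \<Longrightarrow> v \<in> B n - A y \<Longrightarrow> nb d u v \<Longrightarrow> v \<in> C" if "y \<in> B n - C" for y
      using central_contour[OF finite_box conn_box SB C that A_def] by auto
    have short: "card (bd d n (A y)) < L" if "y \<in> B (k + 2) - C" for y
      using nb that S C unfolding bad_def A_def by (auto simp: not_le)
    have AV: "A y \<subseteq> B m" if y: "y \<in> B (k + 2) - C" for y
    proof
      fix z assume z: "z \<in> A y"
      have yB: "y \<in> B n - C" using y Bk by auto
      have zB: "z \<in> B n" using cc(1)[OF yB] z by (auto simp: contours_def)
      have nn: "2 * card (bd d n (A y)) < n" using short[OF y] n m by auto
      have lh: "lo (k + 2 + 2 * L) = lo (k + 2) - int L" "hi (k + 2 + 2 * L) = hi (k + 2) + int L"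
        unfolding lo_def hi_def by (auto simp: algebra_simps)
      have zy: "\<bar>z j - y j\<bar> \<le> int L" for j
        using contour_diameter[OF cc(1)[OF yB] d2 nn z cc(2)[OF yB], of j] short[OF y] by linarith
      have yj: "lo (k + 2) \<le> y j" "y j \<le> hi (k + 2)" if "j < d" for j
        using y that DiffD1[OF y] unfolding mem_box by blast+
      have "lo m \<le> z j \<and> z j \<le> hi m" if "j < d" for j
        using zy[of j] yj[OF that] lh unfolding m by linarith
      then show "z \<in> B m" using zB by (auto simp: mem_box)
    qed
    have "V \<in> screens d k m S" unfolding screens_def
    proof (intro CollectI conjI)
      show "B k \<subseteq> V" by (auto simp: V_def)
      have "B k \<subseteq> B m" using m by (intro box_mono) auto
      then show "V \<subseteq> B m" using AV unfolding V_def by blast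
      show "out d V \<subseteq> S"
      proof
        fix u assume "u \<in> out d V"
        then obtain v where u: "u \<notin> V" "v \<in> V" "nb d u v" by (auto simp: out_def)
        have "v \<in> B m" using u \<open>V \<subseteq> B m\<close> by auto
        then have uB: "u \<in> B n" using nb_box[OF _ u(3) n] by auto
        have "u \<in> C"
        proof (cases "v \<in> B k")
          case True
          then have uk: "u \<in> B (k + 2)" using nb_box[OF _ u(3)] by auto
          show ?thesis
          proof (rule ccontr)
            assume "u \<notin> C"
            then have "u \<in> A u" using cc(2)[of u] uB by auto
            then show False using u(1) uk \<open>u \<notin> C\<close> unfolding V_def by blast
          qed
        next
          case False
          then obtain y where y: "y \<in> B (k + 2) - C" "v \<in> A y" using u(2) unfolding V_def by blast
          have "u \<notin> A y" using u(1) y(1) unfolding V_def by blast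
          moreover have "y \<in> B n - C" using y Bk by auto
          ultimately show ?thesis using cc(3)[of y v u] y uB u(3) nb_sym by blast
        qed
        then show "u \<in> S" using CS by auto
      qed
    qed
    then show False using S SB by (auto simp: Dplus_def)
  qed
  then have "Z n h (OmP n - Dplus d k m n) \<le> Z n h (\<Union>y\<in>B (k + 2). bad n y L)"
    by (intro Zw_mono) (auto simp: bad_def)
  also have "\<dots> \<le> (\<Sum>y\<in>B (k + 2). Z n h (bad n y L))" by (intro Zw_UN_le) (auto simp: bad_def)
  also have "\<dots> \<le> (\<Sum>y\<in>B (k + 2). 2 * (1/8) ^ L * Z n h (OmP n))"
    using Bk by (intro sum_mono bad_le[OF h _ L]) auto
  finally show ?thesis by simp
qed

text \<open>The central minus cluster \<open>C\<close> cannot cross the plus layer around the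
  screened volume \<open>V\<close>. If it avoids \<open>V\<close>, the whole box \<open>k\<close>
  lies in one hole, which is then long. Otherwise it lies in \<open>V\<close> and hence in the box
  \<open>m\<close>; the hole at a corner of the large box then extends to the vicinity of the box
  \<open>m\<close> and is long as well.\<close>

lemma Dplus_OmM_le:
  assumes h: "bounded_field n h" and L: "1 \<le> L" and k: "L + 1 \<le> k" and n: "m + 2 * L + 4 \<le> n" and km: "k \<le> m"
  shows "Z n h (Dplus d k m n \<inter> OmM n) \<le> 4 * (1/8) ^ L * Z n h (OmM n)"
proof -
  \<comment> \<open>\<open>x\<close> and \<open>x'\<close> are opposite corners of the small box,
    \<open>p\<close> is a corner of the large one; the distances are estimated in coordinate
    \<open>0\<close>.\<close>
  define x where "x = (\<lambda>j. if j < d then lo k else 0)"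
  define x' where "x' = (\<lambda>j. if j < d then hi k else 0)"
  define p where "p = (\<lambda>j. if j < d then hi n else 0)"
  have xk: "x \<in> B k" "x' \<in> B k" using hi_lo[of k] k by (auto simp: x_def x'_def mem_box lattice_def)
  have pn: "p \<in> B n" using hi_lo[of n] n by (auto simp: p_def mem_box lattice_def)
  have Bkn: "B k \<subseteq> B n" "B k \<subseteq> B m" using n km by (auto intro!: box_mono)
  define T where "T y = {S. S \<subseteq> B n \<and> B n - S \<in> bad n y L}" for y
  have sub: "bad n y L \<subseteq> Pow (B n)" for y by (auto simp: bad_def Omega_plus_def)
  have Ty: "Z n h (T y) \<le> 2 * (1/8) ^ L * Z n h (OmM n)" if "y \<in> B n" for y
    unfolding T_def Z_compl[OF sub] Z_OmM by (rule bad_le[OF bounded_uminus[OF h] that L])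
  have "Dplus d k m n \<inter> OmM n \<subseteq> T x \<union> T p"
  proof (rule subsetI, rule ccontr)
    fix S assume S: "S \<in> Dplus d k m n \<inter> OmM n" and nT: "S \<notin> T x \<union> T p"
    have SB: "S \<subseteq> B n" "B n - S \<in> OmP n" using S by (auto simp: Omega_minus_def)
    obtain C where C: "is_central d (B n) (B n - S) C" using SB by (auto simp: Omega_plus_def)
    then obtain c where c: "c \<in> B n - S" "C = cluster d (B n - S) c" by (auto simp: is_central_def)
    have CS: "C \<subseteq> B n - S" "conn d C" "c \<in> C" using c cluster_subset conn_cluster cluster_self by auto
    obtain V where V: "B k \<subseteq> V" "V \<subseteq> B m" "out d V \<subseteq> S" using S by (auto simp: Dplus_def screens_def)
    have short: "card (bd d n (cluster d (B n - C) y)) < L" if "y \<in> {x, p}" "y \<notin> C" for y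
      using nT SB C that unfolding T_def bad_def by (auto simp: not_le)
    note cc = central_contour[OF finite_box conn_box Diff_subset C]
    show False
    proof (cases "C \<inter> V = {}")
      case True
      then have "B k \<subseteq> B n - C" using V Bkn by auto
      moreover have xC: "x \<in> B n - C" using calculation xk by auto
      ultimately have "B k \<subseteq> cluster d (B n - C) x" using conn_box xk by (intro conn_subset_cluster) auto
      then have x': "x' \<in> cluster d (B n - C) x" using xk by auto
      have "card (bd d n (cluster d (B n - C) x)) < L" using short[of x] xC by auto
      moreover from this have "\<bar>x 0 - x' 0\<bar> \<le> int (card (bd d n (cluster d (B n - C) x)))"
        using cc(1,3)[OF xC refl] x' n by (intro contour_diameter[OF _ d2]) auto
      ultimately show False using hi_lo[of k] k d2 by (auto simp: x_def x'_def)
    next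
      case False
      then obtain z where z: "z \<in> C" "z \<in> V" by auto
      have "v \<in> V" if "v \<in> C" for v
      proof (rule conn_invariant[OF CS(2) z(1) that, where P = "\<lambda>v. v \<in> V"])
        fix u v assume uv: "u \<in> C" "v \<in> C" "nb d u v" "u \<in> V"
        show "v \<in> V"
        proof (rule ccontr)
          assume "v \<notin> V"
          then have "v \<in> out d V" using uv nb_sym by (auto simp: out_def)
          then show False using V(3) CS uv by auto
        qed
      qed (rule z(2))
      then have Cm: "C \<subseteq> B m" using V by auto
      have hn: "hi m + int L + 2 \<le> hi n" using n unfolding hi_def by linarith
      have p0: "p 0 = hi n" using d2 by (simp add: p_def)
      have "\<not> p 0 \<le> hi m" using p0 hn by linarith
      moreover have "p 0 \<le> hi m" if "p \<in> B m" using that d2 by (simp add: mem_box)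
      ultimately have "p \<notin> B m" by blast
      then have pC: "p \<in> B n - C" using pn Cm by auto
      define A where "A = cluster d (B n - C) p"
      note a = cc[OF pC A_def]
      have sh: "card (bd d n A) < L" using short[of p] pC by (auto simp: A_def)
      have "0 < card (bd d n A)" using contour_bd_pos[OF a(1)] d2 by auto
      then obtain e where e: "e \<in> bd d n A" by (metis card_gt_0_iff equals0I)
      obtain w i where wi: "e = (w, i)" by (cases e)
      have "i < d" "w \<in> B n" "up w i \<in> B n" "(w \<in> A) \<noteq> (up w i \<in> A)" using e wi by (auto simp: bd_def bonds_def)
      moreover have "nb d w (up w i)" "nb d (up w i) w" using nb_up nb_sym \<open>i < d\<close> by blast+
      ultimately obtain u v where uv: "u \<in> A" "v \<in> B n - A" "nb d u v" by blast
      have "v \<in> C" using a(5) uv by auto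
      then have "v 0 \<le> hi m" using Cm d2 by (auto simp: mem_box)
      moreover have "\<bar>u 0 - v 0\<bar> \<le> 1" using uv(3) by (auto simp: nb_def up_def)
      moreover have "\<bar>p 0 - u 0\<bar> \<le> int (card (bd d n A))" using sh n by (intro contour_diameter[OF a(1) d2 _ a(3) uv(1)]) auto
      ultimately show False using hn sh p0 by linarith
    qed
  qed
  moreover have "finite (T x \<union> T p)" by (rule finite_subset[of _ "Pow (B n)"]) (auto simp: T_def)
  ultimately have "Z n h (Dplus d k m n \<inter> OmM n) \<le> Z n h (T x \<union> T p)" by (intro Zw_mono)
  also have "\<dots> \<le> Z n h (T x) + Z n h (T p)"
    by (rule Zw_Un_le) (rule finite_subset[of _ "Pow (B n)"], auto simp: T_def)+
  also have "\<dots> \<le> 2 * (1/8) ^ L * Z n h (OmM n) + 2 * (1/8) ^ L * Z n h (OmM n)"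
    using Ty xk Bkn pn by (intro add_mono) auto
  finally show ?thesis by simp
qed

lemma tail_small:
  assumes "0 < (\<delta>::real)" "0 \<le> c"
  shows "\<exists>L0. \<forall>L\<ge>L0. c * (1/8) ^ L \<le> \<delta>"
proof -
  have "(\<lambda>L. c * (1/8::real) ^ L) \<longlonglongrightarrow> c * 0"
    by (intro tendsto_intros LIMSEQ_power_zero) auto
  then have "eventually (\<lambda>L. c * (1/8::real) ^ L < \<delta>) sequentially"
    using assms by (intro order_tendstoD(2)) auto
  then show ?thesis unfolding eventually_sequentially using less_imp_le by blast
qed

text \<open>The order of choice matters: \<open>La\<close> and with it \<open>k\<close>, then
  \<open>Lb\<close>, whose tail has to beat the number of sites in the box \<open>k + 2\<close>,
  then \<open>m\<close> and \<open>n0\<close>. The lower bound \<open>k0\<close> is left open so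
  that \<open>k\<close> can be pushed beyond the threshold in \<open>plus_limit\<close>.\<close>

lemma Dplus_approx:
  assumes \<delta>: "0 < \<delta>"
  shows "\<exists>k m n0. k0 \<le> k \<and> k \<le> m \<and> m + 2 \<le> n0 \<and> (\<forall>n\<ge>n0. \<forall>h. bounded_field n h \<longrightarrow>
     Z n h (OmP n - Dplus d k m n) + Z n h (Dplus d k m n - OmP n) \<le> \<delta> * Z n h (Pow (B n)))"
proof -
  have d3: "0 < \<delta> / 3" using \<delta> by simp
  obtain L1 where L1: "\<And>L. L1 \<le> L \<Longrightarrow> 4 * (1/8::real) ^ L \<le> \<delta> / 3" using tail_small[OF d3, of 4] by auto
  define La where "La = max 1 L1"
  define k where "k = max k0 (La + 1)"
  obtain L2 where L2: "\<And>L. L2 \<le> L \<Longrightarrow> (real (card (B (k + 2))) * 2) * (1/8::real) ^ L \<le> \<delta> / 3"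
    using tail_small[OF d3, of "real (card (B (k + 2))) * 2"] by auto
  define Lb where "Lb = max 1 L2"
  define m where "m = k + 2 + 2 * Lb"
  obtain n1 where n1: "\<And>n h. n1 \<le> n \<Longrightarrow> bounded_field n h \<Longrightarrow> Z n h (Om0 n) \<le> \<delta> / 3 * Z n h (Pow (B n))"
    using Om0_small[OF d3] by auto
  define n0 where "n0 = max n1 (m + 2 * La + 4)"
  show ?thesis
  proof (rule exI[of _ k], rule exI[of _ m], rule exI[of _ n0], intro conjI allI impI)
    show "k0 \<le> k" "k \<le> m" "m + 2 \<le> n0" by (auto simp: k_def m_def n0_def)
    fix n h assume n: "n0 \<le> n" and h: "bounded_field n h"
    have PP: "Z n h (OmP n) \<le> Z n h (Pow (B n))" "Z n h (OmM n) \<le> Z n h (Pow (B n))"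
      by (auto intro!: Zw_mono simp: Omega_plus_def Omega_minus_def)
    have "Z n h (OmP n - Dplus d k m n) \<le> real (card (B (k + 2))) * (2 * (1/8) ^ Lb) * Z n h (OmP n)"
      by (rule OmP_not_Dplus_le[OF h _ m_def]) (use n in \<open>auto simp: Lb_def n0_def\<close>)
    also have "\<dots> \<le> \<delta> / 3 * Z n h (Pow (B n))"
      using L2[of Lb] PP d3 by (intro mult_mono Zw_nonneg) (auto simp: Lb_def)
    finally have 1: "Z n h (OmP n - Dplus d k m n) \<le> \<delta> / 3 * Z n h (Pow (B n))" .
    have "Z n h (Dplus d k m n \<inter> OmM n) \<le> 4 * (1/8) ^ La * Z n h (OmM n)"
      by (rule Dplus_OmM_le[OF h]) (use n in \<open>auto simp: La_def k_def m_def n0_def\<close>)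
    also have "\<dots> \<le> \<delta> / 3 * Z n h (Pow (B n))"
      using L1[of La] PP d3 by (intro mult_mono Zw_nonneg) (auto simp: La_def)
    finally have 2: "Z n h (Dplus d k m n \<inter> OmM n) \<le> \<delta> / 3 * Z n h (Pow (B n))" .
    have 3: "Z n h (Om0 n) \<le> \<delta> / 3 * Z n h (Pow (B n))" using n1 n h by (auto simp: n0_def)
    have "Dplus d k m n - OmP n \<subseteq> (Dplus d k m n \<inter> OmM n) \<union> Om0 n" by (auto simp: Dplus_def)
    then have "Z n h (Dplus d k m n - OmP n) \<le> Z n h ((Dplus d k m n \<inter> OmM n) \<union> Om0 n)"
      by (intro Zw_mono) auto
    also have "\<dots> \<le> Z n h (Dplus d k m n \<inter> OmM n) + Z n h (Om0 n)" by (intro Zw_Un_le) auto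
    finally show "Z n h (OmP n - Dplus d k m n) + Z n h (Dplus d k m n - OmP n) \<le> \<delta> * Z n h (Pow (B n))"
      using 1 2 3 by (simp add: field_simps)
  qed
qed

lemma sum_diff_bound:
  assumes "finite X" "finite Y" "\<And>S. \<bar>f S\<bar> \<le> M"
  shows "\<bar>(\<Sum>S\<in>X. wt d \<beta> n h S * f S) - (\<Sum>S\<in>Y. wt d \<beta> n h S * f S)\<bar> \<le> M * (Z n h (X - Y) + Z n h (Y - X))"
proof -
  have bd: "\<bar>\<Sum>S\<in>W. wt d \<beta> n h S * f S\<bar> \<le> M * Z n h W" for W
  proof -
    have "\<bar>\<Sum>S\<in>W. wt d \<beta> n h S * f S\<bar> \<le> (\<Sum>S\<in>W. \<bar>wt d \<beta> n h S * f S\<bar>)" by (rule sum_abs)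
    also have "\<dots> \<le> (\<Sum>S\<in>W. M * wt d \<beta> n h S)"
    proof (rule sum_mono)
      fix S
      have "\<bar>f S\<bar> * wt d \<beta> n h S \<le> M * wt d \<beta> n h S"
        using assms(3) wt_pos less_imp_le by (intro mult_right_mono) blast+
      then show "\<bar>wt d \<beta> n h S * f S\<bar> \<le> M * wt d \<beta> n h S"
        using wt_pos[of d \<beta> n h S] by (simp add: abs_mult mult.commute)
    qed
    finally show ?thesis by (simp add: Zw_def sum_distrib_left)
  qed
  have "(\<Sum>S\<in>X. wt d \<beta> n h S * f S) = (\<Sum>S\<in>X - Y. wt d \<beta> n h S * f S) + (\<Sum>S\<in>X \<inter> Y. wt d \<beta> n h S * f S)"
    using sum.Int_Diff[OF assms(1), of "\<lambda>S. wt d \<beta> n h S * f S" Y] by simp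
  moreover have "(\<Sum>S\<in>Y. wt d \<beta> n h S * f S) = (\<Sum>S\<in>Y - X. wt d \<beta> n h S * f S) + (\<Sum>S\<in>X \<inter> Y. wt d \<beta> n h S * f S)"
    using sum.Int_Diff[OF assms(2), of "\<lambda>S. wt d \<beta> n h S * f S" X] by (simp add: Int_commute)
  ultimately show ?thesis using bd[of "X - Y"] bd[of "Y - X"] by (simp add: algebra_simps abs_le_iff)
qed

lemma OmP_limit:
  assumes loc: "local_on (B j) f" and lim: "plus_limit d \<beta> f c" and \<delta>: "0 < \<delta>"
  shows "\<exists>n0. \<forall>n\<ge>n0. \<forall>h. bounded_field n h \<longrightarrow>
     \<bar>(\<Sum>S\<in>OmP n. wt d \<beta> n h S * f S) - c * Z n h (OmP n)\<bar> \<le> \<delta> * Z n h (Pow (B n))"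
proof -
  obtain M where M: "0 \<le> M" "\<And>S. \<bar>f S\<bar> \<le> M" using local_bounded[OF loc] by auto
  \<comment> \<open>Passing from the ensemble to the screened configurations costs a factor
    \<open>M\<close> in the sum of \<open>f\<close> and a factor \<open>\<bar>c\<bar>\<close> in the
    total weight; \<open>plus_limit\<close> itself costs the remaining \<open>1\<close>.\<close>
  define \<epsilon> where "\<epsilon> = \<delta> / (M + \<bar>c\<bar> + 1)"
  have pos: "0 < M + \<bar>c\<bar> + 1" using M by linarith
  then have \<epsilon>: "0 < \<epsilon>" using \<delta> by (simp add: \<epsilon>_def)
  obtain k0 where k0: "\<And>k m n h. k0 \<le> k \<Longrightarrow> k \<le> m \<Longrightarrow> m + 2 \<le> n \<Longrightarrow>
     \<bar>(\<Sum>S\<in>Dplus d k m n. wt d \<beta> n h S * f S) - c * Z n h (Dplus d k m n)\<bar> \<le> \<epsilon> * Z n h (Dplus d k m n)"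
    using lim \<epsilon> unfolding plus_limit_def by metis
  obtain k m n0 where km: "k0 \<le> k" "k \<le> m" "m + 2 \<le> n0" and
    ap: "\<And>n h. n0 \<le> n \<Longrightarrow> bounded_field n h \<Longrightarrow>
       Z n h (OmP n - Dplus d k m n) + Z n h (Dplus d k m n - OmP n) \<le> \<epsilon> * Z n h (Pow (B n))"
    using Dplus_approx[OF \<epsilon>, of k0] by metis
  show ?thesis
  proof (intro exI[of _ n0] allI impI)
    fix n h assume n: "n0 \<le> n" and h: "bounded_field n h"
    define D where "D = Dplus d k m n"
    define ZZ where "ZZ = Z n h (Pow (B n))"
    define sO where "sO = (\<Sum>S\<in>OmP n. wt d \<beta> n h S * f S)"
    define sD where "sD = (\<Sum>S\<in>D. wt d \<beta> n h S * f S)"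
    have ap': "Z n h (OmP n - D) + Z n h (D - OmP n) \<le> \<epsilon> * ZZ" using ap[OF n h] unfolding D_def ZZ_def .
    have "\<bar>sO - sD\<bar> \<le> M * (Z n h (OmP n - D) + Z n h (D - OmP n))"
      unfolding sO_def sD_def using M by (intro sum_diff_bound) (auto simp: D_def)
    also have "\<dots> \<le> M * (\<epsilon> * ZZ)" using ap' M by (intro mult_left_mono)
    finally have 1: "\<bar>sO - sD\<bar> \<le> M * (\<epsilon> * ZZ)" .
    have "\<bar>sD - c * Z n h D\<bar> \<le> \<epsilon> * Z n h D" unfolding sD_def D_def using k0 km n by auto
    also have "Z n h D \<le> ZZ" unfolding ZZ_def D_def by (intro Zw_mono) (auto simp: Dplus_def)
    finally have 2: "\<bar>sD - c * Z n h D\<bar> \<le> \<epsilon> * ZZ" using \<epsilon> by (simp add: mult_left_mono)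
    have "\<bar>Z n h D - Z n h (OmP n)\<bar> \<le> 1 * (Z n h (D - OmP n) + Z n h (OmP n - D))"
      using sum_diff_bound[of D "OmP n" "\<lambda>_. 1" 1 n h] by (simp add: D_def Zw_def)
    also have "\<dots> \<le> \<epsilon> * ZZ" using ap' by simp
    finally have "\<bar>c\<bar> * \<bar>Z n h D - Z n h (OmP n)\<bar> \<le> \<bar>c\<bar> * (\<epsilon> * ZZ)" by (intro mult_left_mono) auto
    then have 3: "\<bar>c * Z n h D - c * Z n h (OmP n)\<bar> \<le> \<bar>c\<bar> * (\<epsilon> * ZZ)"
      by (simp add: abs_mult[symmetric] right_diff_distrib)
    have "\<bar>sO - c * Z n h (OmP n)\<bar> \<le> M * (\<epsilon> * ZZ) + \<epsilon> * ZZ + \<bar>c\<bar> * (\<epsilon> * ZZ)" using 1 2 3 by linarith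
    also have "\<dots> = (M + \<bar>c\<bar> + 1) * \<epsilon> * ZZ" by (simp add: algebra_simps)
    also have "(M + \<bar>c\<bar> + 1) * \<epsilon> = \<delta>" unfolding \<epsilon>_def using pos by simp
    finally show "\<bar>(\<Sum>S\<in>OmP n. wt d \<beta> n h S * f S) - c * Z n h (OmP n)\<bar> \<le> \<delta> * Z n h (Pow (B n))"
      unfolding sO_def ZZ_def .
  qed
qed

text \<open>Complementation turns sums over the minus ensemble into sums over the plus ensemble in
  the reversed field, so \<open>cm\<close> is the plus limit of the function with reversed
  spins.\<close>

lemma gibbs_mixture:
  assumes loc: "local_on (B j) f" and lp: "plus_limit d \<beta> f cp" and lm: "plus_limit d \<beta> (\<lambda>S. f (B j - S)) cm"
    and \<delta>: "0 < \<delta>"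
  shows "\<exists>n0. \<forall>n\<ge>n0. \<forall>h. bounded_field n h \<longrightarrow>
     \<bar>(\<Sum>S\<in>Pow (B n). wt d \<beta> n h S * f S) - cp * Z n h (OmP n) - cm * Z n h (OmM n)\<bar> \<le> \<delta> * Z n h (Pow (B n))"
proof -
  obtain M where M: "0 \<le> M" "\<And>S. \<bar>f S\<bar> \<le> M" using local_bounded[OF loc] by auto
  have d3: "0 < \<delta> / 3" "0 < \<delta> / (3 * (M + 1))" using \<delta> M by auto
  have locc: "local_on (B j) (\<lambda>S. f (B j - S))" unfolding local_on_def
    by (intro allI arg_cong[where f = f]) auto
  obtain n1 where n1: "\<And>n h. n1 \<le> n \<Longrightarrow> bounded_field n h \<Longrightarrow>
     \<bar>(\<Sum>S\<in>OmP n. wt d \<beta> n h S * f S) - cp * Z n h (OmP n)\<bar> \<le> \<delta> / 3 * Z n h (Pow (B n))"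
    using OmP_limit[OF loc lp d3(1)] by metis
  obtain n2 where n2: "\<And>n h. n2 \<le> n \<Longrightarrow> bounded_field n h \<Longrightarrow>
     \<bar>(\<Sum>S\<in>OmP n. wt d \<beta> n h S * f (B j - S)) - cm * Z n h (OmP n)\<bar> \<le> \<delta> / 3 * Z n h (Pow (B n))"
    using OmP_limit[OF locc lm d3(1)] by metis
  obtain n3 where n3: "\<And>n h. n3 \<le> n \<Longrightarrow> bounded_field n h \<Longrightarrow> Z n h (Om0 n) \<le> \<delta> / (3 * (M + 1)) * Z n h (Pow (B n))"
    using Om0_small[OF d3(2)] by metis
  show ?thesis
  proof (intro exI[of _ "max (max n1 n2) (max n3 j)"] allI impI)
    fix n h assume n: "max (max n1 n2) (max n3 j) \<le> n" and h: "bounded_field n h"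
    define ZZ where "ZZ = Z n h (Pow (B n))"
    have Bj: "B j \<subseteq> B n" using n by (intro box_mono) auto
    define s where "s X = (\<Sum>S\<in>X. wt d \<beta> n h S * f S)" for X
    have dj: "OmP n \<inter> OmM n = {}" by (rule Omega_disjoint[OF finite_box conn_box])
    have "Pow (B n) = (OmP n \<union> OmM n) \<union> Om0 n" by (auto simp: Omega_plus_def Omega_minus_def)
    then have "s (Pow (B n)) = s ((OmP n \<union> OmM n) \<union> Om0 n)" by (rule arg_cong)
    also have "\<dots> = s (OmP n \<union> OmM n) + s (Om0 n)" unfolding s_def by (rule sum.union_disjoint) auto
    also have "s (OmP n \<union> OmM n) = s (OmP n) + s (OmM n)" unfolding s_def using dj by (intro sum.union_disjoint) auto
    finally have sp: "s (Pow (B n)) = s (OmP n) + s (OmM n) + s (Om0 n)" .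
    have 1: "\<bar>s (OmP n) - cp * Z n h (OmP n)\<bar> \<le> \<delta> / 3 * ZZ" using n1[of n h] n h unfolding s_def ZZ_def by auto
    have "s (OmM n) = (\<Sum>S\<in>OmP n. wt d \<beta> n (\<lambda>x. - h x) S * f (B j - S))" unfolding s_def
    proof (rule sum.reindex_bij_witness[of _ "\<lambda>S. B n - S" "\<lambda>S. B n - S"])
      fix S assume S: "S \<in> OmM n"
      then have SB: "S \<subseteq> B n" by (auto simp: Omega_minus_def)
      then show "B n - (B n - S) = S" by auto
      show "B n - S \<in> OmP n" using S by (auto simp: Omega_minus_def)
      have "f (B j - (B n - S)) = f S" using Bj by (intro local_onD[OF loc]) auto
      moreover have "wt d \<beta> n (\<lambda>x. - h x) (B n - S) = wt d \<beta> n h S" using wt_compl[OF SB, of "\<lambda>x. - h x"] by simp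
      ultimately show "wt d \<beta> n (\<lambda>x. - h x) (B n - S) * f (B j - (B n - S)) = wt d \<beta> n h S * f S" by simp
    next
      fix S assume S: "S \<in> OmP n"
      then have SB: "S \<subseteq> B n" by (auto simp: Omega_plus_def)
      then show e: "B n - (B n - S) = S" by auto
      show "B n - S \<in> OmM n" using S e by (auto simp: Omega_minus_def)
    qed
    moreover have "Z n h (Pow (B n)) = Z n (\<lambda>x. - h x) (Pow (B n))"
      using Z_compl[of "Pow (B n)" n h] by (simp add: Pow_def)
    ultimately have 2: "\<bar>s (OmM n) - cm * Z n h (OmM n)\<bar> \<le> \<delta> / 3 * ZZ"
      using n2[of n "\<lambda>x. - h x"] n bounded_uminus[OF h] unfolding Z_OmM ZZ_def by auto
    have "\<bar>s (Om0 n) - s {}\<bar> \<le> M * (Z n h (Om0 n - {}) + Z n h ({} - Om0 n))"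
      unfolding s_def using M by (intro sum_diff_bound) auto
    then have "\<bar>s (Om0 n)\<bar> \<le> M * Z n h (Om0 n)" by (simp add: s_def Zw_def)
    also have "\<dots> \<le> (M + 1) * (\<delta> / (3 * (M + 1)) * ZZ)"
      using n3[of n h] n h M Zw_nonneg[of d \<beta> n h "Om0 n"] unfolding ZZ_def by (intro mult_mono) auto
    also have "\<dots> = \<delta> / 3 * ZZ" using M by (simp add: field_simps)
    finally have 3: "\<bar>s (Om0 n)\<bar> \<le> \<delta> / 3 * ZZ" .
    have "\<bar>s (Pow (B n)) - cp * Z n h (OmP n) - cm * Z n h (OmM n)\<bar> \<le> \<delta> / 3 * ZZ + \<delta> / 3 * ZZ + \<delta> / 3 * ZZ"
      using sp 1 2 3 by linarith
    also have "\<dots> = \<delta> * ZZ" by simp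
    finally show "\<bar>(\<Sum>S\<in>Pow (B n). wt d \<beta> n h S * f S) - cp * Z n h (OmP n) - cm * Z n h (OmM n)\<bar> \<le> \<delta> * Z n h (Pow (B n))"
      unfolding s_def ZZ_def .
  qed
qed

end

subsection \<open>The difference of the ensemble free energies\<close>

lemma wt_cong: "(\<And>x. x \<in> bdry d n \<Longrightarrow> h x = h' x) \<Longrightarrow> wt d \<beta> n h S = wt d \<beta> n h' S"
  unfolding wt_def by (intro arg_cong[where f = exp] arg_cong2[where f = "(+)"] sum.cong) auto

lemma Zw_cong: "(\<And>x. x \<in> bdry d n \<Longrightarrow> h x = h' x) \<Longrightarrow> Zw d \<beta> n h X = Zw d \<beta> n h' X"
  unfolding Zw_def by (intro sum.cong refl wt_cong)

text \<open>The guaranteed increase of \<open>G\<close> when one field is raised from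
  \<open>- a\<close> to \<open>a\<close>. Inside the logarithm is the ratio of the weights of the
  plus ensemble for odds of three to one in favour of plus at that site; the factor \<open>2\<close>
  counts the two ensembles.\<close>

definition gain :: "real \<Rightarrow> real" where
  "gain a = 2 * ln ((3 * exp a + exp (- a)) / (3 * exp (- a) + exp a))"

lemma gain_pos:
  assumes "0 < a"
  shows "0 < gain a"
proof -
  have "exp (- a) < exp a" using assms by simp
  then have "1 < (3 * exp a + exp (- a)) / (3 * exp (- a) + exp a)"
    by (subst less_divide_eq_1_pos) (auto intro!: add_pos_pos)
  then show ?thesis unfolding gain_def by simp
qed

lemma wt_upd:
  assumes "x \<in> bdry d n"
  shows "wt d \<beta> n (h(x := s)) S = exp (s * (if x \<in> S then 1 else - 1)) * wt d \<beta> n (h(x := 0)) S"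
proof -
  define g where "g h = (\<Sum>x\<in>bdry d n. h x * (if x \<in> S then 1 else - 1))" for h :: "site \<Rightarrow> real"
  have r: "g k = k x * (if x \<in> S then 1 else - 1) + (\<Sum>y\<in>bdry d n - {x}. k y * (if y \<in> S then 1 else - 1))" for k
    unfolding g_def using assms by (intro sum.remove) auto
  have "(\<Sum>y\<in>bdry d n - {x}. (h(x := s)) y * (if y \<in> S then 1 else - 1)) =
      (\<Sum>y\<in>bdry d n - {x}. (h(x := 0)) y * (if y \<in> S then 1 else - 1))"
    by (intro sum.cong) auto
  then have "g (h(x := s)) = s * (if x \<in> S then 1 else - 1) + g (h(x := 0))"
    using r[of "h(x := s)"] r[of "h(x := 0)"] by simp
  then show ?thesis unfolding wt_def g_def exp_add[symmetric] by (simp add: algebra_simps)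
qed

context low_temp
begin

definition G :: "nat \<Rightarrow> (site \<Rightarrow> real) \<Rightarrow> real" where
  "G n h = ln (Z n h (OmP n)) - ln (Z n h (OmM n))"

lemma box_in_OmP:
  assumes "1 \<le> n"
  shows "B n \<in> OmP n"
proof -
  define x where "x = (\<lambda>j. if j < d then lo n else 0)"
  have x: "x \<in> B n" unfolding x_def by (rule box_nonempty[OF assms])
  have "B n \<subseteq> cluster d (B n) x" using conn_box x by (intro conn_subset_cluster) auto
  then have "cluster d (B n) x = B n" using cluster_subset by blast
  then have "is_central d (B n) (B n) (B n)" using x unfolding is_central_def by auto
  then show ?thesis by (auto simp: Omega_plus_def)
qed

lemma Z_OmP_pos: "1 \<le> n \<Longrightarrow> 0 < Z n h (OmP n)"
  unfolding Zw_def using box_in_OmP[of n] by (intro sum_pos wt_pos) auto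

lemma Z_OmM_pos: "1 \<le> n \<Longrightarrow> 0 < Z n h (OmM n)"
  unfolding Z_OmM by (rule Z_OmP_pos)

lemma Z_Pow_pos: "0 < Z n h (Pow (B n))"
  unfolding Zw_def using wt_pos by (intro sum_pos) auto

lemma G_uminus: "G n (\<lambda>x. - h x) = - G n h"
  unfolding G_def Z_OmM by simp

lemma G_cong: "(\<And>x. x \<in> bdry d n \<Longrightarrow> h x = h' x) \<Longrightarrow> G n h = G n h'"
  unfolding G_def using Zw_cong[of d n h h'] by auto

lemma bounded_upd: "bounded_field n h \<Longrightarrow> \<bar>s\<bar> \<le> l \<Longrightarrow> bounded_field n (h(x := s))"
  by (auto simp: bounded_field_def)

text \<open>With the field at \<open>x\<close> set to zero, plus at \<open>x\<close> has at least
  three times the weight of minus, that is \<open>X \<ge> 3 * Y\<close>. The ratio of the weights at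
  fields \<open>a\<close> and \<open>- a\<close> grows with these odds and with \<open>a\<close>, so
  it is least at odds three and field \<open>a0\<close>.\<close>

lemma OmP_gain:
  assumes h: "bounded_field n h" and x: "x \<in> bdry d n" and a: "0 < a0" "a0 \<le> a"
  shows "gain a0 / 2 \<le> ln (Z n (h(x := a)) (OmP n)) - ln (Z n (h(x := - a)) (OmP n))"
proof -
  define h0 where "h0 = h(x := 0)"
  define X where "X = Z n h0 {S \<in> OmP n. x \<in> S}"
  define Y where "Y = Z n h0 {S \<in> OmP n. x \<notin> S}"
  have xB: "x \<in> B n" using x by (auto simp: bdry_def)
  have n1: "1 \<le> n"
  proof (rule ccontr)
    assume "\<not> 1 \<le> n"
    then have "card (B n) = 0" using d2 by (auto simp: card_box)
    then show False using xB by simp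
  qed
  have h0: "bounded_field n h0" unfolding h0_def using h l_nonneg by (intro bounded_upd) auto
  have split: "(\<Sum>S\<in>OmP n. g S) = (\<Sum>S\<in>{S \<in> OmP n. x \<in> S}. g S) + (\<Sum>S\<in>{S \<in> OmP n. x \<notin> S}. g S)" for g :: "site set \<Rightarrow> real"
  proof -
    have "(\<Sum>S\<in>{S \<in> OmP n. x \<in> S} \<union> {S \<in> OmP n. x \<notin> S}. g S) = (\<Sum>S\<in>{S \<in> OmP n. x \<in> S}. g S) + (\<Sum>S\<in>{S \<in> OmP n. x \<notin> S}. g S)"
      by (rule sum.union_disjoint) auto
    moreover have "{S \<in> OmP n. x \<in> S} \<union> {S \<in> OmP n. x \<notin> S} = OmP n" by auto
    ultimately show ?thesis by metis
  qed
  have Zs: "Z n (h(x := s)) (OmP n) = exp s * X + exp (- s) * Y" for s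
    unfolding X_def Y_def h0_def Zw_def split sum_distrib_left
    by (intro arg_cong2[where f = "(+)"] sum.cong refl) (subst wt_upd[OF x], simp)+
  have tot: "Z n h0 (OmP n) = X + Y" unfolding X_def Y_def Zw_def by (rule split)
  have "Y \<le> 1/4 * (X + Y)" using minus_at_le[OF h0 xB] unfolding Y_def[symmetric] tot .
  then have YX: "3 * Y \<le> X" by simp
  have Yn: "0 \<le> Y" unfolding Y_def by (rule Zw_nonneg)
  have Xp: "0 < X" using Z_OmP_pos[OF n1, of h0] tot YX Yn by linarith
  define e where "e = exp a"
  define f where "f = exp (- a)"
  define e0 where "e0 = exp a0"
  define f0 where "f0 = exp (- a0)"
  have pos: "0 < e" "0 < f" "0 < e0" "0 < f0" by (auto simp: e_def f_def e0_def f0_def)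
  have ord: "f \<le> f0" "f0 \<le> e0" "e0 \<le> e" using a by (auto simp: e_def f_def e0_def f0_def)
  have "f * e0 \<le> f0 * e" using ord pos by (intro mult_mono) auto
  have "(3 * e0 + f0) * (f * X + e * Y) \<le> (e * X + f * Y) * (3 * f0 + e0)"
  proof -
    \<comment> \<open>Cleared of denominators, the difference splits into two products of
      nonnegative factors.\<close>
    have "(e * X + f * Y) * (3 * f0 + e0) - (3 * e0 + f0) * (f * X + e * Y)
       = (e0 * e - f * f0) * (X - 3 * Y) + 3 * (f0 * e - f * e0) * (X - Y / 3) + 0"
      by (simp add: algebra_simps)
    moreover have "f * f0 \<le> e0 * e" using ord pos by (subst mult.commute, intro mult_mono) auto
    then have "0 \<le> (e0 * e - f * f0) * (X - 3 * Y)" using YX by (intro mult_nonneg_nonneg) auto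
    moreover have "0 \<le> 3 * (f0 * e - f * e0) * (X - Y / 3)"
      using \<open>f * e0 \<le> f0 * e\<close> YX Yn Xp by (intro mult_nonneg_nonneg) auto
    ultimately show ?thesis by linarith
  qed
  moreover have p: "0 < f * X + e * Y" "0 < 3 * f0 + e0" "0 < 3 * e0 + f0" "0 < e * X + f * Y"
    using pos Xp Yn by (auto intro!: add_pos_nonneg)
  ultimately have "(3 * e0 + f0) / (3 * f0 + e0) \<le> (e * X + f * Y) / (f * X + e * Y)"
    by (simp add: field_simps)
  then have "ln ((3 * e0 + f0) / (3 * f0 + e0)) \<le> ln ((e * X + f * Y) / (f * X + e * Y))"
    using p by (subst ln_le_cancel_iff) auto
  also have "\<dots> = ln (e * X + f * Y) - ln (f * X + e * Y)" using p by (intro ln_divide_pos) auto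
  finally show ?thesis unfolding Zs gain_def e_def f_def e0_def f0_def by simp
qed

text \<open>The minus ensemble is the plus ensemble in the reversed field, so raising the field
  lowers its logarithm by at least as much; each ensemble contributes half of the gain.\<close>

lemma G_gain:
  assumes h: "bounded_field n h" and x: "x \<in> bdry d n" and a: "0 < a0" "a0 \<le> a"
  shows "G n (h(x := - a)) + gain a0 \<le> G n (h(x := a))"
proof -
  have e: "(\<lambda>y. - (h(x := s)) y) = (\<lambda>y. - h y)(x := - s)" for s by auto
  have "gain a0 / 2 \<le> ln (Z n (h(x := a)) (OmP n)) - ln (Z n (h(x := - a)) (OmP n))"
    by (rule OmP_gain[OF assms])
  moreover have "gain a0 / 2 \<le> ln (Z n ((\<lambda>y. - h y)(x := a)) (OmP n)) - ln (Z n ((\<lambda>y. - h y)(x := - a)) (OmP n))"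
    by (rule OmP_gain[OF bounded_uminus[OF h] x a])
  ultimately show ?thesis unfolding G_def Z_OmM e by simp
qed

text \<open>Raising the fields one by one from \<open>- l\<close> to \<open>l\<close> takes
  \<open>G\<close> from \<open>- G n (\<lambda>_. l)\<close> to \<open>G n (\<lambda>_. l)\<close>
  with an increase of at least \<open>gain l\<close> each time. So in a constant positive field the
  minus ensemble is negligible.\<close>

lemma G_const_ge:
  assumes l: "0 < l"
  shows "real (card (bdry d n)) * gain l / 2 \<le> G n (\<lambda>_. l)"
proof -
  define hT where "hT T = (\<lambda>x. if x \<in> T then l else - l)" for T :: "site set"
  have bnd: "bounded_field n (hT T)" for T using l by (auto simp: bounded_field_def hT_def)
  have "finite T \<Longrightarrow> T \<subseteq> bdry d n \<Longrightarrow> G n (hT {}) + real (card T) * gain l \<le> G n (hT T)" for T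
  proof (induction T rule: finite_induct)
    case (insert x T)
    have "(hT T)(x := - l) = hT T" "(hT T)(x := l) = hT (insert x T)" using insert by (auto simp: hT_def)
    then have "G n (hT T) + gain l \<le> G n (hT (insert x T))" using G_gain[OF bnd[of T], of x l l] insert l by auto
    then show ?case using insert by (simp add: algebra_simps)
  qed simp
  from this[of "bdry d n"] have "G n (hT {}) + real (card (bdry d n)) * gain l \<le> G n (hT (bdry d n))" by simp
  moreover have "G n (hT (bdry d n)) = G n (\<lambda>_. l)" by (rule G_cong) (simp add: hT_def)
  moreover have "G n (hT {}) = - G n (\<lambda>_. l)" using G_uminus[of n "\<lambda>_. l"] by (simp add: hT_def)
  ultimately show ?thesis by simp
qed

lemma card_bdry_ge:
  assumes "1 \<le> n"
  shows "n ^ (d - 1) \<le> card (bdry d n)"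
proof -
  have "lo n \<le> hi n" using hi_lo[of n] assms by linarith
  then have "card (slice d n 0 (hi n)) = n ^ (d - 1)" using d2 by (intro card_slice) auto
  moreover have "slice d n 0 (hi n) \<subseteq> bdry d n" using d2 by (auto simp: slice_def bdry_iff intro!: exI[of _ 0])
  ultimately show ?thesis by (metis card_mono finite_bdry)
qed

lemma n_le_card_bdry:
  assumes "1 \<le> n"
  shows "n \<le> card (bdry d n)"
proof -
  have "n = n ^ 1" by simp
  also have "\<dots> \<le> n ^ (d - 1)" using assms d2 by (intro power_increasing) auto
  also have "\<dots> \<le> card (bdry d n)" by (rule card_bdry_ge[OF assms])
  finally show ?thesis .
qed

lemma Z_ratio:
  assumes "1 \<le> n"
  shows "Z n h (OmM n) = exp (- G n h) * Z n h (OmP n)"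
  unfolding G_def using Z_OmP_pos[OF assms, of h] Z_OmM_pos[OF assms, of h] by (simp add: exp_diff)

text \<open>The Peierls estimates cover fields bounded by \<open>l\<close>, while
  \<open>\<beta>\<close> may be larger. In the constant field \<open>l\<close> the minus ensemble is
  negligible and screens are very likely; the existence of a screen is an increasing event, so
  passing from \<open>l\<close> to \<open>\<beta>\<close> can only make it likelier.\<close>

lemma Dplus_plus_field:
  assumes l: "0 < l" and \<delta>: "0 < \<delta>"
  shows "\<exists>k m n0. k0 \<le> k \<and> k \<le> m \<and> m + 2 \<le> n0 \<and>
    (\<forall>n\<ge>n0. Z n (\<lambda>_. \<beta>) (Pow (B n) - Dplus d k m n) \<le> \<delta> * Z n (\<lambda>_. \<beta>) (Pow (B n)))"
proof -
  have d3: "0 < \<delta> / 3" using \<delta> by simp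
  obtain k m n1 where km: "k0 \<le> k" "k \<le> m" "m + 2 \<le> n1" and
    ap: "\<And>n h. n1 \<le> n \<Longrightarrow> bounded_field n h \<Longrightarrow>
       Z n h (OmP n - Dplus d k m n) + Z n h (Dplus d k m n - OmP n) \<le> \<delta> / 3 * Z n h (Pow (B n))"
    using Dplus_approx[OF d3, of k0] by metis
  obtain n2 where n2: "\<And>n h. n2 \<le> n \<Longrightarrow> bounded_field n h \<Longrightarrow> Z n h (Om0 n) \<le> \<delta> / 3 * Z n h (Pow (B n))"
    using Om0_small[OF d3] by metis
  have gp: "0 < gain l" by (rule gain_pos[OF l])
  obtain n3 where n3: "- ln (\<delta> / 3) / (gain l / 2) < real n3" using reals_Archimedean2 by blast
  define n0 where "n0 = max (max n1 n2) (max n3 1)"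
  have "Z n (\<lambda>_. \<beta>) (Pow (B n) - Dplus d k m n) \<le> \<delta> * Z n (\<lambda>_. \<beta>) (Pow (B n))" if n: "n0 \<le> n" for n
  proof -
    define D where "D = Dplus d k m n"
    define hl where "hl = (\<lambda>_::site. l)"
    define hb where "hb = (\<lambda>_::site. \<beta>)"
    have n1': "1 \<le> n" using n by (simp add: n0_def)
    have h: "bounded_field n hl" using l by (simp add: bounded_field_def hl_def)
    have P: "Z n hl (OmP n) \<le> Z n hl (Pow (B n))" by (intro Zw_mono) (auto simp: Omega_plus_def)
    have "- ln (\<delta> / 3) \<le> real n3 * (gain l / 2)"
      using n3 gp by (simp add: field_simps)
    also have "\<dots> \<le> real n * (gain l / 2)" using n gp by (intro mult_right_mono) (auto simp: n0_def)
    also have "\<dots> \<le> real (card (bdry d n)) * (gain l / 2)"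
      using n_le_card_bdry[OF n1'] gp by (intro mult_right_mono) auto
    also have "\<dots> \<le> G n hl" using G_const_ge[OF l, of n] by (simp add: hl_def)
    finally have "exp (- G n hl) \<le> exp (ln (\<delta> / 3))" by simp
    then have "exp (- G n hl) \<le> \<delta> / 3" using d3 by simp
    then have "Z n hl (OmM n) \<le> \<delta> / 3 * Z n hl (Pow (B n))"
      unfolding Z_ratio[OF n1'] using P d3 by (intro mult_mono Zw_nonneg) auto
    moreover have "Z n hl (OmP n - D) \<le> \<delta> / 3 * Z n hl (Pow (B n))"
      using ap[of n hl] n h Zw_nonneg[of d \<beta> n hl "D - OmP n"] by (auto simp: n0_def D_def)
    moreover have "Z n hl (Om0 n) \<le> \<delta> / 3 * Z n hl (Pow (B n))" using n2[of n hl] n h by (auto simp: n0_def)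
    moreover have "Z n hl (Pow (B n) - D) \<le> Z n hl ((OmP n - D) \<union> OmM n \<union> Om0 n)"
      by (intro Zw_mono) auto
    moreover have "Z n hl ((OmP n - D) \<union> OmM n \<union> Om0 n) \<le> Z n hl (OmP n - D) + Z n hl (OmM n) + Z n hl (Om0 n)"
      using Zw_Un_le[of "(OmP n - D) \<union> OmM n" "Om0 n" d \<beta> n hl] Zw_Un_le[of "OmP n - D" "OmM n" d \<beta> n hl] by simp
    ultimately have hl: "Z n hl (Pow (B n) - D) \<le> \<delta> * Z n hl (Pow (B n))" by (simp add: field_simps)
    \<comment> \<open>Weights in the field \<open>\<beta>\<close> are those in the field
      \<open>l\<close> times the density \<open>r\<close>, increasing because
      \<open>l \<le> \<beta>\<close>; \<open>f\<close> is the increasing indicator to which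
      \<open>fkg_tilt\<close> is applied.\<close>
    define f where "f S = (if S \<in> D then 1 else 0 :: real)" for S
    define r where "r S = exp (\<Sum>x\<in>bdry d n. (\<beta> - l) * (if x \<in> S then 1 else - 1))" for S
    have wr: "wt d \<beta> n hl S * r S = wt d \<beta> n hb S" for S
      unfolding wt_def r_def hl_def hb_def exp_add[symmetric] by (simp add: sum.distrib[symmetric] algebra_simps)
    have ind: "(\<Sum>S\<in>Pow (B n). wt d \<beta> n h S * f S) = Z n h (Pow (B n)) - Z n h (Pow (B n) - D)" for h
    proof -
      have "(\<Sum>S\<in>Pow (B n). wt d \<beta> n h S * f S) = Z n h (Pow (B n) \<inter> D)"
        unfolding Zw_def f_def by (subst sum.inter_restrict) (auto intro!: sum.cong)
      moreover have "Z n h (Pow (B n)) = Z n h (Pow (B n) \<inter> D) + Z n h (Pow (B n) - D)"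
        unfolding Zw_def by (rule sum.Int_Diff) simp
      ultimately show ?thesis by simp
    qed
    have "(\<Sum>S\<in>Pow (B n). wt d \<beta> n hl S * f S) / (\<Sum>S\<in>Pow (B n). wt d \<beta> n hl S)
       \<le> (\<Sum>S\<in>Pow (B n). wt d \<beta> n hl S * r S * f S) / (\<Sum>S\<in>Pow (B n). wt d \<beta> n hl S * r S)"
    proof (rule fkg_tilt)
      show "wt d \<beta> n hl S * wt d \<beta> n hl T \<le> wt d \<beta> n hl (S \<union> T) * wt d \<beta> n hl (S \<inter> T)" for S T
        by (rule wt_supermodular[OF beta_nonneg])
      show "r S \<le> r T" if "S \<subseteq> T" for S T unfolding r_def exp_le_cancel_iff
        using that l_le by (intro sum_mono mult_left_mono) auto
      show "f S \<le> f T" if "S \<subseteq> T" "T \<subseteq> B n" for S T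
      proof -
        have "screens d k m S \<subseteq> screens d k m T" using that(1) unfolding screens_def by blast
        then have "S \<in> D \<Longrightarrow> T \<in> D" using that unfolding D_def Dplus_def by blast
        then show ?thesis by (simp add: f_def)
      qed
    qed (auto simp: wt_pos r_def)
    then have "(Z n hl (Pow (B n)) - Z n hl (Pow (B n) - D)) / Z n hl (Pow (B n))
       \<le> (Z n hb (Pow (B n)) - Z n hb (Pow (B n) - D)) / Z n hb (Pow (B n))"
      unfolding wr ind by (simp add: Zw_def)
    moreover have "0 < Z n hl (Pow (B n))" "0 < Z n hb (Pow (B n))" by (rule Z_Pow_pos)+
    ultimately have "Z n hb (Pow (B n) - D) / Z n hb (Pow (B n)) \<le> Z n hl (Pow (B n) - D) / Z n hl (Pow (B n))"
      by (simp add: diff_divide_distrib)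
    also have "\<dots> \<le> \<delta>" using hl \<open>0 < Z n hl (Pow (B n))\<close> by (simp add: field_simps)
    finally show ?thesis using \<open>0 < Z n hb (Pow (B n))\<close> unfolding hb_def D_def by (simp add: field_simps)
  qed
  moreover have "m + 2 \<le> n0" using km by (simp add: n0_def)
  ultimately show ?thesis using km(1,2) by blast
qed

lemma plus_field_limit:
  assumes l: "0 < l" and loc: "local_on (B j) f" and lim: "plus_limit d \<beta> f c"
  shows "(\<lambda>n. (\<Sum>S\<in>Pow (B n). wt d \<beta> n (\<lambda>_. \<beta>) S * f S) / Z n (\<lambda>_. \<beta>) (Pow (B n))) \<longlonglongrightarrow> c"
proof (rule LIMSEQ_I)
  fix \<delta> :: real assume \<delta>: "0 < \<delta>"
  obtain M where M: "0 \<le> M" "\<And>S. \<bar>f S\<bar> \<le> M" using local_bounded[OF loc] by auto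
  define \<epsilon> where "\<epsilon> = \<delta> / (2 * (M + \<bar>c\<bar> + 1))"
  have pos: "0 < M + \<bar>c\<bar> + 1" using M by linarith
  then have \<epsilon>: "0 < \<epsilon>" using \<delta> by (simp add: \<epsilon>_def)
  obtain k0 where k0: "\<And>k m n h. k0 \<le> k \<Longrightarrow> k \<le> m \<Longrightarrow> m + 2 \<le> n \<Longrightarrow>
     \<bar>(\<Sum>S\<in>Dplus d k m n. wt d \<beta> n h S * f S) - c * Z n h (Dplus d k m n)\<bar> \<le> \<epsilon> * Z n h (Dplus d k m n)"
    using lim \<epsilon> unfolding plus_limit_def by metis
  obtain k m n0 where km: "k0 \<le> k" "k \<le> m" "m + 2 \<le> n0" and
    ap: "\<And>n. n0 \<le> n \<Longrightarrow> Z n (\<lambda>_. \<beta>) (Pow (B n) - Dplus d k m n) \<le> \<epsilon> * Z n (\<lambda>_. \<beta>) (Pow (B n))"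
    using Dplus_plus_field[OF l \<epsilon>, of k0] by metis
  show "\<exists>n0. \<forall>n\<ge>n0. norm ((\<Sum>S\<in>Pow (B n). wt d \<beta> n (\<lambda>_. \<beta>) S * f S) / Z n (\<lambda>_. \<beta>) (Pow (B n)) - c) < \<delta>"
  proof (intro exI[of _ n0] allI impI)
    fix n assume n: "n0 \<le> n"
    define h where "h = (\<lambda>_::site. \<beta>)"
    define D where "D = Dplus d k m n"
    define ZZ where "ZZ = Z n h (Pow (B n))"
    have Zp: "0 < ZZ" unfolding ZZ_def by (rule Z_Pow_pos)
    define s where "s = (\<Sum>S\<in>Pow (B n). wt d \<beta> n h S * f S)"
    define sD where "sD = (\<Sum>S\<in>D. wt d \<beta> n h S * f S)"
    have DP: "D \<subseteq> Pow (B n)" by (auto simp: D_def Dplus_def)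
    then have De: "D - Pow (B n) = {}" by blast
    have ap': "Z n h (Pow (B n) - D) \<le> \<epsilon> * ZZ" using ap[OF n] unfolding D_def ZZ_def h_def .
    have "\<bar>s - sD\<bar> \<le> M * (Z n h (Pow (B n) - D) + Z n h (D - Pow (B n)))"
      unfolding s_def sD_def using M by (intro sum_diff_bound) (auto simp: D_def)
    then have "\<bar>s - sD\<bar> \<le> M * Z n h (Pow (B n) - D)" unfolding De by (simp add: Zw_def)
    also have "\<dots> \<le> M * (\<epsilon> * ZZ)" using ap' M by (intro mult_left_mono)
    finally have 1: "\<bar>s - sD\<bar> \<le> M * (\<epsilon> * ZZ)" .
    have "\<bar>sD - c * Z n h D\<bar> \<le> \<epsilon> * Z n h D" unfolding sD_def D_def using k0 km n by auto
    also have "\<dots> \<le> \<epsilon> * ZZ" unfolding ZZ_def using DP \<epsilon> by (intro mult_left_mono Zw_mono) auto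
    finally have 2: "\<bar>sD - c * Z n h D\<bar> \<le> \<epsilon> * ZZ" .
    have "ZZ = Z n h D + Z n h (Pow (B n) - D)" unfolding ZZ_def Zw_def using DP
      by (subst sum.subset_diff[of D]) auto
    then have "\<bar>Z n h D - ZZ\<bar> \<le> \<epsilon> * ZZ" using ap' Zw_nonneg[of d \<beta> n h "Pow (B n) - D"] by simp
    then have "\<bar>c\<bar> * \<bar>Z n h D - ZZ\<bar> \<le> \<bar>c\<bar> * (\<epsilon> * ZZ)" by (intro mult_left_mono) auto
    then have 3: "\<bar>c * Z n h D - c * ZZ\<bar> \<le> \<bar>c\<bar> * (\<epsilon> * ZZ)"
      by (simp add: abs_mult[symmetric] right_diff_distrib)
    have "\<bar>s - c * ZZ\<bar> \<le> M * (\<epsilon> * ZZ) + \<epsilon> * ZZ + \<bar>c\<bar> * (\<epsilon> * ZZ)" using 1 2 3 by linarith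
    also have "\<dots> = (M + \<bar>c\<bar> + 1) * \<epsilon> * ZZ" by (simp add: algebra_simps)
    also have "(M + \<bar>c\<bar> + 1) * \<epsilon> = \<delta> / 2" unfolding \<epsilon>_def using pos by (simp add: field_simps)
    finally have "\<bar>s - c * ZZ\<bar> < \<delta> * ZZ" using \<delta> Zp by (smt (verit) field_sum_of_halves mult_pos_pos distrib_right)
    moreover have "s / ZZ - c = (s - c * ZZ) / ZZ" using Zp by (simp add: field_simps)
    ultimately have "\<bar>s / ZZ - c\<bar> < \<delta>" using Zp by (simp add: abs_divide field_simps)
    then show "norm ((\<Sum>S\<in>Pow (B n). wt d \<beta> n (\<lambda>_. \<beta>) S * f S) / Z n (\<lambda>_. \<beta>) (Pow (B n)) - c) < \<delta>"
      unfolding s_def ZZ_def h_def by simp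
  qed
qed

lemma sum_compl:
  assumes loc: "local_on (B j) f" and j: "j \<le> n"
  shows "(\<Sum>S\<in>Pow (B n). wt d \<beta> n (\<lambda>x. - h x) S * f S) = (\<Sum>S\<in>Pow (B n). wt d \<beta> n h S * f (B j - S))"
proof (rule sum.reindex_bij_witness[of _ "\<lambda>S. B n - S" "\<lambda>S. B n - S"])
  fix S assume "S \<in> Pow (B n)"
  then have S: "S \<subseteq> B n" by simp
  then show "B n - (B n - S) = S" "B n - S \<in> Pow (B n)" by auto
  have "f (B j - (B n - S)) = f S" using box_mono[OF j] by (intro local_onD[OF loc]) auto
  then show "wt d \<beta> n h (B n - S) * f (B j - (B n - S)) = wt d \<beta> n (\<lambda>x. - h x) S * f S"
    using wt_compl[OF S] by simp
qed auto

lemma minus_field_limit: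
  assumes l: "0 < l" and loc: "local_on (B j) f" and lim: "plus_limit d \<beta> (\<lambda>S. f (B j - S)) c"
  shows "(\<lambda>n. (\<Sum>S\<in>Pow (B n). wt d \<beta> n (\<lambda>_. - \<beta>) S * f S) / Z n (\<lambda>_. - \<beta>) (Pow (B n))) \<longlonglongrightarrow> c"
proof -
  have locc: "local_on (B j) (\<lambda>S. f (B j - S))" unfolding local_on_def
    by (intro allI arg_cong[where f = f]) auto
  have "(\<lambda>n. (\<Sum>S\<in>Pow (B n). wt d \<beta> n (\<lambda>_. \<beta>) S * f (B j - S)) / Z n (\<lambda>_. \<beta>) (Pow (B n))) \<longlonglongrightarrow> c"
    by (rule plus_field_limit[OF l locc lim])
  moreover have "eventually (\<lambda>n. (\<Sum>S\<in>Pow (B n). wt d \<beta> n (\<lambda>_. \<beta>) S * f (B j - S)) / Z n (\<lambda>_. \<beta>) (Pow (B n))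
      = (\<Sum>S\<in>Pow (B n). wt d \<beta> n (\<lambda>_. - \<beta>) S * f S) / Z n (\<lambda>_. - \<beta>) (Pow (B n))) sequentially"
    using eventually_ge_at_top[of j]
  proof eventually_elim
    case (elim n)
    have "Z n (\<lambda>_. - \<beta>) (Pow (B n)) = Z n (\<lambda>_. \<beta>) (Pow (B n))"
      using Z_compl[of "Pow (B n)" n "\<lambda>_. \<beta>"] by (simp add: Pow_def)
    then show ?case using sum_compl[OF loc elim, of "\<lambda>_. \<beta>"] by simp
  qed
  ultimately show ?thesis by (rule Lim_transform_eventually)
qed

end

subsection \<open>Infinite-volume states\<close>

definition cfg :: "site set \<Rightarrow> config" where
  "cfg S x = (if x \<in> S then 1 else - 1)"

definition cylinder :: "nat \<Rightarrow> site set \<Rightarrow> site set \<Rightarrow> config set" where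
  "cylinder d J T = {\<omega> \<in> space (inf_space d). \<forall>x\<in>J. \<omega> x = cfg T x}"

lemma space_inf_space: "space (inf_space d) = PiE (lattice d) (\<lambda>_. {- 1, 1})"
  by (simp add: inf_space_def space_PiM)

lemma coord_measurable:
  assumes "x \<in> lattice d"
  shows "{\<omega> \<in> space (inf_space d). \<omega> x \<in> A} \<in> sets (inf_space d)"
proof -
  have m: "(\<lambda>\<omega>. \<omega> x) \<in> measurable (inf_space d) (count_space {- 1, 1})"
    unfolding inf_space_def using assms by (rule measurable_component_singleton)
  have "{\<omega> \<in> space (inf_space d). \<omega> x \<in> A} = (\<lambda>\<omega>. \<omega> x) -` (A \<inter> {- 1, 1}) \<inter> space (inf_space d)"
    using assms by (auto simp: space_inf_space PiE_def Pi_def)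
  also have "\<dots> \<in> sets (inf_space d)" by (rule measurable_sets[OF m]) simp
  finally show ?thesis .
qed

lemma sets_coords:
  assumes "finite J" "J \<subseteq> lattice d"
  shows "{\<omega> \<in> space (inf_space d). \<forall>x\<in>J. \<omega> x \<in> A x} \<in> sets (inf_space d)"
  using assms by (intro sets.sets_Collect_finite_All coord_measurable) auto

lemma sets_cylinder: "finite J \<Longrightarrow> J \<subseteq> lattice d \<Longrightarrow> cylinder d J T \<in> sets (inf_space d)"
  using sets_coords[of J d "\<lambda>x. {cfg T x}"] by (simp add: cylinder_def)

lemma space_state:
  assumes "is_state d \<nu>"
  shows "space \<nu> = space (inf_space d)"
  using assms unfolding is_state_def by (metis sets_eq_imp_space_eq)

lemma state_integral:
  assumes \<nu>: "is_state d \<nu>" and J: "finite J" "J \<subseteq> lattice d"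
    and f: "\<And>\<sigma> \<tau>. (\<forall>x\<in>J. \<sigma> x = \<tau> x) \<Longrightarrow> f \<sigma> = (f \<tau> :: real)"
  shows "integral\<^sup>L \<nu> f = (\<Sum>T\<in>Pow J. f (cfg T) * measure \<nu> (cylinder d J T))"
proof -
  interpret prob_space \<nu> using \<nu> by (simp add: is_state_def)
  have sp: "space \<nu> = space (inf_space d)" by (rule space_state[OF \<nu>])
  have sc: "cylinder d J T \<in> sets \<nu>" for T using sets_cylinder[OF J] \<nu> by (simp add: is_state_def)
  have "integral\<^sup>L \<nu> f = integral\<^sup>L \<nu> (\<lambda>\<omega>. \<Sum>T\<in>Pow J. f (cfg T) * indicator (cylinder d J T) \<omega>)"
  proof (rule Bochner_Integration.integral_cong[OF refl])
    fix \<omega> assume w: "\<omega> \<in> space \<nu>"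
    define T0 where "T0 = {x \<in> J. \<omega> x = 1}"
    have val: "\<omega> x = 1 \<or> \<omega> x = - 1" if "x \<in> J" for x
      using w J(2) that unfolding sp space_inf_space by (auto simp: PiE_def Pi_def)
    have ag: "\<omega> x = cfg T0 x" if "x \<in> J" for x using val[OF that] that by (auto simp: cfg_def T0_def)
    have iff: "\<omega> \<in> cylinder d J T \<longleftrightarrow> T = T0" if "T \<in> Pow J" for T
    proof
      assume "\<omega> \<in> cylinder d J T"
      then have "\<forall>x\<in>J. cfg T x = cfg T0 x" using ag by (auto simp: cylinder_def)
      then have "\<forall>x\<in>J. x \<in> T \<longleftrightarrow> x \<in> T0" by (auto simp: cfg_def split: if_splits)
      then show "T = T0" using that by (auto simp: T0_def)
    next
      assume "T = T0"
      then show "\<omega> \<in> cylinder d J T" using w ag by (auto simp: cylinder_def sp)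
    qed
    have "(\<Sum>T\<in>Pow J. f (cfg T) * indicator (cylinder d J T) \<omega>) = (\<Sum>T\<in>Pow J. if T = T0 then f (cfg T) else 0)"
      using iff by (intro sum.cong) (auto simp: indicator_def)
    also have "\<dots> = f (cfg T0)" using J by (subst sum.delta) (auto simp: T0_def)
    also have "\<dots> = f \<omega>" using ag by (intro f) auto
    finally show "f \<omega> = (\<Sum>T\<in>Pow J. f (cfg T) * indicator (cylinder d J T) \<omega>)" by simp
  qed
  also have "\<dots> = (\<Sum>T\<in>Pow J. integral\<^sup>L \<nu> (\<lambda>\<omega>. f (cfg T) * indicator (cylinder d J T) \<omega>))"
    using sc by (intro Bochner_Integration.integral_sum integrable_mult_right integrable_real_indicator) (auto simp: emeasure_eq_measure)
  also have "\<dots> = (\<Sum>T\<in>Pow J. f (cfg T) * measure \<nu> (cylinder d J T))"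
    using sets.sets_into_space[OF sc] by (intro sum.cong refl) (simp add: Int_absorb2)
  finally show ?thesis .
qed

text \<open>Indicators of cylinder sets are local and determine a measure on the product; this is
  what gives the definite descriptions in \<open>plus_state\<close> and \<open>minus_state\<close>
  their meaning.\<close>

lemma state_unique:
  assumes \<nu>: "is_state d \<nu>" and \<mu>: "is_state d \<mu>"
    and eq: "\<And>f. local_fun d f \<Longrightarrow> integral\<^sup>L \<nu> f = integral\<^sup>L \<mu> f"
  shows "\<nu> = \<mu>"
proof -
  have ps: "prob_space \<nu>" "prob_space \<mu>" and se: "sets \<nu> = sets (inf_space d)" "sets \<mu> = sets (inf_space d)"
    using \<nu> \<mu> by (auto simp: is_state_def)
  show ?thesis
  proof (rule measure_eqI_PiM_infinite[of \<nu> "lattice d" "\<lambda>_. count_space {- 1, 1}" \<mu>])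
    show "finite_measure \<nu>" using ps by (simp add: prob_space.finite_measure)
    fix A :: "site \<Rightarrow> real set" and J assume J: "finite J" "J \<subseteq> lattice d"
    define f where "f \<omega> = (if \<forall>x\<in>J. \<omega> x \<in> A x then 1 else 0 :: real)" for \<omega>
    define X where "X = {\<omega> \<in> space (inf_space d). \<forall>x\<in>J. \<omega> x \<in> A x}"
    have emb: "prod_emb (lattice d) (\<lambda>_. count_space {- 1, 1}) J (Pi\<^sub>E J A) = X"
      using J unfolding prod_emb_def X_def space_inf_space by auto
    have loc: "local_fun d f" unfolding local_fun_def f_def using J by (intro exI[of _ J]) auto
    have I: "integral\<^sup>L \<rho> f = measure \<rho> X" if r: "is_state d \<rho>" for \<rho>
    proof -
      have sp: "space \<rho> = space (inf_space d)" by (rule space_state[OF r])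
      have "integral\<^sup>L \<rho> f = integral\<^sup>L \<rho> (indicator X)"
        by (rule Bochner_Integration.integral_cong[OF refl]) (auto simp: f_def X_def sp indicator_def)
      also have "\<dots> = measure \<rho> (X \<inter> space \<rho>)" by simp
      also have "X \<inter> space \<rho> = X" unfolding sp X_def by auto
      finally show ?thesis .
    qed
    have "measure \<nu> X = measure \<mu> X" using I[OF \<nu>] I[OF \<mu>] eq[OF loc] by simp
    then show "emeasure \<nu> (prod_emb (lattice d) (\<lambda>_. count_space {- 1, 1}) J (Pi\<^sub>E J A))
       = emeasure \<mu> (prod_emb (lattice d) (\<lambda>_. count_space {- 1, 1}) J (Pi\<^sub>E J A))"
      unfolding emb using ps by (simp add: finite_measure.emeasure_eq_measure prob_space.finite_measure)
  qed (use se in \<open>auto simp: inf_space_def\<close>)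
qed

lemma finite_pmf_exists:
  fixes f :: "'a \<Rightarrow> real"
  assumes "finite A" "\<And>x. x \<in> A \<Longrightarrow> 0 \<le> f x" "sum f A = 1"
  shows "\<exists>p. \<forall>x. pmf p x = (if x \<in> A then f x else 0)"
proof (intro exI allI, rule pmf_embed_pmf)
  have "(\<integral>\<^sup>+ x. ennreal (if x \<in> A then f x else 0) \<partial>count_space UNIV) = (\<Sum>x\<in>A. ennreal (if x \<in> A then f x else 0))"
    using assms by (intro nn_integral_count_space') auto
  also have "\<dots> = ennreal (\<Sum>x\<in>A. if x \<in> A then f x else 0)" using assms by (intro sum_ennreal) auto
  also have "\<dots> = 1" using assms by simp
  finally show "(\<integral>\<^sup>+ x. ennreal (if x \<in> A then f x else 0) \<partial>count_space UNIV) = 1" .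
qed (use assms in auto)

text \<open>Daniell-Kolmogorov extension for spin marginals, given as weights \<open>m J T\<close>
  of the plus sets \<open>T\<close> in finite windows \<open>J\<close>. The marginals are realized
  on real coordinates, where the extension for Polish spaces lives, and the limit is carried back to
  \<open>inf_space d\<close> by \<open>g\<close>, which sends every value other than
  \<open>1\<close> to \<open>- 1\<close>.\<close>

lemma projective_state:
  fixes m :: "site set \<Rightarrow> site set \<Rightarrow> real"
  assumes nn: "\<And>J T. finite J \<Longrightarrow> J \<subseteq> lattice d \<Longrightarrow> T \<subseteq> J \<Longrightarrow> 0 \<le> m J T"
    and one: "\<And>J. finite J \<Longrightarrow> J \<subseteq> lattice d \<Longrightarrow> (\<Sum>T\<in>Pow J. m J T) = 1"
    and cons: "\<And>J K T. finite J \<Longrightarrow> J \<subseteq> lattice d \<Longrightarrow> K \<subseteq> J \<Longrightarrow> T \<subseteq> K \<Longrightarrow>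
      (\<Sum>T'\<in>{T' \<in> Pow J. T' \<inter> K = T}. m J T') = m K T"
  shows "\<exists>\<nu>. is_state d \<nu> \<and> (\<forall>J T. finite J \<longrightarrow> J \<subseteq> lattice d \<longrightarrow> T \<subseteq> J \<longrightarrow> measure \<nu> (cylinder d J T) = m J T)"
proof -
  define fin where "fin J \<longleftrightarrow> finite J \<and> J \<subseteq> lattice d" for J
  have "\<forall>J. \<exists>p. fin J \<longrightarrow> (\<forall>T. pmf p T = (if T \<in> Pow J then m J T else 0))"
  proof
    fix J
    show "\<exists>p. fin J \<longrightarrow> (\<forall>T. pmf p T = (if T \<in> Pow J then m J T else 0))"
    proof (cases "fin J")
      case True
      then show ?thesis using finite_pmf_exists[of "Pow J" "m J"] nn[of J] one[of J] by (auto simp: fin_def)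
    qed simp
  qed
  then obtain p where p: "\<And>J T. fin J \<Longrightarrow> pmf (p J) T = (if T \<in> Pow J then m J T else 0)"
    by metis
  have sp: "set_pmf (p J) \<subseteq> Pow J" if "fin J" for J
    using p[OF that] by (auto simp: set_pmf_eq split: if_splits)
  have prob: "measure_pmf.prob (p J) X = (\<Sum>T\<in>Pow J \<inter> X. m J T)" if J: "fin J" for J X
  proof -
    have "measure_pmf.prob (p J) X = measure_pmf.prob (p J) (Pow J \<inter> X)"
      by (rule measure_prob_cong_0) (use sp[OF J] in \<open>auto simp: set_pmf_eq\<close>)
    also have "\<dots> = (\<Sum>T\<in>Pow J \<inter> X. pmf (p J) T)" using J by (intro measure_measure_pmf_finite) (auto simp: fin_def)
    also have "\<dots> = (\<Sum>T\<in>Pow J \<inter> X. m J T)" using p[OF J] by (intro sum.cong) auto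
    finally show ?thesis .
  qed
  have pcons: "p K = map_pmf (\<lambda>T. T \<inter> K) (p J)" if J: "fin J" and K: "K \<subseteq> J" for J K
  proof (rule pmf_eqI)
    fix T
    have fK: "fin K" using J K by (auto simp: fin_def intro: finite_subset)
    have "pmf (map_pmf (\<lambda>T. T \<inter> K) (p J)) T = measure_pmf.prob (p J) ((\<lambda>T. T \<inter> K) -` {T})"
      by (simp add: pmf_map)
    also have "\<dots> = (\<Sum>T'\<in>{T' \<in> Pow J. T' \<inter> K = T}. m J T')"
      unfolding prob[OF J] by (intro sum.cong) auto
    also have "\<dots> = (if T \<in> Pow K then m K T else 0)"
      using cons[of J K T] J K by (auto simp: fin_def intro!: sum.neutral)
    finally show "pmf (p K) T = pmf (map_pmf (\<lambda>T. T \<inter> K) (p J)) T" using p[OF fK] by simp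
  qed
  define P where "P J = distr (measure_pmf (p J)) (PiM J (\<lambda>_. borel)) (\<lambda>T. restrict (cfg T) J)" for J
  have meas: "(\<lambda>T. restrict (cfg T) J) \<in> measurable (measure_pmf q) (PiM J (\<lambda>_. borel))" for J q
    by (auto simp: space_PiM)
  have pf: "polish_projective (lattice d) P"
    unfolding polish_projective_def projective_family_def
  proof (intro conjI allI impI)
    fix K J :: "site set" assume KJ: "K \<subseteq> J" "finite J" "J \<subseteq> lattice d"
    then have J: "fin J" by (simp add: fin_def)
    have "distr (P J) (PiM K (\<lambda>_. borel)) (\<lambda>f. restrict f K)
        = distr (measure_pmf (p J)) (PiM K (\<lambda>_. borel)) ((\<lambda>f. restrict f K) \<circ> (\<lambda>T. restrict (cfg T) J))"
      unfolding P_def by (rule distr_distr[OF measurable_restrict_subset[OF KJ(1)] meas])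
    also have "(\<lambda>f. restrict f K) \<circ> (\<lambda>T. restrict (cfg T) J) = (\<lambda>T. restrict (cfg T) K) \<circ> (\<lambda>T. T \<inter> K)"
      using KJ by (auto simp: fun_eq_iff restrict_def cfg_def)
    also have "distr (measure_pmf (p J)) (PiM K (\<lambda>_. borel)) ((\<lambda>T. restrict (cfg T) K) \<circ> (\<lambda>T. T \<inter> K))
        = distr (distr (measure_pmf (p J)) (count_space UNIV) (\<lambda>T. T \<inter> K)) (PiM K (\<lambda>_. borel)) (\<lambda>T. restrict (cfg T) K)"
      by (subst distr_distr) (auto simp: space_PiM)
    also have "\<dots> = P K" unfolding P_def pcons[OF J KJ(1)] map_pmf_rep_eq ..
    finally show "P K = distr (P J) (PiM K (\<lambda>_. borel)) (\<lambda>f. restrict f K)" by (rule sym)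
  next
    fix J
    show "prob_space (P J)" unfolding P_def using meas by (intro measure_pmf.prob_space_distr)
  qed
  interpret PP: polish_projective "lattice d" P by (rule pf)
  define g where "g \<omega> = (\<lambda>x\<in>lattice d. if \<omega> x = 1 then 1 else - 1 :: real)" for \<omega> :: config
  have gm: "g \<in> measurable PP.lim (inf_space d)"
    unfolding g_def inf_space_def
  proof (rule measurable_restrict)
    fix x assume x: "x \<in> lattice d"
    have c: "(\<lambda>\<omega>. \<omega> x) \<in> measurable PP.lim borel"
      using measurable_component_singleton[OF x, of "\<lambda>_. borel"] by (simp cong: measurable_cong_sets)
    have e: "(\<lambda>\<omega>. if \<omega> x = 1 then 1 else - 1 :: real) -` A \<inter> space PP.lim \<in> sets PP.lim" for A
    proof -
      have s1: "{\<omega> \<in> space PP.lim. \<omega> x = 1} \<in> sets PP.lim" using c by measurable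
      have "(\<lambda>\<omega>. if \<omega> x = 1 then 1 else - 1 :: real) -` A \<inter> space PP.lim
        = (if 1 \<in> A then {\<omega> \<in> space PP.lim. \<omega> x = 1} else {}) \<union>
          (if - 1 \<in> A then space PP.lim - {\<omega> \<in> space PP.lim. \<omega> x = 1} else {})"
        by (auto split: if_splits)
      also have "\<dots> \<in> sets PP.lim" using s1 by auto
      finally show ?thesis .
    qed
    show "(\<lambda>\<omega>. if \<omega> x = 1 then 1 else - 1 :: real) \<in> measurable PP.lim (count_space {- 1, 1})"
      by (rule measurableI, simp, rule e)
  qed
  define \<nu> where "\<nu> = distr PP.lim (inf_space d) g"
  have "is_state d \<nu>" unfolding is_state_def \<nu>_def using gm by (auto intro!: PP.P.prob_space_distr)
  moreover have "measure \<nu> (cylinder d J T) = m J T" if J: "finite J" "J \<subseteq> lattice d" "T \<subseteq> J" for J T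
  proof -
    have fJ: "fin J" using J by (simp add: fin_def)
    define X where "X = {\<omega> \<in> space (PiM J (\<lambda>_. borel :: real measure)). \<forall>x\<in>J. (\<omega> x = 1) = (x \<in> T)}"
    have XS: "X \<in> sets (PiM J (\<lambda>_. borel))" unfolding X_def
    proof (rule sets.sets_Collect_finite_All)
      fix x assume x: "x \<in> J"
      have c: "(\<lambda>\<omega>. \<omega> x) \<in> measurable (PiM J (\<lambda>_. borel :: real measure)) borel"
        using measurable_component_singleton[OF x, of "\<lambda>_. borel"] by simp
      show "{\<omega> \<in> space (PiM J (\<lambda>_. borel :: real measure)). (\<omega> x = 1) = (x \<in> T)} \<in> sets (PiM J (\<lambda>_. borel))"
        using c by (cases "x \<in> T") (simp_all, measurable)
    qed (rule J(1))
    have "measure \<nu> (cylinder d J T) = measure PP.lim (g -` cylinder d J T \<inter> space PP.lim)"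
      unfolding \<nu>_def using J by (intro measure_distr gm sets_cylinder)
    also have "g -` cylinder d J T \<inter> space PP.lim = prod_emb (lattice d) (\<lambda>_. borel) J X"
    proof (rule set_eqI)
      fix \<omega>
      have gs: "\<omega> \<in> space PP.lim \<Longrightarrow> g \<omega> \<in> space (inf_space d)" using gm by (rule measurable_space)
      have "\<omega> \<in> g -` cylinder d J T \<inter> space PP.lim \<longleftrightarrow> \<omega> \<in> space PP.lim \<and> (\<forall>x\<in>J. g \<omega> x = cfg T x)"
        using gs by (auto simp: cylinder_def)
      also have "\<dots> \<longleftrightarrow> \<omega> \<in> space PP.lim \<and> (\<forall>x\<in>J. (\<omega> x = 1) = (x \<in> T))"
        using J(2) by (auto simp: g_def cfg_def subset_iff split: if_splits)
      also have "\<dots> \<longleftrightarrow> \<omega> \<in> prod_emb (lattice d) (\<lambda>_. borel) J X"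
        by (auto simp: prod_emb_def X_def space_PiM)
      finally show "\<omega> \<in> g -` cylinder d J T \<inter> space PP.lim \<longleftrightarrow> \<omega> \<in> prod_emb (lattice d) (\<lambda>_. borel) J X" .
    qed
    also have "measure PP.lim (prod_emb (lattice d) (\<lambda>_. borel) J X) = measure (P J) X"
      using J XS by (intro PP.measure_lim_emb)
    also have "\<dots> = measure_pmf.prob (p J) ((\<lambda>T. restrict (cfg T) J) -` X \<inter> space (measure_pmf (p J)))"
      unfolding P_def by (rule measure_distr[OF meas XS])
    also have "\<dots> = (\<Sum>T'\<in>Pow J \<inter> ((\<lambda>T. restrict (cfg T) J) -` X \<inter> space (measure_pmf (p J))). m J T')"
      by (rule prob[OF fJ])
    also have "Pow J \<inter> ((\<lambda>T. restrict (cfg T) J) -` X \<inter> space (measure_pmf (p J))) = {T}"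
    proof (rule set_eqI)
      fix T'
      have "T' \<in> Pow J \<inter> ((\<lambda>T. restrict (cfg T) J) -` X \<inter> space (measure_pmf (p J)))
         \<longleftrightarrow> T' \<subseteq> J \<and> (\<forall>x\<in>J. (cfg T' x = 1) = (x \<in> T))"
        by (auto simp: X_def space_PiM)
      also have "\<dots> \<longleftrightarrow> T' \<subseteq> J \<and> (\<forall>x\<in>J. (x \<in> T') = (x \<in> T))" by (auto simp: cfg_def)
      also have "\<dots> \<longleftrightarrow> T' \<in> {T}" using J(3) by auto
      finally show "T' \<in> Pow J \<inter> ((\<lambda>T. restrict (cfg T) J) -` X \<inter> space (measure_pmf (p J))) \<longleftrightarrow> T' \<in> {T}" .
    qed
    finally show ?thesis by simp
  qed
  ultimately show ?thesis by blast
qed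

section \<open>Translation between spin configurations and plus sets\<close>

lemma up_neq: "up x i \<noteq> x"
  by (auto simp: up_def fun_eq_iff)

lemma up_inj:
  assumes "up x i = up x j"
  shows "i = j"
proof (rule ccontr)
  assume "i \<noteq> j"
  then show False using fun_cong[OF assms, of i] by (auto simp: up_def)
qed

lemma up_up_neq: "up (up x i) j \<noteq> x"
proof
  assume "up (up x i) j = x"
  from fun_cong[OF this, of i] show False by (auto simp: up_def split: if_splits)
qed

text \<open>Two different codes of one pair would have exchanged endpoints, but two upward steps
  never lead back.\<close>

lemma bij_bonds_edges: "bij_betw (\<lambda>(x, i). {x, up x i}) (bonds d n) (edges d n)"
proof (rule bij_betwI')
  fix p q assume "p \<in> bonds d n" "q \<in> bonds d n"
  obtain x i y j where pq: "p = (x, i)" "q = (y, j)" by (metis surj_pair)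
  have "{x, up x i} = {y, up y j} \<Longrightarrow> x = y \<and> i = j"
    unfolding doubleton_eq_iff using up_inj up_up_neq by metis
  then show "((case p of (x, i) \<Rightarrow> {x, up x i}) = (case q of (x, i) \<Rightarrow> {x, up x i})) = (p = q)"
    unfolding pq by auto
next
  fix p assume "p \<in> bonds d n"
  then obtain x i where p: "p = (x, i)" "i < d" "x \<in> box d n" "up x i \<in> box d n" by (auto simp: bonds_def)
  then have "adj d x (up x i)" by (auto simp: adj_iff nb_up mem_box)
  then show "(case p of (x, i) \<Rightarrow> {x, up x i}) \<in> edges d n" using p by (auto simp: edges_def)
next
  fix e assume "e \<in> edges d n"
  then obtain x y where xy: "e = {x, y}" "x \<in> box d n" "y \<in> box d n" "adj d x y" by (auto simp: edges_def)
  then obtain i where i: "i < d" "y = up x i \<or> x = up y i" by (auto simp: adj_iff nb_def)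
  then show "\<exists>p\<in>bonds d n. e = (case p of (x, i) \<Rightarrow> {x, up x i})"
  proof (elim disjE)
    assume "y = up x i"
    then show ?thesis using xy i by (intro bexI[of _ "(x, i)"]) (auto simp: bonds_def)
  next
    assume "x = up y i"
    then show ?thesis using xy i by (intro bexI[of _ "(y, i)"]) (auto simp: bonds_def)
  qed
qed

lemma exp_hamiltonian:
  assumes "S \<subseteq> box d n"
  shows "exp (- hamiltonian d \<beta> n h (restrict (cfg S) (box d n))) = wt d \<beta> n h S"
proof -
  define \<sigma> where "\<sigma> = restrict (cfg S) (box d n)"
  have "(\<Sum>e\<in>edges d n. (\<Prod>z\<in>e. \<sigma> z) - 1) = (\<Sum>p\<in>bonds d n. (\<Prod>z\<in>(case p of (x, i) \<Rightarrow> {x, up x i}). \<sigma> z) - 1)"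
    by (rule sum.reindex_bij_betw[OF bij_bonds_edges, symmetric])
  also have "\<dots> = (\<Sum>p\<in>bonds d n. if p \<in> bd d n S then - 2 else 0)"
  proof (rule sum.cong[OF refl])
    fix p assume p: "p \<in> bonds d n"
    obtain x i where pq: "p = (x, i)" by (cases p)
    have "x \<in> box d n" "up x i \<in> box d n" using p pq by (auto simp: bonds_def)
    then have s: "\<sigma> x = cfg S x" "\<sigma> (up x i) = cfg S (up x i)" by (auto simp: \<sigma>_def)
    have "(\<Prod>z\<in>{x, up x i}. \<sigma> z) = \<sigma> x * \<sigma> (up x i)" using up_neq[of x i] by simp
    then show "(\<Prod>z\<in>(case p of (x, i) \<Rightarrow> {x, up x i}). \<sigma> z) - 1 = (if p \<in> bd d n S then - 2 else 0)"
      using p unfolding pq s by (auto simp: bd_def cfg_def)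
  qed
  also have "\<dots> = - 2 * real (card (bd d n S))"
    using bd_subset[of d n S] by (subst sum.inter_restrict[symmetric]) (auto simp: Int_absorb1)
  finally have 1: "(\<Sum>e\<in>edges d n. (\<Prod>z\<in>e. \<sigma> z) - 1) = - 2 * real (card (bd d n S))" .
  have 2: "(\<Sum>x\<in>bdry d n. h x * \<sigma> x) = (\<Sum>x\<in>bdry d n. h x * (if x \<in> S then 1 else - 1))"
    by (intro sum.cong) (auto simp: \<sigma>_def cfg_def bdry_def)
  show ?thesis unfolding \<sigma>_def[symmetric] hamiltonian_def wt_def 1 2 by simp
qed

lemma bij_configs: "bij_betw (\<lambda>S. restrict (cfg S) (box d n)) (Pow (box d n)) (configs d n)"
proof (rule bij_betwI')
  fix S T assume ST: "S \<in> Pow (box d n)" "T \<in> Pow (box d n)"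
  show "(restrict (cfg S) (box d n) = restrict (cfg T) (box d n)) = (S = T)"
  proof
    assume e: "restrict (cfg S) (box d n) = restrict (cfg T) (box d n)"
    have "x \<in> S \<longleftrightarrow> x \<in> T" if "x \<in> box d n" for x
      using fun_cong[OF e, of x] that by (auto simp: cfg_def split: if_splits)
    then show "S = T" using ST by auto
  qed simp
next
  fix S show "restrict (cfg S) (box d n) \<in> configs d n" by (auto simp: configs_def cfg_def)
next
  fix \<sigma> assume s: "\<sigma> \<in> configs d n"
  define S where "S = {x \<in> box d n. \<sigma> x = 1}"
  have "\<sigma> = restrict (cfg S) (box d n)"
  proof
    fix x
    show "\<sigma> x = restrict (cfg S) (box d n) x"
    proof (cases "x \<in> box d n")
      case True
      then have "\<sigma> x \<in> {- 1, 1}" using s by (auto simp: configs_def PiE_def Pi_def)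
      then show ?thesis using True by (auto simp: S_def cfg_def)
    next
      case False
      then show ?thesis using s by (auto simp: configs_def PiE_def extensional_def)
    qed
  qed
  then show "\<exists>S\<in>Pow (box d n). \<sigma> = restrict (cfg S) (box d n)" by (intro bexI[of _ S]) (auto simp: S_def)
qed

lemma gibbs_exp_sets:
  "gibbs_exp d \<beta> n h f = (\<Sum>S\<in>Pow (box d n). wt d \<beta> n h S * f (extend d n (restrict (cfg S) (box d n)))) / Zw d \<beta> n h (Pow (box d n))"
proof -
  have "(\<Sum>\<sigma>\<in>configs d n. exp (- hamiltonian d \<beta> n h \<sigma>) * g \<sigma>) =
      (\<Sum>S\<in>Pow (box d n). wt d \<beta> n h S * g (restrict (cfg S) (box d n)))" for g
    unfolding sum.reindex_bij_betw[OF bij_configs, symmetric]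
    by (intro sum.cong refl arg_cong2[where f = "(*)"] exp_hamiltonian) auto
  from this[of "\<lambda>_. 1"] this[of "\<lambda>\<sigma>. f (extend d n \<sigma>)"] show ?thesis
    unfolding gibbs_exp_def partition_fn_def Zw_def by simp
qed

lemma finite_subset_box:
  assumes "finite A" "A \<subseteq> lattice d"
  shows "\<exists>j. A \<subseteq> box d j"
  using assms
proof (induction A rule: finite_induct)
  case (insert x A)
  then obtain j where j: "A \<subseteq> box d j" by auto
  define M where "M = (\<Sum>i<d. nat \<bar>x i\<bar>)"
  define k where "k = 2 * M + 1"
  have "nat \<bar>x i\<bar> \<le> M" if "i < d" for i unfolding M_def using that by (intro member_le_sum) auto
  then have "\<bar>x i\<bar> \<le> int M" if "i < d" for i using that by (metis nat_le_iff)
  moreover have "lo k = - int M" "hi k = int M" unfolding lo_def hi_def k_def by simp_all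
  ultimately have "x \<in> box d k" using insert by (auto simp: mem_box abs_le_iff) (metis minus_le_iff)
  then have "insert x A \<subseteq> box d (max j k)" using j box_mono[of j "max j k" d] box_mono[of k "max j k" d] by auto
  then show ?case by blast
qed auto

lemma gibbs_exp_local:
  assumes J: "J \<subseteq> box d j" and n: "j \<le> n" and f: "\<And>\<sigma> \<tau>. (\<forall>x\<in>J. \<sigma> x = \<tau> x) \<Longrightarrow> f \<sigma> = (f \<tau> :: real)"
  shows "gibbs_exp d \<beta> n h f = (\<Sum>S\<in>Pow (box d n). wt d \<beta> n h S * f (cfg (S \<inter> J))) / Zw d \<beta> n h (Pow (box d n))"
proof -
  have "f (extend d n (restrict (cfg S) (box d n))) = f (cfg (S \<inter> J))" for S
    using J box_mono[OF n, of d] by (intro f) (auto simp: extend_def cfg_def)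
  then show ?thesis unfolding gibbs_exp_sets by simp
qed

lemma local_funE:
  assumes "local_fun d f"
  obtains J where "finite J" "J \<subseteq> lattice d" "\<And>\<sigma> \<tau>. (\<forall>x\<in>J. \<sigma> x = \<tau> x) \<Longrightarrow> f \<sigma> = f \<tau>"
proof -
  obtain J where J: "finite J \<and> J \<subseteq> lattice d \<and> (\<forall>\<sigma> \<tau>. (\<forall>x\<in>J. \<sigma> x = \<tau> x) \<longrightarrow> f \<sigma> = f \<tau>)"
    using assms unfolding local_fun_def by (rule exE)
  show thesis
  proof (rule that[of J])
    show "f \<sigma> = f \<tau>" if "\<forall>x\<in>J. \<sigma> x = \<tau> x" for \<sigma> \<tau>
      by (rule conjunct2[OF conjunct2[OF J], THEN spec, THEN spec, THEN mp, OF that])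
  qed (use J in simp_all)
qed

text \<open>Cylinder probabilities converge by assumption, and normalization and consistency pass to
  the limit because only finite sums are involved. A local function is a finite combination of
  cylinder indicators, so its limit is the integral against the extended measure.\<close>

lemma state_of_limits:
  assumes conv: "\<And>f. local_fun d f \<Longrightarrow> convergent (\<lambda>n. gibbs_exp d \<beta> n h f)"
  shows "\<exists>\<nu>. is_state d \<nu> \<and> (\<forall>f. local_fun d f \<longrightarrow> (\<lambda>n. gibbs_exp d \<beta> n h f) \<longlonglongrightarrow> integral\<^sup>L \<nu> f)"
proof -
  define E where "E n g = (\<Sum>S\<in>Pow (box d n). wt d \<beta> n h S * g S) / Zw d \<beta> n h (Pow (box d n))" for n and g :: "site set \<Rightarrow> real"
  have Zp: "0 < Zw d \<beta> n h (Pow (box d n))" for n unfolding Zw_def by (intro sum_pos wt_pos) auto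
  have E1: "E n (\<lambda>_. 1) = 1" for n using Zp[of n] unfolding E_def by (simp add: Zw_def)
  have Esum: "E n (\<lambda>S. \<Sum>i\<in>I. c i * g i S) = (\<Sum>i\<in>I. c i * E n (g i))" if "finite I" for n I c g
  proof -
    have "(\<Sum>S\<in>Pow (box d n). wt d \<beta> n h S * (\<Sum>i\<in>I. c i * g i S)) = (\<Sum>S\<in>Pow (box d n). \<Sum>i\<in>I. c i * (wt d \<beta> n h S * g i S))"
      by (simp add: sum_distrib_left mult_ac)
    also have "\<dots> = (\<Sum>i\<in>I. \<Sum>S\<in>Pow (box d n). c i * (wt d \<beta> n h S * g i S))" by (rule sum.swap)
    also have "\<dots> = (\<Sum>i\<in>I. c i * (\<Sum>S\<in>Pow (box d n). wt d \<beta> n h S * g i S))" by (simp add: sum_distrib_left)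
    finally have eq: "(\<Sum>S\<in>Pow (box d n). wt d \<beta> n h S * (\<Sum>i\<in>I. c i * g i S))
        = (\<Sum>i\<in>I. c i * (\<Sum>S\<in>Pow (box d n). wt d \<beta> n h S * g i S))" .
    show ?thesis unfolding E_def eq by (subst sum_divide_distrib) simp
  qed
  define ind where "ind J T S = (if S \<inter> J = T then 1 else 0 :: real)" for J T S :: "site set"
  have indsum: "g (S \<inter> J) = (\<Sum>T\<in>Pow J. g T * ind J T S)" if "finite J" for g :: "site set \<Rightarrow> real" and S J
    unfolding ind_def using that by (simp add: if_distrib cong: if_cong)
  define m where "m J T = lim (\<lambda>n. E n (ind J T))" for J T
  have lim: "(\<lambda>n. E n (ind J T)) \<longlonglongrightarrow> m J T" if J: "finite J" "J \<subseteq> lattice d" and T: "T \<subseteq> J" for J T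
  proof -
    define f where "f \<sigma> = (if \<forall>x\<in>J. \<sigma> x = cfg T x then 1 else 0 :: real)" for \<sigma>
    have fc: "\<And>\<sigma> \<tau>. (\<forall>x\<in>J. \<sigma> x = \<tau> x) \<Longrightarrow> f \<sigma> = f \<tau>" by (auto simp: f_def)
    have "local_fun d f" unfolding local_fun_def using J fc by blast
    then have c: "convergent (\<lambda>n. gibbs_exp d \<beta> n h f)" by (rule conv)
    obtain j where j: "J \<subseteq> box d j" using finite_subset_box[OF J] by auto
    have fe: "f (cfg (S \<inter> J)) = ind J T S" for S
    proof -
      have "(\<forall>x\<in>J. cfg (S \<inter> J) x = cfg T x) \<longleftrightarrow> S \<inter> J = T" using T by (auto simp: cfg_def split: if_splits)
      then show ?thesis by (simp add: f_def ind_def)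
    qed
    have "gibbs_exp d \<beta> n h f = E n (ind J T)" if "j \<le> n" for n
    proof -
      have "gibbs_exp d \<beta> n h f = (\<Sum>S\<in>Pow (box d n). wt d \<beta> n h S * f (cfg (S \<inter> J))) / Zw d \<beta> n h (Pow (box d n))"
        by (rule gibbs_exp_local[OF j that], rule fc)
      then show ?thesis unfolding E_def fe .
    qed
    then have "eventually (\<lambda>n. gibbs_exp d \<beta> n h f = E n (ind J T)) sequentially"
      unfolding eventually_sequentially by blast
    then have "convergent (\<lambda>n. E n (ind J T))" using c convergent_cong[of "\<lambda>n. gibbs_exp d \<beta> n h f" "\<lambda>n. E n (ind J T)"] by simp
    then show ?thesis unfolding m_def by (simp add: convergent_LIMSEQ_iff)
  qed
  have "\<exists>\<nu>. is_state d \<nu> \<and> (\<forall>J T. finite J \<longrightarrow> J \<subseteq> lattice d \<longrightarrow> T \<subseteq> J \<longrightarrow> measure \<nu> (cylinder d J T) = m J T)"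
  proof (rule projective_state)
    fix J T :: "site set" assume J: "finite J" "J \<subseteq> lattice d" "T \<subseteq> J"
    show "0 \<le> m J T"
      by (rule LIMSEQ_le_const[OF lim[OF J]], intro exI[of _ 0] allI impI)
        (auto simp: E_def ind_def intro!: divide_nonneg_nonneg sum_nonneg Zw_nonneg mult_nonneg_nonneg less_imp_le[OF wt_pos])
  next
    fix J :: "site set" assume J: "finite J" "J \<subseteq> lattice d"
    have "(\<lambda>n. \<Sum>T\<in>Pow J. E n (ind J T)) \<longlonglongrightarrow> (\<Sum>T\<in>Pow J. m J T)"
      using J by (intro tendsto_sum lim) auto
    moreover have "(\<Sum>T\<in>Pow J. E n (ind J T)) = 1" for n
      using Esum[of "Pow J" n "\<lambda>_. 1" "ind J"] indsum[OF J(1), of "\<lambda>_. 1"] E1[of n] J by simp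
    ultimately show "(\<Sum>T\<in>Pow J. m J T) = 1" by (simp add: LIMSEQ_const_iff)
  next
    fix J K T :: "site set" assume J: "finite J" "J \<subseteq> lattice d" "K \<subseteq> J" "T \<subseteq> K"
    have fK: "finite K" "K \<subseteq> lattice d" using J by (auto intro: finite_subset)
    have "(\<lambda>n. \<Sum>T'\<in>{T' \<in> Pow J. T' \<inter> K = T}. E n (ind J T')) \<longlonglongrightarrow> (\<Sum>T'\<in>{T' \<in> Pow J. T' \<inter> K = T}. m J T')"
      using J by (intro tendsto_sum lim) auto
    moreover have "(\<Sum>T'\<in>{T' \<in> Pow J. T' \<inter> K = T}. E n (ind J T')) = E n (ind K T)" for n
    proof -
      have "ind K T S = (\<Sum>T'\<in>{T' \<in> Pow J. T' \<inter> K = T}. 1 * ind J T' S)" for S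
      proof -
        have "(S \<inter> J) \<inter> K = S \<inter> K" using J by auto
        then have "ind K T S = ind K T (S \<inter> J)" by (simp add: ind_def)
        also have "\<dots> = (\<Sum>T'\<in>Pow J. ind K T T' * ind J T' S)" by (rule indsum[OF J(1)])
        also have "\<dots> = (\<Sum>T'\<in>{T' \<in> Pow J. T' \<inter> K = T}. 1 * ind J T' S)"
          using J by (intro sum.mono_neutral_cong_right) (auto simp: ind_def)
        finally show ?thesis .
      qed
      then have "ind K T = (\<lambda>S. \<Sum>T'\<in>{T' \<in> Pow J. T' \<inter> K = T}. 1 * ind J T' S)" by (rule ext)
      then have "E n (ind K T) = E n (\<lambda>S. \<Sum>T'\<in>{T' \<in> Pow J. T' \<inter> K = T}. 1 * ind J T' S)" by (rule arg_cong)
      also have "\<dots> = (\<Sum>T'\<in>{T' \<in> Pow J. T' \<inter> K = T}. 1 * E n (ind J T'))"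
        using J by (intro Esum) auto
      finally show ?thesis by simp
    qed
    ultimately have "(\<lambda>n. E n (ind K T)) \<longlonglongrightarrow> (\<Sum>T'\<in>{T' \<in> Pow J. T' \<inter> K = T}. m J T')" by simp
    then show "(\<Sum>T'\<in>{T' \<in> Pow J. T' \<inter> K = T}. m J T') = m K T"
      using lim[OF fK J(4)] LIMSEQ_unique by blast
  qed
  then obtain \<nu> where \<nu>: "is_state d \<nu>"
    and cyl: "\<And>J T. finite J \<Longrightarrow> J \<subseteq> lattice d \<Longrightarrow> T \<subseteq> J \<Longrightarrow> measure \<nu> (cylinder d J T) = m J T" by blast
  have "(\<lambda>n. gibbs_exp d \<beta> n h f) \<longlonglongrightarrow> integral\<^sup>L \<nu> f" if lf: "local_fun d f" for f
  proof -
    obtain J where J: "finite J" "J \<subseteq> lattice d" and fc: "\<And>\<sigma> \<tau>. (\<forall>x\<in>J. \<sigma> x = \<tau> x) \<Longrightarrow> f \<sigma> = f \<tau>"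
      using local_funE[OF lf] by metis
    obtain j where j: "J \<subseteq> box d j" using finite_subset_box[OF J] by auto
    have l1: "(\<lambda>n. \<Sum>T\<in>Pow J. f (cfg T) * E n (ind J T)) \<longlonglongrightarrow> (\<Sum>T\<in>Pow J. f (cfg T) * m J T)"
      using J by (intro tendsto_sum tendsto_mult tendsto_const lim) auto
    have "integral\<^sup>L \<nu> f = (\<Sum>T\<in>Pow J. f (cfg T) * measure \<nu> (cylinder d J T))"
      by (rule state_integral[OF \<nu> J], rule fc)
    then have l2: "(\<Sum>T\<in>Pow J. f (cfg T) * m J T) = integral\<^sup>L \<nu> f"
      using J cyl[OF J] by simp
    have "(\<Sum>T\<in>Pow J. f (cfg T) * E n (ind J T)) = gibbs_exp d \<beta> n h f" if "j \<le> n" for n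
    proof -
      have "gibbs_exp d \<beta> n h f = E n (\<lambda>S. f (cfg (S \<inter> J)))"
        unfolding E_def by (rule gibbs_exp_local[OF j that], rule fc)
      also have "(\<lambda>S. f (cfg (S \<inter> J))) = (\<lambda>S. \<Sum>T\<in>Pow J. f (cfg T) * ind J T S)"
        using indsum[OF J(1), of "\<lambda>T. f (cfg T)"] by (rule ext)
      also have "E n \<dots> = (\<Sum>T\<in>Pow J. f (cfg T) * E n (ind J T))" using J by (intro Esum) auto
      finally show ?thesis by simp
    qed
    then have l3: "eventually (\<lambda>n. (\<Sum>T\<in>Pow J. f (cfg T) * E n (ind J T)) = gibbs_exp d \<beta> n h f) sequentially"
      unfolding eventually_sequentially by blast
    show ?thesis using Lim_transform_eventually[OF l1 l3] unfolding l2 .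
  qed
  then show ?thesis using \<nu> by blast
qed

lemma the_state:
  assumes "\<exists>\<nu>. is_state d \<nu> \<and> (\<forall>f. local_fun d f \<longrightarrow> (\<lambda>n. gibbs_exp d \<beta> n h f) \<longlonglongrightarrow> integral\<^sup>L \<nu> f)"
    and "s = (THE \<nu>. is_state d \<nu> \<and> (\<forall>f. local_fun d f \<longrightarrow> (\<lambda>n. gibbs_exp d \<beta> n h f) \<longlonglongrightarrow> integral\<^sup>L \<nu> f))"
  shows "is_state d s \<and> (\<forall>f. local_fun d f \<longrightarrow> (\<lambda>n. gibbs_exp d \<beta> n h f) \<longlonglongrightarrow> integral\<^sup>L s f)"
  unfolding assms(2)
proof (rule theI', rule ex_ex1I[OF assms(1)])
  fix \<nu> \<mu> assume a: "is_state d \<nu> \<and> (\<forall>f. local_fun d f \<longrightarrow> (\<lambda>n. gibbs_exp d \<beta> n h f) \<longlonglongrightarrow> integral\<^sup>L \<nu> f)"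
    "is_state d \<mu> \<and> (\<forall>f. local_fun d f \<longrightarrow> (\<lambda>n. gibbs_exp d \<beta> n h f) \<longlonglongrightarrow> integral\<^sup>L \<mu> f)"
  show "\<nu> = \<mu>" by (rule state_unique[of d]) (use a LIMSEQ_unique in blast)+
qed

context low_temp
begin

lemma states_and_mixture:
  assumes l: "0 < l"
  shows "is_state d (plus_state d \<beta>)" "is_state d (minus_state d \<beta>)"
    "\<And>f \<delta>. local_fun d f \<Longrightarrow> 0 < \<delta> \<Longrightarrow> \<exists>n0. \<forall>n\<ge>n0. \<forall>h. bounded_field n h \<longrightarrow>
      \<bar>gibbs_exp d \<beta> n h f - (integral\<^sup>L (plus_state d \<beta>) f * Z n h (OmP n) + integral\<^sup>L (minus_state d \<beta>) f * Z n h (OmM n)) / Z n h (Pow (B n))\<bar> \<le> \<delta>"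
proof -
  \<comment> \<open>\<open>F\<close> is \<open>f\<close> read as a function of the plus set, valid
    once the box contains the support; \<open>cp\<close> and \<open>cm\<close> turn out to be its
    means in the plus state and in the minus state.\<close>
  define R where "R f j F cp cm \<longleftrightarrow> local_on (B j) F \<and> plus_limit d \<beta> F cp \<and> plus_limit d \<beta> (\<lambda>S. F (B j - S)) cm \<and>
     (\<forall>n\<ge>j. \<forall>h. gibbs_exp d \<beta> n h f = (\<Sum>S\<in>Pow (B n). wt d \<beta> n h S * F S) / Z n h (Pow (B n)))"
    for f j F cp cm
  have ex: "\<exists>j F cp cm. R f j F cp cm" if lf: "local_fun d f" for f
  proof -
    obtain J where J: "finite J" "J \<subseteq> lattice d" and fc: "\<And>\<sigma> \<tau>. (\<forall>x\<in>J. \<sigma> x = \<tau> x) \<Longrightarrow> f \<sigma> = f \<tau>"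
      using local_funE[OF lf] by metis
    obtain j where j: "J \<subseteq> B j" using finite_subset_box[OF J] by auto
    define F where "F S = f (cfg (S \<inter> J))" for S
    have lF: "local_on (B j) F" unfolding local_on_def F_def
      using j by (intro allI arg_cong[where f = "\<lambda>S. f (cfg S)"]) auto
    have lFc: "local_on (B j) (\<lambda>S. F (B j - S))" unfolding local_on_def
      by (intro allI arg_cong[where f = F]) auto
    obtain cp cm where c: "plus_limit d \<beta> F cp" "plus_limit d \<beta> (\<lambda>S. F (B j - S)) cm"
      using plus_limit_exists[OF beta_nonneg lF] plus_limit_exists[OF beta_nonneg lFc] by blast
    have "gibbs_exp d \<beta> n h f = (\<Sum>S\<in>Pow (B n). wt d \<beta> n h S * F S) / Z n h (Pow (B n))" if "j \<le> n" for n h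
      unfolding F_def by (rule gibbs_exp_local[OF j that], rule fc)
    then have "R f j F cp cm" using lF c unfolding R_def by simp
    then show ?thesis by blast
  qed
  have pl: "(\<lambda>n. gibbs_exp d \<beta> n (\<lambda>_. \<beta>) f) \<longlonglongrightarrow> cp \<and> (\<lambda>n. gibbs_exp d \<beta> n (\<lambda>_. - \<beta>) f) \<longlonglongrightarrow> cm"
    if "R f j F cp cm" for f j F cp cm
  proof -
    have F: "local_on (B j) F" "plus_limit d \<beta> F cp" "plus_limit d \<beta> (\<lambda>S. F (B j - S)) cm"
     "\<forall>n\<ge>j. \<forall>h. gibbs_exp d \<beta> n h f = (\<Sum>S\<in>Pow (B n). wt d \<beta> n h S * F S) / Z n h (Pow (B n))"
      using that unfolding R_def by auto
    have ev: "eventually (\<lambda>n. (\<Sum>S\<in>Pow (B n). wt d \<beta> n h S * F S) / Z n h (Pow (B n)) = gibbs_exp d \<beta> n h f) sequentially" for h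
      unfolding eventually_sequentially using F(4) by (intro exI[of _ j]) simp
    show ?thesis
      using Lim_transform_eventually[OF plus_field_limit[OF l F(1,2)] ev] Lim_transform_eventually[OF minus_field_limit[OF l F(1,3)] ev] by blast
  qed
  have conv: "convergent (\<lambda>n. gibbs_exp d \<beta> n (\<lambda>_. \<beta>) f)" "convergent (\<lambda>n. gibbs_exp d \<beta> n (\<lambda>_. - \<beta>) f)" if lf: "local_fun d f" for f
  proof -
    obtain j F cp cm where "R f j F cp cm" using ex[OF lf] by blast
    from pl[OF this] show "convergent (\<lambda>n. gibbs_exp d \<beta> n (\<lambda>_. \<beta>) f)" "convergent (\<lambda>n. gibbs_exp d \<beta> n (\<lambda>_. - \<beta>) f)"
      using convergentI by auto
  qed
  note P = the_state[OF state_of_limits[OF conv(1)] plus_state_def]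
  note M = the_state[OF state_of_limits[OF conv(2)] minus_state_def]
  show "is_state d (plus_state d \<beta>)" "is_state d (minus_state d \<beta>)" using P M by auto
  fix f and \<delta> :: real assume f: "local_fun d f" and \<delta>: "0 < \<delta>"
  obtain j F cp cm where R: "R f j F cp cm" using ex[OF f] by blast
  then have F: "local_on (B j) F" "plus_limit d \<beta> F cp" "plus_limit d \<beta> (\<lambda>S. F (B j - S)) cm"
     "\<forall>n\<ge>j. \<forall>h. gibbs_exp d \<beta> n h f = (\<Sum>S\<in>Pow (B n). wt d \<beta> n h S * F S) / Z n h (Pow (B n))"
    unfolding R_def by auto
  have "(\<lambda>n. gibbs_exp d \<beta> n (\<lambda>_. \<beta>) f) \<longlonglongrightarrow> integral\<^sup>L (plus_state d \<beta>) f"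
    "(\<lambda>n. gibbs_exp d \<beta> n (\<lambda>_. - \<beta>) f) \<longlonglongrightarrow> integral\<^sup>L (minus_state d \<beta>) f"
    using P M f by simp_all
  then have cp: "integral\<^sup>L (plus_state d \<beta>) f = cp" "integral\<^sup>L (minus_state d \<beta>) f = cm"
    using pl[OF R] LIMSEQ_unique by blast+
  obtain n1 where n1: "\<forall>n\<ge>n1. \<forall>h. bounded_field n h \<longrightarrow>
     \<bar>(\<Sum>S\<in>Pow (B n). wt d \<beta> n h S * F S) - cp * Z n h (OmP n) - cm * Z n h (OmM n)\<bar> \<le> \<delta> * Z n h (Pow (B n))"
    using gibbs_mixture[OF F(1-3) \<delta>] by blast
  show "\<exists>n0. \<forall>n\<ge>n0. \<forall>h. bounded_field n h \<longrightarrow>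
      \<bar>gibbs_exp d \<beta> n h f - (integral\<^sup>L (plus_state d \<beta>) f * Z n h (OmP n) + integral\<^sup>L (minus_state d \<beta>) f * Z n h (OmM n)) / Z n h (Pow (B n))\<bar> \<le> \<delta>"
  proof (intro exI[of _ "max n1 j"] allI impI)
    fix n h assume n: "max n1 j \<le> n" and h: "bounded_field n h"
    define ZZ where "ZZ = Z n h (Pow (B n))"
    define s where "s = (\<Sum>S\<in>Pow (B n). wt d \<beta> n h S * F S)"
    have Zp: "0 < ZZ" unfolding ZZ_def by (rule Z_Pow_pos)
    have b: "\<bar>s - (cp * Z n h (OmP n) + cm * Z n h (OmM n))\<bar> \<le> \<delta> * ZZ"
      using n1 n h unfolding s_def ZZ_def by (simp add: diff_diff_eq)
    have "\<bar>s / ZZ - (cp * Z n h (OmP n) + cm * Z n h (OmM n)) / ZZ\<bar> = \<bar>s - (cp * Z n h (OmP n) + cm * Z n h (OmM n))\<bar> / ZZ"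
      using Zp by (simp add: diff_divide_distrib[symmetric] abs_divide)
    also have "\<dots> \<le> \<delta>" using b Zp by (simp add: pos_divide_le_eq)
    finally show "\<bar>gibbs_exp d \<beta> n h f - (integral\<^sup>L (plus_state d \<beta>) f * Z n h (OmP n) + integral\<^sup>L (minus_state d \<beta>) f * Z n h (OmM n)) / Z n h (Pow (B n))\<bar> \<le> \<delta>"
      using F(4) n unfolding cp s_def ZZ_def by simp
  qed
qed

end

subsection \<open>Limit points of a deterministic sequence\<close>

context low_temp
begin

lemma Z_total: "Z n h (Pow (B n)) = Z n h (OmP n) + Z n h (OmM n) + Z n h (Om0 n)"
proof -
  have dj: "OmP n \<inter> OmM n = {}" by (rule Omega_disjoint[OF finite_box conn_box])
  have "Pow (B n) = (OmP n \<union> OmM n) \<union> Om0 n" by (auto simp: Omega_plus_def Omega_minus_def)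
  then have "Z n h (Pow (B n)) = Z n h ((OmP n \<union> OmM n) \<union> Om0 n)" by (rule arg_cong)
  also have "\<dots> = Z n h (OmP n \<union> OmM n) + Z n h (Om0 n)" unfolding Zw_def by (rule sum.union_disjoint) auto
  also have "Z n h (OmP n \<union> OmM n) = Z n h (OmP n) + Z n h (OmM n)"
    unfolding Zw_def using dj by (intro sum.union_disjoint) auto
  finally show ?thesis .
qed

definition pP :: "nat \<Rightarrow> (site \<Rightarrow> real) \<Rightarrow> real" where "pP n h = Z n h (OmP n) / Z n h (Pow (B n))"
definition pM :: "nat \<Rightarrow> (site \<Rightarrow> real) \<Rightarrow> real" where "pM n h = Z n h (OmM n) / Z n h (Pow (B n))"
definition p0 :: "nat \<Rightarrow> (site \<Rightarrow> real) \<Rightarrow> real" where "p0 n h = Z n h (Om0 n) / Z n h (Pow (B n))"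

lemma p_sum: "pP n h + pM n h + p0 n h = 1"
  using Z_total[of n h] Z_Pow_pos[of n h] unfolding pP_def pM_def p0_def
  by (simp add: add_divide_distrib[symmetric])

lemma p_nonneg: "0 \<le> pP n h" "0 \<le> pM n h" "0 \<le> p0 n h"
  using Z_Pow_pos[of n h] by (auto simp: pP_def pM_def p0_def intro!: divide_nonneg_nonneg Zw_nonneg)

lemma pM_eq: "1 \<le> n \<Longrightarrow> pM n h = exp (- G n h) * pP n h"
  unfolding pP_def pM_def by (simp add: Z_ratio)

lemma pM_le:
  assumes "1 \<le> n"
  shows "pM n h \<le> exp (- G n h)"
proof -
  have "exp (- G n h) * pP n h \<le> exp (- G n h) * 1"
    using p_sum[of n h] p_nonneg[of n h] by (intro mult_left_mono) auto
  then show ?thesis unfolding pM_eq[OF assms] by simp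
qed

lemma pP_le:
  assumes "1 \<le> n"
  shows "pP n h \<le> exp (G n h)"
proof -
  have "pP n h = exp (G n h) * pM n h" unfolding pM_eq[OF assms] by (simp add: exp_minus)
  also have "\<dots> \<le> exp (G n h) * 1" using p_sum[of n h] p_nonneg[of n h] by (intro mult_left_mono) auto
  finally show ?thesis by simp
qed

lemma p0_tendsto:
  assumes N: "filterlim N at_top sequentially" and h: "\<And>n. bounded_field n h"
  shows "(\<lambda>k. p0 (N k) h) \<longlonglongrightarrow> 0"
proof (rule LIMSEQ_I)
  fix \<delta> :: real assume "0 < \<delta>"
  then have "0 < \<delta> / 2" by simp
  then obtain n0 where n0: "\<forall>n\<ge>n0. \<forall>h. bounded_field n h \<longrightarrow> Z n h (Om0 n) \<le> \<delta> / 2 * Z n h (Pow (B n))"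
    using Om0_small by blast
  have "eventually (\<lambda>k. n0 \<le> N k) sequentially" using N by (simp add: filterlim_at_top)
  then obtain k0 where k0: "\<And>k. k0 \<le> k \<Longrightarrow> n0 \<le> N k" unfolding eventually_sequentially by blast
  show "\<exists>k0. \<forall>k\<ge>k0. norm (p0 (N k) h - 0) < \<delta>"
  proof (intro exI[of _ k0] allI impI)
    fix k assume "k0 \<le> k"
    then have "Z (N k) h (Om0 (N k)) \<le> \<delta> / 2 * Z (N k) h (Pow (B (N k)))" using n0 k0 h by simp
    then have "p0 (N k) h \<le> \<delta> / 2" unfolding p0_def using Z_Pow_pos[of "N k" h] by (simp add: pos_divide_le_eq)
    then show "norm (p0 (N k) h - 0) < \<delta>" using p_nonneg(3)[of "N k" h] \<open>0 < \<delta>\<close> by simp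
  qed
qed

lemma mixture_tendsto:
  assumes l: "0 < l" and N: "filterlim N at_top sequentially" and h: "\<And>n. bounded_field n h" and f: "local_fun d f"
  shows "(\<lambda>k. gibbs_exp d \<beta> (N k) h f - (integral\<^sup>L (plus_state d \<beta>) f * pP (N k) h + integral\<^sup>L (minus_state d \<beta>) f * pM (N k) h)) \<longlonglongrightarrow> 0"
proof (rule LIMSEQ_I)
  fix \<delta> :: real assume "0 < \<delta>"
  then have "0 < \<delta> / 2" by simp
  from states_and_mixture(3)[OF l f this] obtain n0 where n0: "\<forall>n\<ge>n0. \<forall>h. bounded_field n h \<longrightarrow>
      \<bar>gibbs_exp d \<beta> n h f - (integral\<^sup>L (plus_state d \<beta>) f * Z n h (OmP n) + integral\<^sup>L (minus_state d \<beta>) f * Z n h (OmM n)) / Z n h (Pow (B n))\<bar> \<le> \<delta> / 2"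
    by blast
  have "eventually (\<lambda>k. n0 \<le> N k) sequentially" using N by (simp add: filterlim_at_top)
  then obtain k0 where k0: "\<And>k. k0 \<le> k \<Longrightarrow> n0 \<le> N k" unfolding eventually_sequentially by blast
  show "\<exists>k0. \<forall>k\<ge>k0. norm (gibbs_exp d \<beta> (N k) h f - (integral\<^sup>L (plus_state d \<beta>) f * pP (N k) h + integral\<^sup>L (minus_state d \<beta>) f * pM (N k) h) - 0) < \<delta>"
  proof (intro exI[of _ k0] allI impI)
    fix k assume "k0 \<le> k"
    then have "\<bar>gibbs_exp d \<beta> (N k) h f - (integral\<^sup>L (plus_state d \<beta>) f * Z (N k) h (OmP (N k)) + integral\<^sup>L (minus_state d \<beta>) f * Z (N k) h (OmM (N k))) / Z (N k) h (Pow (B (N k)))\<bar> \<le> \<delta> / 2"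
      using n0 k0 h by simp
    then show "norm (gibbs_exp d \<beta> (N k) h f - (integral\<^sup>L (plus_state d \<beta>) f * pP (N k) h + integral\<^sup>L (minus_state d \<beta>) f * pM (N k) h) - 0) < \<delta>"
      using \<open>0 < \<delta>\<close> unfolding pP_def pM_def by (simp add: add_divide_distrib)
  qed
qed

lemma gibbs_tendsto:
  assumes l: "0 < l" and N: "filterlim N at_top sequentially" and h: "\<And>n. bounded_field n h" and f: "local_fun d f"
  shows "filterlim (\<lambda>k. G (N k) h) at_top sequentially \<Longrightarrow> (\<lambda>k. gibbs_exp d \<beta> (N k) h f) \<longlonglongrightarrow> integral\<^sup>L (plus_state d \<beta>) f"
    "filterlim (\<lambda>k. - G (N k) h) at_top sequentially \<Longrightarrow> (\<lambda>k. gibbs_exp d \<beta> (N k) h f) \<longlonglongrightarrow> integral\<^sup>L (minus_state d \<beta>) f"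
proof -
  define ip where "ip = integral\<^sup>L (plus_state d \<beta>) f"
  define im where "im = integral\<^sup>L (minus_state d \<beta>) f"
  have m: "(\<lambda>k. gibbs_exp d \<beta> (N k) h f - (ip * pP (N k) h + im * pM (N k) h)) \<longlonglongrightarrow> 0"
    unfolding ip_def im_def by (rule mixture_tendsto[OF assms])
  have z: "(\<lambda>k. p0 (N k) h) \<longlonglongrightarrow> 0" by (rule p0_tendsto[OF N h])
  have ev1: "eventually (\<lambda>k. 1 \<le> N k) sequentially" using N by (simp add: filterlim_at_top)
  have exp0: "(\<lambda>k. exp (- g k)) \<longlonglongrightarrow> 0" if "filterlim g at_top sequentially" for g :: "nat \<Rightarrow> real"
    using that by (intro filterlim_compose[OF exp_at_bot]) (simp add: filterlim_uminus_at_bot)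
  { assume "filterlim (\<lambda>k. G (N k) h) at_top sequentially"
    from exp0[OF this] have t0: "(\<lambda>k. pM (N k) h) \<longlonglongrightarrow> 0"
      by (rule tendsto_sandwich[rotated 2, OF tendsto_const])
        (use ev1 p_nonneg pM_le in \<open>auto elim: eventually_mono\<close>)
    have "(\<lambda>k. 1 - pM (N k) h - p0 (N k) h) \<longlonglongrightarrow> 1 - 0 - 0"
      using t0 z by (intro tendsto_intros)
    moreover have "(\<lambda>k. 1 - pM (N k) h - p0 (N k) h) = (\<lambda>k. pP (N k) h)" using p_sum[of _ h] by (intro ext) (simp add: algebra_simps)
    ultimately have "(\<lambda>k. pP (N k) h) \<longlonglongrightarrow> 1" by simp
    with t0 have "(\<lambda>k. gibbs_exp d \<beta> (N k) h f - (ip * pP (N k) h + im * pM (N k) h) + (ip * pP (N k) h + im * pM (N k) h)) \<longlonglongrightarrow> 0 + (ip * 1 + im * 0)"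
      using m by (intro tendsto_intros)
    then show "(\<lambda>k. gibbs_exp d \<beta> (N k) h f) \<longlonglongrightarrow> integral\<^sup>L (plus_state d \<beta>) f" by (simp add: ip_def) }
  { assume "filterlim (\<lambda>k. - G (N k) h) at_top sequentially"
    from exp0[OF this] have "(\<lambda>k. exp (G (N k) h)) \<longlonglongrightarrow> 0" by simp
    then have t0: "(\<lambda>k. pP (N k) h) \<longlonglongrightarrow> 0"
      by (rule tendsto_sandwich[rotated 2, OF tendsto_const])
        (use ev1 p_nonneg pP_le in \<open>auto elim: eventually_mono\<close>)
    have "(\<lambda>k. 1 - pP (N k) h - p0 (N k) h) \<longlonglongrightarrow> 1 - 0 - 0"
      using t0 z by (intro tendsto_intros)
    moreover have "(\<lambda>k. 1 - pP (N k) h - p0 (N k) h) = (\<lambda>k. pM (N k) h)" using p_sum[of _ h] by (intro ext) (simp add: algebra_simps)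
    ultimately have "(\<lambda>k. pM (N k) h) \<longlonglongrightarrow> 1" by simp
    with t0 have "(\<lambda>k. gibbs_exp d \<beta> (N k) h f - (ip * pP (N k) h + im * pM (N k) h) + (ip * pP (N k) h + im * pM (N k) h)) \<longlonglongrightarrow> 0 + (ip * 0 + im * 1)"
      using m by (intro tendsto_intros)
    then show "(\<lambda>k. gibbs_exp d \<beta> (N k) h f) \<longlonglongrightarrow> integral\<^sup>L (minus_state d \<beta>) f" by (simp add: im_def) }
qed

text \<open>Every subsequence has infinitely many terms with \<open>G\<close> positive or infinitely
  many with \<open>G\<close> at most zero. Once it is thinned accordingly, the divergence of
  \<open>\<bar>G\<bar>\<close> removes one ensemble, so a limit must be one of the two states. That
  both signs occur infinitely often makes both states limit points.\<close>

lemma limit_points_eq: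
  assumes l: "0 < l" and N: "filterlim N at_top sequentially" and h: "\<And>n. bounded_field n h"
    and inf: "filterlim (\<lambda>k. \<bar>G (N k) h\<bar>) at_top sequentially"
    and pos: "infinite {k. 0 < G (N k) h}" and neg: "infinite {k. G (N k) h < 0}"
  shows "limit_points d (\<lambda>n. gibbs_exp d \<beta> (N n) h) = {plus_state d \<beta>, minus_state d \<beta>}"
proof -
  note st = states_and_mixture(1,2)[OF l]
  have sub: "filterlim (\<lambda>k. N (r k)) at_top sequentially" "filterlim (\<lambda>k. \<bar>G (N (r k)) h\<bar>) at_top sequentially"
    if "strict_mono r" for r
    using filterlim_compose[OF N filterlim_subseq[OF that]] filterlim_compose[OF inf filterlim_subseq[OF that]] by auto
  have toP: "(\<lambda>k. gibbs_exp d \<beta> (N (r k)) h f) \<longlonglongrightarrow> integral\<^sup>L (plus_state d \<beta>) f"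
    if r: "strict_mono r" "\<And>k. 0 < G (N (r k)) h" and f: "local_fun d f" for r f
  proof -
    have "(\<lambda>k. \<bar>G (N (r k)) h\<bar>) = (\<lambda>k. G (N (r k)) h)" using r(2) by (intro ext) (simp add: less_imp_le)
    then have "filterlim (\<lambda>k. G (N (r k)) h) at_top sequentially" using sub(2)[OF r(1)] by simp
    then show ?thesis by (rule gibbs_tendsto(1)[OF l sub(1)[OF r(1)] h f])
  qed
  have toM: "(\<lambda>k. gibbs_exp d \<beta> (N (r k)) h f) \<longlonglongrightarrow> integral\<^sup>L (minus_state d \<beta>) f"
    if r: "strict_mono r" "\<And>k. G (N (r k)) h \<le> 0" and f: "local_fun d f" for r f
  proof -
    have "(\<lambda>k. \<bar>G (N (r k)) h\<bar>) = (\<lambda>k. - G (N (r k)) h)" using r(2) by (intro ext) simp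
    then have "filterlim (\<lambda>k. - G (N (r k)) h) at_top sequentially" using sub(2)[OF r(1)] by simp
    then show ?thesis by (rule gibbs_tendsto(2)[OF l sub(1)[OF r(1)] h f])
  qed
  have "plus_state d \<beta> \<in> limit_points d (\<lambda>n. gibbs_exp d \<beta> (N n) h)"
  proof -
    obtain r :: "nat \<Rightarrow> nat" where r: "strict_mono r" "\<And>k. r k \<in> {k. 0 < G (N k) h}" using infinite_enumerate[OF pos] by blast
    then have "\<forall>f. local_fun d f \<longrightarrow> (\<lambda>k. gibbs_exp d \<beta> (N (r k)) h f) \<longlonglongrightarrow> integral\<^sup>L (plus_state d \<beta>) f"
      by (intro allI impI toP) auto
    then show ?thesis unfolding limit_points_def using st r(1) by blast
  qed
  moreover have "minus_state d \<beta> \<in> limit_points d (\<lambda>n. gibbs_exp d \<beta> (N n) h)"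
  proof -
    obtain r :: "nat \<Rightarrow> nat" where r: "strict_mono r" "\<And>k. r k \<in> {k. G (N k) h < 0}" using infinite_enumerate[OF neg] by blast
    have "G (N (r k)) h \<le> 0" for k using less_imp_le[of "G (N (r k)) h" 0] r(2)[of k] by blast
    then have "\<forall>f. local_fun d f \<longrightarrow> (\<lambda>k. gibbs_exp d \<beta> (N (r k)) h f) \<longlonglongrightarrow> integral\<^sup>L (minus_state d \<beta>) f"
      using r(1) by (intro allI impI toM)
    then show ?thesis unfolding limit_points_def using st r(1) by blast
  qed
  moreover have "\<nu> = plus_state d \<beta> \<or> \<nu> = minus_state d \<beta>" if "\<nu> \<in> limit_points d (\<lambda>n. gibbs_exp d \<beta> (N n) h)" for \<nu>
  proof -
    have nu: "is_state d \<nu>" using that by (simp add: limit_points_def)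
    have "\<exists>r. strict_mono r \<and> (\<forall>f. local_fun d f \<longrightarrow> (\<lambda>k. gibbs_exp d \<beta> (N (r k)) h f) \<longlonglongrightarrow> integral\<^sup>L \<nu> f)"
      using that by (simp add: limit_points_def)
    then obtain r where r: "strict_mono r" and
      lim: "\<And>f. local_fun d f \<Longrightarrow> (\<lambda>k. gibbs_exp d \<beta> (N (r k)) h f) \<longlonglongrightarrow> integral\<^sup>L \<nu> f" by blast
    have subl: "(\<lambda>k. gibbs_exp d \<beta> (N ((r \<circ> s) k)) h f) \<longlonglongrightarrow> integral\<^sup>L \<nu> f" if "strict_mono s" "local_fun d f" for s f
      using LIMSEQ_subseq_LIMSEQ[OF lim[OF that(2)] that(1)] by (simp add: o_def)
    have "infinite {k. 0 < G (N (r k)) h} \<or> infinite {k. G (N (r k)) h \<le> 0}"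
    proof (rule ccontr)
      assume "\<not> ?thesis"
      then have "finite ({k. 0 < G (N (r k)) h} \<union> {k. G (N (r k)) h \<le> 0})" by blast
      moreover have "{k. 0 < G (N (r k)) h} \<union> {k. G (N (r k)) h \<le> 0} = (UNIV :: nat set)" by auto
      ultimately show False by simp
    qed
    then show ?thesis
    proof
      assume "infinite {k. 0 < G (N (r k)) h}"
      then obtain s :: "nat \<Rightarrow> nat" where s: "strict_mono s" "\<And>k. s k \<in> {k. 0 < G (N (r k)) h}" using infinite_enumerate by blast
      have rs: "strict_mono (r \<circ> s)" using r s(1) by (rule strict_mono_o)
      have "0 < G (N ((r \<circ> s) k)) h" for k using s(2)[of k] by simp
      then have "integral\<^sup>L \<nu> f = integral\<^sup>L (plus_state d \<beta>) f" if "local_fun d f" for f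
        by (rule LIMSEQ_unique[OF subl[OF s(1) that] toP[OF rs _ that]])
      then show ?thesis using state_unique[OF nu st(1)] by blast
    next
      assume "infinite {k. G (N (r k)) h \<le> 0}"
      then obtain s :: "nat \<Rightarrow> nat" where s: "strict_mono s" "\<And>k. s k \<in> {k. G (N (r k)) h \<le> 0}" using infinite_enumerate by blast
      have rs: "strict_mono (r \<circ> s)" using r s(1) by (rule strict_mono_o)
      have "G (N ((r \<circ> s) k)) h \<le> 0" for k using s(2)[of k] by simp
      then have "integral\<^sup>L \<nu> f = integral\<^sup>L (minus_state d \<beta>) f" if "local_fun d f" for f
        by (rule LIMSEQ_unique[OF subl[OF s(1) that] toM[OF rs _ that]])
      then show ?thesis using state_unique[OF nu st(2)] by blast
    qed
  qed
  ultimately show ?thesis by blast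
qed

end

subsection \<open>Anticoncentration under random signs\<close>

text \<open>Signs are imposed in two ways. \<open>sgn_upd\<close> puts them on the absolute values
  and is monotone in \<open>s\<close>, as the antichain argument requires; \<open>flips\<close>
  multiplies by them and preserves a symmetric product law.\<close>

definition sgn_upd :: "'i set \<Rightarrow> ('i \<Rightarrow> real) \<Rightarrow> 'i set \<Rightarrow> 'i \<Rightarrow> real" where
  "sgn_upd J h s = (\<lambda>x\<in>J. if x \<in> s then \<bar>h x\<bar> else - \<bar>h x\<bar>)"

definition flips :: "'i set \<Rightarrow> 'i set \<Rightarrow> ('i \<Rightarrow> real) \<Rightarrow> 'i \<Rightarrow> real" where
  "flips J s h = (\<lambda>x\<in>J. if x \<in> s then h x else - h x)"

text \<open>Along a chain of sign choices the functional grows by at least \<open>g\<close> per step, so the sign choices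
  with a value in a half-open interval of length \<open>g\<close> form an antichain.\<close>

lemma window_count:
  fixes F :: "('i \<Rightarrow> real) \<Rightarrow> real"
  assumes J: "finite J" and T: "T \<subseteq> J" "T \<noteq> {}" and g: "0 < g" and u: "u \<subseteq> J - T"
    and inc: "\<And>s x. s \<subseteq> J \<Longrightarrow> x \<in> T \<Longrightarrow> x \<notin> s \<Longrightarrow> F (sgn_upd J h s) + g \<le> F (sgn_upd J h (insert x s))"
  shows "real (card {v \<in> Pow T. c \<le> F (sgn_upd J h (u \<union> v)) \<and> F (sgn_upd J h (u \<union> v)) < c + g})
     \<le> 2 * 2 ^ card T / sqrt (real (card T))"
proof -
  have fT: "finite T" using J T finite_subset by blast
  define E where "E v = F (sgn_upd J h (u \<union> v))" for v
  have grow: "E v + real (card w) * g \<le> E (v \<union> w)" if "finite w" "w \<subseteq> T" "v \<subseteq> T" "v \<inter> w = {}" for v w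
    using that
  proof (induction w rule: finite_induct)
    case (insert x w)
    have "E (v \<union> w) + g \<le> E (insert x (v \<union> w))"
    proof -
      have "F (sgn_upd J h (u \<union> (v \<union> w))) + g \<le> F (sgn_upd J h (insert x (u \<union> (v \<union> w))))"
        using insert T u by (intro inc) auto
      then show ?thesis unfolding E_def by simp
    qed
    then show ?case using insert by (simp add: algebra_simps)
  qed simp
  have "card {v \<in> Pow T. c \<le> E v \<and> E v < c + g} \<le> card T choose (card T div 2)"
  proof (rule sperner[OF fT])
    fix A B assume A: "A \<in> {v \<in> Pow T. c \<le> E v \<and> E v < c + g}" and B: "B \<in> {v \<in> Pow T. c \<le> E v \<and> E v < c + g}"
      and AB: "A \<subseteq> B"
    show "A = B"
    proof (rule ccontr)
      assume ne: "A \<noteq> B"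
      have fB: "finite (B - A)" using B fT finite_subset by auto
      then have "0 < card (B - A)" using AB ne by (auto simp: card_gt_0_iff)
      then have "1 * g \<le> real (card (B - A)) * g" using g by (intro mult_right_mono) auto
      moreover have "E A + real (card (B - A)) * g \<le> E (A \<union> (B - A))"
        using A B fB by (intro grow) auto
      moreover have "A \<union> (B - A) = B" using AB by auto
      moreover have "c \<le> E A" "E B < c + g" using A B by auto
      ultimately show False by simp
    qed
  qed auto
  then have "real (card {v \<in> Pow T. c \<le> E v \<and> E v < c + g}) \<le> real (card T choose (card T div 2))" by simp
  also have "\<dots> \<le> 2 * 2 ^ card T / sqrt (real (card T))"
    using fT T by (intro central_binomial_le) (auto simp: card_gt_0_iff)
  finally show ?thesis unfolding E_def .
qed

lemma sign_count:
  fixes F :: "('i \<Rightarrow> real) \<Rightarrow> real" and R :: nat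
  assumes J: "finite J" and T: "T \<subseteq> J" "T \<noteq> {}" and g: "0 < g" and R: "2 * K < real R * g"
    and inc: "\<And>s x. s \<subseteq> J \<Longrightarrow> x \<in> T \<Longrightarrow> x \<notin> s \<Longrightarrow> F (sgn_upd J h s) + g \<le> F (sgn_upd J h (insert x s))"
  shows "real (card {s \<in> Pow J. \<bar>F (sgn_upd J h s)\<bar> \<le> K}) \<le> 2 ^ card J * (2 * real R / sqrt (real (card T)))"
proof -
  have fT: "finite T" "finite (J - T)" using J T finite_subset by auto
  define W where "W u i = {v \<in> Pow T. - K + real i * g \<le> F (sgn_upd J h (u \<union> v)) \<and> F (sgn_upd J h (u \<union> v)) < (- K + real i * g) + g}" for u i
  have fW: "finite (W u i)" for u i unfolding W_def using fT by auto
  define X where "X = (SIGMA u:Pow (J - T). \<Union>i<R. W u i)"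
  have fX: "finite X" unfolding X_def using fT fW by auto
  have sub: "(\<lambda>s. (s - T, s \<inter> T)) ` {s \<in> Pow J. \<bar>F (sgn_upd J h s)\<bar> \<le> K} \<subseteq> X"
  proof (rule image_subsetI)
    fix s assume s: "s \<in> {s \<in> Pow J. \<bar>F (sgn_upd J h s)\<bar> \<le> K}"
    define y where "y = (F (sgn_upd J h s) + K) / g"
    define i where "i = nat \<lfloor>y\<rfloor>"
    have y0: "0 \<le> y" using s g by (auto simp: y_def)
    have "y * g \<le> 2 * K" using s g by (auto simp: y_def)
    then have "y * g < real R * g" using R by linarith
    then have yR: "y < real R" using g by simp
    have ri: "real i = of_int \<lfloor>y\<rfloor>" using y0 by (simp add: i_def)
    have iR: "i < R" using yR ri by linarith
    have "real i \<le> y" "y < real i + 1" unfolding ri by linarith+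
    then have "real i * g \<le> y * g" "y * g < (real i + 1) * g" using g by auto
    moreover have "y * g = F (sgn_upd J h s) + K" using g by (simp add: y_def)
    ultimately have "- K + real i * g \<le> F (sgn_upd J h s)" "F (sgn_upd J h s) < (- K + real i * g) + g"
      by (simp_all add: algebra_simps)
    moreover have "(s - T) \<union> (s \<inter> T) = s" by auto
    ultimately have "s \<inter> T \<in> W (s - T) i" unfolding W_def by simp
    then show "(s - T, s \<inter> T) \<in> X" unfolding X_def using s iR by auto
  qed
  have inj: "inj_on (\<lambda>s. (s - T, s \<inter> T)) {s \<in> Pow J. \<bar>F (sgn_upd J h s)\<bar> \<le> K}"
    by (rule inj_onI) (metis Int_Diff_Un Un_commute prod.inject)
  have "card {s \<in> Pow J. \<bar>F (sgn_upd J h s)\<bar> \<le> K} \<le> card X" by (rule card_inj_on_le[OF inj sub fX])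
  also have "card X = (\<Sum>u\<in>Pow (J - T). card (\<Union>i<R. W u i))"
    unfolding X_def using fT fW by (intro card_SigmaI) auto
  finally have "real (card {s \<in> Pow J. \<bar>F (sgn_upd J h s)\<bar> \<le> K}) \<le> (\<Sum>u\<in>Pow (J - T). real (card (\<Union>i<R. W u i)))"
    unfolding of_nat_sum[symmetric] of_nat_le_iff .
  also have "\<dots> \<le> (\<Sum>u\<in>Pow (J - T). real R * (2 * 2 ^ card T / sqrt (real (card T))))"
  proof (rule sum_mono)
    fix u assume u: "u \<in> Pow (J - T)"
    have "card (\<Union>i<R. W u i) \<le> (\<Sum>i<R. card (W u i))" by (rule card_UN_le) simp
    then have "real (card (\<Union>i<R. W u i)) \<le> (\<Sum>i<R. real (card (W u i)))" unfolding of_nat_sum[symmetric] of_nat_le_iff .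
    also have "\<dots> \<le> (\<Sum>i<R. 2 * 2 ^ card T / sqrt (real (card T)))"
      unfolding W_def using u by (intro sum_mono window_count[OF J T g _ inc]) auto
    finally show "real (card (\<Union>i<R. W u i)) \<le> real R * (2 * 2 ^ card T / sqrt (real (card T)))" by simp
  qed
  also have "\<dots> = 2 ^ card (J - T) * (real R * (2 * 2 ^ card T / sqrt (real (card T))))"
    using fT by (simp add: card_Pow)
  also have "\<dots> = (2 ^ card (J - T) * 2 ^ card T) * (2 * real R / sqrt (real (card T)))" by simp
  also have "2 ^ card (J - T) * 2 ^ card T = (2::real) ^ card J"
    using J T fT by (metis card_Diff_subset card_mono le_add_diff_inverse2 power_add)
  finally show ?thesis .
qed

text \<open>Symmetric difference with the set of negative coordinates is an involution of
  \<open>Pow J\<close> that turns one sign rule into the other.\<close>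

lemma flips_count:
  fixes F :: "('i \<Rightarrow> real) \<Rightarrow> real"
  shows "card {s \<in> Pow J. \<bar>F (flips J s h)\<bar> \<le> K} = card {s \<in> Pow J. \<bar>F (sgn_upd J h s)\<bar> \<le> K}"
proof -
  define N where "N = {x \<in> J. h x < 0}"
  define t where "t s = (s - N) \<union> (N - s)" for s
  have tt: "t (t s) = s" for s by (auto simp: t_def)
  have tJ: "t s \<subseteq> J" if "s \<subseteq> J" for s using that by (auto simp: t_def N_def)
  have e: "flips J s h = sgn_upd J h (t s)" for s
    by (auto simp: flips_def sgn_upd_def t_def N_def fun_eq_iff)
  have e': "flips J (t s) h = sgn_upd J h s" for s unfolding e tt ..
  show ?thesis
  proof (rule bij_betw_same_card[of t], rule bij_betw_byWitness[where f' = t])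
    show "t ` {s \<in> Pow J. \<bar>F (flips J s h)\<bar> \<le> K} \<subseteq> {s \<in> Pow J. \<bar>F (sgn_upd J h s)\<bar> \<le> K}"
      using tJ e by auto
    show "t ` {s \<in> Pow J. \<bar>F (sgn_upd J h s)\<bar> \<le> K} \<subseteq> {s \<in> Pow J. \<bar>F (flips J s h)\<bar> \<le> K}"
      using tJ e' by auto
  qed (use tt in auto)
qed

section \<open>Symmetric product laws\<close>

locale sym_law =
  fixes P :: "real measure" and l :: real
  assumes prob: "prob_space P" and P_borel: "sets P = sets borel" and sym: "distr P borel uminus = P"
    and supp: "measure P {x. l < \<bar>x\<bar>} = 0"
begin

lemma P_space [simp]: "space P = UNIV"
  using sets_eq_imp_space_eq[OF P_borel] by simp

lemma prod_prob: "product_prob_space (\<lambda>_::'i. P)"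
  unfolding product_prob_space_def product_prob_space_axioms_def product_sigma_finite_def
  using prob by (auto simp: prob_space_imp_sigma_finite)

lemma emeasure_uminus:
  assumes "A \<in> sets P"
  shows "emeasure P (uminus -` A) = emeasure P A"
proof -
  have "uminus \<in> measurable P borel" using P_borel by (simp cong: measurable_cong_sets)
  then have "emeasure (distr P borel uminus) A = emeasure P (uminus -` A \<inter> space P)"
    using assms P_borel by (intro emeasure_distr) auto
  then show ?thesis unfolding sym by simp
qed

lemma flips_measurable: "flips J s \<in> measurable (PiM J (\<lambda>_. P)) (PiM J (\<lambda>_. P))"
  unfolding flips_def
proof (rule measurable_restrict)
  fix x assume x: "x \<in> J"
  have c: "(\<lambda>h. h x) \<in> measurable (PiM J (\<lambda>_. P)) P" using x by (rule measurable_component_singleton)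
  have m: "uminus \<in> measurable P P" using P_borel by (simp cong: measurable_cong_sets)
  show "(\<lambda>h. if x \<in> s then h x else - h x) \<in> measurable (PiM J (\<lambda>_. P)) P"
    using c measurable_compose[OF c m] by (cases "x \<in> s") auto
qed

lemma distr_flips:
  assumes J: "finite J"
  shows "distr (PiM J (\<lambda>_. P)) (PiM J (\<lambda>_. P)) (flips J s) = PiM J (\<lambda>_. P)"
proof -
  interpret product_prob_space "\<lambda>_. P" J by (rule prod_prob)
  show ?thesis
  proof (rule PiM_eqI[OF J])
    fix A :: "'a \<Rightarrow> real set" assume A: "\<And>i. i \<in> J \<Longrightarrow> A i \<in> sets P"
    define A' where "A' i = (if i \<in> s then A i else uminus -` A i)" for i
    have m: "uminus \<in> measurable P P" using P_borel by (simp cong: measurable_cong_sets)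
    have A': "A' i \<in> sets P" if "i \<in> J" for i
      using A[OF that] measurable_sets[OF m A[OF that]] by (auto simp: A'_def)
    have "emeasure (distr (PiM J (\<lambda>_. P)) (PiM J (\<lambda>_. P)) (flips J s)) (Pi\<^sub>E J A)
        = emeasure (PiM J (\<lambda>_. P)) (flips J s -` Pi\<^sub>E J A \<inter> space (PiM J (\<lambda>_. P)))"
      using A J by (intro emeasure_distr flips_measurable sets_PiM_I_finite) auto
    also have "flips J s -` Pi\<^sub>E J A \<inter> space (PiM J (\<lambda>_. P)) = Pi\<^sub>E J A'"
      by (auto simp: flips_def A'_def space_PiM PiE_def Pi_def)
    also have "emeasure (PiM J (\<lambda>_. P)) (Pi\<^sub>E J A') = (\<Prod>i\<in>J. emeasure P (A' i))"
      using A' J by (intro emeasure_PiM) auto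
    also have "\<dots> = (\<Prod>i\<in>J. emeasure P (A i))"
      using A emeasure_uminus by (intro prod.cong) (auto simp: A'_def)
    finally show "emeasure (distr (PiM J (\<lambda>_. P)) (PiM J (\<lambda>_. P)) (flips J s)) (Pi\<^sub>E J A) = (\<Prod>i\<in>J. emeasure P (A i))" .
  qed simp
qed

lemma indep_coords: 
  assumes I: "I \<noteq> {}"
  shows "prob_space.indep_vars (PiM I (\<lambda>_. P)) (\<lambda>_. P) (\<lambda>i h. h i) I"
proof -
  interpret Q: prob_space "PiM I (\<lambda>_. P)" by (rule prob_space_PiM) (rule prob)
  show ?thesis
  proof (subst Q.indep_vars_iff_distr_eq_PiM'[OF I])
    show "(\<lambda>h. h i) \<in> measurable (PiM I (\<lambda>_. P)) P" if "i \<in> I" for i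
      using that by (rule measurable_component_singleton)
    have d: "distr (PiM I (\<lambda>_. P)) P (\<lambda>h. h i) = P" if "i \<in> I" for i
      using that by (rule product_prob_space.PiM_component[OF prod_prob])
    have "distr (PiM I (\<lambda>_. P)) (PiM I (\<lambda>_. P)) (\<lambda>h. \<lambda>i\<in>I. h i) = distr (PiM I (\<lambda>_. P)) (PiM I (\<lambda>_. P)) (\<lambda>h. h)"
      by (rule distr_cong) (auto simp: space_PiM PiE_def extensional_restrict)
    also have "\<dots> = PiM I (\<lambda>_. P)" by (rule distr_id)
    also have "\<dots> = PiM I (\<lambda>i. distr (PiM I (\<lambda>_. P)) P (\<lambda>h. h i))" by (rule PiM_cong) (auto simp: d)
    finally show "distr (PiM I (\<lambda>_. P)) (PiM I (\<lambda>_. P)) (\<lambda>h. \<lambda>i\<in>I. h i) = PiM I (\<lambda>i. distr (PiM I (\<lambda>_. P)) P (\<lambda>h. h i))" .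
  qed
qed

text \<open>Hoeffding's inequality for the number of large fields, at half of its mean
  \<open>p * card J\<close>: the exponent is
  \<open>- 2 * (p * card J / 2) ^ 2 / card J\<close>.\<close>

lemma few_large_prob:
  fixes J :: "'i set"
  assumes J: "finite J" "J \<noteq> {}" and p: "p = measure P {x. a \<le> \<bar>x\<bar>}"
  shows "measure (PiM J (\<lambda>_. P)) {h \<in> space (PiM J (\<lambda>_. P)). real (card {x \<in> J. a \<le> \<bar>h x\<bar>}) \<le> p * real (card J) / 2}
      \<le> exp (- p\<^sup>2 * real (card J) / 2)"
proof -
  define Q where "Q = PiM J (\<lambda>_. P)"
  interpret Q: prob_space Q unfolding Q_def by (rule prob_space_PiM) (rule prob)
  define L where "L = {x::real. a \<le> \<bar>x\<bar>}"
  have LP: "L \<in> sets P" unfolding L_def P_borel by measurable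
  define X where "X i h = (indicator L (h i) :: real)" for i and h :: "'i \<Rightarrow> real"
  have mi: "(indicator L :: real \<Rightarrow> real) \<in> measurable P borel" using LP by simp
  have ind: "Q.indep_vars (\<lambda>_. borel) X J"
    unfolding Q_def X_def using prob_space.indep_vars_compose2[OF Q.prob_space_axioms[unfolded Q_def] indep_coords[OF J(2)], of "\<lambda>_. indicator L :: real \<Rightarrow> real" "\<lambda>_. borel"] mi
    by simp
  interpret H: Hoeffding_ineq Q J X "\<lambda>_. 0" "\<lambda>_. 1" "\<Sum>i\<in>J. integral\<^sup>L Q (X i)"
    unfolding Hoeffding_ineq_def indep_interval_bounded_random_variables_def indep_interval_bounded_random_variables_axioms_def
    using J ind Q.prob_space_axioms by (auto simp: X_def)
  have EX: "integral\<^sup>L Q (X i) = p" if i: "i \<in> J" for i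
  proof -
    have m: "(\<lambda>h. h i) \<in> measurable Q P" unfolding Q_def using i by (rule measurable_component_singleton)
    have "integral\<^sup>L Q (X i) = integral\<^sup>L (distr Q P (\<lambda>h. h i)) (indicator L :: real \<Rightarrow> real)"
      unfolding X_def by (rule integral_distr[OF m, symmetric]) (simp add: mi)
    also have "distr Q P (\<lambda>h. h i) = P" unfolding Q_def using i by (rule product_prob_space.PiM_component[OF prod_prob])
    also have "integral\<^sup>L P (indicator L :: real \<Rightarrow> real) = p" unfolding p L_def by simp
    finally show ?thesis .
  qed
  have sumX: "(\<Sum>i\<in>J. X i h) = real (card {x \<in> J. a \<le> \<bar>h x\<bar>})" for h
  proof -
    have "(\<Sum>i\<in>J. X i h) = (\<Sum>i\<in>J. if a \<le> \<bar>h i\<bar> then 1 else 0)"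
      by (intro sum.cong) (auto simp: X_def L_def indicator_def)
    then show ?thesis using J by (simp only: sum.inter_filter[symmetric]) simp
  qed
  have cJ: "0 < real (card J)" using J by (auto simp: card_gt_0_iff)
  have p0: "0 \<le> p" unfolding p by simp
  have h1: "Q.prob {h \<in> space Q. (\<Sum>i\<in>J. X i h) \<le> (\<Sum>i\<in>J. integral\<^sup>L Q (X i)) - p * real (card J) / 2}
     \<le> exp (- 2 * (p * real (card J) / 2)\<^sup>2 / (\<Sum>i\<in>J. (1 - 0)\<^sup>2))"
    using p0 cJ by (intro H.Hoeffding_ineq_le) auto
  have h2: "(\<Sum>i\<in>J. integral\<^sup>L Q (X i)) - p * real (card J) / 2 = p * real (card J) / 2"
    using EX by (simp add: field_simps)
  have h3: "- 2 * (p * real (card J) / 2)\<^sup>2 / (\<Sum>i\<in>J. (1 - 0)\<^sup>2) = - p\<^sup>2 * real (card J) / 2"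
    using cJ by (simp add: power2_eq_square field_simps)
  show ?thesis using h1 unfolding h2 h3 sumX unfolding Q_def .
qed

lemma AE_bounded:
  assumes J: "finite J"
  shows "AE h in PiM J (\<lambda>_. P). \<forall>x\<in>J. \<bar>h x\<bar> \<le> l"
proof -
  interpret PS: prob_space P by (rule prob)
  have "{x. l < \<bar>x\<bar>} \<in> sets P" unfolding P_borel by measurable
  then have "AE x in P. x \<notin> {x. l < \<bar>x\<bar>}" using supp PS.prob_eq_0 by blast
  then have "AE x in P. \<not> l < \<bar>x\<bar>" by simp
  then have "AE h in PiM J (\<lambda>_. P). \<not> l < \<bar>h x\<bar>" if "x \<in> J" for x using that by (intro product_prob_space.AE_component[OF prod_prob])
  then have "AE h in PiM J (\<lambda>_. P). \<forall>x\<in>J. \<not> l < \<bar>h x\<bar>" using J by (intro AE_finite_allI) auto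
  then show ?thesis by (rule AE_mp) (simp add: not_less)
qed

text \<open>Symmetry allows resampling all signs: the probability is the mean of the fraction
  \<open>c h\<close> of sign choices that keep the functional in the interval. If more than
  \<open>p * card J / 2\<close> fields are large, \<open>sign_count\<close> with \<open>T\<close>
  the set of large fields bounds this fraction; the signs of the small fields, which may have too
  little influence, are frozen. The remaining event is the Hoeffding term.\<close>

lemma anticoncentration:
  fixes F :: "('i \<Rightarrow> real) \<Rightarrow> real" and R :: nat
  assumes J: "finite J" "J \<noteq> {}" and p: "p = measure P {x. a \<le> \<bar>x\<bar>}" "0 < p" and g: "0 < g" and R: "2 * K < real R * g"
    and F: "F \<in> borel_measurable (PiM J (\<lambda>_. P))"
    and inc: "\<And>h x b. \<forall>y\<in>J. \<bar>h y\<bar> \<le> l \<Longrightarrow> x \<in> J \<Longrightarrow> a \<le> b \<Longrightarrow> b \<le> l \<Longrightarrow> h \<in> extensional J \<Longrightarrow> F (h(x := - b)) + g \<le> F (h(x := b))"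
  shows "measure (PiM J (\<lambda>_. P)) {h \<in> space (PiM J (\<lambda>_. P)). \<bar>F h\<bar> \<le> K}
     \<le> exp (- p\<^sup>2 * real (card J) / 2) + 2 * real R / sqrt (p * real (card J) / 2)"
proof -
  define Q where "Q = PiM J (\<lambda>_. P)"
  interpret Q: prob_space Q unfolding Q_def by (rule prob_space_PiM) (rule prob)
  define A where "A = {h \<in> space Q. \<bar>F h\<bar> \<le> K}"
  define m where "m = p * real (card J) / 2"
  define Bd where "Bd = {h \<in> space Q. real (card {x \<in> J. a \<le> \<bar>h x\<bar>}) \<le> m}"
  have cJ: "0 < real (card J)" using J by (auto simp: card_gt_0_iff)
  have mp: "0 < m" using p cJ by (simp add: m_def)
  have FQ: "F \<in> borel_measurable Q" using F by (simp add: Q_def)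
  have AQ: "A \<in> sets Q" unfolding A_def using FQ by measurable
  have coord: "{h \<in> space Q. a \<le> \<bar>h x\<bar>} \<in> sets Q" if "x \<in> J" for x
  proof -
    have c: "(\<lambda>h. h x) \<in> measurable Q P" unfolding Q_def using that by (rule measurable_component_singleton)
    have "{x::real. a \<le> \<bar>x\<bar>} \<in> sets P" unfolding P_borel by measurable
    from measurable_sets[OF c this] show ?thesis by (simp add: vimage_def Int_def conj_commute)
  qed
  have cm: "(\<lambda>h. real (card {x \<in> J. a \<le> \<bar>h x\<bar>})) \<in> borel_measurable Q"
  proof -
    have "(\<lambda>h. \<Sum>x\<in>J. indicator {h \<in> space Q. a \<le> \<bar>h x\<bar>} h :: real) \<in> borel_measurable Q"
      using coord by (intro borel_measurable_sum borel_measurable_indicator) auto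
    moreover have "(\<Sum>x\<in>J. indicator {h \<in> space Q. a \<le> \<bar>h x\<bar>} h :: real) = real (card {x \<in> J. a \<le> \<bar>h x\<bar>})" if "h \<in> space Q" for h
    proof -
      have "(\<Sum>x\<in>J. indicator {h \<in> space Q. a \<le> \<bar>h x\<bar>} h :: real) = (\<Sum>x\<in>J. if a \<le> \<bar>h x\<bar> then 1 else 0)"
        using that by (intro sum.cong) (auto simp: indicator_def)
      then show ?thesis using J by (simp only: sum.inter_filter[symmetric]) simp
    qed
    ultimately show ?thesis by (simp cong: measurable_cong)
  qed
  have BQ: "Bd \<in> sets Q" unfolding Bd_def using cm by measurable
  have fm: "flips J s \<in> measurable Q Q" for s unfolding Q_def by (rule flips_measurable)
  have inv: "Q.prob A = integral\<^sup>L Q (\<lambda>h. indicator A (flips J s h))" for s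
  proof -
    have "Q.prob A = integral\<^sup>L Q (indicator A :: _ \<Rightarrow> real)" using AQ sets.sets_into_space[OF AQ] by (simp add: Int_absorb2)
    also have "\<dots> = integral\<^sup>L (distr Q Q (flips J s)) (indicator A :: _ \<Rightarrow> real)" unfolding Q_def distr_flips[OF J(1)] ..
    also have "\<dots> = integral\<^sup>L Q (\<lambda>h. indicator A (flips J s h))" using AQ by (intro integral_distr fm) simp
    finally show ?thesis .
  qed
  define c where "c h = (\<Sum>s\<in>Pow J. indicator A (flips J s h) :: real) / 2 ^ card J" for h
  have int: "integrable Q (\<lambda>h. indicator A (flips J s h) :: real)" for s
    by (rule Q.integrable_const_bound[of _ 1]) (use measurable_compose[OF fm, of "indicator A" borel] AQ in \<open>auto simp: indicator_def\<close>)
  have intc: "integrable Q c" unfolding c_def using int by (intro integrable_divide Bochner_Integration.integrable_sum)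
  have "integral\<^sup>L Q c = (\<Sum>s\<in>Pow J. integral\<^sup>L Q (\<lambda>h. indicator A (flips J s h))) / 2 ^ card J"
    unfolding c_def using int by (simp add: Bochner_Integration.integral_sum)
  also have "\<dots> = Q.prob A" using J unfolding inv[symmetric] by (simp add: card_Pow)
  finally have Ec: "Q.prob A = integral\<^sup>L Q c" by simp
  have "AE h in Q. c h \<le> indicator Bd h + 2 * real R / sqrt m"
    using AE_bounded[OF J(1)] AE_space unfolding Q_def[symmetric]
  proof eventually_elim
    case (elim h)
    have cJp: "0 < (2::real) ^ card J" by simp
    have fsp: "flips J s h \<in> space Q" for s using measurable_space[OF fm elim(2)] .
    have "(\<Sum>s\<in>Pow J. indicator A (flips J s h) :: real) = real (card {s \<in> Pow J. \<bar>F (flips J s h)\<bar> \<le> K})"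
    proof -
      have "(\<Sum>s\<in>Pow J. indicator A (flips J s h) :: real) = (\<Sum>s\<in>Pow J. if \<bar>F (flips J s h)\<bar> \<le> K then 1 else 0)"
        using fsp by (intro sum.cong) (auto simp: A_def indicator_def)
      moreover have "finite (Pow J)" using J by simp
      ultimately show ?thesis by (simp only: sum.inter_filter[symmetric]) simp
    qed
    then have ch: "c h = real (card {s \<in> Pow J. \<bar>F (sgn_upd J h s)\<bar> \<le> K}) / 2 ^ card J"
      unfolding c_def flips_count by simp
    have Rn: "0 \<le> 2 * real R / sqrt m" using mp by simp
    show ?case
    proof (cases "h \<in> Bd")
      case True
      have "card {s \<in> Pow J. \<bar>F (sgn_upd J h s)\<bar> \<le> K} \<le> card (Pow J)" using J by (intro card_mono) auto
      then have "real (card {s \<in> Pow J. \<bar>F (sgn_upd J h s)\<bar> \<le> K}) \<le> 2 ^ card J"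
        using J by (metis card_Pow of_nat_le_iff of_nat_numeral of_nat_power)
      then have "c h \<le> 1" unfolding ch by simp
      then show ?thesis using True Rn by simp
    next
      case False
      define T where "T = {x \<in> J. a \<le> \<bar>h x\<bar>}"
      have Tm: "m < real (card T)" using False elim(2) by (auto simp: Bd_def T_def)
      then have Tne: "T \<noteq> {}" using mp by auto
      have "real (card {s \<in> Pow J. \<bar>F (sgn_upd J h s)\<bar> \<le> K}) \<le> 2 ^ card J * (2 * real R / sqrt (real (card T)))"
      proof (rule sign_count[OF J(1) _ Tne g R])
        show "T \<subseteq> J" by (auto simp: T_def)
        fix s x assume s: "s \<subseteq> J" "x \<in> T" "x \<notin> s"
        have xJ: "x \<in> J" "a \<le> \<bar>h x\<bar>" using s by (auto simp: T_def)
        have e: "sgn_upd J h s = (sgn_upd J h s)(x := - \<bar>h x\<bar>)" "sgn_upd J h (insert x s) = (sgn_upd J h s)(x := \<bar>h x\<bar>)"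
          using s xJ by (auto simp: sgn_upd_def fun_eq_iff)
        have "F ((sgn_upd J h s)(x := - \<bar>h x\<bar>)) + g \<le> F ((sgn_upd J h s)(x := \<bar>h x\<bar>))"
          using xJ elim(1) by (intro inc) (auto simp: sgn_upd_def)
        then show "F (sgn_upd J h s) + g \<le> F (sgn_upd J h (insert x s))" using e by metis
      qed
      then have "c h \<le> 2 * real R / sqrt (real (card T))" unfolding ch using cJp by (simp add: divide_le_eq mult.commute)
      also have "\<dots> \<le> 2 * real R / sqrt m" using Tm mp by (intro divide_left_mono) auto
      finally show ?thesis using False by simp
    qed
  qed
  moreover have intB: "integrable Q (\<lambda>h. indicator Bd h + 2 * real R / sqrt m :: real)"
    using BQ by (intro Bochner_Integration.integrable_add integrable_real_indicator Q.integrable_const) (auto simp: Q.emeasure_eq_measure)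
  ultimately have "integral\<^sup>L Q c \<le> integral\<^sup>L Q (\<lambda>h. indicator Bd h + 2 * real R / sqrt m)"
    using intc by (intro integral_mono_AE) auto
  also have "\<dots> = Q.prob Bd + 2 * real R / sqrt m"
    using BQ sets.sets_into_space[OF BQ] by (subst Bochner_Integration.integral_add) (auto simp: Q.emeasure_eq_measure Q.prob_space Int_absorb2)
  also have "Q.prob Bd \<le> exp (- p\<^sup>2 * real (card J) / 2)"
    using few_large_prob[OF J p(1)] unfolding Bd_def m_def Q_def .
  finally show ?thesis using Ec unfolding A_def Q_def m_def by simp
qed

end

subsection \<open>Almost sure behaviour\<close>

text \<open>The source of independence of \<open>G\<close> along a sparse sequence of boxes.\<close>

lemma bdry_disjoint:
  assumes "m + 2 \<le> n"
  shows "bdry d m \<inter> bdry d n = {}"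
proof (rule ccontr)
  assume "\<not> ?thesis"
  then obtain x where x: "x \<in> bdry d m" "x \<in> bdry d n" by blast
  obtain i where i: "i < d" "x i = lo n \<or> x i = hi n" using x(2) by (auto simp: bdry_iff)
  have "lo m \<le> x i" "x i \<le> hi m" using x(1) i(1) by (auto simp: bdry_iff mem_box)
  moreover have "lo n \<le> lo (m + 2)" "hi (m + 2) \<le> hi n" using assms by (auto intro: lo_hi_mono)
  ultimately show False using i(2) unfolding lo_hi_plus2 by linarith
qed

lemma bdry_lattice: "bdry d n \<subseteq> lattice d"
  by (auto simp: bdry_iff mem_box)

lemma countable_lattice: "countable (lattice d)"
proof -
  have "lattice d \<subseteq> (\<Union>j. box d j)"
  proof
    fix x assume "x \<in> lattice d"
    then obtain j where "{x} \<subseteq> box d j" using finite_subset_box[of "{x}" d] by auto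
    then show "x \<in> (\<Union>j. box d j)" by auto
  qed
  moreover have "countable (\<Union>j. box d j)" by (intro countable_UN) (auto intro: countable_finite)
  ultimately show ?thesis by (rule countable_subset)
qed

locale random_field = low_temp d \<beta> l + sym_law P l for d :: nat and \<beta> l :: real and P :: "real measure" +
  fixes a p :: real
  assumes l_pos: "0 < l" and a_pos: "0 < a" and p_def: "p = measure P {x. a \<le> \<bar>x\<bar>}" and p_pos: "0 < p"
begin

abbreviation "Q \<equiv> PiM (lattice d) (\<lambda>_. P)"
abbreviation "QJ n \<equiv> PiM (bdry d n) (\<lambda>_. P)"

lemma prob_Q: "prob_space (PiM I (\<lambda>_. P))"
  by (rule prob_space_PiM) (rule prob)

lemma Zw_measurable:
  assumes "bdry d n \<subseteq> I"
  shows "(\<lambda>h. Z n h X) \<in> borel_measurable (PiM I (\<lambda>_. P))"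
proof -
  have c: "(\<lambda>h. h x) \<in> borel_measurable (PiM I (\<lambda>_. P))" if "x \<in> bdry d n" for x
  proof -
    have "(\<lambda>h. h x) \<in> measurable (PiM I (\<lambda>_. P)) P" using that assms by (intro measurable_component_singleton) auto
    then show ?thesis using P_borel by (simp cong: measurable_cong_sets)
  qed
  show ?thesis unfolding Zw_def wt_def
    by (intro borel_measurable_sum borel_measurable_exp[THEN measurable_compose[rotated]] borel_measurable_add
        borel_measurable_const borel_measurable_times c)
qed

lemma G_measurable:
  assumes "bdry d n \<subseteq> I"
  shows "G n \<in> borel_measurable (PiM I (\<lambda>_. P))"
  unfolding G_def[abs_def] using Zw_measurable[OF assms]
  by (intro borel_measurable_diff borel_measurable_ln)

lemma G_restrict: "G n (restrict h (bdry d n)) = G n h"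
  by (rule G_cong) simp

text \<open>\<open>G n\<close> sees only the finitely many fields on the boundary, so its law under
  the infinite product is computed under the finite one, where the sign argument takes
  place.\<close>

lemma prob_transfer:
  assumes "A \<in> sets borel"
  shows "measure Q {h \<in> space Q. G n h \<in> A} = measure (QJ n) {h \<in> space (QJ n). G n h \<in> A}"
proof -
  have m: "(\<lambda>h. restrict h (bdry d n)) \<in> measurable Q (QJ n)"
    by (rule measurable_restrict_subset[OF bdry_lattice])
  have S: "{h \<in> space (QJ n). G n h \<in> A} \<in> sets (QJ n)"
    using measurable_sets[OF G_measurable[OF order_refl, of n] assms] by (simp add: vimage_def Int_def conj_commute)
  have "measure (QJ n) {h \<in> space (QJ n). G n h \<in> A} = measure (distr Q (QJ n) (\<lambda>h. restrict h (bdry d n))) {h \<in> space (QJ n). G n h \<in> A}"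
    using product_prob_space.distr_PiM_restrict_finite[OF prod_prob finite_bdry bdry_lattice] by simp
  also have "\<dots> = measure Q ((\<lambda>h. restrict h (bdry d n)) -` {h \<in> space (QJ n). G n h \<in> A} \<inter> space Q)"
    by (rule measure_distr[OF m S])
  also have "(\<lambda>h. restrict h (bdry d n)) -` {h \<in> space (QJ n). G n h \<in> A} \<inter> space Q = {h \<in> space Q. G n h \<in> A}"
    using measurable_space[OF m] by (auto simp: G_restrict)
  finally show ?thesis by simp
qed

text \<open>Puts the Hoeffding term on the scale of the Sperner term.\<close>

lemma exp_le_inverse_sqrt: "0 < (x::real) \<Longrightarrow> exp (- x) \<le> 1 / sqrt x"
proof -
  assume x: "0 < x"
  have "sqrt x \<le> 1 + x"
    by (rule real_le_lsqrt) (use x in \<open>auto simp: power2_eq_square algebra_simps\<close>)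
  also have "\<dots> \<le> exp x" by (rule exp_ge_add_one_self)
  finally show ?thesis using x by (simp add: exp_minus field_simps)
qed

lemma small_G_prob:
  "\<exists>C\<ge>0. \<forall>n\<ge>1. measure Q {h \<in> space Q. \<bar>G n h\<bar> \<le> K} \<le> C / sqrt (real n ^ (d - 1))"
proof -
  have g: "0 < gain a" by (rule gain_pos[OF a_pos])
  obtain R :: nat where "2 * K / gain a < real R" using reals_Archimedean2 by blast
  then have R: "2 * K < real R * gain a" using g by (simp add: field_simps)
  \<comment> \<open>The summands stem from the Hoeffding term, weakened to an inverse root, and from
    the window count; \<open>R\<close> depends on \<open>K\<close> but not on
    \<open>n\<close>.\<close>
  define C where "C = 1 / sqrt (p\<^sup>2 / 2) + 2 * real R / sqrt (p / 2)"
  have C: "0 \<le> C" using p_pos by (simp add: C_def)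
  show ?thesis
  proof (intro exI[of _ C] conjI C allI impI)
    fix n :: nat assume n: "1 \<le> n"
    define N where "N = real (card (bdry d n))"
    have Nn: "real n ^ (d - 1) \<le> N" unfolding N_def of_nat_power[symmetric] of_nat_le_iff by (rule card_bdry_ge[OF n])
    have np: "0 < real n ^ (d - 1)" using n by simp
    have Np: "0 < N" using Nn np by linarith
    have ne: "bdry d n \<noteq> {}" using Np by (auto simp: N_def)
    have sN: "sqrt (real n ^ (d - 1)) \<le> sqrt N" "0 < sqrt (real n ^ (d - 1))" "0 < sqrt N" using Nn np Np by auto
    have "measure Q {h \<in> space Q. \<bar>G n h\<bar> \<le> K} = measure Q {h \<in> space Q. G n h \<in> {- K..K}}"
      by (intro arg_cong[where f = "measure Q"]) auto
    also have "\<dots> = measure (QJ n) {h \<in> space (QJ n). G n h \<in> {- K..K}}" by (rule prob_transfer) simp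
    also have "\<dots> = measure (QJ n) {h \<in> space (QJ n). \<bar>G n h\<bar> \<le> K}"
      by (intro arg_cong[where f = "measure (QJ n)"]) auto
    also have "\<dots> \<le> exp (- p\<^sup>2 * real (card (bdry d n)) / 2) + 2 * real R / sqrt (p * real (card (bdry d n)) / 2)"
    proof (rule anticoncentration[OF finite_bdry ne p_def p_pos g R G_measurable[OF order_refl]])
      fix h x b assume "\<forall>y\<in>bdry d n. \<bar>h y\<bar> \<le> l" "x \<in> bdry d n" "a \<le> b" "b \<le> l"
      then show "G n (h(x := - b)) + gain a \<le> G n (h(x := b))"
        using a_pos by (intro G_gain) (auto simp: bounded_field_def)
    qed
    also have "\<dots> = exp (- (p\<^sup>2 / 2 * N)) + 2 * real R / sqrt (p / 2 * N)" by (simp add: N_def)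
    also have "\<dots> \<le> 1 / sqrt (p\<^sup>2 / 2 * N) + 2 * real R / sqrt (p / 2 * N)"
      using p_pos Np by (intro add_right_mono exp_le_inverse_sqrt) auto
    also have "\<dots> = C / sqrt N" unfolding C_def real_sqrt_mult by (simp add: add_divide_distrib)
    also have "\<dots> \<le> C / sqrt (real n ^ (d - 1))" using sN C by (intro divide_left_mono) auto
    finally show "measure Q {h \<in> space Q. \<bar>G n h\<bar> \<le> K} \<le> C / sqrt (real n ^ (d - 1))" .
  qed
qed

lemma AE_G_infinite:
  assumes N: "filterlim N at_top sequentially" and sm: "summable (\<lambda>k. 1 / sqrt (real (N k) ^ (d - 1)))"
  shows "AE h in Q. filterlim (\<lambda>k. \<bar>G (N k) h\<bar>) at_top sequentially"
proof -
  interpret PQ: prob_space Q by (rule prob_Q)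
  have "AE h in Q. eventually (\<lambda>k. h \<in> space Q - {h \<in> space Q. \<bar>G (N k) h\<bar> \<le> real K}) sequentially" for K :: nat
  proof (rule borel_cantelli_AE1)
    show "{h \<in> space Q. \<bar>G (N k) h\<bar> \<le> real K} \<in> sets Q" for k
      using G_measurable[OF bdry_lattice, of "N k"] by measurable
    show "emeasure Q {h \<in> space Q. \<bar>G (N k) h\<bar> \<le> real K} < \<infinity>" for k by (simp add: PQ.emeasure_eq_measure)
    obtain C where C: "0 \<le> C" "\<forall>n\<ge>1. measure Q {h \<in> space Q. \<bar>G n h\<bar> \<le> real K} \<le> C / sqrt (real n ^ (d - 1))"
      using small_G_prob by blast
    have ev: "eventually (\<lambda>k. 1 \<le> N k) sequentially" using N by (simp add: filterlim_at_top)
    show "summable (\<lambda>k. measure Q {h \<in> space Q. \<bar>G (N k) h\<bar> \<le> real K})"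
    proof (rule summable_comparison_test_ev)
      show "summable (\<lambda>k. C * (1 / sqrt (real (N k) ^ (d - 1))))" using sm by (rule summable_mult)
      show "eventually (\<lambda>k. norm (measure Q {h \<in> space Q. \<bar>G (N k) h\<bar> \<le> real K}) \<le> C * (1 / sqrt (real (N k) ^ (d - 1)))) sequentially"
        using ev by eventually_elim (use C in auto)
    qed
  qed
  then have "AE h in Q. \<forall>K::nat. eventually (\<lambda>k. h \<in> space Q - {h \<in> space Q. \<bar>G (N k) h\<bar> \<le> real K}) sequentially"
    by (simp add: AE_all_countable)
  then show ?thesis
  proof eventually_elim
    case (elim h)
    show ?case unfolding filterlim_at_top
    proof
      fix c :: real
      obtain K :: nat where K: "c < real K" using reals_Archimedean2 by blast
      from elim[rule_format, of K] show "eventually (\<lambda>k. c \<le> \<bar>G (N k) h\<bar>) sequentially"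
        by eventually_elim (use K in auto)
    qed
  qed
qed

text \<open>Symmetry gives equal mass to the two signs of \<open>G\<close>; with mass
  \<open>t\<close> at zero the event has probability \<open>(1 + t) / 2\<close>, at most
  \<open>3/4\<close> for \<open>t \<le> 1/2\<close>.\<close>

lemma half_prob:
  assumes e: "e = 1 \<or> e = - 1" and z: "measure Q {h \<in> space Q. \<bar>G n h\<bar> \<le> 0} \<le> 1/2"
  shows "measure Q {h \<in> space Q. e * G n h \<le> 0} \<le> 3/4"
proof -
  interpret PQ: prob_space Q by (rule prob_Q)
  interpret PJ: prob_space "QJ n" by (rule prob_Q)
  have Gm: "G n \<in> borel_measurable Q" by (rule G_measurable[OF bdry_lattice])
  have GJ: "G n \<in> borel_measurable (QJ n)" by (rule G_measurable) simp
  have fl: "G n (flips (bdry d n) {} h) = - G n h" for h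
  proof -
    have "G n (flips (bdry d n) {} h) = G n (\<lambda>x. - h x)" by (rule G_cong) (simp add: flips_def)
    then show ?thesis by (simp add: G_uminus)
  qed
  have S: "{h \<in> space (QJ n). G n h < 0} \<in> sets (QJ n)" using GJ by measurable
  have "measure (QJ n) {h \<in> space (QJ n). G n h < 0} = measure (distr (QJ n) (QJ n) (flips (bdry d n) {})) {h \<in> space (QJ n). G n h < 0}"
    by (simp add: distr_flips)
  also have "\<dots> = measure (QJ n) (flips (bdry d n) {} -` {h \<in> space (QJ n). G n h < 0} \<inter> space (QJ n))"
    by (rule measure_distr[OF flips_measurable S])
  also have "flips (bdry d n) {} -` {h \<in> space (QJ n). G n h < 0} \<inter> space (QJ n) = {h \<in> space (QJ n). 0 < G n h}"
    using measurable_space[OF flips_measurable, of _ "bdry d n" "{}"] by (auto simp: fl)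
  finally have "measure (QJ n) {h \<in> space (QJ n). G n h \<in> {..<0}} = measure (QJ n) {h \<in> space (QJ n). G n h \<in> {0<..}}" by simp
  then have sy: "measure Q {h \<in> space Q. G n h < 0} = measure Q {h \<in> space Q. 0 < G n h}"
    using prob_transfer[of "{..<0}" n] prob_transfer[of "{0<..}" n] by simp
  have m: "{h \<in> space Q. G n h < 0} \<in> sets Q" "{h \<in> space Q. 0 < G n h} \<in> sets Q" "{h \<in> space Q. \<bar>G n h\<bar> \<le> 0} \<in> sets Q"
    using Gm by measurable
  have "measure Q (({h \<in> space Q. G n h < 0} \<union> {h \<in> space Q. 0 < G n h}) \<union> {h \<in> space Q. \<bar>G n h\<bar> \<le> 0})
      = measure Q ({h \<in> space Q. G n h < 0} \<union> {h \<in> space Q. 0 < G n h}) + measure Q {h \<in> space Q. \<bar>G n h\<bar> \<le> 0}"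
    using m by (intro PQ.finite_measure_Union) auto
  also have "measure Q ({h \<in> space Q. G n h < 0} \<union> {h \<in> space Q. 0 < G n h}) = measure Q {h \<in> space Q. G n h < 0} + measure Q {h \<in> space Q. 0 < G n h}"
    using m by (intro PQ.finite_measure_Union) auto
  also have "({h \<in> space Q. G n h < 0} \<union> {h \<in> space Q. 0 < G n h}) \<union> {h \<in> space Q. \<bar>G n h\<bar> \<le> 0} = space Q" by auto
  finally have half: "measure Q {h \<in> space Q. G n h < 0} + measure Q {h \<in> space Q. 0 < G n h} + measure Q {h \<in> space Q. \<bar>G n h\<bar> \<le> 0} = 1"
    using PQ.prob_space by simp
  have u: "measure Q (X \<union> {h \<in> space Q. \<bar>G n h\<bar> \<le> 0}) \<le> measure Q X + measure Q {h \<in> space Q. \<bar>G n h\<bar> \<le> 0}" if "X \<in> sets Q" for X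
    by (rule measure_Un_le[OF that m(3)])
  show ?thesis using e
  proof
    assume "e = 1"
    then have "{h \<in> space Q. e * G n h \<le> 0} = {h \<in> space Q. G n h < 0} \<union> {h \<in> space Q. \<bar>G n h\<bar> \<le> 0}" by auto
    then show ?thesis using u[OF m(1)] half sy z by simp
  next
    assume "e = - 1"
    then have "{h \<in> space Q. e * G n h \<le> 0} = {h \<in> space Q. 0 < G n h} \<union> {h \<in> space Q. \<bar>G n h\<bar> \<le> 0}" by auto
    then show ?thesis using u[OF m(2)] half sy z by simp
  qed
qed

lemma eventually_half:
  assumes e: "e = 1 \<or> e = - 1"
  shows "\<exists>n0. \<forall>n\<ge>n0. measure Q {h \<in> space Q. e * G n h \<le> 0} \<le> 3/4"
proof -
  obtain C where C: "0 \<le> C" "\<forall>n\<ge>1. measure Q {h \<in> space Q. \<bar>G n h\<bar> \<le> 0} \<le> C / sqrt (real n ^ (d - 1))"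
    using small_G_prob by blast
  obtain n1 :: nat where n1: "(2 * C)\<^sup>2 < real n1" using reals_Archimedean2 by blast
  show ?thesis
  proof (intro exI[of _ "max 1 n1"] allI impI half_prob[OF e])
    fix n assume n: "max 1 n1 \<le> n"
    have "real n = real n ^ 1" by simp
    also have "\<dots> \<le> real n ^ (d - 1)" using n d2 by (intro power_increasing) auto
    finally have "real n \<le> real n ^ (d - 1)" .
    then have "(2 * C)\<^sup>2 \<le> real n ^ (d - 1)" using n1 n by linarith
    then have "2 * C \<le> sqrt (real n ^ (d - 1))" by (rule real_le_rsqrt)
    moreover have "0 < sqrt (real n ^ (d - 1))" using n by simp
    ultimately have "C / sqrt (real n ^ (d - 1)) \<le> 1/2" by (simp add: divide_le_eq)
    moreover have "measure Q {h \<in> space Q. \<bar>G n h\<bar> \<le> 0} \<le> C / sqrt (real n ^ (d - 1))" using C(2) n by simp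
    ultimately show "measure Q {h \<in> space Q. \<bar>G n h\<bar> \<le> 0} \<le> 1/2" by linarith
  qed
qed

text \<open>\<open>N\<close> tends to infinity but may repeat values, so a subsequence with jumps of
  at least two is selected; along it the boundaries are disjoint and the values of \<open>G\<close>
  independent. The probability that the sign fails at \<open>M\<close> such boxes is at most
  \<open>(3/4) ^ M\<close>, so beyond every index it almost surely succeeds once more.\<close>

lemma AE_sign_infinitely_often:
  assumes N: "filterlim N at_top sequentially" and e: "e = 1 \<or> e = - 1"
  shows "AE h in Q. infinite {k. 0 < e * G (N k) h}"
proof -
  interpret PQ: prob_space Q by (rule prob_Q)
  have Gm: "G n \<in> borel_measurable Q" for n by (rule G_measurable[OF bdry_lattice])
  obtain n0 where n0: "\<forall>n\<ge>n0. measure Q {h \<in> space Q. e * G n h \<le> 0} \<le> 3/4" using eventually_half[OF e] by blast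
  have "AE h in Q. \<exists>k\<ge>i. 0 < e * G (N k) h" for i
  proof -
    define good where "good x \<longleftrightarrow> i \<le> x \<and> n0 \<le> N x" for x
    have ev: "\<exists>y>x. good y \<and> c \<le> N y" for x c
    proof -
      have "eventually (\<lambda>y. max n0 c \<le> N y) sequentially" using N unfolding filterlim_at_top by blast
      then obtain y0 where "\<And>y. y0 \<le> y \<Longrightarrow> max n0 c \<le> N y" unfolding eventually_sequentially by blast
      from this[of "max y0 (max i (Suc x))"] show ?thesis
        by (intro exI[of _ "max y0 (max i (Suc x))"]) (auto simp: good_def)
    qed
    have "\<exists>r. \<forall>k. good (r k) \<and> N (r k) + 2 \<le> N (r (Suc k))"
    proof (rule dependent_nat_choice)
      show "\<exists>x. good x" using ev by blast
      show "\<exists>y. good y \<and> N x + 2 \<le> N y" for x using ev by blast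
    qed
    then obtain r where r: "\<And>k. good (r k)" "\<And>k. N (r k) + 2 \<le> N (r (Suc k))" by blast
    have rsep: "N (r j) + 2 \<le> N (r k)" if "j < k" for j k
      using that
    proof (induction k)
      case (Suc k)
      then show ?case using r(2)[of k] by (cases "j = k") auto
    qed simp
    define Kb where "Kb k = bdry d (N (r k))" for k
    have "disjoint_family_on Kb UNIV"
      unfolding disjoint_family_on_def
    proof (intro ballI impI)
      fix j k :: nat assume "j \<noteq> k"
      then show "Kb j \<inter> Kb k = {}" unfolding Kb_def
        using bdry_disjoint[OF rsep[of j k], of d] bdry_disjoint[OF rsep[of k j], of d]
        by (cases "j < k") (auto simp: not_less)
    qed
    then have dis: "disjoint_family_on Kb {..<M}" for M by (rule disjoint_family_on_mono[rotated]) simp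
    have lne: "lattice d \<noteq> {}" by (auto simp: lattice_def intro!: exI[of _ "\<lambda>_. 0"])
    have indep: "PQ.indep_vars (\<lambda>_. borel) (\<lambda>k h. G (N (r k)) (\<lambda>x\<in>Kb k. h x)) {..<M}" for M
      by (rule PQ.indep_vars_compose2[OF PQ.indep_vars_restrict[OF indep_coords[OF lne] _ dis]])
        (auto simp: Kb_def bdry_lattice intro!: G_measurable)
    have Gr: "G (N (r k)) (\<lambda>x\<in>Kb k. h x) = G (N (r k)) h" for k h unfolding Kb_def by (rule G_restrict)
    have pw: "measure Q {h \<in> space Q. \<forall>k<M. e * G (N (r k)) h \<le> 0} \<le> (3/4) ^ M" if "0 < M" for M
    proof -
      have "{h \<in> space Q. \<forall>k<M. e * G (N (r k)) h \<le> 0}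
        = (\<Inter>k\<in>{..<M}. (\<lambda>h. G (N (r k)) (\<lambda>x\<in>Kb k. h x)) -` {x. e * x \<le> 0} \<inter> space Q)"
        using that unfolding Gr by auto
      also have "measure Q \<dots> = (\<Prod>k<M. measure Q ((\<lambda>h. G (N (r k)) (\<lambda>x\<in>Kb k. h x)) -` {x. e * x \<le> 0} \<inter> space Q))"
        using that by (intro PQ.indep_varsD_finite[OF indep]) auto
      also have "\<dots> \<le> (\<Prod>k<M. 3/4)"
      proof (rule prod_mono)
        fix k
        have "(\<lambda>h. G (N (r k)) (\<lambda>x\<in>Kb k. h x)) -` {x. e * x \<le> 0} \<inter> space Q = {h \<in> space Q. e * G (N (r k)) h \<le> 0}"
          unfolding Gr by auto
        then show "0 \<le> measure Q ((\<lambda>h. G (N (r k)) (\<lambda>x\<in>Kb k. h x)) -` {x. e * x \<le> 0} \<inter> space Q) \<and>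
          measure Q ((\<lambda>h. G (N (r k)) (\<lambda>x\<in>Kb k. h x)) -` {x. e * x \<le> 0} \<inter> space Q) \<le> 3/4"
          using n0 r(1)[of k] by (simp add: good_def)
      qed
      finally show ?thesis by simp
    qed
    define Z0 where "Z0 = {h \<in> space Q. \<forall>k\<in>{i..}. e * G (N k) h \<le> 0}"
    have Z0m: "Z0 \<in> sets Q" unfolding Z0_def using Gm by measurable
    have "measure Q Z0 \<le> (3/4) ^ M" if "0 < M" for M
    proof -
      define Y where "Y = {h \<in> space Q. \<forall>k\<in>{..<M}. e * G (N (r k)) h \<le> 0}"
      have sub: "Z0 \<subseteq> Y" unfolding Y_def Z0_def using r(1) by (auto simp: good_def)
      have "Y \<in> sets Q" unfolding Y_def using Gm by measurable
      with sub have "measure Q Z0 \<le> measure Q Y" by (rule PQ.finite_measure_mono)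
      also have "Y = {h \<in> space Q. \<forall>k<M. e * G (N (r k)) h \<le> 0}" unfolding Y_def lessThan_iff Ball_def ..
      also have "measure Q \<dots> \<le> (3/4) ^ M" by (rule pw[OF that])
      finally show ?thesis .
    qed
    then have "\<forall>M\<ge>1. measure Q Z0 \<le> (3/4) ^ M" by simp
    moreover have "(\<lambda>M. (3/4::real) ^ M) \<longlonglongrightarrow> 0" by (simp add: LIMSEQ_power_zero)
    ultimately have "measure Q Z0 \<le> 0" using LIMSEQ_le_const by blast
    then have "measure Q Z0 = 0" by (simp add: measure_le_0_iff)
    then have "AE h in Q. h \<notin> Z0" using PQ.prob_eq_0[OF Z0m] by simp
    moreover have "AE h in Q. h \<in> space Q" by (rule AE_space)
    ultimately show ?thesis
    proof eventually_elim
      case (elim h)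
      then show ?case unfolding Z0_def by (auto simp: not_le)
    qed
  qed
  then have "AE h in Q. \<forall>i. \<exists>k\<ge>i. 0 < e * G (N k) h" by (simp add: AE_all_countable)
  then show ?thesis
  proof eventually_elim
    case (elim h)
    then show ?case unfolding infinite_nat_iff_unbounded_le by simp
  qed
qed

lemma AE_bounded_field: "AE h in Q. \<forall>n. bounded_field n h"
proof -
  interpret PS: prob_space P by (rule prob)
  have "{x. l < \<bar>x\<bar>} \<in> sets P" unfolding P_borel by measurable
  then have "AE x in P. x \<notin> {x. l < \<bar>x\<bar>}" using supp PS.prob_eq_0 by blast
  then have b: "AE x in P. \<bar>x\<bar> \<le> l" by (simp add: not_less)
  have "AE h in Q. \<bar>h x\<bar> \<le> l" if "x \<in> lattice d" for x
    using product_prob_space.AE_component[OF prod_prob that b] .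
  then have "AE h in Q. \<forall>x\<in>lattice d. \<bar>h x\<bar> \<le> l" using countable_lattice by (simp add: AE_ball_countable)
  then show ?thesis
  proof eventually_elim
    case (elim h)
    then show ?case using bdry_lattice unfolding bounded_field_def by blast
  qed
qed

theorem AE_limit_points:
  assumes N: "filterlim N at_top sequentially" and sm: "summable (\<lambda>k. 1 / sqrt (real (N k) ^ (d - 1)))"
  shows "AE h in Q. limit_points d (\<lambda>n. gibbs_exp d \<beta> (N n) h) = {plus_state d \<beta>, minus_state d \<beta>}"
proof -
  have "AE h in Q. infinite {k. 0 < 1 * G (N k) h}" "AE h in Q. infinite {k. 0 < - 1 * G (N k) h}"
    by (rule AE_sign_infinitely_often[OF N]; simp)+
  with AE_bounded_field AE_G_infinite[OF assms] show ?thesis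
  proof eventually_elim
    case (elim h)
    show ?case by (rule limit_points_eq[OF l_pos N]) (use elim in auto)
  qed
qed

end

text \<open>If no \<open>a\<close> worked, the law would be concentrated at zero and have variance
  zero. This \<open>a\<close> separates the fields whose sign is known to matter from those too
  small to be used.\<close>

lemma large_values:
  assumes P: "prob_space P" "sets P = sets borel" and v: "prob_space.variance P (\<lambda>x. x) > (0::real)"
    and m: "integral\<^sup>L P (\<lambda>x. x) = 0"
  shows "\<exists>a>0. 0 < measure P {x. a \<le> \<bar>x\<bar>}"
proof (rule ccontr)
  assume no: "\<not> ?thesis"
  interpret prob_space P by (rule P)
  have "AE x in P. \<not> 1 / real (Suc k) \<le> \<bar>x\<bar>" for k
  proof -
    have "measure P {x. 1 / real (Suc k) \<le> \<bar>x\<bar>} = 0"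
      using no by (metis measure_le_0_iff not_less of_nat_0_less_iff zero_less_Suc zero_less_divide_1_iff)
    moreover have "{x. 1 / real (Suc k) \<le> \<bar>x\<bar>} \<in> sets P" unfolding P(2) by measurable
    ultimately have "AE x in P. x \<notin> {x. 1 / real (Suc k) \<le> \<bar>x\<bar>}" using prob_eq_0 by blast
    then show ?thesis by simp
  qed
  then have "AE x in P. \<forall>k. \<not> 1 / real (Suc k) \<le> \<bar>x\<bar>" by (simp only: AE_all_countable) blast
  then have "AE x in P. x\<^sup>2 = 0"
  proof eventually_elim
    case (elim x)
    show ?case
    proof (rule ccontr)
      assume "x\<^sup>2 \<noteq> 0"
      then have "0 < \<bar>x\<bar>" by simp
      then obtain k where "inverse (real (Suc k)) < \<bar>x\<bar>" using reals_Archimedean by blast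
      then show False using elim[rule_format, of k] by (simp add: inverse_eq_divide)
    qed
  qed
  then have "integral\<^sup>L P (\<lambda>x. x\<^sup>2) = 0" by (rule integral_eq_zero_AE)
  then show False using v m by simp
qed

lemma powr_floor_filterlim:
  assumes "1 < (e::real)"
  shows "filterlim (\<lambda>n. nat \<lfloor>real n powr e\<rfloor>) at_top sequentially"
  unfolding filterlim_at_top
proof
  fix c :: nat
  have "c \<le> nat \<lfloor>real n powr e\<rfloor>" if n: "max c 1 \<le> n" for n
  proof -
    have "real n = real n powr 1" using n by simp
    also have "\<dots> \<le> real n powr e" using n assms by (intro powr_mono) auto
    finally have "int n \<le> \<lfloor>real n powr e\<rfloor>" by (simp add: le_floor_iff)
    then show ?thesis using n by linarith
  qed
  then show "eventually (\<lambda>n. c \<le> nat \<lfloor>real n powr e\<rfloor>) sequentially"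
    unfolding eventually_sequentially by blast
qed

lemma powr_floor_summable:
  assumes "1 < (e::real)" "1 < e * real k / 2"
  shows "summable (\<lambda>n. 1 / sqrt (real (nat \<lfloor>real n powr e\<rfloor>) ^ k))"
proof (rule summable_comparison_test_ev)
  have "summable (\<lambda>n. real n powr (- (e * real k / 2)))" using assms by (simp add: summable_real_powr_iff)
  then show "summable (\<lambda>n. sqrt (2 ^ k) * real n powr (- (e * real k / 2)))" by (rule summable_mult)
  show "eventually (\<lambda>n. norm (1 / sqrt (real (nat \<lfloor>real n powr e\<rfloor>) ^ k)) \<le> sqrt (2 ^ k) * real n powr (- (e * real k / 2))) sequentially"
    using eventually_ge_at_top[of 2]
  proof eventually_elim
    case (elim n)
    define y where "y = real n powr e"
    have "real n = real n powr 1" using elim by simp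
    also have "\<dots> \<le> y" unfolding y_def using elim assms by (intro powr_mono) auto
    \<comment> \<open>From \<open>2\<close> on the integer part is at least half of the number,
      which costs the factor \<open>sqrt (2 ^ k)\<close>.\<close>
    finally have y2: "2 \<le> y" using elim by linarith
    have "y - 1 \<le> of_int \<lfloor>y\<rfloor>" by linarith
    moreover have "of_int \<lfloor>y\<rfloor> = real (nat \<lfloor>y\<rfloor>)" using y2 by simp
    ultimately have h: "y / 2 \<le> real (nat \<lfloor>y\<rfloor>)" using y2 by linarith
    have "sqrt ((y / 2) ^ k) \<le> sqrt (real (nat \<lfloor>y\<rfloor>) ^ k)" using h y2 by (intro real_sqrt_le_mono power_mono) auto
    moreover have "0 < sqrt ((y / 2) ^ k)" using y2 by simp
    ultimately have "1 / sqrt (real (nat \<lfloor>y\<rfloor>) ^ k) \<le> 1 / sqrt ((y / 2) ^ k)" by (intro frac_le) simp_all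
    also have "\<dots> = sqrt (2 ^ k) * (1 / sqrt (y ^ k))" using y2 by (simp add: power_divide real_sqrt_divide)
    also have "sqrt (y ^ k) = real n powr (e * real k / 2)"
    proof -
      have "y ^ k = real n powr (e * real k)" unfolding y_def using elim by (simp add: powr_realpow[symmetric] powr_powr)
      then show ?thesis using elim by (simp add: powr_half_sqrt[symmetric] powr_powr)
    qed
    also have "1 / real n powr (e * real k / 2) = real n powr (- (e * real k / 2))" by (simp add: powr_minus_divide)
    finally show ?case using y2 unfolding y_def by simp
  qed
qed

theorem theorem2p1:
  fixes d :: nat and lam_star :: real
  assumes "2 \<le> d" and "0 < lam_star"
  shows "\<exists>\<beta>0>0. \<forall>\<beta>. \<beta>0 \<le> \<beta> \<longrightarrow> (\<forall>P. admissible_law lam_star P \<longrightarrow>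
     (3 < d \<longrightarrow>
        (AE lam in PiM (lattice d) (\<lambda>_. P).
           limit_points d (\<lambda>n. gibbs_exp d \<beta> n lam) = {plus_state d \<beta>, minus_state d \<beta>})) \<and>
     (d \<in> {2, 3} \<longrightarrow> (\<forall>\<omega>::real. 0 < \<omega> \<longrightarrow>
        (AE lam in PiM (lattice d) (\<lambda>_. P).
           limit_points d (\<lambda>n. gibbs_exp d \<beta> (nat \<lfloor>real n powr (4 - real d + \<omega>)\<rfloor>) lam)
             = {plus_state d \<beta>, minus_state d \<beta>}))))"
proof -
  have cc_pos: "0 < contour_const d" using assms by (simp add: contour_const_def)
  \<comment> \<open>The second entry solves \<open>exp (- 2 * \<beta> + 8 * d * lam_star) *
    contour_const d = 1/8\<close> for \<open>\<beta>\<close>; the first one guarantees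
    \<open>lam_star \<le> \<beta>\<close>.\<close>
  define \<beta>0 where "\<beta>0 = max lam_star ((8 * real d * lam_star + ln (8 * contour_const d)) / 2)"
  have b0: "0 < \<beta>0" using assms by (simp add: \<beta>0_def)
  have main: "AE lam in PiM (lattice d) (\<lambda>_. P). limit_points d (\<lambda>n. gibbs_exp d \<beta> (N n) lam) = {plus_state d \<beta>, minus_state d \<beta>}"
    if \<beta>: "\<beta>0 \<le> \<beta>" and adm: "admissible_law lam_star P" and N: "filterlim N at_top sequentially"
      "summable (\<lambda>k. 1 / sqrt (real (N k) ^ (d - 1)))" for \<beta> P N
  proof -
    have lt: "low_temp d \<beta> lam_star"
    proof
      show "2 \<le> d" "0 \<le> lam_star" using assms by auto
      show "lam_star \<le> \<beta>" using \<beta> by (simp add: \<beta>0_def)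
      have "8 * real d * lam_star + ln (8 * contour_const d) \<le> 2 * \<beta>" using \<beta> by (simp add: \<beta>0_def)
      then have "exp (- 2 * \<beta> + 8 * real d * lam_star) \<le> exp (- ln (8 * contour_const d))" by simp
      also have "\<dots> = 1 / (8 * contour_const d)" using cc_pos by (simp add: exp_minus inverse_eq_divide)
      finally have "exp (- 2 * \<beta> + 8 * real d * lam_star) * contour_const d \<le> 1 / (8 * contour_const d) * contour_const d"
        using cc_pos by (intro mult_right_mono) auto
      then show "exp (- 2 * \<beta> + 8 * real d * lam_star) * contour_const d \<le> 1 / 8" using cc_pos by simp
    qed
    have sl: "sym_law P lam_star" using adm unfolding admissible_law_def sym_law_def by simp
    obtain a where a: "0 < a" "0 < measure P {x. a \<le> \<bar>x\<bar>}"
      using large_values[of P] adm unfolding admissible_law_def by blast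
    have "random_field d \<beta> lam_star P a (measure P {x. a \<le> \<bar>x\<bar>})"
      unfolding random_field_def random_field_axioms_def using lt sl a assms by simp
    then show ?thesis using random_field.AE_limit_points N by blast
  qed
  show ?thesis
  proof (rule exI[of _ \<beta>0], intro conjI b0 allI impI)
    fix \<beta> P assume \<beta>: "\<beta>0 \<le> \<beta>" and adm: "admissible_law lam_star P"
    {
      assume d: "3 < d"
      \<comment> \<open>Here \<open>d - 1 \<ge> 3\<close>, so the terms are at most
        \<open>k powr (- (3/2))\<close>.\<close>
      have "summable (\<lambda>k. 1 / sqrt (real k ^ (d - 1)))"
      proof (rule summable_comparison_test_ev)
        show "summable (\<lambda>k. real k powr (- (3/2)))" by (simp add: summable_real_powr_iff)
        show "eventually (\<lambda>k. norm (1 / sqrt (real k ^ (d - 1))) \<le> real k powr (- (3/2))) sequentially"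
          using eventually_ge_at_top[of 1]
        proof eventually_elim
          case (elim k)
          have "real k powr (3/2) = (real k powr 3) powr (1/2)" using powr_powr[of "real k" 3 "1/2"] by simp
          also have "\<dots> = sqrt (real k powr 3)" by (rule powr_half_sqrt) simp
          also have "real k powr 3 = real k ^ 3" using elim by (simp add: powr_numeral)
          also have "sqrt (real k ^ 3) \<le> sqrt (real k ^ (d - 1))"
            using elim d by (intro real_sqrt_le_mono power_increasing) auto
          finally have "1 / sqrt (real k ^ (d - 1)) \<le> 1 / real k powr (3/2)"
            using elim by (intro divide_left_mono) auto
          then show ?case by (simp add: powr_minus_divide)
        qed
      qed
      from main[OF \<beta> adm filterlim_ident this]
      show "AE lam in PiM (lattice d) (\<lambda>_. P).
           limit_points d (\<lambda>n. gibbs_exp d \<beta> n lam) = {plus_state d \<beta>, minus_state d \<beta>}" .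
    }
    {
      fix \<omega> :: real assume d: "d \<in> {2, 3}" and \<omega>: "0 < \<omega>"
      \<comment> \<open>For \<open>d = 2\<close> the second number is
        \<open>(2 + \<omega>) / 2\<close>, for \<open>d = 3\<close> it is
        \<open>1 + \<omega>\<close>.\<close>
      have "1 < 4 - real d + \<omega>" "1 < (4 - real d + \<omega>) * real (d - 1) / 2" using d \<omega> by auto
      from main[OF \<beta> adm powr_floor_filterlim[OF this(1)] powr_floor_summable[OF this]]
      show "AE lam in PiM (lattice d) (\<lambda>_. P).
           limit_points d (\<lambda>n. gibbs_exp d \<beta> (nat \<lfloor>real n powr (4 - real d + \<omega>)\<rfloor>) lam)
             = {plus_state d \<beta>, minus_state d \<beta>}" .
    }
  qed
qed

end
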